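(* Let $d,n,m,k\in\mathbb{N}$ with $n>1$, let $\Omega\subset\mathbb{R}^d$ be a bounded Lipschitz domain, and let $\mathcal{A}(D)=\sum_{|\alpha|=k}A_\alpha\partial^\alpha$ with constant matrices $A_\alpha\in\mathbb{R}^{m\times n}$, with wave cone $\Lambda_{\mathcal{A}}$ and subspace $I_{\mathcal{A}}$ as defined in the context. Let $A,B\in\mathbb{R}^n$, and for $\lambda\in(0,1)$ set $F_\lambda=\lambda A+(1-\lambda)B$. Let $E_{el}$, $E_{surf}$ and $\mathcal{D}_{F_\lambda}$ be as in the context. Then the following hold. (i) (Incompatible case) Assume $B-A\notin\Lambda_{\mathcal{A}}$. Then there is a constant $C=C(A,B)>0$ (the operator $\mathcal{A}(D)$ being fixed) such that $$\inf_{\chi\in L^2(\Omega;\{A,B\})}\ \inf_{u\in\mathcal{D}_{F_\lambda}}E_{el}(u,\chi)\ \ge\ C\,(\min\{\lambda,1-\lambda\})^2\,|\Omega|.$$ (ii) (Compatible case) Assume that $k=1$ and $B-A\in\Lambda_{\mathcal{A}}\setminus I_{\mathcal{A}}$. Then there exist $C=C(\mathcal{A}(D),A,B,\Omega,d,\lambda)>0$ and $\epsilon_0=\epsilon_0(\mathcal{A}(D),A,B,\Omega,d,\lambda)>0$ such that for all $\epsilon\in(0,\epsilon_0)$ $$\inf_{\chi\in BV(\Omega;\{A,B\})}\ \inf_{u\in\mathcal{D}_{F_\lambda}}\big(E_{el}(u,\chi)+\epsilon E_{surf}(\chi)\big)\ \ge\ C\epsilon^{2/3}.$$ Furthermore,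 if in addition $\mathcal{A}(D)=\operatorname{div}$ (the row-wise divergence) and $\Omega=[0,1]^d$, then there exists a constant $c=c(A,B,\lambda)>0$ such that for all $\epsilon>0$ $$\inf_{\chi\in BV(\Omega;\{A,B\})}\ \inf_{u\in\mathcal{D}_{F_\lambda}}\big(E_{el}(u,\chi)+\epsilon E_{surf}(\chi)\big)\ \le\ c\,\epsilon^{2/3}.$$ (iii) (Super-compatible case) Assume $A-B\in I_{\mathcal{A}}$. Then (for every $\epsilon>0$) $$\inf_{\chi\in BV(\Omega;\{A,B\})}\ \inf_{u\in\mathcal{D}_{F_\lambda}}\big(E_{el}(u,\chi)+\epsilon E_{surf}(\chi)\big)=0.$$
   Context: The symbol of $\mathcal{A}(D)=\sum_{|\alpha|=k}A_\alpha\partial^\alpha$ is $\mathbb{A}(\xi)=\sum_{|\alpha|=k}A_\alpha\xi^\alpha\in\mathbb{R}^{m\times n}$, $\xi\in\mathbb{R}^d$. The wave cone is $\Lambda_{\mathcal{A}}=\bigcup_{\xi\in\mathbb{S}^{d-1}}\ker\mathbb{A}(\xi)\subset\mathbb{R}^n$, and $I_{\mathcal{A}}=\bigcap_{\xi\in\mathbb{R}^d}\ker\mathbb{A}(\xi)=\bigcap_{|\alpha|=k}\ker A_\alpha$. Admissible class: $\mathcal{D}_{F}=\{u\in L^2_{loc}(\mathbb{R}^d;\mathbb{R}^n):\ \mathcal{A}(D)u=0\text{ in }\mathbb{R}^d\text{ in the sense of distributions},\ u=F\text{ in }\mathbb{R}^d\setminus\overline{\Omega}\}$. Energies: $E_{el}(u,\chi)=\int_\Omega|u-\chi|^2dx$,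 and $E_{surf}(\chi)=\int_\Omega|\nabla\chi|$, the total variation of $\nabla\chi$ in $\Omega$. $L^2(\Omega;\{A,B\})$ and $BV(\Omega;\{A,B\})$ denote the functions in $L^2$, respectively $BV$, with values a.e. in $\{A,B\}$. The row-wise divergence acts on matrix fields $u:\mathbb{R}^d\to\mathbb{R}^{m\times d}$ (so that $\mathbb{R}^n$ is identified with $\mathbb{R}^{m\times d}$) by $\operatorname{div}u=\sum_{j=1}^d(\partial_ju)e_j$; its symbol is $\mathbb{A}(\xi)M=M\xi$. *)

theory Defs
  imports "HOL-Analysis.Analysis"
begin

section \<open>Derivatives and test functions\<close>

definition partial_deriv :: "'d::finite \<Rightarrow> (real^'d \<Rightarrow> real) \<Rightarrow> real^'d \<Rightarrow> real" where
  "partial_deriv j f x = frechet_derivative f (at x) (axis j 1)"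

primrec C_diff :: "nat \<Rightarrow> (real^'d::finite \<Rightarrow> real) \<Rightarrow> bool" where
  "C_diff 0 f \<longleftrightarrow> continuous_on UNIV f"
| "C_diff (Suc r) f \<longleftrightarrow> (\<forall>x. f differentiable (at x)) \<and> (\<forall>j. C_diff r (partial_deriv j f))"

definition multi_indices :: "nat \<Rightarrow> ('d::finite \<Rightarrow> nat) set" where
  "multi_indices k = {\<alpha>. (\<Sum>j\<in>UNIV. \<alpha> j) = k}"

lemma finite_multi_indices: "finite (multi_indices k :: ('d::finite \<Rightarrow> nat) set)"
proof (rule finite_subset)
  show "multi_indices k \<subseteq> (PiE UNIV (\<lambda>_. {..k}) :: ('d \<Rightarrow> nat) set)"
    by (auto simp: multi_indices_def PiE_def Pi_def intro: member_le_sum)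
  show "finite (PiE UNIV (\<lambda>_. {..k}) :: ('d \<Rightarrow> nat) set)"
    by (intro finite_PiE) auto
qed

text \<open>The partial derivatives are composed along a fixed but arbitrary enumeration of the
  coordinates. On the smooth functions to which this is applied below, the result does not
  depend on the enumeration (Schwarz).\<close>

definition multi_deriv :: "('d::finite \<Rightarrow> nat) \<Rightarrow> (real^'d \<Rightarrow> real) \<Rightarrow> real^'d \<Rightarrow> real" where
  "multi_deriv \<alpha> f =
     foldr (\<lambda>j. partial_deriv j ^^ \<alpha> j) (SOME js. distinct js \<and> set js = UNIV) f"

definition test_functions :: "(real^'d::finite \<Rightarrow> real) set" where
  "test_functions = {\<phi>. (\<forall>r. C_diff r \<phi>) \<and> compact (closure {x. \<phi> x \<noteq> 0})}"


section \<open>Homogeneous constant-coefficient operators\<close>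

text \<open>The operator \<open>\<Sum>\<^bsub>|\<alpha>|=k\<^esub> A\<^sub>\<alpha> \<partial>\<^sup>\<alpha>\<close> is given by its order \<open>k\<close> and a coefficient family \<open>Aop\<close>,
  of which only the values at multi-indices of length \<open>k\<close> matter.\<close>

definition op_symbol ::
    "(('d::finite \<Rightarrow> nat) \<Rightarrow> real^'n::finite^'m::finite) \<Rightarrow> nat \<Rightarrow> real^'d \<Rightarrow> real^'n^'m" where
  "op_symbol Aop k \<xi> = (\<Sum>\<alpha>\<in>multi_indices k. (\<Prod>j\<in>UNIV. (\<xi> $ j) ^ \<alpha> j) *\<^sub>R Aop \<alpha>)"

definition mat_kernel :: "real^'n::finite^'m::finite \<Rightarrow> (real^'n) set" where
  "mat_kernel M = {v. M *v v = 0}"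

definition wave_cone ::
    "(('d::finite \<Rightarrow> nat) \<Rightarrow> real^'n::finite^'m::finite) \<Rightarrow> nat \<Rightarrow> (real^'n) set" where
  "wave_cone Aop k = (\<Union>\<xi>\<in>sphere 0 1. mat_kernel (op_symbol Aop k \<xi>))"

definition common_kernel ::
    "(('d::finite \<Rightarrow> nat) \<Rightarrow> real^'n::finite^'m::finite) \<Rightarrow> nat \<Rightarrow> (real^'n) set" where
  "common_kernel Aop k = (\<Inter>\<xi>. mat_kernel (op_symbol Aop k \<xi>))"

definition distributional_solution ::
    "(('d::finite \<Rightarrow> nat) \<Rightarrow> real^'n::finite^'m::finite) \<Rightarrow> nat \<Rightarrow> (real^'d \<Rightarrow> real^'n) \<Rightarrow> bool" where
  "distributional_solution Aop k u \<longleftrightarrow>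
     (\<forall>\<phi>\<in>test_functions.
        (\<Sum>\<alpha>\<in>multi_indices k.
           Aop \<alpha> *v ((-1) ^ k *\<^sub>R (LINT x|lebesgue. multi_deriv \<alpha> \<phi> x *\<^sub>R u x))) = 0)"

text \<open>The bijection \<open>e\<close> identifies \<open>\<real>\<^sup>n\<close> with \<open>\<real>\<^bsup>m\<times>d\<^esup>\<close>: the matrix entry at \<open>(i, j)\<close> is the component
  \<open>e (i, j)\<close>. In \<open>div u = \<Sum>\<^sub>j (\<partial>\<^sub>j u) e\<^sub>j\<close> the coefficient of \<open>\<partial>\<^sub>j\<close> maps a matrix to its
  \<open>j\<close>-th column.\<close>

definition is_row_divergence ::
    "('m::finite \<times> 'd::finite \<Rightarrow> 'n::finite) \<Rightarrow> (('d \<Rightarrow> nat) \<Rightarrow> real^'n^'m) \<Rightarrow> bool" where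
  "is_row_divergence e Aop \<longleftrightarrow>
     bij e \<and> (\<forall>j v. Aop (\<lambda>l. if l = j then 1 else 0) *v v = (\<chi> i. v $ e (i, j)))"


section \<open>Domains, function classes and energies\<close>

text \<open>Near every boundary point the domain is, in suitable orthonormal coordinates with last basis
  vector \<open>\<nu>\<close>, the region above the graph of a Lipschitz function on the hyperplane orthogonal
  to \<open>\<nu>\<close>.\<close>

definition lipschitz_domain :: "(real^'d::finite) set \<Rightarrow> bool" where
  "lipschitz_domain \<Omega> \<longleftrightarrow> open \<Omega> \<and> connected \<Omega> \<and> \<Omega> \<noteq> {} \<and>
     (\<forall>x\<in>frontier \<Omega>. \<exists>r>0. \<exists>\<nu> L \<gamma>. norm \<nu> = 1 \<and> L-lipschitz_on {z. z \<bullet> \<nu> = 0} \<gamma> \<and>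
        \<Omega> \<inter> ball x r = {y \<in> ball x r. y \<bullet> \<nu> > \<gamma> (y - (y \<bullet> \<nu>) *\<^sub>R \<nu>)})"

definition L2_loc :: "(real^'d::finite \<Rightarrow> real^'n::finite) set" where
  "L2_loc = {u. u \<in> borel_measurable lebesgue \<and>
     (\<forall>K. compact K \<longrightarrow> set_integrable lebesgue K (\<lambda>x. (norm (u x))\<^sup>2))}"

definition admissible ::
    "(('d::finite \<Rightarrow> nat) \<Rightarrow> real^'n::finite^'m::finite) \<Rightarrow> nat \<Rightarrow> (real^'d) set \<Rightarrow> real^'n \<Rightarrow>
     (real^'d \<Rightarrow> real^'n) set" where
  "admissible Aop k \<Omega> F = {u \<in> L2_loc. distributional_solution Aop k u \<and>
     (AE x in lebesgue. x \<notin> closure \<Omega> \<longrightarrow> u x = F)}"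

definition elastic_energy ::
    "(real^'d::finite) set \<Rightarrow> (real^'d \<Rightarrow> real^'n::finite) \<Rightarrow> (real^'d \<Rightarrow> real^'n) \<Rightarrow> ennreal" where
  "elastic_energy \<Omega> u f = (\<integral>\<^sup>+x\<in>\<Omega>. ennreal ((norm (u x - f x))\<^sup>2) \<partial>lebesgue)"

text \<open>The norm on \<open>real^'d^'n\<close> is the Frobenius norm.\<close>

definition TV_test_fields :: "(real^'d::finite) set \<Rightarrow> (real^'d \<Rightarrow> real^'d^'n::finite) set" where
  "TV_test_fields \<Omega> = {\<phi>. (\<forall>i j. C_diff 1 (\<lambda>x. \<phi> x $ i $ j)) \<and> (\<forall>x. norm (\<phi> x) \<le> 1) \<and>
     compact (closure {x. \<phi> x \<noteq> 0}) \<and> closure {x. \<phi> x \<noteq> 0} \<subseteq> \<Omega>}"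

text \<open>Truncating negative integrals to zero does not change the supremum, as the zero
  field is a test field.\<close>

definition surface_energy ::
    "(real^'d::finite) set \<Rightarrow> (real^'d \<Rightarrow> real^'n::finite) \<Rightarrow> ennreal" where
  "surface_energy \<Omega> f =
     (SUP \<phi>\<in>TV_test_fields \<Omega>. ennreal (LINT x:\<Omega>|lebesgue.
        (\<Sum>i\<in>UNIV. f x $ i * (\<Sum>j\<in>UNIV. partial_deriv j (\<lambda>y. \<phi> y $ i $ j) x))))"

text \<open>Elements of the following classes are represented by total functions whose values
  outside \<open>\<Omega>\<close> are irrelevant.\<close>

definition L2_fields ::
    "(real^'d::finite) set \<Rightarrow> (real^'n::finite) set \<Rightarrow> (real^'d \<Rightarrow> real^'n) set" where
  "L2_fields \<Omega> S = {f. set_borel_measurable lebesgue \<Omega> f \<and>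
     set_integrable lebesgue \<Omega> (\<lambda>x. (norm (f x))\<^sup>2) \<and>
     (AE x in lebesgue. x \<in> \<Omega> \<longrightarrow> f x \<in> S)}"

definition BV_fields ::
    "(real^'d::finite) set \<Rightarrow> (real^'n::finite) set \<Rightarrow> (real^'d \<Rightarrow> real^'n) set" where
  "BV_fields \<Omega> S = {f. set_integrable lebesgue \<Omega> f \<and> surface_energy \<Omega> f < \<infinity> \<and>
     (AE x in lebesgue. x \<in> \<Omega> \<longrightarrow> f x \<in> S)}"

definition min_elastic_energy ::
    "(('d::finite \<Rightarrow> nat) \<Rightarrow> real^'n::finite^'m::finite) \<Rightarrow> nat \<Rightarrow> (real^'d) set \<Rightarrow>
     real^'n \<Rightarrow> real^'n \<Rightarrow> real^'n \<Rightarrow> ennreal" where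
  "min_elastic_energy Aop k \<Omega> A B F =
     (INF f\<in>L2_fields \<Omega> {A, B}. INF u\<in>admissible Aop k \<Omega> F. elastic_energy \<Omega> u f)"

definition min_total_energy ::
    "(('d::finite \<Rightarrow> nat) \<Rightarrow> real^'n::finite^'m::finite) \<Rightarrow> nat \<Rightarrow> (real^'d) set \<Rightarrow>
     real^'n \<Rightarrow> real^'n \<Rightarrow> real^'n \<Rightarrow> real \<Rightarrow> ennreal" where
  "min_total_energy Aop k \<Omega> A B F \<epsilon> =
     (INF f\<in>BV_fields \<Omega> {A, B}. INF u\<in>admissible Aop k \<Omega> F.
        elastic_energy \<Omega> u f + ennreal \<epsilon> * surface_energy \<Omega> f)"

end

theory Submission
  imports Defs
begin

text \<open>Write \<open>v = B - A\<close> and let \<open>f v = \<chi> - F\<^sub>\<lambda>\<close> in \<open>\<Omega>\<close> and \<open>f = 0\<close> outside, so that \<open>f\<close> takes the values \<open>\<lambda>\<close> and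
  \<open>\<lambda> - 1\<close> in \<open>\<Omega>\<close>; the boundary of \<open>\<Omega>\<close> is a null set. With \<open>g = u - F\<^sub>\<lambda> - f v\<close> the elastic energy is the squared
  \<open>L\<^sup>2\<close> norm of \<open>g\<close>, and \<open>\<A>(D) (f v) = - \<A>(D) g\<close>.

  Incompatible case: testing with plane waves bounds each cosine moment of \<open>f\<close> by moments of \<open>g\<close>,
  uniformly in the frequency, because the symbol applied to \<open>v\<close> does not vanish on the sphere. Summing
  against trigonometric kernels with nonnegative coefficients that concentrate at the origin gives
  \<open>\<parallel>f\<parallel> \<le> C \<parallel>g\<parallel>\<close> in \<open>L\<^sup>2\<close>.

  Lower bound: \<open>f\<close> is integrated against an average of its sign at scale \<open>\<delta>\<close>. The averaging costs at most
  \<open>\<delta>\<close> times the surface energy; what remains is tested with the primitive of the average along a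
  direction in which \<open>f\<close> is differentiated by the equation, and is at most of order \<open>E\<^sub>e\<^sub>l\<^sup>1\<^sup>/\<^sup>2 / \<delta>\<close>. Optimising
  \<open>\<delta>\<close> yields the exponent 2/3.

  Upper bound: if \<open>\<xi>\<close> is a unit vector annihilated by \<open>v\<close>, then \<open>v \<partial>\<^sub>\<xi> \<Phi> - (v \<nabla>\<Phi>) \<otimes> \<xi>\<close> is divergence
  free for every Lipschitz \<open>\<Phi>\<close>. As \<open>\<Phi>\<close> serves the minimum of sawtooth functions in \<open>x \<bullet> \<xi>\<close> on finer and
  finer scales, each penalised by a multiple of the distance to the boundary, so that the scales
  refine towards the boundary of the cube.\<close>


section \<open>Smooth functions and cutoffs\<close>

text \<open>Behind the lower exponent stands one inequality,
  \<open>c \<le> K * (E / \<delta>\<^sup>2 + \<delta> * S)\<close> for all small \<delta>: the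
  averaged sign has derivatives of size 1 / \<delta>, and these are what the test function puts on
  g. With \<delta> = \<epsilon>^(1/3), multiplication by the square of \<delta> leaves E +
  \<epsilon> S. The upper bound takes 2^J of order \<epsilon>^(-1/3): scale j costs elastic energy
  of order 4^(-J) 2^(-j) and interface of order 2^J 2^(-j) + 1, so no scale dominates except the
  coarsest and the two sums balance. In the incompatible case the constant may depend neither on
  \<Omega> nor on \<lambda>; the comparison at single frequencies is carried over to space by
  kernels whose mass cancels at the end. Weak derivatives are handled by difference quotients
  throughout: translation invariance moves them between the factors of an integral, and dominated
  convergence gives the limit. The obstacle in the upper bound is that the interface is known only
  implicitly, through the active piece of a minimum. Its area is controlled by locating the points
  where a short segment can cross it.\<close>

lemma partial_deriv_eqI:
  "(f has_derivative f') (at x) \<Longrightarrow> partial_deriv j f x = f' (axis j 1)"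
  unfolding partial_deriv_def using frechet_derivative_at by metis

lemma has_derivative_partials:
  assumes "f differentiable (at x)"
  shows "(f has_derivative (\<lambda>h. \<Sum>j\<in>UNIV. h $ j * partial_deriv j f x)) (at x)"
proof -
  let ?D = "frechet_derivative f (at x)"
  have D: "(f has_derivative ?D) (at x)"
    using assms frechet_derivative_works by blast
  then have lin: "linear ?D"
    using has_derivative_linear by blast
  have "?D h = (\<Sum>j\<in>UNIV. h $ j * partial_deriv j f x)" for h
  proof -
    have "?D h = ?D (\<Sum>j\<in>UNIV. (h $ j) *\<^sub>R axis j 1)"
      using basis_expansion[of h] by (simp add: scalar_mult_eq_scaleR)
    also have "\<dots> = (\<Sum>j\<in>UNIV. h $ j * partial_deriv j f x)"
      by (simp add: linear_sum[OF lin] linear_cmul[OF lin] partial_deriv_def)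
    finally show ?thesis .
  qed
  then have "?D = (\<lambda>h. \<Sum>j\<in>UNIV. h $ j * partial_deriv j f x)" by (rule ext)
  with D show ?thesis by simp
qed

lemma C_diff_continuous: "C_diff r f \<Longrightarrow> continuous_on UNIV f"
  by (cases r) (auto simp: continuous_on_eq_continuous_within differentiable_imp_continuous_within)

lemma C_diff_Suc_imp: "C_diff (Suc r) f \<Longrightarrow> C_diff r f"
proof (induction r arbitrary: f)
  case 0
  then show ?case using C_diff_continuous by (metis C_diff.simps(1))
next
  case (Suc r)
  then show ?case by (metis C_diff.simps(2))
qed

lemma C_diff_le: "C_diff r f \<Longrightarrow> s \<le> r \<Longrightarrow> C_diff s f"
proof (induction r)
  case (Suc r)
  then show ?case using C_diff_Suc_imp by (metis le_Suc_eq)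
qed simp

lemma C_diff_const: "C_diff r (\<lambda>x::real^'d::finite. c)"
proof (induction r arbitrary: c)
  case (Suc r)
  have "partial_deriv j (\<lambda>x::real^'d. c) = (\<lambda>x. 0)" for j
    by (rule ext, subst partial_deriv_eqI) (auto intro!: derivative_eq_intros)
  then show ?case using Suc[of 0] by simp
qed simp

lemma partial_deriv_add:
  assumes "f differentiable (at x)" "g differentiable (at x)"
  shows "partial_deriv j (\<lambda>x. f x + g x) x = partial_deriv j f x + partial_deriv j g x"
proof -
  have "((\<lambda>x. f x + g x) has_derivative
     (\<lambda>h. frechet_derivative f (at x) h + frechet_derivative g (at x) h)) (at x)"
    using assms by (intro has_derivative_add) (auto simp: frechet_derivative_works)
  from partial_deriv_eqI[OF this] show ?thesis by (simp add: partial_deriv_def)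
qed

lemma partial_deriv_mult:
  fixes f g :: "real^'d::finite \<Rightarrow> real"
  assumes "f differentiable (at x)" "g differentiable (at x)"
  shows "partial_deriv j (\<lambda>x. f x * g x) x = f x * partial_deriv j g x + partial_deriv j f x * g x"
proof -
  have "((\<lambda>x. f x * g x) has_derivative
     (\<lambda>h. f x * frechet_derivative g (at x) h + frechet_derivative f (at x) h * g x)) (at x)"
    using assms by (intro has_derivative_mult) (auto simp: frechet_derivative_works)
  from partial_deriv_eqI[OF this] show ?thesis by (simp add: partial_deriv_def)
qed

lemma C_diff_add: "C_diff r f \<Longrightarrow> C_diff r g \<Longrightarrow> C_diff r (\<lambda>x. f x + g x)"
proof (induction r arbitrary: f g)
  case (Suc r)
  have "partial_deriv j (\<lambda>x. f x + g x) = (\<lambda>x. partial_deriv j f x + partial_deriv j g x)" for j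
    using Suc.prems by (auto simp: partial_deriv_add)
  with Suc show ?case by (auto intro: differentiable_add)
qed (auto intro: continuous_on_add)

lemma C_diff_mult: "C_diff r f \<Longrightarrow> C_diff r g \<Longrightarrow> C_diff r (\<lambda>x. f x * g x)"
proof (induction r arbitrary: f g)
  case (Suc r)
  have "partial_deriv j (\<lambda>x. f x * g x) = (\<lambda>x. f x * partial_deriv j g x + partial_deriv j f x * g x)" for j
    using Suc.prems by (auto simp: partial_deriv_mult)
  moreover have "C_diff r f" "C_diff r g" using Suc.prems C_diff_Suc_imp by blast+
  ultimately show ?case using Suc by (auto intro!: C_diff_add)
qed (auto intro: continuous_on_mult)

lemma C_diff_cmult: "C_diff r f \<Longrightarrow> C_diff r (\<lambda>x. c * f x)"
  by (rule C_diff_mult[OF C_diff_const])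

lemma C_diff_diff: "C_diff r f \<Longrightarrow> C_diff r g \<Longrightarrow> C_diff r (\<lambda>x. f x - g x)"
  using C_diff_add[of r f "\<lambda>x. (-1) * g x"] C_diff_cmult[of r g "-1"] by simp

lemma C_diff_sum: "finite I \<Longrightarrow> (\<And>i. i \<in> I \<Longrightarrow> C_diff r (f i)) \<Longrightarrow> C_diff r (\<lambda>x. \<Sum>i\<in>I. f i x)"
  by (induction I rule: finite_induct) (auto intro: C_diff_const C_diff_add)

lemma C_diff_inner: "C_diff r (\<lambda>x. (a::real^'d::finite) \<bullet> x)"
proof (cases r)
  case (Suc s)
  have D: "((\<lambda>x. a \<bullet> x) has_derivative (\<lambda>h. a \<bullet> h)) (at x)" for x
    by (auto intro!: derivative_eq_intros)
  have "partial_deriv j (\<lambda>x. a \<bullet> x) = (\<lambda>x. a \<bullet> axis j 1)" for j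
    by (rule ext) (rule partial_deriv_eqI[OF D])
  with D Suc show ?thesis using C_diff_const[of s] by (auto simp: differentiable_def)
qed (auto intro: continuous_intros)

section \<open>Smooth functions of one real variable and bump functions\<close>

primrec C_diff_real :: "nat \<Rightarrow> (real \<Rightarrow> real) \<Rightarrow> bool" where
  "C_diff_real 0 g \<longleftrightarrow> continuous_on UNIV g"
| "C_diff_real (Suc r) g \<longleftrightarrow> (\<exists>g'. (\<forall>x. (g has_real_derivative g' x) (at x)) \<and> C_diff_real r g')"

lemma C_diff_real_SucI:
  "(\<And>x. (g has_real_derivative g' x) (at x)) \<Longrightarrow> C_diff_real r g' \<Longrightarrow> C_diff_real (Suc r) g"
  by auto

lemma C_diff_real_continuous: "C_diff_real r g \<Longrightarrow> continuous_on UNIV g"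
  by (cases r) (auto intro: DERIV_continuous_on continuous_at_imp_continuous_on DERIV_isCont)

lemma C_diff_real_Suc_imp: "C_diff_real (Suc r) g \<Longrightarrow> C_diff_real r g"
proof (induction r arbitrary: g)
  case 0
  then show ?case using C_diff_real_continuous by (metis C_diff_real.simps(1))
next
  case (Suc r)
  then show ?case by (metis C_diff_real.simps(2))
qed

lemma C_diff_real_const: "C_diff_real r (\<lambda>x. c)"
  by (induction r arbitrary: c) (auto intro!: exI[of _ "\<lambda>x. 0"])

lemma C_diff_real_add: "C_diff_real r f \<Longrightarrow> C_diff_real r g \<Longrightarrow> C_diff_real r (\<lambda>x. f x + g x)"
proof (induction r arbitrary: f g)
  case (Suc r)
  then obtain f' g' where "\<And>x. (f has_real_derivative f' x) (at x)" "C_diff_real r f'"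
    "\<And>x. (g has_real_derivative g' x) (at x)" "C_diff_real r g'" by auto
  then show ?case using Suc.IH[of f' g']
    by (auto intro!: exI[of _ "\<lambda>x. f' x + g' x"] derivative_eq_intros)
qed (auto intro: continuous_on_add)

lemma C_diff_real_mult: "C_diff_real r f \<Longrightarrow> C_diff_real r g \<Longrightarrow> C_diff_real r (\<lambda>x. f x * g x)"
proof (induction r arbitrary: f g)
  case (Suc r)
  then obtain f' g' where "\<And>x. (f has_real_derivative f' x) (at x)" "C_diff_real r f'"
    "\<And>x. (g has_real_derivative g' x) (at x)" "C_diff_real r g'" by auto
  moreover have "C_diff_real r f" "C_diff_real r g" using Suc.prems C_diff_real_Suc_imp by blast+
  ultimately show ?case using Suc.IH[of f g'] Suc.IH[of f' g]
    by (auto intro!: exI[of _ "\<lambda>x. f x * g' x + f' x * g x"] derivative_eq_intros C_diff_real_add)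
qed (auto intro: continuous_on_mult)

lemma C_diff_real_reflect: "C_diff_real r f \<Longrightarrow> C_diff_real r (\<lambda>x. f (c - x))"
proof (induction r arbitrary: f)
  case 0
  then show ?case by (auto intro!: continuous_on_compose2[of UNIV f] continuous_intros)
next
  case (Suc r)
  then obtain f' where f': "\<And>x. (f has_real_derivative f' x) (at x)" "C_diff_real r f'" by auto
  have "((\<lambda>x. f (c - x)) has_real_derivative (-1) * f' (c - x)) (at x)" for x
    by (rule DERIV_cong[OF DERIV_chain2[OF f'(1)]]) (auto intro!: derivative_eq_intros)
  then show ?case using C_diff_real_mult[OF C_diff_real_const Suc.IH[OF f'(2)], of "-1"]
    by (rule C_diff_real_SucI)
qed

lemma C_diff_real_inverse:
  assumes "\<And>x. f x \<noteq> 0" "C_diff_real r f" shows "C_diff_real r (\<lambda>x. inverse (f x))"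
  using assms(2)
proof (induction r)
  case (Suc r)
  then obtain f' where f': "\<And>x. (f has_real_derivative f' x) (at x)" "C_diff_real r f'" by auto
  have "C_diff_real r (\<lambda>x. inverse (f x))" using Suc C_diff_real_Suc_imp by blast
  then have "C_diff_real r (\<lambda>x. (-1) * f' x * (inverse (f x) * inverse (f x)))"
    using f' by (intro C_diff_real_mult C_diff_real_const)
  then show ?case
  proof (rule C_diff_real_SucI[rotated])
    show "((\<lambda>x. inverse (f x)) has_real_derivative (-1) * f' x * (inverse (f x) * inverse (f x))) (at x)" for x
    using assms(1) by (auto intro!: derivative_eq_intros f'(1))
  qed
qed (use assms in \<open>auto intro!: continuous_intros\<close>)

lemma C_diff_compose: "C_diff_real r g \<Longrightarrow> C_diff r f \<Longrightarrow> C_diff r (\<lambda>x. g (f x))"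
proof (induction r arbitrary: f g)
  case 0
  then show ?case by (auto intro!: continuous_on_compose2[of UNIV g])
next
  case (Suc r)
  then obtain g' where g': "\<And>x. (g has_real_derivative g' x) (at x)" "C_diff_real r g'" by auto
  have f: "C_diff r f" using Suc.prems C_diff_Suc_imp by blast
  have D: "((\<lambda>x. g (f x)) has_derivative (\<lambda>h. g' (f x) * frechet_derivative f (at x) h)) (at x)" for x
    using Suc.prems(2) g'(1)[of "f x", unfolded has_field_derivative_def]
    by (intro has_derivative_compose[of f _ x UNIV g]) (auto simp: frechet_derivative_works)
  have "partial_deriv j (\<lambda>x. g (f x)) = (\<lambda>x. g' (f x) * partial_deriv j f x)" for j
    by (rule ext, subst partial_deriv_eqI[OF D]) (simp add: partial_deriv_def)
  moreover have "C_diff r (\<lambda>x. g' (f x) * partial_deriv j f x)" for j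
    using C_diff_mult[OF Suc.IH[OF g'(2) f]] Suc.prems(2) by simp
  moreover have "(\<lambda>x. g (f x)) differentiable (at x)" for x using D differentiableI by blast
  ultimately show ?case by simp
qed

text \<open>The classical flat function is the case n = 0. The powers of 1 / t are included because
  differentiation stays within linear combinations of the family, so smoothness of every order is a
  single induction with n arbitrary.\<close>

definition flat_exp :: "nat \<Rightarrow> real \<Rightarrow> real" where
  "flat_exp n t = (if t > 0 then inverse t ^ n * exp (- inverse t) else 0)"

lemma flat_exp_tendsto_0: "(flat_exp n \<longlongrightarrow> 0) (at 0)"
proof -
  have "((\<lambda>t. inverse t ^ n / exp (inverse t)) \<longlongrightarrow> (0::real)) (at_right 0)"
    by (rule filterlim_compose[OF tendsto_power_div_exp_0 filterlim_inverse_at_top_right])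
  then have "(flat_exp n \<longlongrightarrow> 0) (at_right 0)"
    by (rule Lim_transform_eventually)
       (auto simp: eventually_at_right_less flat_exp_def exp_minus divide_inverse
             intro!: eventually_mono[OF eventually_at_right_less[of 0]])
  moreover have "(flat_exp n \<longlongrightarrow> 0) (at_left 0)"
    by (rule Lim_transform_eventually[OF tendsto_const])
       (auto simp: flat_exp_def eventually_at intro!: exI[of _ 1])
  ultimately show ?thesis by (simp add: filterlim_split_at)
qed

lemma flat_exp_deriv:
  "(flat_exp n has_real_derivative flat_exp (n + 2) t + (- real n) * flat_exp (n + 1) t) (at t)"
proof -
  consider "t > 0" | "t < 0" | "t = 0" by linarith
  then show ?thesis
  proof cases
    case 1
    have "((\<lambda>t. inverse t ^ n * exp (- inverse t)) has_real_derivative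
       flat_exp (n + 2) t + (- real n) * flat_exp (n + 1) t) (at t)"
      using 1
      by (auto intro!: DERIV_cong[OF DERIV_mult[OF DERIV_power[OF DERIV_inverse]
            DERIV_fun_exp[OF DERIV_minus[OF DERIV_inverse]]]]
          simp: flat_exp_def algebra_simps power2_eq_square power_Suc[symmetric] numeral_2_eq_2
          simp del: power_Suc split: nat.splits)
         (cases n; simp add: algebra_simps)
    then show ?thesis
      by (rule DERIV_cong_ev[THEN iffD1, rotated -1])
         (use 1 in \<open>auto simp: flat_exp_def intro!: eventually_mono[OF order_tendstoD(1)[OF tendsto_ident_at 1]] eventually_nhds_in_open[of "{0<..}", THEN eventually_mono]\<close>)
  next
    case 2
    have "((\<lambda>t. 0) has_real_derivative 0) (at t)" by simp
    then show ?thesis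
      by (rule DERIV_cong_ev[THEN iffD1, rotated -1])
         (use 2 in \<open>auto simp: flat_exp_def intro!: eventually_nhds_in_open[of "{..<0}", THEN eventually_mono]\<close>)
  next
    case 3
    \<comment> \<open>The difference quotient at 0 is itself the next member of the family, so
      differentiability at 0 is the limit already computed.\<close>
    have "(flat_exp n (0 + h) - flat_exp n 0) / h = flat_exp (n + 1) h" for h
      by (auto simp: flat_exp_def divide_inverse)
    then have "(flat_exp n has_real_derivative 0) (at 0)"
      using flat_exp_tendsto_0[of "n+1"] by (simp add: DERIV_def)
    then show ?thesis using 3 by (simp add: flat_exp_def)
  qed
qed

lemma C_diff_real_flat_exp: "C_diff_real r (flat_exp n)"
proof (induction r arbitrary: n)
  case 0
  show ?case
    by (auto intro: DERIV_isCont flat_exp_deriv continuous_at_imp_continuous_on)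
next
  case (Suc r)
  have "C_diff_real r (\<lambda>t. flat_exp (n + 2) t + (- real n) * flat_exp (n + 1) t)"
    by (intro C_diff_real_add C_diff_real_mult C_diff_real_const Suc)
  with flat_exp_deriv show ?case by (rule C_diff_real_SucI)
qed

definition smooth_step :: "real \<Rightarrow> real" where
  "smooth_step t = flat_exp 0 t * inverse (flat_exp 0 t + flat_exp 0 (1 - t))"

lemma flat_exp_0: "flat_exp 0 t \<ge> 0" "flat_exp 0 t = 0 \<longleftrightarrow> t \<le> 0" "flat_exp 0 t > 0 \<longleftrightarrow> t > 0"
  by (auto simp: flat_exp_def)

lemma flat_exp_sum_pos: "flat_exp 0 t + flat_exp 0 (1 - t) > 0"
  using flat_exp_0[of t] flat_exp_0[of "1 - t"] by (smt (verit))

lemma C_diff_real_smooth_step: "C_diff_real r smooth_step"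
  unfolding smooth_step_def using flat_exp_sum_pos
  by (intro C_diff_real_mult C_diff_real_inverse C_diff_real_add C_diff_real_flat_exp
      C_diff_real_reflect[of _ "flat_exp 0"]) (simp add: less_imp_neq[symmetric])

lemma smooth_step_simps: "t \<le> 0 \<Longrightarrow> smooth_step t = 0" "t \<ge> 1 \<Longrightarrow> smooth_step t = 1"
  "0 \<le> smooth_step t" "smooth_step t \<le> 1"
proof -
  show "t \<le> 0 \<Longrightarrow> smooth_step t = 0" "t \<ge> 1 \<Longrightarrow> smooth_step t = 1"
    by (auto simp: smooth_step_def flat_exp_def)
  show "0 \<le> smooth_step t" "smooth_step t \<le> 1"
    using flat_exp_0[of t] flat_exp_0[of "1 - t"] flat_exp_sum_pos[of t]
    by (auto simp: smooth_step_def field_simps)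
qed

text \<open>Finitely many smooth bumps cover K; their sum s has a positive minimum m on K, and a
  smooth step applied to 2 s / m is 1 where s > m / 2. The open set V matters beyond K itself: on V
  the derivatives of \<eta> times a function are those of the function.\<close>

lemma smooth_urysohn:
  fixes K U :: "(real^'d::finite) set"
  assumes "compact K" "open U" "K \<subseteq> U"
  obtains \<eta> V L where "\<And>r. C_diff r \<eta>" "\<And>x. 0 \<le> \<eta> x" "\<And>x. \<eta> x \<le> 1"
    "open V" "K \<subseteq> V" "\<And>x. x \<in> V \<Longrightarrow> \<eta> x = 1"
    "compact L" "L \<subseteq> U" "\<And>x. x \<notin> L \<Longrightarrow> \<eta> x = 0"
proof (cases "K = {}")
  case True
  show ?thesis
    by (rule that[of "\<lambda>x. 0" "{}" "{}"]) (use True in \<open>auto intro: C_diff_const\<close>)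
next
  case False
  have "\<forall>x\<in>K. \<exists>r>0. cball x r \<subseteq> U"
    using assms open_contains_cball by blast
  then obtain \<rho> where \<rho>: "\<And>x. x \<in> K \<Longrightarrow> \<rho> x > 0" "\<And>x. x \<in> K \<Longrightarrow> cball x (\<rho> x) \<subseteq> U"
    by metis
  obtain T where T: "T \<subseteq> K" "finite T" "K \<subseteq> (\<Union>x\<in>T. ball x (\<rho> x))"
  proof (rule compactE_image[OF assms(1), of K "\<lambda>x. ball x (\<rho> x)"])
    show "K \<subseteq> (\<Union>x\<in>K. ball x (\<rho> x))" using \<rho>(1) by auto
  qed (use that in auto)
  define s where "s y = (\<Sum>x\<in>T. flat_exp 0 ((\<rho> x)\<^sup>2 - (y - x) \<bullet> (y - x)))" for y
  have sC: "C_diff r s" for r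
  proof -
    have "C_diff r (\<lambda>y. (\<rho> x)\<^sup>2 - (\<Sum>i\<in>UNIV. (axis i 1 \<bullet> y - x $ i) * (axis i 1 \<bullet> y - x $ i)))" for x
      by (intro C_diff_diff C_diff_sum C_diff_mult C_diff_inner C_diff_const) auto
    moreover have "(y - x) \<bullet> (y - x) = (\<Sum>i\<in>UNIV. (axis i 1 \<bullet> y - x $ i) * (axis i 1 \<bullet> y - x $ i))" for x y :: "real^'d"
      by (simp add: inner_vec_def[of "y - x"] inner_axis')
    ultimately show ?thesis
      unfolding s_def using T(2)
      by (intro C_diff_sum C_diff_compose[OF C_diff_real_flat_exp]) simp_all
  qed
  have s0: "s y \<ge> 0" for y unfolding s_def by (intro sum_nonneg flat_exp_0)
  have spos: "s y > 0" if "y \<in> K" for y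
  proof -
    obtain x where x: "x \<in> T" "y \<in> ball x (\<rho> x)" using T(3) \<open>y \<in> K\<close> by (meson UN_E subsetD)
    then have "(norm (y - x))\<^sup>2 < (\<rho> x)\<^sup>2"
      by (intro power_strict_mono) (auto simp: dist_norm norm_minus_commute)
    then have "flat_exp 0 ((\<rho> x)\<^sup>2 - (y - x) \<bullet> (y - x)) > 0"
      by (simp add: flat_exp_0 power2_norm_eq_inner)
    then show ?thesis unfolding s_def using x T(2) by (intro sum_pos2[of T x]) (auto simp: flat_exp_0)
  qed
  have cont: "continuous_on S s" for S using C_diff_continuous[OF sC] continuous_on_subset by blast
  obtain z where z: "z \<in> K" "\<And>y. y \<in> K \<Longrightarrow> s z \<le> s y"
    using continuous_attains_inf[OF assms(1) False cont] by blast
  define m where "m = s z"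
  have m: "m > 0" using spos z m_def by blast
  show ?thesis
  proof (rule that[of "\<lambda>y. smooth_step (2 / m * s y)" "{y. s y > m / 2}" "\<Union>x\<in>T. cball x (\<rho> x)"])
    show "C_diff r (\<lambda>y. smooth_step (2 / m * s y))" for r
      by (rule C_diff_compose[OF C_diff_real_smooth_step C_diff_cmult[OF sC]])
    show "open {y. s y > m / 2}"
      using cont[of UNIV] by (intro open_Collect_less continuous_on_const)
    show "K \<subseteq> {y. s y > m / 2}" using z(2) m m_def by fastforce
    show "smooth_step (2 / m * s x) = 1" if "x \<in> {y. s y > m / 2}" for x
      using that m by (intro smooth_step_simps) (auto simp: field_simps)
    show "(\<Union>x\<in>T. cball x (\<rho> x)) \<subseteq> U" using \<rho> T by blast
    show "smooth_step (2 / m * s y) = 0" if y: "y \<notin> (\<Union>x\<in>T. cball x (\<rho> x))" for y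
    proof -
      have "flat_exp 0 ((\<rho> x)\<^sup>2 - (y - x) \<bullet> (y - x)) = 0" if "x \<in> T" for x
      proof -
        have "\<rho> x < norm (y - x)" using y that by (auto simp: dist_norm norm_minus_commute)
        moreover have "\<rho> x > 0" using \<rho> T that by blast
        ultimately have "(\<rho> x)\<^sup>2 < (norm (y - x))\<^sup>2" by (intro power_strict_mono) auto
        then show ?thesis by (simp add: flat_exp_0 power2_norm_eq_inner)
      qed
      then have "s y = 0" by (simp add: s_def)
      then show ?thesis by (simp add: smooth_step_simps)
    qed
  qed (use T in \<open>auto simp: smooth_step_simps\<close>)
qed

section \<open>Test functions and first-order operators\<close>

lemma measurable_lebesgue_translate:
  "(\<lambda>x. x + a) \<in> lebesgue \<rightarrow>\<^sub>M (lebesgue :: 'a::euclidean_space measure)"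
  using lebesgue_affine_measurable[where c="\<lambda>_. 1" and t=a]
  by (simp add: euclidean_representation add.commute)

lemma distr_lebesgue_translate:
  "distr lebesgue lebesgue (\<lambda>x. x + a) = (lebesgue :: 'a::euclidean_space measure)"
  using lebesgue_affine_euclidean[where c="\<lambda>_. 1" and t=a]
  by (simp add: euclidean_representation density_1 add.commute)

lemma borel_measurable_lebesgue_translate:
  fixes f :: "'a::euclidean_space \<Rightarrow> 'b::topological_space"
  shows "f \<in> borel_measurable lebesgue \<Longrightarrow> (\<lambda>x. f (x + a)) \<in> borel_measurable lebesgue"
  using measurable_comp[OF measurable_lebesgue_translate] by (auto simp: comp_def)

lemma integral_lebesgue_translate:
  fixes f :: "'a::euclidean_space \<Rightarrow> 'b::{banach, second_countable_topology}"
  assumes "f \<in> borel_measurable lebesgue"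
  shows "(LINT x|lebesgue. f (x + a)) = (LINT x|lebesgue. f x)"
  using integral_distr[OF measurable_lebesgue_translate assms, of a] by (simp add: distr_lebesgue_translate)

lemma integrable_lebesgue_translate:
  fixes f :: "'a::euclidean_space \<Rightarrow> 'b::{banach, second_countable_topology}"
  assumes "integrable lebesgue f"
  shows "integrable lebesgue (\<lambda>x. f (x + a))"
  using integrable_distr_eq[OF measurable_lebesgue_translate borel_measurable_integrable[OF assms], of a] assms
  by (simp add: distr_lebesgue_translate)

lemma continuous_imp_lebesgue_measurable:
  fixes f :: "'a::euclidean_space \<Rightarrow> 'b::topological_space"
  shows "continuous_on UNIV f \<Longrightarrow> f \<in> borel_measurable lebesgue"
  by (simp add: borel_measurable_continuous_onI measurable_completion)

lemma integrable_indicator_cball: "integrable lebesgue (indicat_real (cball (c::'a::euclidean_space) R))"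
  using emeasure_bounded_finite[of "cball c R"] by (intro integrable_real_indicator) (auto simp: less_top)

lemma partial_deriv_local:
  assumes "open U" "x \<in> U" "\<And>y. y \<in> U \<Longrightarrow> f y = g y"
  shows "partial_deriv j f x = partial_deriv j g x"
proof -
  have "(f has_derivative D) (at x) \<longleftrightarrow> (g has_derivative D) (at x)" for D
    using assms has_derivative_transform_within_open[of f D x UNIV U g]
      has_derivative_transform_within_open[of g D x UNIV U f] by auto
  then show ?thesis unfolding partial_deriv_def frechet_derivative_def by simp
qed

lemma partial_deriv_vanish:
  fixes f :: "real^'d::finite \<Rightarrow> real"
  assumes "closed L" "\<And>x. x \<notin> L \<Longrightarrow> f x = 0" "x \<notin> L"
  shows "partial_deriv j f x = 0"
proof -
  have "partial_deriv j f x = partial_deriv j (\<lambda>_. 0) x"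
    using assms by (intro partial_deriv_local[of "-L"]) auto
  also have "\<dots> = 0" by (subst partial_deriv_eqI[OF has_derivative_const]) simp
  finally show ?thesis .
qed

lemma test_functionsI:
  fixes \<phi> :: "real^'d::finite \<Rightarrow> real"
  assumes "\<And>r. C_diff r \<phi>" "bounded L" "\<And>x. x \<notin> L \<Longrightarrow> \<phi> x = 0"
  shows "\<phi> \<in> test_functions"
proof -
  have "bounded {x. \<phi> x \<noteq> 0}" by (rule bounded_subset[OF assms(2)]) (use assms(3) in auto)
  then show ?thesis unfolding test_functions_def using assms(1) by (auto simp: compact_closure)
qed

lemma test_functions_vanish:
  assumes "\<phi> \<in> test_functions"
  obtains R where "R > 0" "\<And>x. x \<notin> cball 0 R \<Longrightarrow> \<phi> x = 0"
proof -
  have "bounded {x. \<phi> x \<noteq> 0}"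
    using assms compact_imp_bounded bounded_subset[OF _ closure_subset] by (fastforce simp: test_functions_def)
  then obtain R where R: "R > 0" "\<And>x. \<phi> x \<noteq> 0 \<Longrightarrow> norm x \<le> R" unfolding bounded_pos by auto
  show ?thesis
  proof (rule that[OF R(1)])
    fix x :: "real^'a" assume "x \<notin> cball 0 R"
    then show "\<phi> x = 0" using R(2)[of x] by (auto simp: dist_norm)
  qed
qed

lemma test_functions_C_diff: "\<phi> \<in> test_functions \<Longrightarrow> C_diff r \<phi>"
  by (simp add: test_functions_def)

lemma test_functions_partial_deriv:
  assumes "\<phi> \<in> test_functions" shows "partial_deriv j \<phi> \<in> test_functions"
proof -
  obtain R where "R > 0" and R: "\<And>x. x \<notin> cball 0 R \<Longrightarrow> \<phi> x = 0" using test_functions_vanish[OF assms] by blast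
  have "C_diff r (partial_deriv j \<phi>)" for r
    using test_functions_C_diff[OF assms, of "Suc r"] by simp
  moreover have "partial_deriv j \<phi> x = 0" if "x \<notin> cball 0 R" for x
    using partial_deriv_vanish[OF _ R that] by simp
  ultimately show ?thesis by (intro test_functionsI[of _ "cball 0 R"]) auto
qed

lemma C_diff_differentiable: "C_diff r \<phi> \<Longrightarrow> r \<ge> 1 \<Longrightarrow> \<phi> differentiable (at x)"
  by (cases r) auto

lemma C_diff_partial_continuous: "C_diff r \<phi> \<Longrightarrow> r \<ge> 1 \<Longrightarrow> continuous_on UNIV (partial_deriv j \<phi>)"
  by (cases r) (auto dest: C_diff_continuous)

text \<open>Written through the partial derivatives, so that it is linear in the direction without
  any differentiability and is again a smooth function of x when f is.\<close>

definition dir_deriv :: "real^'d::finite \<Rightarrow> (real^'d \<Rightarrow> real) \<Rightarrow> real^'d \<Rightarrow> real" where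
  "dir_deriv e f x = (\<Sum>j\<in>UNIV. e $ j * partial_deriv j f x)"

lemma dir_deriv_axis: "dir_deriv (axis j 1) f = partial_deriv j f"
  by (rule ext) (simp add: dir_deriv_def axis_def if_distrib[of "\<lambda>c. c * _"] cong: if_cong)

lemma has_derivative_dir_deriv:
  "f differentiable (at x) \<Longrightarrow> (f has_derivative (\<lambda>h. dir_deriv h f x)) (at x)"
  unfolding dir_deriv_def by (rule has_derivative_partials)

lemma dir_deriv_eqI: "(f has_derivative f') (at x) \<Longrightarrow> dir_deriv h f x = f' h"
  using has_derivative_dir_deriv has_derivative_unique differentiableI by metis

text \<open>The function and its partial derivatives are continuous and vanish off a ball, so
  compactness bounds them; the mean value inequality gives the Lipschitz estimate. A single constant
  serves all bounds.\<close>

lemma C_diff_lipschitz: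
  fixes f :: "real^'d::finite \<Rightarrow> real"
  assumes "C_diff 1 f" "\<And>x. x \<notin> cball 0 R \<Longrightarrow> f x = 0"
  obtains C where "C > 0" "\<And>x h. \<bar>dir_deriv h f x\<bar> \<le> C * norm h" "\<And>x y. \<bar>f x - f y\<bar> \<le> C * norm (x - y)"
    "\<And>x j. \<bar>partial_deriv j f x\<bar> \<le> C" "\<And>x. \<bar>f x\<bar> \<le> C"
proof -
  have "\<exists>C>0. \<forall>x. \<bar>partial_deriv j f x\<bar> \<le> C" for j
  proof -
    have "compact (partial_deriv j f ` cball 0 R)"
      using assms by (intro compact_continuous_image continuous_on_subset[OF C_diff_partial_continuous]) auto
    then obtain C where C: "C > 0" "\<And>x. x \<in> cball 0 R \<Longrightarrow> \<bar>partial_deriv j f x\<bar> \<le> C"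
      unfolding bounded_pos[THEN iffD1] using compact_imp_bounded bounded_pos by (metis image_eqI real_norm_def)
    have "\<bar>partial_deriv j f x\<bar> \<le> C" for x
      using C partial_deriv_vanish[of "cball 0 R" f x j] assms(2) by (cases "x \<in> cball 0 R") auto
    then show ?thesis using C(1) by blast
  qed
  then obtain C where C: "\<And>j. C j > 0" "\<And>j x. \<bar>partial_deriv j f x\<bar> \<le> C j" by metis
  define C' where "C' = (\<Sum>j\<in>UNIV. C j)"
  have "C' > 0" unfolding C'_def using C by (intro sum_pos) auto
  have b: "\<bar>dir_deriv h f x\<bar> \<le> C' * norm h" for x h
  proof -
    have "\<bar>dir_deriv h f x\<bar> \<le> (\<Sum>j\<in>UNIV. \<bar>h $ j * partial_deriv j f x\<bar>)"
      unfolding dir_deriv_def by (rule sum_abs)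
    also have "\<dots> \<le> (\<Sum>j\<in>UNIV. C j * norm h)"
      using C component_le_norm_cart[of h] by (intro sum_mono) (simp add: abs_mult mult.commute[of "C _"] mult_mono)
    finally show ?thesis by (simp add: C'_def sum_distrib_right)
  qed
  have l: "\<bar>f x - f y\<bar> \<le> C' * norm (x - y)" for x y
  proof -
    have "norm (f x - f y) \<le> C' * norm (x - y)"
    proof (rule differentiable_bound[of UNIV f "\<lambda>x h. dir_deriv h f x"])
      show "(f has_derivative (\<lambda>h. dir_deriv h f x)) (at x within UNIV)" for x
        using has_derivative_dir_deriv C_diff_differentiable[OF assms(1)] by auto
      show "onorm (\<lambda>h. dir_deriv h f x) \<le> C'" for x
        using b by (intro onorm_le) auto
    qed auto
    then show ?thesis by simp
  qed
  have "compact (f ` cball 0 R)"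
    using assms by (intro compact_continuous_image continuous_on_subset[OF C_diff_continuous[OF assms(1)]]) auto
  then obtain B where B: "B > 0" "\<And>x. x \<in> cball 0 R \<Longrightarrow> \<bar>f x\<bar> \<le> B"
    using compact_imp_bounded bounded_pos by (metis image_eqI real_norm_def)
  have B': "\<bar>f x\<bar> \<le> B" for x using B assms(2)[of x] by (cases "x \<in> cball 0 R") auto
  have Cle: "C j \<le> C'" for j unfolding C'_def using C(1) by (intro member_le_sum) (auto intro: less_imp_le)
  show ?thesis
  proof (rule that[of "C' + B"])
    show "C' + B > 0" using \<open>C' > 0\<close> B by simp
    show "\<bar>dir_deriv h f x\<bar> \<le> (C' + B) * norm h" for x h
      using b[of h x] B(1) by (smt (verit) mult_right_mono norm_ge_zero)
    show "\<bar>f x - f y\<bar> \<le> (C' + B) * norm (x - y)" for x y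
      using l[of x y] B(1) by (smt (verit) mult_right_mono norm_ge_zero)
    show "\<bar>partial_deriv j f x\<bar> \<le> C' + B" for x j
      using C(2)[of j x] Cle[of j] B(1) by linarith
    show "\<bar>f x\<bar> \<le> C' + B" for x using B'[of x] \<open>C' > 0\<close> by linarith
  qed
qed

lemma integrable_bounded_on_ball:
  fixes f :: "'a::euclidean_space \<Rightarrow> 'b::{banach, second_countable_topology}"
  assumes "f \<in> borel_measurable lebesgue" "\<And>x. norm (f x) \<le> M" "\<And>x. x \<notin> cball 0 R \<Longrightarrow> f x = 0"
  shows "integrable lebesgue f"
proof (rule Bochner_Integration.integrable_bound[of _ "\<lambda>x. M * indicator (cball 0 R) x"])
  show "integrable lebesgue (\<lambda>x. M * indicator (cball 0 R) x :: real)"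
    by (intro integrable_mult_right integrable_indicator_cball)
  show "AE x in lebesgue. norm (f x) \<le> norm (M * indicator (cball 0 R) x :: real)"
  proof (rule AE_I2)
    fix x :: 'a
    show "norm (f x) \<le> norm (M * indicator (cball 0 R) x :: real)"
      using assms(2)[of x] assms(3)[of x] by (cases "x \<in> cball 0 R") auto
  qed
qed (use assms in auto)

section \<open>Difference quotients and integrals of derivatives\<close>

lemma LIMSEQ_diff_quot:
  assumes "f differentiable (at x)"
  shows "(\<lambda>n. real (Suc n) * (f (x + (1 / real (Suc n)) *\<^sub>R e) - f x)) \<longlonglongrightarrow> dir_deriv e f x"
proof -
  have "((\<lambda>t. f (x + t *\<^sub>R e)) has_derivative (\<lambda>t. dir_deriv (t *\<^sub>R e) f x)) (at 0)"
    by (rule has_derivative_compose[of "\<lambda>t. x + t *\<^sub>R e" "\<lambda>t. t *\<^sub>R e" 0 UNIV f "\<lambda>h. dir_deriv h f x", simplified])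
       (use has_derivative_dir_deriv[OF assms] in \<open>auto intro!: derivative_eq_intros\<close>)
  then have "((\<lambda>t. f (x + t *\<^sub>R e)) has_real_derivative dir_deriv e f x) (at 0)"
    by (auto simp: has_field_derivative_def dir_deriv_def sum_distrib_left algebra_simps elim!: has_derivative_eq_rhs)
  then have lim: "((\<lambda>h. (f (x + h *\<^sub>R e) - f x) / h) \<longlongrightarrow> dir_deriv e f x) (at 0)"
    by (simp add: DERIV_def)
  have "filterlim (\<lambda>n. 1 / real (Suc n)) (at 0) sequentially"
    unfolding filterlim_at using LIMSEQ_inverse_real_of_nat by (auto simp: inverse_eq_divide)
  from filterlim_compose[OF lim this] show ?thesis by (simp add: field_simps)
qed

text \<open>The Lipschitz bound of f dominates all difference quotients. Since q is merely locally
  integrable, this is the device by which a derivative on a test function becomes a translation that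
  can be shifted to q.\<close>

lemma LIMSEQ_integral_diff_quot:
  fixes q :: "real^'d::finite \<Rightarrow> real"
  assumes "C_diff 1 f" "\<And>x. x \<notin> cball 0 R \<Longrightarrow> f x = 0"
    and q: "q \<in> borel_measurable lebesgue" "\<And>R. set_integrable lebesgue (cball 0 R) q"
  shows "(\<lambda>n. LINT x|lebesgue. q x * (real (Suc n) * (f (x + (1 / real (Suc n)) *\<^sub>R e) - f x)))
      \<longlonglongrightarrow> (LINT x|lebesgue. q x * dir_deriv e f x)"
proof -
  obtain C where C: "C > 0" "\<And>x y. \<bar>f x - f y\<bar> \<le> C * norm (x - y)" "\<And>x h. \<bar>dir_deriv h f x\<bar> \<le> C * norm h"
    using C_diff_lipschitz[OF assms(1,2)] by metis
  have cf: "continuous_on UNIV f" using assms(1) C_diff_continuous by blast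
  have cp: "continuous_on UNIV (\<lambda>x. dir_deriv e f x)"
    unfolding dir_deriv_def using assms(1) by (intro continuous_intros C_diff_partial_continuous) auto
  \<comment> \<open>The radius is enlarged by \<open>norm e\<close> so that the ball contains the
    supports of all shifted copies of f.\<close>
  define w where "w x = (C * norm e) * norm (indicator (cball 0 (\<bar>R\<bar> + norm e)) x *\<^sub>R q x)" for x
  show ?thesis
  proof (rule integral_dominated_convergence[where w=w])
    show "integrable lebesgue w"
      using q(2)[of "\<bar>R\<bar> + norm e"] unfolding w_def set_integrable_def
      by (intro integrable_mult_right integrable_norm)
    show "AE x in lebesgue. (\<lambda>n. q x * (real (Suc n) * (f (x + (1 / real (Suc n)) *\<^sub>R e) - f x)))
        \<longlonglongrightarrow> q x * dir_deriv e f x"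
      using LIMSEQ_diff_quot[OF C_diff_differentiable[OF assms(1)]] by (intro AE_I2 tendsto_mult tendsto_const) auto
    show "(\<lambda>x. q x * dir_deriv e f x) \<in> borel_measurable lebesgue"
      using q(1) continuous_imp_lebesgue_measurable[OF cp] by auto
    have "(\<lambda>x. f (x + (1 / real (Suc n)) *\<^sub>R e)) \<in> borel_measurable lebesgue" for n
      by (intro continuous_imp_lebesgue_measurable continuous_on_compose2[OF cf] continuous_intros) auto
    then show "(\<lambda>x. q x * (real (Suc n) * (f (x + (1 / real (Suc n)) *\<^sub>R e) - f x))) \<in> borel_measurable lebesgue" for n
      using q(1) continuous_imp_lebesgue_measurable[OF cf] by (intro borel_measurable_times borel_measurable_diff) auto
    show "AE x in lebesgue. norm (q x * (real (Suc n) * (f (x + (1 / real (Suc n)) *\<^sub>R e) - f x))) \<le> w x" for n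
    proof (rule AE_I2)
      fix x
      let ?D = "real (Suc n) * (f (x + (1 / real (Suc n)) *\<^sub>R e) - f x)"
      have D: "\<bar>?D\<bar> \<le> C * norm e"
      proof -
        have "\<bar>?D\<bar> = real (Suc n) * \<bar>f (x + (1 / real (Suc n)) *\<^sub>R e) - f x\<bar>" by (simp add: abs_mult)
        also have "\<dots> \<le> real (Suc n) * (C * norm ((1 / real (Suc n)) *\<^sub>R e))"
          using C(2)[of "x + (1 / real (Suc n)) *\<^sub>R e" x] by (intro mult_left_mono) auto
        also have "\<dots> = C * norm e" by simp
        finally show ?thesis .
      qed
      show "norm (q x * ?D) \<le> w x"
      proof (cases "x \<in> cball 0 (\<bar>R\<bar> + norm e)")
        case True
        then show ?thesis using mult_left_mono[OF D, of "\<bar>q x\<bar>"] by (simp add: w_def abs_mult mult_ac)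
      next
        case False
        then have x: "norm x > \<bar>R\<bar> + norm e" by (simp add: dist_norm)
        have "norm ((1 / real (Suc n)) *\<^sub>R e) \<le> norm e" by (simp add: field_simps)
        then have "norm (x + (1 / real (Suc n)) *\<^sub>R e) > R"
          using x norm_diff_ineq[of x "(1 / real (Suc n)) *\<^sub>R e"] by linarith
        moreover have "norm x > R" using x norm_ge_zero[of e] by linarith
        ultimately have "f (x + (1 / real (Suc n)) *\<^sub>R e) = 0" "f x = 0"
          using assms(2) by (simp_all add: not_le[symmetric] del: of_nat_Suc)
        then show ?thesis using C(1) by (simp add: w_def)
      qed
    qed
  qed
qed

text \<open>Each difference quotient integrates to zero by translation invariance, and so does the
  limit.\<close>

lemma integral_dir_deriv_zero:
  fixes f :: "real^'d::finite \<Rightarrow> real"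
  assumes "C_diff 1 f" "\<And>x. x \<notin> cball 0 R \<Longrightarrow> f x = 0"
  shows "(LINT x|lebesgue. dir_deriv e f x) = 0"
proof -
  obtain C where C: "\<And>x. \<bar>f x\<bar> \<le> C"
    using C_diff_lipschitz[OF assms] by metis
  have cf: "f \<in> borel_measurable lebesgue"
    using assms(1) C_diff_continuous continuous_imp_lebesgue_measurable by blast
  have i: "integrable lebesgue f"
    using integrable_bounded_on_ball[OF cf, of C R] C assms(2) by auto
  have "(LINT x|lebesgue. 1 * (real (Suc n) * (f (x + (1 / real (Suc n)) *\<^sub>R e) - f x))) = 0" for n
    using integral_lebesgue_translate[OF cf] integrable_lebesgue_translate[OF i] i by simp
  moreover have "set_integrable lebesgue (cball 0 R) (\<lambda>x::real^'d. 1::real)" for R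
    using integrable_indicator_cball[of 0 R] by (simp add: set_integrable_def)
  ultimately show ?thesis
    using LIMSEQ_integral_diff_quot[OF assms(1), where q="\<lambda>_. 1" and e=e and R=R] assms(2)
      LIMSEQ_unique[OF _ tendsto_const[of 0]] by simp
qed

lemma integral_partial_deriv_zero:
  fixes f :: "real^'d::finite \<Rightarrow> real"
  assumes "C_diff 1 f" "\<And>x. x \<notin> cball 0 R \<Longrightarrow> f x = 0"
  shows "(LINT x|lebesgue. partial_deriv j f x) = 0"
  using integral_dir_deriv_zero[OF assms, where e="axis j 1"] by (simp add: dir_deriv_axis)

lemma enum_UNIV:
  fixes js :: "'d::finite list"
  defines "js \<equiv> SOME js. distinct js \<and> set js = UNIV"
  shows "distinct js" "set js = UNIV"
proof -
  have "\<exists>js::'d list. distinct js \<and> set js = UNIV"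
    using finite_distinct_list[of "UNIV :: 'd set"] by auto
  from someI_ex[OF this] show "distinct js" "set js = UNIV" unfolding js_def by auto
qed

lemma test_functions_partial_deriv_pow:
  "\<phi> \<in> test_functions \<Longrightarrow> (partial_deriv j ^^ n) \<phi> \<in> test_functions"
  by (induction n) (auto intro: test_functions_partial_deriv)

lemma test_functions_foldr:
  "\<phi> \<in> test_functions \<Longrightarrow> foldr (\<lambda>j. partial_deriv j ^^ \<alpha> j) js \<phi> \<in> test_functions"
  by (induction js) (auto intro: test_functions_partial_deriv_pow)

lemma test_functions_multi_deriv: "\<phi> \<in> test_functions \<Longrightarrow> multi_deriv \<alpha> \<phi> \<in> test_functions"
  unfolding multi_deriv_def by (rule test_functions_foldr)

text \<open>Since k is positive, some coordinate is differentiated at least once; the outermost such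
  derivative along the enumeration exhibits \<open>multi_deriv \<alpha> \<phi>\<close> as a partial
  derivative of a test function.\<close>

lemma integral_multi_deriv_zero:
  fixes \<phi> :: "real^'d::finite \<Rightarrow> real"
  assumes \<phi>: "\<phi> \<in> test_functions" and "\<alpha> \<in> multi_indices k" "k \<ge> 1"
  shows "(LINT x|lebesgue. multi_deriv \<alpha> \<phi> x) = 0"
proof -
  have *: "\<exists>\<psi>\<in>test_functions. \<exists>l. foldr (\<lambda>j. partial_deriv j ^^ \<alpha> j) js \<phi> = partial_deriv l \<psi>"
    if "j \<in> set js" "\<alpha> j \<ge> 1" for j :: 'd and js
    using that(1)
  proof (induction js)
    case (Cons l js)
    show ?case
    proof (cases "\<alpha> l")
      case 0
      then show ?thesis using Cons that(2) by auto
    next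
      case (Suc n)
      then show ?thesis
        using test_functions_partial_deriv_pow[OF test_functions_foldr[OF \<phi>, of \<alpha> js], where j=l and n=n] by auto
    qed
  qed simp
  have "\<exists>j. \<alpha> j \<ge> 1"
  proof (rule ccontr)
    assume "\<not> ?thesis"
    then have "\<alpha> j = 0" for j by (simp add: not_le)
    then show False using assms(2,3) by (simp add: multi_indices_def)
  qed
  then obtain j where j: "\<alpha> j \<ge> 1" by blast
  have "j \<in> set (SOME js. distinct js \<and> set js = UNIV)" using enum_UNIV(2)[where 'd='d] by simp
  from *[OF this j] obtain \<psi> l where \<psi>: "\<psi> \<in> test_functions" "multi_deriv \<alpha> \<phi> = partial_deriv l \<psi>"
    unfolding multi_deriv_def by auto
  obtain R where "\<And>x. x \<notin> cball 0 R \<Longrightarrow> \<psi> x = 0" using test_functions_vanish[OF \<psi>(1)] by blast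
  then show ?thesis
    using integral_partial_deriv_zero[OF test_functions_C_diff[OF \<psi>(1)], where R=R] \<psi>(2) by simp
qed

text \<open>Square integrability gives integrability on a ball through
  \<open>norm (u x) \<le> 1 + (norm (u x))\<^sup>2\<close>.\<close>

lemma L2_loc_integrable_mult:
  fixes u :: "real^'d::finite \<Rightarrow> real^'n::finite"
  assumes u: "u \<in> L2_loc" and q: "q \<in> borel_measurable lebesgue" "\<And>x. \<bar>q x\<bar> \<le> M" "\<And>x. x \<notin> cball 0 R \<Longrightarrow> q x = 0"
  shows "integrable lebesgue (\<lambda>x. q x *\<^sub>R u x)"
proof -
  have u': "u \<in> borel_measurable lebesgue" "set_integrable lebesgue (cball 0 R) (\<lambda>x. (norm (u x))\<^sup>2)"
    using u by (auto simp: L2_loc_def)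
  have "M \<ge> 0" using q(2)[of 0] by linarith
  have "integrable lebesgue (\<lambda>x. indicator (cball 0 R) x *\<^sub>R (norm (u x))\<^sup>2)"
    using u'(2) by (simp add: set_integrable_def)
  moreover have "integrable lebesgue (indicat_real (cball (0::real^'d) R))"
    by (rule integrable_indicator_cball)
  ultimately have "integrable lebesgue (\<lambda>x. M * (indicat_real (cball 0 R) x + indicator (cball 0 R) x *\<^sub>R (norm (u x))\<^sup>2))"
    by (intro integrable_mult_right Bochner_Integration.integrable_add)
  then show ?thesis
  proof (rule Bochner_Integration.integrable_bound)
    show "(\<lambda>x. q x *\<^sub>R u x) \<in> borel_measurable lebesgue" using q u' by auto
    show "AE x in lebesgue. norm (q x *\<^sub>R u x)
        \<le> norm (M * (indicat_real (cball 0 R) x + indicator (cball 0 R) x *\<^sub>R (norm (u x))\<^sup>2))"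
    proof (rule AE_I2)
      fix x
      show "norm (q x *\<^sub>R u x) \<le> norm (M * (indicat_real (cball 0 R) x + indicator (cball 0 R) x *\<^sub>R (norm (u x))\<^sup>2))"
      proof (cases "x \<in> cball 0 R")
        case True
        have "norm (u x) \<le> 1 + (norm (u x))\<^sup>2"
          using zero_le_power2[of "norm (u x) - 1"] norm_ge_zero[of "u x"]
          unfolding power2_diff power_one mult_1_right by linarith
        then show ?thesis using True q(2)[of x] \<open>M \<ge> 0\<close> by (auto simp: abs_mult intro!: mult_mono)
      qed (use q(3) in auto)
    qed
  qed
qed

lemma test_functions_bounds:
  assumes "\<phi> \<in> test_functions"
  obtains M R where "\<And>x. \<bar>\<phi> x\<bar> \<le> M" "\<And>x. x \<notin> cball 0 R \<Longrightarrow> \<phi> x = 0" "\<phi> \<in> borel_measurable lebesgue"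
proof -
  obtain R where R: "\<And>x. x \<notin> cball 0 R \<Longrightarrow> \<phi> x = 0" using test_functions_vanish[OF assms] by blast
  obtain C where "\<And>x. \<bar>\<phi> x\<bar> \<le> C"
    using C_diff_lipschitz[OF test_functions_C_diff[OF assms] R] by metis
  then show ?thesis
    using that R continuous_imp_lebesgue_measurable[OF C_diff_continuous[OF test_functions_C_diff[OF assms]]] by blast
qed

lemma test_functions_integrable:
  assumes "\<phi> \<in> test_functions" shows "integrable lebesgue \<phi>"
proof -
  obtain M R where "\<And>x. \<bar>\<phi> x\<bar> \<le> M" "\<And>x. x \<notin> cball 0 R \<Longrightarrow> \<phi> x = 0" "\<phi> \<in> borel_measurable lebesgue"
    using test_functions_bounds[OF assms] by metis
  then show ?thesis by (intro integrable_bounded_on_ball[of _ M R]) auto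
qed

lemma test_functions_L2_loc_integrable:
  assumes "\<phi> \<in> test_functions" "u \<in> L2_loc" shows "integrable lebesgue (\<lambda>x. \<phi> x *\<^sub>R u x)"
proof -
  obtain M R where "\<And>x. \<bar>\<phi> x\<bar> \<le> M" "\<And>x. x \<notin> cball 0 R \<Longrightarrow> \<phi> x = 0" "\<phi> \<in> borel_measurable lebesgue"
    using test_functions_bounds[OF assms(1)] by metis
  then show ?thesis by (intro L2_loc_integrable_mult[OF assms(2), of _ M R]) auto
qed

abbreviation unit_index :: "'d::finite \<Rightarrow> 'd \<Rightarrow> nat" where
  "unit_index j \<equiv> \<lambda>l. if l = j then 1 else 0"

lemma multi_indices_1: "multi_indices 1 = range (unit_index :: 'd::finite \<Rightarrow> _)"
proof -
  have "\<alpha> \<in> range unit_index" if "\<alpha> \<in> multi_indices 1" for \<alpha> :: "'d \<Rightarrow> nat"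
  proof -
    have "sum \<alpha> UNIV = 1" using that by (simp add: multi_indices_def)
    then obtain j where "\<alpha> j = 1" "\<And>l. l \<noteq> j \<Longrightarrow> \<alpha> l = 0"
        using sum_eq_1_iff[of UNIV \<alpha>] by auto
    then have "\<alpha> = unit_index j" by auto
    then show ?thesis by blast
  qed
  moreover have "unit_index j \<in> multi_indices 1" for j :: 'd
    by (simp add: multi_indices_def)
  ultimately show ?thesis by auto
qed

lemma sum_multi_indices_1:
  "(\<Sum>\<alpha>\<in>multi_indices 1. h \<alpha>) = (\<Sum>j\<in>(UNIV::'d::finite set). h (unit_index j))"
proof -
  have "inj (unit_index :: 'd \<Rightarrow> _)" by (rule injI) (metis zero_neq_one)
  then show ?thesis by (simp only: multi_indices_1 sum.reindex comp_def)
qed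

lemma multi_deriv_unit_index:
  fixes \<phi> :: "real^'d::finite \<Rightarrow> real"
  shows "multi_deriv (unit_index j) \<phi> = partial_deriv j \<phi>"
proof -
  have "distinct js \<Longrightarrow> foldr (\<lambda>l. partial_deriv l ^^ unit_index j l) js \<phi> = (if j \<in> set js then partial_deriv j \<phi> else \<phi>)" for js
    by (induction js) auto
  then show ?thesis unfolding multi_deriv_def using enum_UNIV[where 'd='d] by simp
qed

lemma op_symbol_1: "op_symbol Aop 1 \<xi> = (\<Sum>j\<in>UNIV. (\<xi> $ j) *\<^sub>R Aop (unit_index j))"
proof -
  have "(\<Prod>l\<in>UNIV. (\<xi> $ l) ^ unit_index j l) = \<xi> $ j" for j
    by (simp add: if_distrib[of "\<lambda>n. _ ^ n"] prod.If_cases cong: if_cong)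
  then show ?thesis unfolding op_symbol_def sum_multi_indices_1 by simp
qed

lemma distributional_solution_1:
  "distributional_solution Aop 1 u \<longleftrightarrow>
    (\<forall>\<phi>\<in>test_functions. (\<Sum>j\<in>UNIV. Aop (unit_index j) *v (LINT x|lebesgue. partial_deriv j \<phi> x *\<^sub>R u x)) = 0)"
proof -
  have "Aop \<alpha> *v ((-1) ^ 1 *\<^sub>R z) = - (Aop \<alpha> *v z)" for \<alpha> z
    by (simp add: matrix_vector_mult_def sum_negf vec_eq_iff)
  then show ?thesis
    unfolding distributional_solution_def sum_multi_indices_1
    by (simp add: multi_deriv_unit_index sum_negf)
qed

section \<open>Domains, total variation and the super-compatible case\<close>

text \<open>Locally a boundary point lies neither strictly above the graph, where it would belong to
  the open set \<Omega>, nor strictly below, where a neighbourhood misses \<Omega>. Hence the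
  boundary is locally part of the graph, a Lipschitz image of a hyperplane. It is needed because
  admissibility prescribes u only off the closure of \<Omega>, whereas the elastic energy sees only
  \<Omega>.\<close>

lemma lipschitz_domain_frontier_negligible:
  fixes \<Omega> :: "(real^'d::finite) set"
  assumes "lipschitz_domain \<Omega>"
  shows "negligible (frontier \<Omega>)"
proof -
  have \<Omega>: "open \<Omega>" using assms by (simp add: lipschitz_domain_def)
  have "\<exists>U. openin (top_of_set (frontier \<Omega>)) U \<and> x \<in> U \<and> negligible U" if x: "x \<in> frontier \<Omega>" for x
  proof -
    obtain r \<nu> L \<gamma> where r: "r > 0" and \<nu>: "norm \<nu> = 1"
      and \<gamma>: "L-lipschitz_on {z. z \<bullet> \<nu> = 0} \<gamma>"
      and eq: "\<Omega> \<inter> ball x r = {y \<in> ball x r. y \<bullet> \<nu> > \<gamma> (y - (y \<bullet> \<nu>) *\<^sub>R \<nu>)}"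
      using assms x unfolding lipschitz_domain_def by blast
    have \<nu>1: "\<nu> \<bullet> \<nu> = 1" using \<nu> by (simp add: dot_square_norm)
    define P where "P y = y - (y \<bullet> \<nu>) *\<^sub>R \<nu>" for y
    have P: "P y \<in> {z. z \<bullet> \<nu> = 0}" for y by (simp add: P_def inner_diff_left \<nu>1)
    have cont: "continuous_on UNIV (\<lambda>y. \<gamma> (P y))"
      by (rule continuous_on_compose2[OF lipschitz_on_continuous_on[OF \<gamma>]])
         (use P in \<open>auto simp: P_def intro!: continuous_intros\<close>)
    have o1: "open {y. \<gamma> (P y) < y \<bullet> \<nu>}" and o2: "open {y. y \<bullet> \<nu> < \<gamma> (P y)}"
      by (intro open_Collect_less cont continuous_intros)+
    define h where "h z = z + \<gamma> z *\<^sub>R \<nu>" for z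
    have "frontier \<Omega> \<inter> ball x r \<subseteq> h ` {z. \<nu> \<bullet> z = 0}"
    proof
      fix y assume y: "y \<in> frontier \<Omega> \<inter> ball x r"
      have "\<not> \<gamma> (P y) < y \<bullet> \<nu>"
      proof
        assume "\<gamma> (P y) < y \<bullet> \<nu>"
        then have "y \<in> \<Omega> \<inter> ball x r" using y unfolding eq by (simp add: P_def)
        then have "y \<in> \<Omega>" by simp
        then show False using \<Omega> y by (simp add: frontier_def interior_open)
      qed
      moreover have "\<not> y \<bullet> \<nu> < \<gamma> (P y)"
      proof
        assume "y \<bullet> \<nu> < \<gamma> (P y)"
        then have "y \<in> {y. y \<bullet> \<nu> < \<gamma> (P y)} \<inter> ball x r" using y by auto
        moreover have "open ({y. y \<bullet> \<nu> < \<gamma> (P y)} \<inter> ball x r)" using o2 by auto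
        moreover have "({y. y \<bullet> \<nu> < \<gamma> (P y)} \<inter> ball x r) \<inter> \<Omega> = {}"
        proof -
          have c: "\<gamma> (P z) < z \<bullet> \<nu>" if "z \<in> ball x r" "z \<in> \<Omega>" for z
          proof -
            have "z \<in> \<Omega> \<inter> ball x r" using that by simp
            then show ?thesis unfolding eq by (simp add: P_def)
          qed
          show ?thesis
          proof (rule equals0I)
            fix z assume "z \<in> ({y. y \<bullet> \<nu> < \<gamma> (P y)} \<inter> ball x r) \<inter> \<Omega>"
            then show False using c[of z] by simp
          qed
        qed
        ultimately have "y \<notin> closure \<Omega>" using open_Int_closure_eq_empty[of "{y. y \<bullet> \<nu> < \<gamma> (P y)} \<inter> ball x r" \<Omega>] by auto
        then show False using y by (simp add: frontier_def)
      qed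
      ultimately have "y = h (P y)" by (simp add: h_def) (simp add: P_def)
      then show "y \<in> h ` {z. \<nu> \<bullet> z = 0}" using P by (auto simp: inner_commute)
    qed
    moreover have "negligible (h ` {z. \<nu> \<bullet> z = 0})"
    proof (rule negligible_locally_Lipschitz_image)
      show "negligible {z. \<nu> \<bullet> z = 0}" using \<nu> by (intro negligible_hyperplane) auto
      fix z assume z: "z \<in> {z. \<nu> \<bullet> z = 0}"
      have "norm (h y - h z) \<le> (1 + L) * norm (y - z)" if "y \<in> {z. \<nu> \<bullet> z = 0}" for y
      proof -
        have "norm ((y - z) + (\<gamma> y - \<gamma> z) *\<^sub>R \<nu>) \<le> norm (y - z) + norm ((\<gamma> y - \<gamma> z) *\<^sub>R \<nu>)"
          by (rule norm_triangle_ineq)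
        moreover have "norm ((\<gamma> y - \<gamma> z) *\<^sub>R \<nu>) = \<bar>\<gamma> y - \<gamma> z\<bar>" using \<nu> by simp
        moreover have "h y - h z = (y - z) + (\<gamma> y - \<gamma> z) *\<^sub>R \<nu>" by (simp add: h_def algebra_simps)
        ultimately have "norm (h y - h z) \<le> norm (y - z) + \<bar>\<gamma> y - \<gamma> z\<bar>" by (simp only:)
        then show ?thesis using lipschitz_onD[OF \<gamma>, of y z] that z
          by (simp add: dist_norm inner_commute algebra_simps)
      qed
      then show "\<exists>T B. open T \<and> z \<in> T \<and> (\<forall>y\<in>{z. \<nu> \<bullet> z = 0} \<inter> T. norm (h y - h z) \<le> B * norm (y - z))"
        by (intro exI[of _ UNIV] exI[of _ "1 + L"]) auto
    qed simp
    ultimately have "negligible (frontier \<Omega> \<inter> ball x r)" using negligible_subset by blast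
    moreover have "openin (top_of_set (frontier \<Omega>)) (frontier \<Omega> \<inter> ball x r)" by auto
    ultimately show ?thesis using x r by (intro exI[of _ "frontier \<Omega> \<inter> ball x r"]) auto
  qed
  then show ?thesis by (subst locally_negligible_alt) blast
qed

lemma TV_test_fieldsD:
  assumes "\<phi> \<in> TV_test_fields \<Omega>"
  shows "C_diff 1 (\<lambda>x. \<phi> x $ i $ j)" "\<bar>\<phi> x $ i $ j\<bar> \<le> 1"
    "\<exists>R. \<forall>x. x \<notin> cball 0 R \<longrightarrow> \<phi> x $ i $ j = 0"
    "x \<notin> \<Omega> \<Longrightarrow> partial_deriv l (\<lambda>x. \<phi> x $ i $ j) x = 0"
proof -
  let ?S = "closure {x. \<phi> x \<noteq> 0}"
  have \<phi>: "\<And>i j. C_diff 1 (\<lambda>x. \<phi> x $ i $ j)" "\<And>x. norm (\<phi> x) \<le> 1" "compact ?S" "?S \<subseteq> \<Omega>"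
    using assms by (auto simp: TV_test_fields_def)
  show "C_diff 1 (\<lambda>x. \<phi> x $ i $ j)" by (rule \<phi>)
  show "\<bar>\<phi> x $ i $ j\<bar> \<le> 1"
    using component_le_norm_cart[of "\<phi> x $ i" j] Finite_Cartesian_Product.norm_nth_le[of "\<phi> x" i] \<phi>(2)[of x] by linarith
  have z: "\<phi> x $ i $ j = 0" if "x \<notin> ?S" for x
    using that closure_subset[of "{x. \<phi> x \<noteq> 0}"] by (metis (mono_tags) mem_Collect_eq subsetD zero_index)
  obtain R where "\<And>x. x \<in> ?S \<Longrightarrow> norm x \<le> R" using compact_imp_bounded[OF \<phi>(3)] unfolding bounded_iff by blast
  then show "\<exists>R. \<forall>x. x \<notin> cball 0 R \<longrightarrow> \<phi> x $ i $ j = 0" using z by (auto intro!: exI[of _ R])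
  show "partial_deriv l (\<lambda>x. \<phi> x $ i $ j) x = 0" if "x \<notin> \<Omega>"
    using that \<phi>(4) z by (intro partial_deriv_vanish[of ?S]) auto
qed

lemma C1_compact_support_partial_integrable:
  fixes f :: "real^'d::finite \<Rightarrow> real"
  assumes "C_diff 1 f" "\<And>x. x \<notin> cball 0 R \<Longrightarrow> f x = 0"
  shows "integrable lebesgue (partial_deriv j f)"
proof -
  obtain C where "\<And>x j. \<bar>partial_deriv j f x\<bar> \<le> C" using C_diff_lipschitz[OF assms] by metis
  then show ?thesis
    using assms partial_deriv_vanish[of "cball 0 R" f]
    by (intro integrable_bounded_on_ball[of _ C R] continuous_imp_lebesgue_measurable C_diff_partial_continuous) auto
qed

lemma TV_test_fields_partial_integrable:
  assumes "\<phi> \<in> TV_test_fields \<Omega>"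
  shows "integrable lebesgue (partial_deriv l (\<lambda>x. \<phi> x $ i $ j))"
  using TV_test_fieldsD(1,3)[OF assms, of i j] C1_compact_support_partial_integrable by blast

lemma TV_test_fields_integral_zero:
  assumes "\<phi> \<in> TV_test_fields \<Omega>"
  shows "(LINT x|lebesgue. partial_deriv l (\<lambda>x. \<phi> x $ i $ j) x) = 0"
  using TV_test_fieldsD(1,3)[OF assms, of i j] integral_partial_deriv_zero by blast

text \<open>Each entry of a test field is compactly supported in \<Omega>, so its partial
  derivatives integrate to zero.\<close>

lemma surface_energy_const:
  fixes c :: "real^'n::finite"
  shows "surface_energy \<Omega> (\<lambda>x::real^'d::finite. c) = 0"
proof -
  have "(LINT x:\<Omega>|lebesgue. (\<Sum>i\<in>UNIV. c $ i * (\<Sum>j\<in>UNIV. partial_deriv j (\<lambda>y. \<phi> y $ i $ j) x))) = 0"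
    if \<phi>: "\<phi> \<in> TV_test_fields \<Omega>" for \<phi>
  proof -
    have "(LINT x:\<Omega>|lebesgue. (\<Sum>i\<in>UNIV. c $ i * (\<Sum>j\<in>UNIV. partial_deriv j (\<lambda>y. \<phi> y $ i $ j) x)))
       = (LINT x|lebesgue. (\<Sum>i\<in>UNIV. c $ i * (\<Sum>j\<in>UNIV. partial_deriv j (\<lambda>y. \<phi> y $ i $ j) x)))"
      unfolding set_lebesgue_integral_def using TV_test_fieldsD(4)[OF \<phi>]
      by (intro Bochner_Integration.integral_cong) (auto simp: indicator_def)
    also have "\<dots> = 0"
      using TV_test_fields_partial_integrable[OF \<phi>] TV_test_fields_integral_zero[OF \<phi>]
      by (subst Bochner_Integration.integral_sum) (auto simp: Bochner_Integration.integral_sum)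
    finally show ?thesis .
  qed
  then have "surface_energy \<Omega> (\<lambda>x. c) \<le> 0" unfolding surface_energy_def by (intro SUP_least) simp
  then show ?thesis by simp
qed

section \<open>Identity of polynomials, the common kernel and the super-compatible case\<close>

lemma digits_unique:
  fixes a b :: "nat \<Rightarrow> nat"
  assumes "\<And>i. i < n \<Longrightarrow> a i < M" "\<And>i. i < n \<Longrightarrow> b i < M"
    "(\<Sum>i<n. a i * M ^ i) = (\<Sum>i<n. b i * M ^ i)" "i < n"
  shows "a i = b i"
  using assms
proof (induction n arbitrary: a b i)
  case (Suc n)
  have shift: "(\<Sum>i<Suc n. c i * M ^ i) = c 0 + M * (\<Sum>i<n. c (Suc i) * M ^ i)" for c :: "nat \<Rightarrow> nat"
    by (simp only: sum.lessThan_Suc_shift sum_distrib_left) (simp add: mult_ac)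
  have eq: "a 0 + M * (\<Sum>i<n. a (Suc i) * M ^ i) = b 0 + M * (\<Sum>i<n. b (Suc i) * M ^ i)"
    using Suc.prems(3) shift by metis
  have lt: "a 0 < M" "b 0 < M" using Suc.prems(1,2)[of 0] by auto
  have 0: "a 0 = b 0"
    using arg_cong[OF eq, of "\<lambda>z. z mod M"] lt by simp
  then have "(\<Sum>i<n. a (Suc i) * M ^ i) = (\<Sum>i<n. b (Suc i) * M ^ i)" using eq lt by auto
  then have "a (Suc i) = b (Suc i)" if "i < n" for i
    using Suc.IH[of "\<lambda>i. a (Suc i)" "\<lambda>i. b (Suc i)" i] Suc.prems(1,2) that by auto
  then show ?case using 0 Suc.prems(4) by (cases i) auto
qed simp

text \<open>Kronecker substitution \<open>\<xi>\<^sub>j = T^((k+1)^(\<sigma> j))\<close> turns distinct monomials into distinct powers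
  of one variable.\<close>

lemma homogeneous_polynomial_zero:
  fixes c :: "('d::finite \<Rightarrow> nat) \<Rightarrow> real"
  assumes zero: "\<And>\<xi>::real^'d. (\<Sum>\<alpha>\<in>multi_indices k. (\<Prod>j\<in>UNIV. (\<xi> $ j) ^ \<alpha> j) * c \<alpha>) = 0"
    and \<alpha>: "\<alpha> \<in> multi_indices k"
  shows "c \<alpha> = 0"
proof -
  obtain \<sigma> :: "'d \<Rightarrow> nat" where \<sigma>: "bij_betw \<sigma> UNIV {..<CARD('d)}"
    using ex_bij_betw_finite_nat[of "UNIV :: 'd set"] by (auto simp: atLeast0LessThan)
  define N where "N \<alpha> = (\<Sum>j\<in>UNIV. \<alpha> j * (k + 1) ^ \<sigma> j)" for \<alpha> :: "'d \<Rightarrow> nat"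
  have inj: "inj_on N (multi_indices k)"
  proof (rule inj_onI)
    fix \<alpha> \<beta> :: "'d \<Rightarrow> nat" assume \<alpha>: "\<alpha> \<in> multi_indices k" and \<beta>: "\<beta> \<in> multi_indices k" and eq: "N \<alpha> = N \<beta>"
    define a where "a i = \<alpha> (inv_into UNIV \<sigma> i)" for i
    define b where "b i = \<beta> (inv_into UNIV \<sigma> i)" for i
    \<comment> \<open>No exponent exceeds k, so the exponents are genuine digits in base k + 1 and N
      determines them.\<close>
    have le: "\<gamma> j < k + 1" if "\<gamma> \<in> multi_indices k" for \<gamma> :: "'d \<Rightarrow> nat" and j
      using that member_le_sum[of j UNIV \<gamma>] by (auto simp: multi_indices_def)
    have inv: "inv_into UNIV \<sigma> (\<sigma> j) = j" for j using \<sigma> by (simp add: bij_betw_def)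
    have N: "N \<gamma> = (\<Sum>i<CARD('d). \<gamma> (inv_into UNIV \<sigma> i) * (k + 1) ^ i)" for \<gamma>
      using sum.reindex_bij_betw[OF \<sigma>, of "\<lambda>i. \<gamma> (inv_into UNIV \<sigma> i) * (k + 1) ^ i"]
      unfolding N_def inv by simp
    have "a i = b i" if "i < CARD('d)" for i
      by (rule digits_unique[of "CARD('d)" a "k + 1" b]) (use le \<alpha> \<beta> eq N that in \<open>auto simp: a_def b_def\<close>)
    moreover have "\<sigma> j < CARD('d)" for j using bij_betwE[OF \<sigma>] by auto
    ultimately have "\<alpha> j = \<beta> j" for j using inv[of j] by (metis a_def b_def)
    then show "\<alpha> = \<beta>" by auto
  qed
  define p where "p = (\<Sum>\<alpha>\<in>multi_indices k. monom (c \<alpha>) (N \<alpha>))"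
  have "poly p T = 0" for T
  proof -
    have "(\<Prod>j\<in>UNIV. ((\<chi> j. T ^ ((k + 1) ^ \<sigma> j)) $ j) ^ \<alpha> j) = T ^ N \<alpha>" for \<alpha>
      unfolding N_def by (simp add: power_sum power_mult[symmetric] mult.commute)
    then show ?thesis using zero[of "\<chi> j. T ^ ((k + 1) ^ \<sigma> j)"]
      by (simp add: p_def poly_sum poly_monom mult.commute)
  qed
  then have "p = 0" using poly_all_0_iff_0 by blast
  then have "0 = coeff p (N \<alpha>)" by simp
  also have "\<dots> = (\<Sum>\<beta>\<in>multi_indices k. if \<beta> = \<alpha> then c \<beta> else 0)"
    unfolding p_def coeff_sum coeff_monom using inj \<alpha> by (intro sum.cong) (auto simp: inj_on_def)
  also have "\<dots> = c \<alpha>" using \<alpha> by (simp add: finite_multi_indices sum.delta)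
  finally show ?thesis by simp
qed

lemma op_symbol_mult:
  fixes Aop :: "('d::finite \<Rightarrow> nat) \<Rightarrow> real^'n::finite^'m::finite"
  shows "op_symbol Aop k \<xi> *v z = (\<Sum>\<alpha>\<in>multi_indices k. (\<Prod>j\<in>UNIV. (\<xi> $ j) ^ \<alpha> j) *\<^sub>R (Aop \<alpha> *v z))"
proof -
  have "sum f S *v z = (\<Sum>\<alpha>\<in>S. f \<alpha> *v z)" if "finite S" for f :: "_ \<Rightarrow> real^'n^'m" and S :: "('d \<Rightarrow> nat) set"
    using that by (induction S rule: finite_induct) (auto simp: matrix_vector_mult_add_rdistrib)
  then show ?thesis
    unfolding op_symbol_def by (simp add: finite_multi_indices scaleR_matrix_vector_assoc)
qed

text \<open>This is the second description of the common kernel, as the intersection of the kernels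
  of the coefficients: a vector annihilated by all symbols makes each component of the symbol
  applied to it a vanishing polynomial.\<close>

lemma common_kernel_coeff:
  assumes "z \<in> common_kernel Aop k" "\<alpha> \<in> multi_indices k"
  shows "Aop \<alpha> *v z = 0"
proof -
  have "(\<Sum>\<alpha>\<in>multi_indices k. (\<Prod>j\<in>UNIV. (\<xi> $ j) ^ \<alpha> j) * (Aop \<alpha> *v z) $ i) = 0" for \<xi> i
  proof -
    have "op_symbol Aop k \<xi> *v z = 0" using assms(1) by (auto simp: common_kernel_def mat_kernel_def)
    from arg_cong[OF this, of "\<lambda>y. y $ i"] show ?thesis unfolding op_symbol_mult by simp
  qed
  then show ?thesis using homogeneous_polynomial_zero[OF _ assms(2), of "\<lambda>\<alpha>. (Aop \<alpha> *v z) $ _"]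
    by (simp add: vec_eq_iff)
qed

lemma L2_locI_bounded:
  fixes u :: "real^'d::finite \<Rightarrow> real^'n::finite"
  assumes "u \<in> borel_measurable lebesgue" "\<And>x. norm (u x) \<le> M"
  shows "u \<in> L2_loc"
proof -
  have "set_integrable lebesgue K (\<lambda>x. (norm (u x))\<^sup>2)" if K': "compact K" for K
  proof -
    obtain R where R: "K \<subseteq> cball 0 R" using compact_imp_bounded[OF K'] unfolding bounded_iff by (auto simp: subset_iff)
    have K: "K \<in> sets lebesgue" using K' by (simp add: compact_imp_closed)
    show ?thesis unfolding set_integrable_def
    proof (rule integrable_bounded_on_ball[of _ "M\<^sup>2" R])
      show "(\<lambda>x. indicat_real K x *\<^sub>R (norm (u x))\<^sup>2) \<in> borel_measurable lebesgue" using K assms(1) by simp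
      show "norm (indicat_real K x *\<^sub>R (norm (u x))\<^sup>2) \<le> M\<^sup>2" for x
        using assms(2)[of x] by (auto simp: indicator_def intro!: power_mono)
      show "indicat_real K x *\<^sub>R (norm (u x))\<^sup>2 = 0" if "x \<notin> cball 0 R" for x
        using R that by (auto simp: indicator_def)
    qed
  qed
  then show ?thesis using assms(1) by (simp add: L2_loc_def)
qed

text \<open>Every coefficient sees u only as the constant c, and derivatives of test functions have
  integral zero. It covers both the constant field and the discontinuous competitor of the
  super-compatible case.\<close>

lemma distributional_solution_zero_coeff:
  fixes Aop :: "('d::finite \<Rightarrow> nat) \<Rightarrow> real^'n::finite^'m::finite"
  assumes u: "u \<in> L2_loc" and "k \<ge> 1"
    and *: "\<And>x \<alpha>. \<alpha> \<in> multi_indices k \<Longrightarrow> Aop \<alpha> *v (u x - c) = 0"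
  shows "distributional_solution Aop k u"
  unfolding distributional_solution_def
proof (intro ballI sum.neutral)
  fix \<phi> :: "real^'d \<Rightarrow> real" and \<alpha> :: "'d \<Rightarrow> nat"
  assume \<phi>: "\<phi> \<in> test_functions" and \<alpha>: "\<alpha> \<in> multi_indices k"
  have t: "multi_deriv \<alpha> \<phi> \<in> test_functions" using test_functions_multi_deriv \<phi> by blast
  have i: "integrable lebesgue (\<lambda>x. multi_deriv \<alpha> \<phi> x *\<^sub>R u x)"
    by (rule test_functions_L2_loc_integrable[OF t u])
  have "Aop \<alpha> *v (LINT x|lebesgue. multi_deriv \<alpha> \<phi> x *\<^sub>R u x) = (LINT x|lebesgue. Aop \<alpha> *v (multi_deriv \<alpha> \<phi> x *\<^sub>R u x))"
    using integral_bounded_linear[OF matrix_vector_mul_bounded_linear i, of "Aop \<alpha>"] by simp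
  also have "\<dots> = (LINT x|lebesgue. multi_deriv \<alpha> \<phi> x *\<^sub>R (Aop \<alpha> *v c))"
    using *[OF \<alpha>] by (simp add: matrix_vector_mult_scaleR matrix_vector_mult_diff_distrib)
  also have "\<dots> = 0"
    using integral_multi_deriv_zero[OF \<phi> \<alpha> assms(2)] test_functions_integrable[OF t] by simp
  finally show "Aop \<alpha> *v ((-1) ^ k *\<^sub>R (LINT x|lebesgue. multi_deriv \<alpha> \<phi> x *\<^sub>R u x)) = 0"
    by (simp add: matrix_vector_mult_scaleR)
qed

lemma const_in_BV_fields:
  fixes \<Omega> :: "(real^'d::finite) set"
  assumes "bounded \<Omega>" "open \<Omega>"
  shows "(\<lambda>x. A) \<in> BV_fields \<Omega> {A, B}"
proof -
  have "set_integrable lebesgue \<Omega> (\<lambda>x. A)"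
    unfolding set_integrable_def using assms emeasure_bounded_finite[OF assms(1)]
    by (intro integrable_scaleR_left integrable_real_indicator) auto
  then show ?thesis by (simp add: BV_fields_def surface_energy_const)
qed

lemma min_total_energy_leI:
  assumes "f \<in> BV_fields \<Omega> {A, B}" "u \<in> admissible Aop k \<Omega> F"
    "elastic_energy \<Omega> u f + ennreal \<epsilon> * surface_energy \<Omega> f \<le> E"
  shows "min_total_energy Aop k \<Omega> A B F \<epsilon> \<le> E"
  unfolding min_total_energy_def using assms by (meson INF_lower2)

text \<open>The phase is constantly A and u equals A in \<Omega> and F outside. Its jump A - F is a
  multiple of A - B, which no coefficient of the operator detects, so both energies vanish.\<close>

lemma min_total_energy_supercompatible:
  fixes Aop :: "('d::finite \<Rightarrow> nat) \<Rightarrow> real^'n::finite^'m::finite"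
  assumes "k \<ge> 1" "A - B \<in> common_kernel Aop k" "bounded \<Omega>" "open \<Omega>"
  shows "min_total_energy Aop k \<Omega> A B (t *\<^sub>R A + (1 - t) *\<^sub>R B) \<epsilon> = 0"
proof -
  define F where "F = t *\<^sub>R A + (1 - t) *\<^sub>R B"
  define u where "u x = (if x \<in> \<Omega> then A else F)" for x
  have um: "u \<in> borel_measurable lebesgue"
    unfolding u_def using assms(4) by (intro measurable_If_set) auto
  have u: "u \<in> L2_loc"
    by (rule L2_locI_bounded[OF um, of "norm A + norm F"]) (auto simp: u_def)
  have F: "A - F = (1 - t) *\<^sub>R (A - B)" by (simp add: F_def algebra_simps)
  have "distributional_solution Aop k u"
    by (rule distributional_solution_zero_coeff[OF u assms(1), where c=F])
       (auto simp: u_def F matrix_vector_mult_scaleR common_kernel_coeff[OF assms(2)])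
  then have "u \<in> admissible Aop k \<Omega> F"
    using u closure_subset[of \<Omega>] by (auto simp: admissible_def u_def)
  moreover have "elastic_energy \<Omega> u (\<lambda>x. A) = 0"
  proof -
    have "(\<lambda>x. ennreal ((norm (u x - A))\<^sup>2) * indicator \<Omega> x) = (\<lambda>x. 0)"
      by (auto simp: u_def indicator_def)
    then show ?thesis unfolding elastic_energy_def by simp
  qed
  ultimately have "min_total_energy Aop k \<Omega> A B F \<epsilon> \<le> 0"
    using const_in_BV_fields[OF assms(3,4)] by (intro min_total_energy_leI) (auto simp: surface_energy_const)
  then show ?thesis by (simp add: F_def)
qed

section \<open>Averaging in coordinate directions\<close>

text \<open>Two weights occur. The constant 1 gives the mean over the segment from x to x + e; the
  weight 1 - s gives a function whose derivative along e is the difference between that mean and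
  h.\<close>

definition line_avg :: "(real \<Rightarrow> real) \<Rightarrow> 'a::real_normed_vector \<Rightarrow> ('a \<Rightarrow> real) \<Rightarrow> 'a \<Rightarrow> real" where
  "line_avg w e h x = integral {0..1} (\<lambda>s. w s * h (x + s *\<^sub>R e))"

lemma line_avg_continuous_integrand:
  fixes h :: "'a::real_normed_vector \<Rightarrow> real" and w :: "real \<Rightarrow> real"
  assumes "continuous_on UNIV w" "continuous_on UNIV h"
  shows "continuous_on S (\<lambda>s. w s * h (x + s *\<^sub>R e))"
  by (intro continuous_on_mult continuous_on_subset[OF assms(1)] continuous_on_compose2[OF assms(2)] continuous_intros) auto

lemma line_avg_integrable:
  fixes h :: "'a::real_normed_vector \<Rightarrow> real" and w :: "real \<Rightarrow> real"
  assumes "continuous_on UNIV w" "continuous_on UNIV h"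
  shows "(\<lambda>s. w s * h (x + s *\<^sub>R e)) integrable_on {0..1::real}"
  by (rule integrable_continuous_interval[OF line_avg_continuous_integrand[OF assms]])

lemma continuous_on_line_avg:
  assumes "continuous_on UNIV w" "continuous_on UNIV h"
  shows "continuous_on UNIV (line_avg w e h)"
proof -
  have "continuous_on (UNIV \<times> cbox 0 1) (\<lambda>(x, s). w s * h (x + s *\<^sub>R e))"
    unfolding case_prod_beta
    by (intro continuous_intros continuous_on_compose2[OF assms(1)] continuous_on_compose2[OF assms(2)]) auto
  from integral_continuous_on_param[OF this] show ?thesis
    unfolding line_avg_def[abs_def] by simp
qed

lemma line_avg_bound:
  assumes "continuous_on UNIV w" "continuous_on UNIV h" "\<And>s. s \<in> {0..1} \<Longrightarrow> \<bar>w s\<bar> \<le> 1" "\<And>x. \<bar>h x\<bar> \<le> C"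
  shows "\<bar>line_avg w e h x\<bar> \<le> C"
proof -
  have "norm (integral {0..1} (\<lambda>s. w s * h (x + s *\<^sub>R e))) \<le> C * (1 - 0)"
  proof (rule integral_bound)
    fix s :: real assume "s \<in> {0..1}"
    then show "norm (w s * h (x + s *\<^sub>R e)) \<le> C"
      using assms(3)[of s] assms(4)[of "x + s *\<^sub>R e"] mult_mono[of "\<bar>w s\<bar>" 1 "\<bar>h (x + s *\<^sub>R e)\<bar>" C]
      by (simp add: abs_mult)
  qed (use assms in \<open>auto intro: line_avg_continuous_integrand\<close>)
  then show ?thesis by (simp add: line_avg_def)
qed

lemma line_avg_vanish:
  assumes "\<And>x. x \<notin> cball c R \<Longrightarrow> h x = 0" "x \<notin> cball c (R + norm e)"
  shows "line_avg w e h x = 0"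
proof -
  have "w s * h (x + s *\<^sub>R e) = 0" if "s \<in> {0..1}" for s
  proof -
    have "dist c x \<le> dist c (x + s *\<^sub>R e) + norm (s *\<^sub>R e)"
      using dist_triangle[of c x "x + s *\<^sub>R e"] by (simp add: dist_norm)
    moreover have "norm (s *\<^sub>R e) \<le> norm e" using that by (auto simp: mult_left_le_one_le)
    ultimately have "x + s *\<^sub>R e \<notin> cball c R" using assms(2) by simp
    then show ?thesis using assms(1) by simp
  qed
  then have "integral {0..1} (\<lambda>s. w s * h (x + s *\<^sub>R e)) = integral {0..1::real} (\<lambda>s. 0)"
    by (rule Henstock_Kurzweil_Integration.integral_cong)
  then show ?thesis by (simp add: line_avg_def)
qed

lemma line_avg_has_derivative:
  fixes h :: "real^'d::finite \<Rightarrow> real"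
  assumes w: "continuous_on UNIV w" and h: "C_diff 1 h"
  shows "(line_avg w e h has_derivative (\<lambda>k. \<Sum>j\<in>UNIV. k $ j * line_avg w e (partial_deriv j h) x)) (at x)"
proof -
  \<comment> \<open>The derivative is packed into a bounded linear map because differentiation under
    the integral needs it to be continuous in operator norm.\<close>
  define D where "D x s = (\<Sum>j\<in>UNIV. (w s * partial_deriv j h (x + s *\<^sub>R e)) *\<^sub>R blinfun_inner_left (axis j (1::real)))"
    for x :: "real^'d" and s :: real
  have hc: "continuous_on UNIV h" and pc: "\<And>j. continuous_on UNIV (partial_deriv j h)"
    using C_diff_continuous[OF h] C_diff_partial_continuous[OF h] by auto
  have D: "blinfun_apply (D x s) k = w s * dir_deriv k h (x + s *\<^sub>R e)" for x s k
    unfolding D_def dir_deriv_def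
    by (simp add: blinfun.sum_left blinfun.scaleR_left inner_axis sum_distrib_left mult_ac)
  have contD: "continuous_on (UNIV \<times> cbox 0 1) (\<lambda>(x, s). D x s)"
    unfolding case_prod_beta D_def
    by (intro continuous_intros continuous_on_compose2[OF w] continuous_on_compose2[OF pc]) auto
  have der: "((\<lambda>x. w s * h (x + s *\<^sub>R e)) has_derivative blinfun_apply (D x s)) (at x within UNIV)" for x s
  proof -
    have "((\<lambda>x. h (x + s *\<^sub>R e)) has_derivative (\<lambda>k. dir_deriv k h (x + s *\<^sub>R e))) (at x)"
      by (rule has_derivative_compose[of "\<lambda>x. x + s *\<^sub>R e" "\<lambda>k. k" x UNIV h "\<lambda>k. dir_deriv k h (x + s *\<^sub>R e)", simplified])
         (use has_derivative_dir_deriv[OF C_diff_differentiable[OF h]] in \<open>auto intro!: derivative_eq_intros\<close>)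
    then have "((\<lambda>x. w s * h (x + s *\<^sub>R e)) has_derivative (\<lambda>k. w s * dir_deriv k h (x + s *\<^sub>R e))) (at x)"
      by (rule has_derivative_mult_right)
    moreover have "blinfun_apply (D x s) = (\<lambda>k. w s * dir_deriv k h (x + s *\<^sub>R e))" using D by (rule ext)
    ultimately show ?thesis by simp
  qed
  have "((\<lambda>x. integral (cbox 0 1) (\<lambda>s. w s * h (x + s *\<^sub>R e))) has_derivative
      blinfun_apply (integral (cbox 0 1) (D x))) (at x within UNIV)"
    by (rule leibniz_rule[OF der _ contD]) (use line_avg_integrable[OF w hc] in auto)
  then have L: "(line_avg w e h has_derivative blinfun_apply (integral {0..1} (D x))) (at x)"
    unfolding line_avg_def[abs_def] by simp
  have iD: "D x integrable_on {0..1}"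
    unfolding D_def
    by (intro integrable_continuous_interval continuous_intros continuous_on_subset[OF w] continuous_on_compose2[OF pc]) auto
  have "blinfun_apply (integral {0..1} (D x)) k = (\<Sum>j\<in>UNIV. k $ j * line_avg w e (partial_deriv j h) x)" for k
  proof -
    have "blinfun_apply (integral {0..1} (D x)) k = integral {0..1} (\<lambda>s. blinfun_apply (D x s) k)"
      by (rule blinfun_apply_integral[OF iD])
    also have "\<dots> = integral {0..1} (\<lambda>s. \<Sum>j\<in>UNIV. k $ j * (w s * partial_deriv j h (x + s *\<^sub>R e)))"
      by (simp add: D dir_deriv_def sum_distrib_left mult_ac)
    also have "\<dots> = (\<Sum>j\<in>UNIV. k $ j * line_avg w e (partial_deriv j h) x)"
      using line_avg_integrable[OF w pc]
      by (subst integral_sum) (auto simp: line_avg_def intro!: integrable_on_mult_right)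
    finally show ?thesis .
  qed
  then have "blinfun_apply (integral {0..1} (D x)) = (\<lambda>k. \<Sum>j\<in>UNIV. k $ j * line_avg w e (partial_deriv j h) x)"
    by (rule ext)
  with L show ?thesis by simp
qed

lemma partial_deriv_line_avg:
  fixes h :: "real^'d::finite \<Rightarrow> real"
  assumes w: "continuous_on UNIV w" and h: "C_diff 1 h"
  shows "partial_deriv j (line_avg w e h) = line_avg w e (partial_deriv j h)"
  by (rule ext, subst partial_deriv_eqI[OF line_avg_has_derivative[OF assms]])
     (simp add: axis_def if_distrib[of "\<lambda>c. c * _"] cong: if_cong)

lemma C_diff_line_avg:
  fixes h :: "real^'d::finite \<Rightarrow> real"
  assumes w: "continuous_on UNIV w"
  shows "C_diff r h \<Longrightarrow> C_diff r (line_avg w e h)"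
proof (induction r arbitrary: h)
  case 0
  then show ?case using continuous_on_line_avg[OF w] by simp
next
  case (Suc r)
  have 1: "C_diff 1 h" by (rule C_diff_le[OF Suc.prems]) simp
  have "line_avg w e h differentiable (at x)" for x
    using line_avg_has_derivative[OF w 1] differentiableI by blast
  then show ?case using Suc partial_deriv_line_avg[OF w 1] by simp
qed

lemma dir_deriv_line_avg:
  fixes h :: "real^'d::finite \<Rightarrow> real"
  assumes w: "continuous_on UNIV w" and h: "C_diff 1 h"
  shows "dir_deriv k (line_avg w e h) x = line_avg w e (dir_deriv k h) x"
proof -
  have pc: "\<And>j. continuous_on UNIV (partial_deriv j h)" using C_diff_partial_continuous[OF h] by auto
  have "line_avg w e (dir_deriv k h) x = integral {0..1} (\<lambda>s. \<Sum>j\<in>UNIV. k $ j * (w s * partial_deriv j h (x + s *\<^sub>R e)))"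
    by (simp add: line_avg_def dir_deriv_def sum_distrib_left mult_ac)
  also have "\<dots> = (\<Sum>j\<in>UNIV. k $ j * line_avg w e (partial_deriv j h) x)"
    using line_avg_integrable[OF w pc]
    by (subst integral_sum) (auto simp: line_avg_def intro!: integrable_on_mult_right)
  finally show ?thesis by (simp add: dir_deriv_def[of k "line_avg w e h"] partial_deriv_line_avg[OF assms])
qed

lemma has_vector_derivative_along_line:
  fixes h :: "real^'d::finite \<Rightarrow> real"
  assumes h: "C_diff 1 h"
  shows "((\<lambda>s. h (x + s *\<^sub>R e)) has_real_derivative dir_deriv e h (x + s *\<^sub>R e)) (at s)"
proof -
  have "((\<lambda>s. h (x + s *\<^sub>R e)) has_derivative (\<lambda>k. dir_deriv (k *\<^sub>R e) h (x + s *\<^sub>R e))) (at s)"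
    by (rule has_derivative_compose[of "\<lambda>s. x + s *\<^sub>R e" "\<lambda>k. k *\<^sub>R e" s UNIV h "\<lambda>k. dir_deriv k h (x + s *\<^sub>R e)", simplified])
       (use has_derivative_dir_deriv[OF C_diff_differentiable[OF h]] in \<open>auto intro!: derivative_eq_intros\<close>)
  then show ?thesis
    by (auto simp: has_field_derivative_def dir_deriv_def sum_distrib_left algebra_simps elim!: has_derivative_eq_rhs)
qed

lemma line_avg_dir_deriv_1:
  fixes h :: "real^'d::finite \<Rightarrow> real"
  assumes h: "C_diff 1 h"
  shows "line_avg (\<lambda>_. 1) e (dir_deriv e h) x = h (x + e) - h x"
proof -
  have "((\<lambda>s. dir_deriv e h (x + s *\<^sub>R e)) has_integral (h (x + 1 *\<^sub>R e) - h (x + 0 *\<^sub>R e))) {0..1}"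
    using has_vector_derivative_along_line[OF h]
    by (intro fundamental_theorem_of_calculus)
       (auto simp: has_real_derivative_iff_has_vector_derivative[symmetric] intro: has_field_derivative_at_within)
  then show ?thesis by (simp add: line_avg_def integral_unique)
qed

text \<open>Integration by parts along the segment. Together with the commutation of derivatives and
  averages it writes the averaging error as a derivative of a bounded function, which is the form
  that total variation can be tested with.\<close>

lemma line_avg_dir_deriv_weight:
  fixes h :: "real^'d::finite \<Rightarrow> real"
  assumes h: "C_diff 1 h"
  shows "line_avg (\<lambda>s. 1 - s) e (dir_deriv e h) x = line_avg (\<lambda>_. 1) e h x - h x"
proof -
  have c: "continuous_on UNIV h" using C_diff_continuous h by blast
  have "((\<lambda>s. (1 - s) * dir_deriv e h (x + s *\<^sub>R e) - h (x + s *\<^sub>R e)) has_integral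
      ((1 - 1) * h (x + 1 *\<^sub>R e) - (1 - 0) * h (x + 0 *\<^sub>R e))) {0..1}"
    by (intro fundamental_theorem_of_calculus)
       (auto simp: has_real_derivative_iff_has_vector_derivative[symmetric]
         intro!: derivative_eq_intros has_field_derivative_at_within[OF has_vector_derivative_along_line[OF h]])
  moreover have "((\<lambda>s. 1 * h (x + s *\<^sub>R e)) has_integral line_avg (\<lambda>_. 1) e h x) {0..1}"
    unfolding line_avg_def using line_avg_integrable[of "\<lambda>_. 1" h x e] c by (intro integrable_integral) auto
  ultimately have "((\<lambda>s. ((1 - s) * dir_deriv e h (x + s *\<^sub>R e) - h (x + s *\<^sub>R e)) + 1 * h (x + s *\<^sub>R e)) has_integral
     ((1 - 1) * h (x + 1 *\<^sub>R e) - (1 - 0) * h (x + 0 *\<^sub>R e)) + line_avg (\<lambda>_. 1) e h x) {0..1}"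
    by (rule has_integral_add)
  then show ?thesis by (simp add: line_avg_def integral_unique)
qed

lemma integrable_mult_bounded:
  fixes f g :: "'a::euclidean_space \<Rightarrow> real"
  assumes "integrable lebesgue f" "g \<in> borel_measurable lebesgue" "\<And>x. \<bar>g x\<bar> \<le> C"
  shows "integrable lebesgue (\<lambda>x. f x * g x)"
proof (rule Bochner_Integration.integrable_bound[of _ "\<lambda>x. C * f x"])
  show "AE x in lebesgue. norm (f x * g x) \<le> norm (C * f x)"
  proof (rule AE_I2)
    fix x
    have "\<bar>g x\<bar> \<le> \<bar>C\<bar>" using assms(3)[of x] by linarith
    then show "norm (f x * g x) \<le> norm (C * f x)"
      by (simp add: abs_mult mult.commute[of "\<bar>f x\<bar>"] mult_right_mono)
  qed
qed (use assms in auto)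

text \<open>Averaging over segments in the coordinate directions one after the other gains a bound
  \<open>2 / \<delta>\<close> on one partial derivative at a time; integration against a BV function changes by
  at most \<open>\<delta>\<close> times its variation.\<close>

lemma coordinate_averaging:
  fixes f h :: "real^'d::finite \<Rightarrow> real"
  assumes h: "\<And>r. C_diff r h" "\<And>x. \<bar>h x\<bar> \<le> 1" "\<And>x. x \<notin> cball x0 \<rho> \<Longrightarrow> h x = 0"
    and f: "integrable lebesgue f" and \<delta>: "\<delta> > 0" and \<rho>': "\<rho> + \<delta> * real CARD('d) \<le> \<rho>'"
    and TV: "\<And>\<zeta> j. C_diff 1 \<zeta> \<Longrightarrow> (\<And>x. \<bar>\<zeta> x\<bar> \<le> 1) \<Longrightarrow> (\<And>x. x \<notin> cball x0 \<rho>' \<Longrightarrow> \<zeta> x = 0) \<Longrightarrow>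
        \<bar>LINT x|lebesgue. f x * partial_deriv j \<zeta> x\<bar> \<le> S"
  shows "\<exists>g. (\<forall>r. C_diff r g) \<and> (\<forall>x. \<bar>g x\<bar> \<le> 1) \<and> (\<forall>x. x \<notin> cball x0 (\<rho> + \<delta> * real (card J)) \<longrightarrow> g x = 0) \<and>
     (\<forall>j\<in>J. \<forall>x. \<bar>partial_deriv j g x\<bar> \<le> 2 / \<delta>) \<and>
     \<bar>(LINT x|lebesgue. f x * g x) - (LINT x|lebesgue. f x * h x)\<bar> \<le> \<delta> * real (card J) * S"
proof -
  have "finite J" by simp
  then show ?thesis
  proof (induction J rule: finite_induct)
    case empty
    then show ?case using h by (intro exI[of _ h]) auto
  next
    case (insert l J)
    then obtain g where g: "\<And>r. C_diff r g" "\<And>x. \<bar>g x\<bar> \<le> 1"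
      "\<And>x. x \<notin> cball x0 (\<rho> + \<delta> * real (card J)) \<Longrightarrow> g x = 0"
      "\<And>j x. j \<in> J \<Longrightarrow> \<bar>partial_deriv j g x\<bar> \<le> 2 / \<delta>"
      "\<bar>(LINT x|lebesgue. f x * g x) - (LINT x|lebesgue. f x * h x)\<bar> \<le> \<delta> * real (card J) * S" by blast
    define e where "e = \<delta> *\<^sub>R axis l (1::real)"
    have ne: "norm e = \<delta>" using \<delta> by (simp add: e_def)
    define g' where "g' = line_avg (\<lambda>_. 1) e g"
    define \<zeta> where "\<zeta> = line_avg (\<lambda>s. 1 - s) e g"
    have gc: "continuous_on UNIV g" using g(1) C_diff_continuous by blast
    have w: "continuous_on UNIV (\<lambda>s::real. 1 - s)" "continuous_on UNIV (\<lambda>_::real. 1::real)" by (auto intro: continuous_intros)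
    have Cg': "C_diff r g'" and C\<zeta>: "C_diff r \<zeta>" for r
      unfolding g'_def \<zeta>_def using C_diff_line_avg[OF w(2) g(1)] C_diff_line_avg[OF w(1) g(1)] by auto
    have bg': "\<bar>g' x\<bar> \<le> 1" for x unfolding g'_def using g(2) by (intro line_avg_bound[OF w(2) gc]) auto
    have b\<zeta>: "\<bar>\<zeta> x\<bar> \<le> 1" for x unfolding \<zeta>_def using g(2) by (intro line_avg_bound[OF w(1) gc]) auto
    have card: "card (insert l J) = Suc (card J)" using insert by simp
    have rad: "\<rho> + \<delta> * real (card (insert l J)) = (\<rho> + \<delta> * real (card J)) + norm e"
      by (simp add: card ne algebra_simps)
    have vg': "g' x = 0" and v\<zeta>: "\<zeta> x = 0" if "x \<notin> cball x0 (\<rho> + \<delta> * real (card (insert l J)))" for x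
      using that unfolding rad g'_def \<zeta>_def by (intro line_avg_vanish[OF g(3)]; simp)+
    have dir: "dir_deriv e \<phi> x = \<delta> * partial_deriv l \<phi> x" for \<phi> :: "real^'d \<Rightarrow> real" and x
      by (simp add: e_def dir_deriv_def axis_def if_distrib[of "\<lambda>c. c * _"] if_distrib[of "\<lambda>c. _ * c"] cong: if_cong)
    \<comment> \<open>Along the segment the derivative of the mean is g (x + e) - g x, of modulus at
      most 2, and the segment has length \<delta>.\<close>
    have pl: "\<bar>partial_deriv l g' x\<bar> \<le> 2 / \<delta>" for x
    proof -
      have "\<delta> * partial_deriv l g' x = g (x + e) - g x"
        using dir_deriv_line_avg[OF w(2) g(1), of e e x] line_avg_dir_deriv_1[OF g(1), of e x]
        unfolding g'_def[symmetric] dir by simp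
      then have "\<bar>\<delta> * partial_deriv l g' x\<bar> \<le> 2" using g(2)[of "x + e"] g(2)[of x] by linarith
      then show ?thesis using \<delta> by (simp add: abs_mult field_simps)
    qed
    \<comment> \<open>Bounds gained earlier survive, since the average of a partial derivative is
      bounded by the same constant.\<close>
    have pj: "\<bar>partial_deriv j g' x\<bar> \<le> 2 / \<delta>" if "j \<in> J" for j x
      unfolding g'_def partial_deriv_line_avg[OF w(2) g(1)]
      using g(4)[OF that] by (intro line_avg_bound[OF w(2)] C_diff_partial_continuous[OF g(1)]) auto
    \<comment> \<open>This is where the variation enters: \<zeta> is bounded by 1 with support in
      the enlarged ball, so replacing g by g' costs at most \<delta> S.\<close>
    have diff: "g' x - g x = \<delta> * partial_deriv l \<zeta> x" for x
      using dir_deriv_line_avg[OF w(1) g(1), of e e x] line_avg_dir_deriv_weight[OF g(1), of e x]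
      unfolding g'_def[symmetric] \<zeta>_def[symmetric] dir by simp
    have "card (insert l J) \<le> CARD('d)" by (rule card_mono) auto
    then have "\<rho> + \<delta> * real (card (insert l J)) \<le> \<rho>'"
    proof -
      assume "card (insert l J) \<le> CARD('d)"
      then have "real (card (insert l J)) \<le> real CARD('d)" by (rule of_nat_mono)
      then have "\<delta> * real (card (insert l J)) \<le> \<delta> * real CARD('d)" using \<delta> by (intro mult_left_mono) auto
      then show ?thesis using \<rho>' by linarith
    qed
    then have "\<bar>LINT x|lebesgue. f x * partial_deriv l \<zeta> x\<bar> \<le> S"
      using v\<zeta> by (intro TV C\<zeta> b\<zeta>) (auto simp del: card_insert_disjoint)
    moreover have "(LINT x|lebesgue. f x * g' x) - (LINT x|lebesgue. f x * g x) = \<delta> * (LINT x|lebesgue. f x * partial_deriv l \<zeta> x)"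
    proof -
      have "integrable lebesgue (\<lambda>x. f x * g' x)" "integrable lebesgue (\<lambda>x. f x * g x)"
        using bg' g(2) C_diff_continuous[OF Cg'] gc
        by (auto intro!: integrable_mult_bounded[OF f] continuous_imp_lebesgue_measurable)
      then have "(LINT x|lebesgue. f x * g' x) - (LINT x|lebesgue. f x * g x) = (LINT x|lebesgue. f x * (g' x - g x))"
        by (simp add: algebra_simps)
      also have "\<dots> = \<delta> * (LINT x|lebesgue. f x * partial_deriv l \<zeta> x)"
        unfolding diff by (simp add: mult.left_commute)
      finally show ?thesis .
    qed
    ultimately have "\<bar>(LINT x|lebesgue. f x * g' x) - (LINT x|lebesgue. f x * g x)\<bar> \<le> \<delta> * S"
      using \<delta> by (simp add: abs_mult)
    then have "\<bar>(LINT x|lebesgue. f x * g' x) - (LINT x|lebesgue. f x * h x)\<bar> \<le> \<delta> * real (card (insert l J)) * S"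
      using g(5) unfolding card by (simp add: algebra_simps)
    then show ?case using Cg' bg' vg' pl pj by (intro exI[of _ g']) auto
  qed
qed

section \<open>Reduction of an admissible pair to a scalar phase function\<close>

lemma lebesgue_inner_compact:
  fixes E :: "'a::euclidean_space set"
  assumes "E \<in> sets lebesgue" "bounded E" "e > 0"
  obtains K where "compact K" "K \<subseteq> E" "measure lebesgue (E - K) < e" "E - K \<in> lmeasurable"
proof -
  obtain K where K: "closed K" "K \<subseteq> E" "E - K \<in> lmeasurable" "emeasure lebesgue (E - K) < ennreal e"
    using sets_lebesgue_inner_closed[OF assms(1,3)] by blast
  have "compact K" using K assms(2) bounded_subset compact_eq_bounded_closed by blast
  moreover have "measure lebesgue (E - K) < e"
    using K(3,4) assms(3) by (simp add: emeasure_eq_measure2 ennreal_less_iff)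
  ultimately show ?thesis using that K by blast
qed

text \<open>Common starting point of both lower bounds. It replaces \<chi>', which is arbitrary
  outside \<Omega> and on a null set, by functions f and g that are measurable, vanish identically
  outside \<Omega> and satisfy the pointwise alternatives everywhere in \<Omega>.\<close>

lemma two_phase_setup:
  fixes Aop :: "('d::finite \<Rightarrow> nat) \<Rightarrow> real^'n::finite^'m::finite"
  assumes \<Omega>: "bounded \<Omega>" "lipschitz_domain \<Omega>" and t: "t \<in> {0<..<1}" and AB: "A \<noteq> B"
    and F: "F = t *\<^sub>R A + (1 - t) *\<^sub>R B"
    and f\<chi>: "set_borel_measurable lebesgue \<Omega> \<chi>'" "AE x in lebesgue. x \<in> \<Omega> \<longrightarrow> \<chi>' x \<in> {A, B}"
    and u: "u \<in> admissible Aop k \<Omega> F"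
  obtains f g where
    "f \<in> borel_measurable lebesgue" "\<And>x. x \<in> \<Omega> \<Longrightarrow> f x \<in> {t, t - 1}" "\<And>x. x \<notin> \<Omega> \<Longrightarrow> f x = 0"
    "AE x in lebesgue. x \<in> \<Omega> \<longrightarrow> \<chi>' x = F + f x *\<^sub>R (B - A)"
    "g \<in> borel_measurable lebesgue" "\<And>x. x \<notin> \<Omega> \<Longrightarrow> g x = 0"
    "AE x in lebesgue. u x = F + f x *\<^sub>R (B - A) + g x"
    "integrable lebesgue (\<lambda>x. (norm (g x))\<^sup>2)" "integrable lebesgue g" "integrable lebesgue f"
    "elastic_energy \<Omega> u \<chi>' = ennreal (LINT x|lebesgue. (norm (g x))\<^sup>2)"
proof -
  define v where "v = B - A"
  have o: "open \<Omega>" using \<Omega> by (simp add: lipschitz_domain_def)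
  have \<Omega>m[measurable]: "\<Omega> \<in> sets lebesgue" using o by simp
  have u1: "u \<in> L2_loc" "AE x in lebesgue. x \<notin> closure \<Omega> \<longrightarrow> u x = F"
    using u by (auto simp: admissible_def)
  have um[measurable]: "u \<in> borel_measurable lebesgue" using u1 by (simp add: L2_loc_def)
  have \<chi>m[measurable]: "(\<lambda>x. indicat_real \<Omega> x *\<^sub>R \<chi>' x) \<in> borel_measurable lebesgue"
    using f\<chi>(1) by (simp add: set_borel_measurable_def)
  \<comment> \<open>Only the product with the indicator is known to be measurable; the intersection
    with \<Omega> removes the exterior, which would enter if B were zero.\<close>
  define P where "P = {x \<in> space lebesgue. indicat_real \<Omega> x *\<^sub>R \<chi>' x = B} \<inter> \<Omega>"
  have Pm[measurable]: "P \<in> sets lebesgue" unfolding P_def by measurable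
  have P: "x \<in> P \<longleftrightarrow> \<chi>' x = B" if "x \<in> \<Omega>" for x using that by (auto simp: P_def)
  define f where "f x = indicat_real \<Omega> x * (if x \<in> P then t else t - 1)" for x
  define g where "g x = indicat_real \<Omega> x *\<^sub>R (u x - F - f x *\<^sub>R v)" for x
  have fm[measurable]: "f \<in> borel_measurable lebesgue" unfolding f_def by measurable
  have gm[measurable]: "g \<in> borel_measurable lebesgue" unfolding g_def by measurable
  have fv: "f x \<in> {t, t - 1}" if "x \<in> \<Omega>" for x using that by (simp add: f_def)
  have f0: "f x = 0" if "x \<notin> \<Omega>" for x using that by (simp add: f_def)
  have g0: "g x = 0" if "x \<notin> \<Omega>" for x using that by (simp add: g_def)
  have fb: "\<bar>f x\<bar> \<le> 1" for x using fv[of x] f0[of x] t by (cases "x \<in> \<Omega>") auto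
  have BF: "B - F = t *\<^sub>R v" "A - F = (t - 1) *\<^sub>R v" by (simp_all add: F v_def algebra_simps)
  have \<chi>f: "AE x in lebesgue. x \<in> \<Omega> \<longrightarrow> \<chi>' x = F + f x *\<^sub>R v"
    using f\<chi>(2)
  proof (rule AE_mp, intro AE_I2 impI)
    fix x assume "x \<in> \<Omega> \<longrightarrow> \<chi>' x \<in> {A, B}" "x \<in> \<Omega>"
    then show "\<chi>' x = F + f x *\<^sub>R v" using P[of x] AB BF by (auto simp: f_def algebra_simps)
  qed
  \<comment> \<open>The null boundary extends u = F from the complement of the closure to almost all
    of the complement of \<Omega>.\<close>
  have "frontier \<Omega> \<in> null_sets lebesgue"
    using lipschitz_domain_frontier_negligible[OF \<Omega>(2)] by (simp add: negligible_iff_null_sets)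
  then have "AE x in lebesgue. x \<notin> frontier \<Omega>" by (rule AE_not_in)
  with u1(2) have uF: "AE x in lebesgue. x \<notin> \<Omega> \<longrightarrow> u x = F"
  proof eventually_elim
    case (elim x)
    then show ?case using o by (auto simp: frontier_def interior_open)
  qed
  then have ufg: "AE x in lebesgue. u x = F + f x *\<^sub>R v + g x"
  proof eventually_elim
    case (elim x)
    then show ?case by (cases "x \<in> \<Omega>") (auto simp: f0 g0, simp add: g_def)
  qed
  obtain R where R: "\<Omega> \<subseteq> cball 0 R" using \<Omega>(1) unfolding bounded_iff by (auto simp: subset_iff)
  have fi: "integrable lebesgue f"
    by (rule integrable_bounded_on_ball[OF fm, of 1 R]) (use fb in simp, use f0 R in blast)
  have ui: "integrable lebesgue (\<lambda>x. indicator (cball 0 R) x *\<^sub>R (norm (u x))\<^sup>2)"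
    using u1(1) unfolding L2_loc_def set_integrable_def by auto
  have g2: "integrable lebesgue (\<lambda>x. (norm (g x))\<^sup>2)"
  proof (rule Bochner_Integration.integrable_bound)
    define c where "c = norm F + norm v"
    show "integrable lebesgue (\<lambda>x. 2 * (indicator (cball 0 R) x *\<^sub>R (norm (u x))\<^sup>2) + (2 * c\<^sup>2) * indicat_real (cball 0 R) x)"
      by (intro Bochner_Integration.integrable_add integrable_mult_right ui integrable_indicator_cball)
    show "AE x in lebesgue. norm ((norm (g x))\<^sup>2) \<le> norm (2 * (indicator (cball 0 R) x *\<^sub>R (norm (u x))\<^sup>2) + (2 * c\<^sup>2) * indicat_real (cball 0 R) x)"
    proof (rule AE_I2)
      fix x
      show "norm ((norm (g x))\<^sup>2) \<le> norm (2 * (indicator (cball 0 R) x *\<^sub>R (norm (u x))\<^sup>2) + (2 * c\<^sup>2) * indicat_real (cball 0 R) x)"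
      proof (cases "x \<in> \<Omega>")
        case True
        have "norm (g x) \<le> norm (u x) + norm (F + f x *\<^sub>R v)"
          using True norm_triangle_ineq4[of "u x" "F + f x *\<^sub>R v"] by (simp add: g_def algebra_simps)
        also have "norm (F + f x *\<^sub>R v) \<le> c"
          using norm_triangle_ineq[of F "f x *\<^sub>R v"] mult_right_mono[OF fb[of x] norm_ge_zero[of v]] by (simp add: c_def)
        finally have "norm (g x) \<le> norm (u x) + c" by simp
        then have "(norm (g x))\<^sup>2 \<le> (norm (u x) + c)\<^sup>2" by (intro power_mono) auto
        also have "\<dots> \<le> 2 * (norm (u x))\<^sup>2 + 2 * c\<^sup>2"
          using zero_le_power2[of "norm (u x) - c"] unfolding power2_sum power2_diff by linarith
        finally show ?thesis using True R by auto
      qed (simp add: g0)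
    qed
  qed measurable
  have gi: "integrable lebesgue g"
  proof (rule Bochner_Integration.integrable_bound)
    show "integrable lebesgue (\<lambda>x. indicat_real (cball 0 R) x + (norm (g x))\<^sup>2)"
      by (intro Bochner_Integration.integrable_add g2 integrable_indicator_cball)
    show "AE x in lebesgue. norm (g x) \<le> norm (indicat_real (cball 0 R) x + (norm (g x))\<^sup>2)"
    proof (rule AE_I2)
      fix x
      have "norm (g x) \<le> 1 + (norm (g x))\<^sup>2"
        using zero_le_power2[of "norm (g x) - 1"] norm_ge_zero[of "g x"]
        unfolding power2_diff power_one mult_1_right by linarith
      then show "norm (g x) \<le> norm (indicat_real (cball 0 R) x + (norm (g x))\<^sup>2)"
        using g0[of x] R by (cases "x \<in> \<Omega>") auto
    qed
  qed measurable
  have "elastic_energy \<Omega> u \<chi>' = (\<integral>\<^sup>+x. ennreal ((norm (g x))\<^sup>2) \<partial>lebesgue)"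
    unfolding elastic_energy_def
  proof (rule nn_integral_cong_AE)
    show "AE x in lebesgue. ennreal ((norm (u x - \<chi>' x))\<^sup>2) * indicator \<Omega> x = ennreal ((norm (g x))\<^sup>2)"
      using \<chi>f
    proof eventually_elim
      case (elim x)
      then show ?case by (cases "x \<in> \<Omega>") (auto simp: g0, simp add: g_def algebra_simps)
    qed
  qed
  also have "\<dots> = ennreal (LINT x|lebesgue. (norm (g x))\<^sup>2)"
    by (rule nn_integral_eq_integral[OF g2]) auto
  finally show ?thesis
    using that[OF fm fv f0 \<chi>f[unfolded v_def] gm g0 ufg[unfolded v_def] g2 gi fi] by simp
qed

text \<open>The constant part F disappears because \<psi> has mean zero, which derivatives of test
  functions have.\<close>

lemma integral_scaleR_two_phase:
  fixes u g :: "real^'d::finite \<Rightarrow> real^'n::finite"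
  assumes \<psi>: "\<psi> \<in> test_functions" and "(LINT x|lebesgue. \<psi> x) = 0"
    and ufg: "AE x in lebesgue. u x = F + f x *\<^sub>R v + g x" and i: "integrable lebesgue f" "integrable lebesgue g"
    and u: "u \<in> borel_measurable lebesgue"
  shows "(LINT x|lebesgue. \<psi> x *\<^sub>R u x) = (LINT x|lebesgue. f x * \<psi> x) *\<^sub>R v + (LINT x|lebesgue. \<psi> x *\<^sub>R g x)"
    "integrable lebesgue (\<lambda>x. f x * \<psi> x)" "integrable lebesgue (\<lambda>x. \<psi> x *\<^sub>R g x)"
proof -
  obtain M R where M: "\<And>x. \<bar>\<psi> x\<bar> \<le> M" "\<And>x. x \<notin> cball 0 R \<Longrightarrow> \<psi> x = 0" and \<psi>m[measurable]: "\<psi> \<in> borel_measurable lebesgue"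
    using test_functions_bounds[OF \<psi>] by metis
  have i\<psi>: "integrable lebesgue \<psi>" by (rule test_functions_integrable[OF \<psi>])
  show if\<psi>: "integrable lebesgue (\<lambda>x. f x * \<psi> x)" by (rule integrable_mult_bounded[OF i(1) \<psi>m M(1)])
  have gm[measurable]: "g \<in> borel_measurable lebesgue" and fm[measurable]: "f \<in> borel_measurable lebesgue" using i by auto
  note [measurable] = u
  show ig: "integrable lebesgue (\<lambda>x. \<psi> x *\<^sub>R g x)"
  proof (rule Bochner_Integration.integrable_bound[of _ "\<lambda>x. M *\<^sub>R g x"])
    show "AE x in lebesgue. norm (\<psi> x *\<^sub>R g x) \<le> norm (M *\<^sub>R g x)"
    proof (rule AE_I2)
      fix x
      have "\<bar>\<psi> x\<bar> \<le> \<bar>M\<bar>" using M(1)[of x] by linarith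
      then show "norm (\<psi> x *\<^sub>R g x) \<le> norm (M *\<^sub>R g x)" by (simp add: mult_right_mono)
    qed
  qed (use i in auto)
  have "(LINT x|lebesgue. \<psi> x *\<^sub>R u x) = (LINT x|lebesgue. \<psi> x *\<^sub>R F + ((f x * \<psi> x) *\<^sub>R v + \<psi> x *\<^sub>R g x))"
  proof (rule integral_cong_AE)
    show "AE x in lebesgue. \<psi> x *\<^sub>R u x = \<psi> x *\<^sub>R F + ((f x * \<psi> x) *\<^sub>R v + \<psi> x *\<^sub>R g x)"
      using ufg by eventually_elim (simp add: algebra_simps)
  qed measurable
  also have "\<dots> = (LINT x|lebesgue. \<psi> x) *\<^sub>R F + ((LINT x|lebesgue. f x * \<psi> x) *\<^sub>R v + (LINT x|lebesgue. \<psi> x *\<^sub>R g x))"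
    using i\<psi> if\<psi> ig by simp
  finally show "(LINT x|lebesgue. \<psi> x *\<^sub>R u x) = (LINT x|lebesgue. f x * \<psi> x) *\<^sub>R v + (LINT x|lebesgue. \<psi> x *\<^sub>R g x)"
    using assms(2) by simp
qed

text \<open>The inner approximation by compact sets is needed only qualitatively: all constants below
  depend on \<open>h\<close> through \<open>\<bar>h\<bar> \<le> 1\<close> and its support only.\<close>

lemma two_valued_test_function:
  fixes f :: "real^'d::finite \<Rightarrow> real"
  assumes t: "t \<in> {0<..<1}" and fm: "f \<in> borel_measurable lebesgue" and \<rho>: "\<rho> > 0"
    and f: "\<And>x. x \<in> ball x0 \<rho> \<Longrightarrow> f x \<in> {t, t - 1}" and fi: "integrable lebesgue f" and fb: "\<And>x. \<bar>f x\<bar> \<le> 1"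
  shows "\<exists>h. (\<forall>r. C_diff r h) \<and> (\<forall>x. \<bar>h x\<bar> \<le> 1) \<and> (\<forall>x. x \<notin> cball x0 \<rho> \<longrightarrow> h x = 0) \<and>
    (LINT x|lebesgue. f x * h x) \<ge> min t (1 - t) * measure lebesgue (ball x0 \<rho>) / 2"
proof -
  define D where "D = ball x0 \<rho>"
  define m where "m = min t (1 - t)"
  define \<mu> where "\<mu> = measure lebesgue D"
  have m: "0 < m" "m \<le> 1" using t by (auto simp: m_def)
  have \<mu>: "\<mu> > 0" unfolding \<mu>_def D_def using \<rho> content_ball_pos[of \<rho> x0] by simp
  \<comment> \<open>The exceptional set N has measure at most 2 \<tau> and is charged twice, so the
    loss is 4 \<tau>, half of m \<mu>.\<close>
  define \<tau> where "\<tau> = m * \<mu> / 8"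
  have \<tau>: "\<tau> > 0" using m \<mu> by (simp add: \<tau>_def)
  note [measurable] = fm
  have Dm[measurable]: "D \<in> sets lebesgue" by (simp add: D_def)
  define Ep where "Ep = {x \<in> space lebesgue. f x = t} \<inter> D"
  define En where "En = {x \<in> space lebesgue. f x \<noteq> t} \<inter> D"
  have Em: "Ep \<in> sets lebesgue" "En \<in> sets lebesgue" unfolding Ep_def En_def by measurable
  have bD: "bounded D" by (simp add: D_def)
  have Eb: "bounded Ep" "bounded En" using bounded_subset[OF bD] by (auto simp: Ep_def En_def)
  obtain Kp where Kp: "compact Kp" "Kp \<subseteq> Ep" "measure lebesgue (Ep - Kp) < \<tau>" "Ep - Kp \<in> lmeasurable"
    using lebesgue_inner_compact[OF Em(1) Eb(1) \<tau>] by blast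
  obtain Kn where Kn: "compact Kn" "Kn \<subseteq> En" "measure lebesgue (En - Kn) < \<tau>" "En - Kn \<in> lmeasurable"
    using lebesgue_inner_compact[OF Em(2) Eb(2) \<tau>] by blast
  have disj: "Kp \<inter> Kn = {}" using Kp Kn by (auto simp: Ep_def En_def)
  have sub: "Kp \<subseteq> D" "Kn \<subseteq> D" using Kp Kn by (auto simp: Ep_def En_def)
  have o: "open (D - Kn)" "open (D - Kp)" using Kp Kn by (auto simp: D_def compact_imp_closed intro!: open_Diff)
  have s1: "Kp \<subseteq> D - Kn" "Kn \<subseteq> D - Kp" using sub disj by auto
  obtain hp Vp Lp where hp: "\<And>r. C_diff r hp" "\<And>x. 0 \<le> hp x" "\<And>x. hp x \<le> 1" "Kp \<subseteq> Vp" "\<And>x. x \<in> Vp \<Longrightarrow> hp x = 1"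
    "Lp \<subseteq> D - Kn" "\<And>x. x \<notin> Lp \<Longrightarrow> hp x = 0" using smooth_urysohn[OF Kp(1) o(1) s1(1)] by metis
  obtain hn Vn Ln where hn: "\<And>r. C_diff r hn" "\<And>x. 0 \<le> hn x" "\<And>x. hn x \<le> 1" "Kn \<subseteq> Vn" "\<And>x. x \<in> Vn \<Longrightarrow> hn x = 1"
    "Ln \<subseteq> D - Kp" "\<And>x. x \<notin> Ln \<Longrightarrow> hn x = 0" using smooth_urysohn[OF Kn(1) o(2) s1(2)] by metis
  define h where "h x = hp x - hn x" for x
  have Ch: "C_diff r h" for r unfolding h_def using hp(1) hn(1) by (intro C_diff_diff)
  have hb: "\<bar>h x\<bar> \<le> 1" for x using hp(2,3)[of x] hn(2,3)[of x] by (auto simp: h_def)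
  have h0: "h x = 0" if "x \<notin> D" for x
  proof -
    have "x \<notin> Lp" "x \<notin> Ln" using that hp(6) hn(6) by auto
    then show ?thesis using hp(7) hn(7) by (simp add: h_def)
  qed
  have hm[measurable]: "h \<in> borel_measurable lebesgue" using continuous_imp_lebesgue_measurable[OF C_diff_continuous[OF Ch]] .
  define N where "N = (Ep - Kp) \<union> (En - Kn)"
  have Nm: "N \<in> lmeasurable" unfolding N_def using Kp Kn by auto
  have N\<mu>: "measure lebesgue N \<le> 2 * \<tau>"
  proof -
    have "measure lebesgue N \<le> measure lebesgue (Ep - Kp) + measure lebesgue (En - Kn)"
      unfolding N_def using Kp(4) Kn(4) by (intro measure_Un_le) auto
    then show ?thesis using Kp(3) Kn(3) by linarith
  qed
  \<comment> \<open>On the compact sets h is the sign of f, so the product is t or 1 - t; on N it is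
    at least -1, and m - 2 \<le> -1.\<close>
  have pt: "f x * h x \<ge> m * indicat_real D x - 2 * indicat_real N x" for x
  proof (cases "x \<in> D")
    case False
    then have "x \<notin> N" by (auto simp: N_def Ep_def En_def)
    then show ?thesis using False h0 by simp
  next
    case True
    then have fx: "f x \<in> {t, t - 1}" using f by (simp add: D_def)
    consider "x \<in> Kp" | "x \<in> Kn" | "x \<in> N" using True by (auto simp: N_def Ep_def En_def)
    then show ?thesis
    proof cases
      case 1
      then have "f x = t" "x \<in> Vp" "x \<notin> Ln" using Kp(2) hp(4) hn(6) by (auto simp: Ep_def)
      then have "f x = t" "h x = 1" using hp(5) hn(7) by (auto simp: h_def)
      then show ?thesis using True t by (auto simp: m_def indicator_def)
    next
      case 2
      then have "f x = t - 1" "x \<in> Vn" "x \<notin> Lp" using Kn(2) hn(4) hp(6) fx by (auto simp: En_def)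
      then have "f x = t - 1" "h x = -1" using hn(5) hp(7) by (auto simp: h_def)
      then show ?thesis using True t by (auto simp: m_def indicator_def)
    next
      case 3
      have "\<bar>f x * h x\<bar> \<le> 1" using fb[of x] hb[of x] by (simp add: abs_mult mult_le_one)
      then show ?thesis using 3 True m by simp
    qed
  qed
  have Di: "integrable lebesgue (indicat_real D)" and Ni: "integrable lebesgue (indicat_real N)"
    using Nm lmeasurable_ball[of x0 \<rho>] by (auto simp: D_def fmeasurable_def less_top intro!: integrable_real_indicator)
  have "m * \<mu> - 2 * measure lebesgue N = (LINT x|lebesgue. m * indicat_real D x - 2 * indicat_real N x)"
    using Di Ni by (simp add: \<mu>_def)
  also have "\<dots> \<le> (LINT x|lebesgue. f x * h x)"
    using Di Ni integrable_mult_bounded[OF fi hm hb] pt by (intro integral_mono) auto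
  finally have "(LINT x|lebesgue. f x * h x) \<ge> m * \<mu> - 4 * \<tau>" using N\<mu> by linarith
  then have "(LINT x|lebesgue. f x * h x) \<ge> m * \<mu> / 2" unfolding \<tau>_def by linarith
  moreover have "\<forall>x. x \<notin> cball x0 \<rho> \<longrightarrow> h x = 0" using h0 unfolding D_def by auto
  ultimately show ?thesis using Ch hb unfolding m_def \<mu>_def D_def by blast
qed

text \<open>Test fields of the form \<open>\<zeta>(x) v e\<^sub>j\<^sup>T / \<bar>v\<bar>\<close> detect the variation of \<open>f\<close> through that of \<open>F + f v\<close>.\<close>

lemma surface_energy_scalar_bound:
  fixes \<chi>' :: "real^'d::finite \<Rightarrow> real^'n::finite"
  assumes "open \<Omega>" and fi: "integrable lebesgue f" and v: "v \<noteq> 0"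
    and \<chi>f: "AE x in lebesgue. x \<in> \<Omega> \<longrightarrow> \<chi>' x = F + f x *\<^sub>R v" and f0: "\<And>x. x \<notin> \<Omega> \<Longrightarrow> f x = 0"
    and \<chi>m: "(\<lambda>x. indicat_real \<Omega> x *\<^sub>R \<chi>' x) \<in> borel_measurable lebesgue"
    and S: "surface_energy \<Omega> \<chi>' = ennreal S" "S \<ge> 0"
    and \<zeta>: "C_diff 1 \<zeta>" "\<And>x. \<bar>\<zeta> x\<bar> \<le> 1" "\<And>x. x \<notin> cball x0 \<rho> \<Longrightarrow> \<zeta> x = 0" "cball x0 \<rho> \<subseteq> \<Omega>"
  shows "\<bar>LINT x|lebesgue. f x * partial_deriv j \<zeta> x\<bar> \<le> S / norm v"
proof -
  have *: "(LINT x|lebesgue. f x * partial_deriv j \<zeta> x) \<le> S / norm v"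
    if \<zeta>: "C_diff 1 \<zeta>" "\<And>x. \<bar>\<zeta> x\<bar> \<le> 1" "\<And>x. x \<notin> cball x0 \<rho> \<Longrightarrow> \<zeta> x = 0" for \<zeta>
  proof -
    define \<phi> :: "real^'d \<Rightarrow> real^'d^'n" where
      "\<phi> y = (\<chi> i l. if l = j then v $ i / norm v * \<zeta> y else 0)" for y
    have comp: "(\<lambda>y. \<phi> y $ i $ l) = (if l = j then (\<lambda>y. v $ i / norm v * \<zeta> y) else (\<lambda>y. 0))" for i l
      by (auto simp: \<phi>_def)
    have C: "C_diff 1 (\<lambda>y. \<phi> y $ i $ l)" for i l
      unfolding comp by (cases "l = j") (simp_all only: if_True if_False simp_thms C_diff_cmult[OF \<zeta>(1)] C_diff_const)
    have nrm: "norm (\<phi> y) \<le> 1" for y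
    proof -
      have r: "norm (\<phi> y $ i) = \<bar>v $ i\<bar> / norm v * \<bar>\<zeta> y\<bar>" for i
      proof -
        have "\<phi> y $ i = (v $ i / norm v * \<zeta> y) *\<^sub>R axis j 1" by (auto simp: \<phi>_def vec_eq_iff axis_def)
        then show ?thesis by (simp add: abs_mult)
      qed
      have "norm (\<phi> y) = L2_set (\<lambda>i. \<bar>v $ i\<bar> * (\<bar>\<zeta> y\<bar> / norm v)) UNIV"
        by (simp add: norm_vec_def[of "\<phi> y"] r mult_ac)
      also have "\<dots> = norm v * (\<bar>\<zeta> y\<bar> / norm v)"
      proof -
        have "norm v = L2_set (\<lambda>i. \<bar>v $ i\<bar>) UNIV" by (simp add: norm_vec_def)
        then show ?thesis using L2_set_left_distrib[of "\<bar>\<zeta> y\<bar> / norm v" "\<lambda>i. \<bar>v $ i\<bar>" UNIV] by simp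
      qed
      also have "\<dots> \<le> 1" using v \<zeta>(2) by simp
      finally show ?thesis .
    qed
    have supp: "{x. \<phi> x \<noteq> 0} \<subseteq> cball x0 \<rho>"
    proof
      fix x assume "x \<in> {x. \<phi> x \<noteq> 0}"
      then have "\<zeta> x \<noteq> 0" by (auto simp: \<phi>_def vec_eq_iff split: if_splits)
      then show "x \<in> cball x0 \<rho>" using \<zeta>(3) by blast
    qed
    then have cs: "closure {x. \<phi> x \<noteq> 0} \<subseteq> cball x0 \<rho>" by (rule closure_minimal) simp
    have \<phi>: "\<phi> \<in> TV_test_fields \<Omega>"
      using C nrm cs assms(12) bounded_subset[OF bounded_cball supp]
      by (auto simp: TV_test_fields_def compact_closure simp del: C_diff.simps One_nat_def)
    let ?p = "partial_deriv j \<zeta>"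
    have pz: "?p x = 0" if "x \<notin> \<Omega>" for x
    proof -
      have "x \<notin> cball x0 \<rho>" using assms(12) that by blast
      then show ?thesis using partial_deriv_vanish[of "cball x0 \<rho>" \<zeta> x j] \<zeta>(3) by simp
    qed
    have pd: "partial_deriv l (\<lambda>y. \<phi> y $ i $ l) x = (if l = j then v $ i / norm v * ?p x else 0)" for i l x
    proof (cases "l = j")
      case True
      have "(\<zeta> has_derivative (\<lambda>h. dir_deriv h \<zeta> x)) (at x)"
        by (rule has_derivative_dir_deriv[OF C_diff_differentiable[OF \<zeta>(1)]]) simp
      then have "((\<lambda>y. v $ i / norm v * \<zeta> y) has_derivative (\<lambda>h. v $ i / norm v * dir_deriv h \<zeta> x)) (at x)"
        by (rule has_derivative_mult_right)
      from partial_deriv_eqI[OF this, of j] show ?thesis using True comp by (simp add: dir_deriv_axis)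
    next
      case False
      then show ?thesis using comp partial_deriv_eqI[OF has_derivative_const] by simp
    qed
    obtain R where R: "\<And>x. x \<in> cball x0 \<rho> \<Longrightarrow> norm x \<le> R" using bounded_cball[of x0 \<rho>] unfolding bounded_iff by blast
    then have R': "\<zeta> x = 0" if "x \<notin> cball 0 R" for x using \<zeta>(3) that by force
    have ip: "integrable lebesgue ?p" using C1_compact_support_partial_integrable[OF \<zeta>(1) R'] by simp
    obtain C where C': "\<And>x l. \<bar>partial_deriv l \<zeta> x\<bar> \<le> C" using C_diff_lipschitz[OF \<zeta>(1) R'] by metis
    have ifp: "integrable lebesgue (\<lambda>x. f x * ?p x)"
      using ip C' by (intro integrable_mult_bounded[OF fi]) auto
    have "(LINT x:\<Omega>|lebesgue. (\<Sum>i\<in>UNIV. \<chi>' x $ i * (\<Sum>l\<in>UNIV. partial_deriv l (\<lambda>y. \<phi> y $ i $ l) x)))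
       = (LINT x:\<Omega>|lebesgue. (\<chi>' x \<bullet> v) / norm v * ?p x)"
    proof -
      have "(\<Sum>i\<in>UNIV. \<chi>' x $ i * (\<Sum>l\<in>UNIV. partial_deriv l (\<lambda>y. \<phi> y $ i $ l) x)) = (\<chi>' x \<bullet> v) / norm v * ?p x" for x
        by (simp add: pd inner_vec_def sum_distrib_right sum_divide_distrib mult.assoc)
      then show ?thesis by simp
    qed
    also have "\<dots> = (LINT x|lebesgue. ((indicat_real \<Omega> x *\<^sub>R \<chi>' x) \<bullet> v) / norm v * ?p x)"
      unfolding set_lebesgue_integral_def by (simp add: mult_ac)
    also have "\<dots> = (LINT x|lebesgue. (F \<bullet> v) / norm v * ?p x + norm v * (f x * ?p x))"
    proof (rule integral_cong_AE)
      show "AE x in lebesgue. ((indicat_real \<Omega> x *\<^sub>R \<chi>' x) \<bullet> v) / norm v * ?p x = (F \<bullet> v) / norm v * ?p x + norm v * (f x * ?p x)"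
        using \<chi>f
      proof eventually_elim
        case (elim x)
        show ?case
        proof (cases "x \<in> \<Omega>")
          case True
          have "v \<bullet> v / norm v = norm v" using v by (simp add: power2_norm_eq_inner[symmetric] power2_eq_square)
          then have "(F + f x *\<^sub>R v) \<bullet> v / norm v = (F \<bullet> v) / norm v + f x * norm v"
            by (simp add: inner_add_left add_divide_distrib) (metis times_divide_eq_right)
          then show ?thesis using True elim by (simp add: algebra_simps)
        qed (simp add: pz)
      qed
      show "(\<lambda>x. ((indicat_real \<Omega> x *\<^sub>R \<chi>' x) \<bullet> v) / norm v * ?p x) \<in> borel_measurable lebesgue"
        using \<chi>m borel_measurable_integrable[OF ip] by (intro borel_measurable_times borel_measurable_divide borel_measurable_inner) auto
      show "(\<lambda>x. (F \<bullet> v) / norm v * ?p x + norm v * (f x * ?p x)) \<in> borel_measurable lebesgue"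
        using ip ifp by auto
    qed
    also have "\<dots> = norm v * (LINT x|lebesgue. f x * ?p x)"
      using ip ifp integral_partial_deriv_zero[OF \<zeta>(1) R'] by simp
    finally have "ennreal (norm v * (LINT x|lebesgue. f x * ?p x)) \<le> surface_energy \<Omega> \<chi>'"
      unfolding surface_energy_def 
      by (intro SUP_upper2[OF \<phi>]) (simp only: order_refl)
    then have "norm v * (LINT x|lebesgue. f x * ?p x) \<le> S"
      using S by (metis ennreal_le_iff)
    then show ?thesis using v by (simp add: field_simps)
  qed
  \<comment> \<open>The surface energy yields upper bounds only; the bound from below is the same
    estimate for the negative of \<zeta>.\<close>
  have "partial_deriv j (\<lambda>x. (-1) * \<zeta> x) x = - partial_deriv j \<zeta> x" for x
  proof -
    have "(\<zeta> has_derivative (\<lambda>h. dir_deriv h \<zeta> x)) (at x)"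
      by (rule has_derivative_dir_deriv[OF C_diff_differentiable[OF \<zeta>(1)]]) simp
    then have "((\<lambda>y. (-1) * \<zeta> y) has_derivative (\<lambda>h. (-1) * dir_deriv h \<zeta> x)) (at x)"
      by (rule has_derivative_mult_right)
    from partial_deriv_eqI[OF this, of j] show ?thesis by (simp add: dir_deriv_axis)
  qed
  moreover have "(LINT x|lebesgue. f x * partial_deriv j (\<lambda>x. (-1) * \<zeta> x) x) \<le> S / norm v"
    using \<zeta> by (intro * C_diff_cmult) auto
  ultimately show ?thesis using *[OF \<zeta>(1,2,3)] by simp
qed

section \<open>Lower bound in the compatible case\<close>

lemma inner_sum_matrix_bound:
  fixes M :: "'d::finite \<Rightarrow> real^'n::finite^'m::finite" and p :: "real^'m"
  obtains K where "K > 0" "\<And>j z. \<bar>p \<bullet> (M j *v z)\<bar> \<le> K * norm z"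
proof -
  have "\<exists>K>0. \<forall>z. norm (M j *v z) \<le> K * norm z" for j
    using bounded_linear.pos_bounded[OF matrix_vector_mul_bounded_linear[of "M j"]] by (auto simp: mult.commute)
  then obtain K where K: "\<And>j. K j > 0" "\<And>j z. norm (M j *v z) \<le> K j * norm z" by metis
  define K' where "K' = (norm p + 1) * (\<Sum>j\<in>UNIV. K j)"
  have "K' > 0" unfolding K'_def using K(1) by (intro mult_pos_pos sum_pos add_nonneg_pos) auto
  moreover have "\<bar>p \<bullet> (M j *v z)\<bar> \<le> K' * norm z" for j z
  proof -
    have "K j \<le> (\<Sum>j\<in>UNIV. K j)" using K(1) by (intro member_le_sum) (auto intro: less_imp_le)
    then have "norm (M j *v z) \<le> (\<Sum>j\<in>UNIV. K j) * norm z"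
      using K(2)[of j z] by (meson mult_right_mono norm_ge_zero order.trans)
    then have "norm p * norm (M j *v z) \<le> (norm p + 1) * ((\<Sum>j\<in>UNIV. K j) * norm z)"
      by (intro mult_mono) auto
    then show ?thesis using Cauchy_Schwarz_ineq2[of p "M j *v z"] by (simp add: K'_def mult.assoc)
  qed
  ultimately show ?thesis using that by blast
qed

text \<open>The first-order equation is tested with \<open>\<psi>(x) = \<integral>\<^sub>0\<^sup>T g(x - s \<eta>) ds\<close>, where \<open>\<eta>\<^sub>j = p \<bullet> A\<^sub>j v\<close>
  and \<open>g\<close> is an average at scale \<open>\<delta>\<close> of a function close to the sign of \<open>f\<close>; thus
  \<open>\<partial>\<^sub>\<eta> \<psi> = g - g(\<cdot> - T \<eta>)\<close> and the last term vanishes on \<open>\<Omega>\<close>.\<close>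

lemma compatible_energy_estimate:
  fixes Aop :: "('d::finite \<Rightarrow> nat) \<Rightarrow> real^'n::finite^'m::finite"
  assumes \<Omega>: "bounded \<Omega>" "lipschitz_domain \<Omega>" and t: "t \<in> {0<..<1}"
    and v: "B - A \<notin> common_kernel Aop 1" and F: "F = t *\<^sub>R A + (1 - t) *\<^sub>R B"
  obtains c K \<delta>0 where "c > 0" "K > 0" "\<delta>0 > 0"
    "\<And>\<chi>' u \<delta>. \<chi>' \<in> BV_fields \<Omega> {A, B} \<Longrightarrow> u \<in> admissible Aop 1 \<Omega> F \<Longrightarrow> 0 < \<delta> \<Longrightarrow> \<delta> \<le> \<delta>0 \<Longrightarrow>
       \<exists>E S. E \<ge> 0 \<and> S \<ge> 0 \<and> elastic_energy \<Omega> u \<chi>' = ennreal E \<and> surface_energy \<Omega> \<chi>' = ennreal S \<and>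
         c \<le> K * (E / \<delta>\<^sup>2 + \<delta> * S)"
proof -
  define v where "v = B - A"
  have "\<exists>j. Aop (unit_index j) *v v \<noteq> 0"
  proof (rule ccontr)
    assume "\<not> ?thesis"
    then have "op_symbol Aop 1 \<xi> *v v = 0" for \<xi>
      unfolding op_symbol_mult sum_multi_indices_1 by simp
    then show False using v by (simp add: common_kernel_def mat_kernel_def v_def)
  qed
  then obtain j0 where j0: "Aop (unit_index j0) *v v \<noteq> 0" by blast
  have v0: "v \<noteq> 0" using j0 by auto
  then have AB: "A \<noteq> B" by (auto simp: v_def)
  \<comment> \<open>Pairing the system with this p makes the coefficient of the derivative in
    direction j0 equal to the squared norm of p, so that the resulting scalar equation really
    differentiates f along a nonzero \<eta>.\<close>
  define p where "p = Aop (unit_index j0) *v v"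
  define \<eta> where "\<eta> = (\<chi> j. p \<bullet> (Aop (unit_index j) *v v))"
  have "\<eta> $ j0 \<noteq> 0" using j0 by (simp add: \<eta>_def p_def)
  then have \<eta>: "norm \<eta> > 0" by auto
  obtain M where M: "M > 0" "\<And>j z. \<bar>p \<bullet> (Aop (unit_index j) *v z)\<bar> \<le> M * norm z"
    using inner_sum_matrix_bound[where p=p and M="\<lambda>j. Aop (unit_index j)"] by metis
  have o: "open \<Omega>" "\<Omega> \<noteq> {}" using \<Omega> by (auto simp: lipschitz_domain_def)
  then obtain x0 R0 where x0: "R0 > 0" "cball x0 R0 \<subseteq> \<Omega>" using open_contains_cball by (metis all_not_in_conv)
  \<comment> \<open>The sign is approximated on the inner half of the ball; the outer half absorbs
    the spreading by d averages of length \<delta>, whence the bound \<rho> / d on \<delta>.\<close>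
  define \<rho> where "\<rho> = R0 / 2"
  have \<rho>: "\<rho> > 0" using x0 by (simp add: \<rho>_def)
  obtain Rb where Rb: "Rb > 0" "\<And>x. x \<in> \<Omega> \<Longrightarrow> norm x \<le> Rb" using \<Omega>(1) unfolding bounded_pos by blast
  \<comment> \<open>The shift T \<eta> has length 2 Rb + 1, more than the diameter of the ball that
    contains \<Omega>.\<close>
  define T where "T = (2 * Rb + 1) / norm \<eta>"
  have T: "T > 0" using Rb \<eta> by (simp add: T_def)
  define m where "m = min t (1 - t) * measure lebesgue (ball x0 \<rho>) / 2"
  have m: "m > 0" unfolding m_def using t \<rho> content_ball_pos[of \<rho> x0] by simp
  define \<mu> where "\<mu> = measure lebesgue \<Omega>"
  have \<Omega>m: "\<Omega> \<in> lmeasurable" using o \<Omega>(1) by (simp add: lmeasurable_open)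
  define d where "d = real CARD('d)"
  have d: "d > 0" by (simp add: d_def)
  define Q where "Q = 2 * d * M * T"
  have Q: "Q > 0" using d M T by (simp add: Q_def)
  \<comment> \<open>Parameter of the Young inequality below, small enough that Q \<kappa> \<mu>
    \<le> m / 2 and the volume term is absorbed by m.\<close>
  define \<kappa> where "\<kappa> = m / (2 * Q * (\<mu> + 1))"
  have \<mu>: "\<mu> \<ge> 0" by (simp add: \<mu>_def)
  have \<kappa>: "\<kappa> > 0" using m Q \<mu> by (simp add: \<kappa>_def)
  define K where "K = Q / \<kappa> + d / norm v"
  show ?thesis
  proof (rule that[of "m / 2" K "\<rho> / d"])
    show "m / 2 > 0" "\<rho> / d > 0" using m \<rho> d by auto
    have K1: "Q / \<kappa> > 0" "d / norm v > 0" using Q \<kappa> d v0 by auto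
    then show "K > 0" by (simp add: K_def)
    fix \<chi>' u \<delta>
    assume \<chi>': "\<chi>' \<in> BV_fields \<Omega> {A, B}" and u: "u \<in> admissible Aop 1 \<Omega> F" and \<delta>: "0 < \<delta>" "\<delta> \<le> \<rho> / d"
    have \<chi>m: "(\<lambda>x. indicat_real \<Omega> x *\<^sub>R \<chi>' x) \<in> borel_measurable lebesgue"
      and \<chi>AE: "AE x in lebesgue. x \<in> \<Omega> \<longrightarrow> \<chi>' x \<in> {A, B}" and sf: "surface_energy \<Omega> \<chi>' < \<infinity>"
      using \<chi>' by (auto simp: BV_fields_def set_integrable_def)
    have \<chi>m': "set_borel_measurable lebesgue \<Omega> \<chi>'" using \<chi>m by (simp add: set_borel_measurable_def)
    obtain f g where fg: "f \<in> borel_measurable lebesgue" "\<And>x. x \<in> \<Omega> \<Longrightarrow> f x \<in> {t, t - 1}" "\<And>x. x \<notin> \<Omega> \<Longrightarrow> f x = 0"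
      "AE x in lebesgue. x \<in> \<Omega> \<longrightarrow> \<chi>' x = F + f x *\<^sub>R (B - A)"
      "g \<in> borel_measurable lebesgue" "\<And>x. x \<notin> \<Omega> \<Longrightarrow> g x = 0"
      "AE x in lebesgue. u x = F + f x *\<^sub>R (B - A) + g x"
      "integrable lebesgue (\<lambda>x. (norm (g x))\<^sup>2)" "integrable lebesgue g" "integrable lebesgue f"
      "elastic_energy \<Omega> u \<chi>' = ennreal (LINT x|lebesgue. (norm (g x))\<^sup>2)"
      by (rule two_phase_setup[OF \<Omega> t AB F \<chi>m' \<chi>AE u], rule that) blast+
    note fg' = fg(4,7)[folded v_def]
    have fb: "\<bar>f x\<bar> \<le> 1" for x using fg(2)[of x] fg(3)[of x] t by (cases "x \<in> \<Omega>") auto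
    define E where "E = (LINT x|lebesgue. (norm (g x))\<^sup>2)"
    have E: "E \<ge> 0" by (simp add: E_def)
    obtain S where S: "surface_energy \<Omega> \<chi>' = ennreal S" "S \<ge> 0" using sf by (metis less_top_ennreal infinity_ennreal_def)
    have sub: "ball x0 \<rho> \<subseteq> \<Omega>" using x0 \<rho> by (auto simp: \<rho>_def subset_iff)
    have ht: "f x \<in> {t, t - 1}" if "x \<in> ball x0 \<rho>" for x using fg(2) sub that by blast
    obtain h where h: "\<And>r. C_diff r h" "\<And>x. \<bar>h x\<bar> \<le> 1" "\<And>x. x \<notin> cball x0 \<rho> \<Longrightarrow> h x = 0"
      "(LINT x|lebesgue. f x * h x) \<ge> m"
      using two_valued_test_function[where ?x0.0 = x0, OF t fg(1) \<rho> ht fg(10) fb, folded m_def] by blast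
    have "\<delta> * d \<le> \<rho>" using \<delta> d by (simp add: field_simps)
    then have rad: "\<rho> + \<delta> * real CARD('d) \<le> R0" by (simp add: \<rho>_def d_def)
    have TV: "\<bar>LINT x|lebesgue. f x * partial_deriv j \<zeta> x\<bar> \<le> S / norm v"
      if "C_diff 1 \<zeta>" "\<And>x. \<bar>\<zeta> x\<bar> \<le> 1" "\<And>x. x \<notin> cball x0 R0 \<Longrightarrow> \<zeta> x = 0" for \<zeta> j
      by (rule surface_energy_scalar_bound[OF o(1) fg(10) v0 fg'(1) fg(3) \<chi>m S that x0(2)])
    have "\<exists>G. (\<forall>r. C_diff r G) \<and> (\<forall>x. \<bar>G x\<bar> \<le> 1) \<and> (\<forall>x. x \<notin> cball x0 (\<rho> + \<delta> * real CARD('d)) \<longrightarrow> G x = 0) \<and>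
       (\<forall>j\<in>UNIV. \<forall>x. \<bar>partial_deriv j G x\<bar> \<le> 2 / \<delta>) \<and>
       \<bar>(LINT x|lebesgue. f x * G x) - (LINT x|lebesgue. f x * h x)\<bar> \<le> \<delta> * real CARD('d) * (S / norm v)"
      by (rule coordinate_averaging[where ?x0.0 = x0 and J=UNIV, OF h(1-3) fg(10) \<delta>(1) rad TV])
    then obtain G where G: "\<And>r. C_diff r G" "\<And>x. \<bar>G x\<bar> \<le> 1" "\<And>x. x \<notin> cball x0 (\<rho> + \<delta> * real CARD('d)) \<Longrightarrow> G x = 0"
      "\<And>j x. \<bar>partial_deriv j G x\<bar> \<le> 2 / \<delta>"
      "\<bar>(LINT x|lebesgue. f x * G x) - (LINT x|lebesgue. f x * h x)\<bar> \<le> \<delta> * d * (S / norm v)"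
      unfolding d_def by blast
    have G0: "G x = 0" if "x \<notin> \<Omega>" for x
    proof -
      have "cball x0 (\<rho> + \<delta> * real CARD('d)) \<subseteq> cball x0 R0" using rad by auto
      then show ?thesis using G(3)[of x] x0(2) that by blast
    qed
    define e where "e = (- T) *\<^sub>R \<eta>"
    define \<psi> where "\<psi> x = T * line_avg (\<lambda>_. 1) e G x" for x
    have one: "continuous_on UNIV (\<lambda>_::real. 1::real)" by simp
    have C\<psi>: "C_diff r \<psi>" for r
      unfolding \<psi>_def by (intro C_diff_cmult C_diff_line_avg one G(1))
    have "\<psi> x = 0" if "x \<notin> cball x0 (\<rho> + \<delta> * real CARD('d) + norm e)" for x
      unfolding \<psi>_def using line_avg_vanish[OF G(3) that] by simp
    then have \<psi>: "\<psi> \<in> test_functions" by (intro test_functionsI[OF C\<psi>, of "cball x0 (\<rho> + \<delta> * real CARD('d) + norm e)"]) auto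
    have D\<psi>: "dir_deriv k \<psi> x = T * line_avg (\<lambda>_. 1) e (dir_deriv k G) x" for k x
    proof -
      have dl: "(line_avg (\<lambda>_. 1) e G has_derivative (\<lambda>h. dir_deriv h (line_avg (\<lambda>_. 1) e G) x)) (at x)"
        by (rule has_derivative_dir_deriv[OF C_diff_differentiable[OF C_diff_line_avg[OF one G(1)], of 1]]) simp
      have "(\<psi> has_derivative (\<lambda>h. T * dir_deriv h (line_avg (\<lambda>_. 1) e G) x)) (at x)"
        unfolding \<psi>_def by (rule has_derivative_mult_right[OF dl])
      from dir_deriv_eqI[OF this, of k] show ?thesis by (simp add: dir_deriv_line_avg[OF one G(1)])
    qed
    have P\<psi>: "\<bar>partial_deriv j \<psi> x\<bar> \<le> 2 * T / \<delta>" for j x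
    proof -
      have "\<bar>line_avg (\<lambda>_. 1) e (partial_deriv j G) x\<bar> \<le> 2 / \<delta>"
        using G(4) by (intro line_avg_bound[OF one] C_diff_partial_continuous[OF G(1)]) auto
      then have "T * \<bar>line_avg (\<lambda>_. 1) e (partial_deriv j G) x\<bar> \<le> T * (2 / \<delta>)" using T by (intro mult_left_mono) auto
      then show ?thesis using D\<psi>[of "axis j 1" x] T by (simp add: dir_deriv_axis abs_mult mult.commute)
    qed
    \<comment> \<open>For x in \<Omega> the shifted end point x + e lies outside \<Omega>, where G
      vanishes; outside \<Omega> the factor f vanishes.\<close>
    have \<psi>G: "f x * dir_deriv \<eta> \<psi> x = f x * G x" for x
    proof (cases "x \<in> \<Omega>")
      case True
      have "norm e = 2 * Rb + 1" using \<eta> T Rb(1) by (simp add: e_def T_def)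
      then have "norm (x + e) > Rb" using norm_triangle_ineq2[of e "- x"] Rb(2)[OF True] Rb(1) by (simp add: add.commute)
      then have "G (x + e) = 0" using G0 Rb(2) by (meson not_le)
      moreover have "line_avg (\<lambda>_. 1) e (dir_deriv e G) x = G (x + e) - G x" by (rule line_avg_dir_deriv_1[OF G(1)])
      moreover have "dir_deriv e \<psi> x = (- T) * dir_deriv \<eta> \<psi> x" by (simp add: e_def dir_deriv_def sum_distrib_left mult_ac sum_negf)
      ultimately have "(- T) * dir_deriv \<eta> \<psi> x = (- T) * G x" using D\<psi>[of e x] by auto
      then show ?thesis using T by (metis mult_cancel_left neg_equal_0_iff_equal less_irrefl)
    qed (simp add: fg(3))
    have sol: "(\<Sum>j\<in>UNIV. Aop (unit_index j) *v (LINT x|lebesgue. partial_deriv j \<psi> x *\<^sub>R u x)) = 0"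
      using u \<psi> unfolding admissible_def distributional_solution_1 by blast
    have um: "u \<in> borel_measurable lebesgue" using u by (simp add: admissible_def L2_loc_def)
    have pt: "partial_deriv j \<psi> \<in> test_functions" for j by (rule test_functions_partial_deriv[OF \<psi>])
    have pz: "(LINT x|lebesgue. partial_deriv j \<psi> x) = 0" for j
    proof -
      obtain R where "\<And>x. x \<notin> cball 0 R \<Longrightarrow> \<psi> x = 0" using test_functions_vanish[OF \<psi>] by blast
      then show ?thesis by (rule integral_partial_deriv_zero[OF C\<psi>])
    qed
    note dec = integral_scaleR_two_phase[OF pt pz fg'(2) fg(10,9) um]
    define X where "X j = (LINT x|lebesgue. f x * partial_deriv j \<psi> x)" for j
    define Y where "Y j = (LINT x|lebesgue. partial_deriv j \<psi> x *\<^sub>R g x)" for j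
    \<comment> \<open>The X terms add up to the integral of f against G, which is bounded below; the
      Y terms carry g and the derivatives of \<psi>, of size T / \<delta>.\<close>
    have "0 = p \<bullet> (\<Sum>j\<in>UNIV. Aop (unit_index j) *v (X j *\<^sub>R v + Y j))"
      using sol by (simp add: dec(1) X_def Y_def)
    also have "\<dots> = (\<Sum>j\<in>UNIV. X j * \<eta> $ j) + (\<Sum>j\<in>UNIV. p \<bullet> (Aop (unit_index j) *v Y j))"
      by (simp add: inner_sum_right matrix_vector_right_distrib matrix_vector_mult_scaleR inner_add_right sum.distrib \<eta>_def)
    finally have XY: "(\<Sum>j\<in>UNIV. X j * \<eta> $ j) = - (\<Sum>j\<in>UNIV. p \<bullet> (Aop (unit_index j) *v Y j))" by simp
    have "(\<Sum>j\<in>UNIV. X j * \<eta> $ j) = (LINT x|lebesgue. (\<Sum>j\<in>UNIV. (f x * partial_deriv j \<psi> x) * \<eta> $ j))"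
      unfolding X_def using dec(2) by (subst Bochner_Integration.integral_sum) auto
    also have "\<dots> = (LINT x|lebesgue. f x * dir_deriv \<eta> \<psi> x)"
      by (simp add: dir_deriv_def sum_distrib_left mult_ac)
    finally have X: "(\<Sum>j\<in>UNIV. X j * \<eta> $ j) = (LINT x|lebesgue. f x * G x)" unfolding \<psi>G .
    define N where "N = (LINT x|lebesgue. norm (g x))"
    have Yb: "norm (Y j) \<le> 2 * T / \<delta> * N" for j
    proof -
      have "norm (Y j) \<le> (LINT x|lebesgue. norm (partial_deriv j \<psi> x *\<^sub>R g x))"
        unfolding Y_def by (rule integral_norm_bound)
      also have "\<dots> \<le> (LINT x|lebesgue. 2 * T / \<delta> * norm (g x))"
      proof (rule integral_mono)
        show "norm (partial_deriv j \<psi> x *\<^sub>R g x) \<le> 2 * T / \<delta> * norm (g x)" for x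
          unfolding norm_scaleR real_norm_def by (rule mult_right_mono[OF P\<psi> norm_ge_zero])
      qed (use fg(9) dec(3)[THEN integrable_norm] in auto)
      finally show ?thesis by (simp add: N_def)
    qed
    have "\<bar>\<Sum>j\<in>UNIV. p \<bullet> (Aop (unit_index j) *v Y j)\<bar> \<le> (\<Sum>j\<in>(UNIV::'d set). M * (2 * T / \<delta> * N))"
      using M Yb by (intro order.trans[OF sum_abs] sum_mono order.trans[OF M(2)] mult_left_mono) auto
    also have "\<dots> = Q / \<delta> * N" by (simp add: Q_def d_def)
    finally have "(LINT x|lebesgue. f x * G x) \<le> Q / \<delta> * N" using XY X by simp
    moreover have "(LINT x|lebesgue. f x * G x) \<ge> m - \<delta> * d * (S / norm v)" using G(5) h(4) by linarith
    ultimately have est: "m \<le> Q / \<delta> * N + \<delta> * d * (S / norm v)" by linarith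
    \<comment> \<open>Passage from the first to the second power of g by the Young inequality
      instead of Cauchy-Schwarz; the weight \<kappa> \<delta> makes the volume term independent of
      \<delta> after division by \<delta>.\<close>
    have N: "2 * N \<le> \<kappa> * \<delta> * \<mu> + E / (\<kappa> * \<delta>)"
    proof -
      have i\<Omega>: "integrable lebesgue (indicat_real \<Omega>)" using \<Omega>m by (auto simp: fmeasurable_def intro!: integrable_real_indicator)
      have "2 * N = (LINT x|lebesgue. 2 * norm (g x))" by (simp add: N_def)
      also have "\<dots> \<le> (LINT x|lebesgue. (\<kappa> * \<delta>) * indicat_real \<Omega> x + (norm (g x))\<^sup>2 / (\<kappa> * \<delta>))"
      proof (rule integral_mono)
        fix x
        have s: "\<kappa> * \<delta> > 0" using \<kappa> \<delta> by simp
        have "2 * norm (g x) * (\<kappa> * \<delta>) \<le> (\<kappa> * \<delta>)\<^sup>2 + (norm (g x))\<^sup>2"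
          using zero_le_power2[of "norm (g x) - \<kappa> * \<delta>"] unfolding power2_diff by linarith
        then have "2 * norm (g x) \<le> \<kappa> * \<delta> + (norm (g x))\<^sup>2 / (\<kappa> * \<delta>)"
        proof -
          assume a: "2 * norm (g x) * (\<kappa> * \<delta>) \<le> (\<kappa> * \<delta>)\<^sup>2 + (norm (g x))\<^sup>2"
          have "\<kappa> * \<delta> + (norm (g x))\<^sup>2 / (\<kappa> * \<delta>) = ((\<kappa> * \<delta>)\<^sup>2 + (norm (g x))\<^sup>2) / (\<kappa> * \<delta>)"
            using s by (simp only: add_divide_distrib power2_eq_square[of "\<kappa> * \<delta>"]) simp
          then show ?thesis using a pos_le_divide_eq[OF s] by simp
        qed
        then show "2 * norm (g x) \<le> (\<kappa> * \<delta>) * indicat_real \<Omega> x + (norm (g x))\<^sup>2 / (\<kappa> * \<delta>)"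
          using fg(6)[of x] by (cases "x \<in> \<Omega>") auto
      qed (use fg(8,9) i\<Omega> in auto)
      also have "\<dots> = \<kappa> * \<delta> * \<mu> + E / (\<kappa> * \<delta>)" using fg(8) i\<Omega> by (simp add: \<mu>_def E_def)
      finally show ?thesis .
    qed
    have "Q / \<delta> * N \<le> Q / \<delta> * ((\<kappa> * \<delta> * \<mu> + E / (\<kappa> * \<delta>)) / 2)"
      using N Q \<delta> by (intro mult_left_mono) auto
    also have "\<dots> = Q * \<kappa> * \<mu> / 2 + Q / \<kappa> * (E / \<delta>\<^sup>2) / 2"
      using \<delta> \<kappa> by (simp add: field_simps power2_eq_square)
    also have "Q * \<kappa> * \<mu> \<le> m / 2"
    proof -
      have "Q * \<kappa> * \<mu> = Q * m * \<mu> / (2 * Q * (\<mu> + 1))" by (simp add: \<kappa>_def)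
      also have "\<dots> = (m / 2) * (\<mu> / (\<mu> + 1))" using Q by simp
      also have "\<dots> \<le> (m / 2) * 1" using m \<mu> by (intro mult_left_mono) auto
      finally show ?thesis by simp
    qed
    finally have "Q / \<delta> * N \<le> m / 4 + Q / \<kappa> * (E / \<delta>\<^sup>2) / 2" by linarith
    moreover have "Q / \<kappa> * (E / \<delta>\<^sup>2) \<ge> 0" using K1 E by (intro mult_nonneg_nonneg) auto
    moreover have "m / 2 \<le> b + s" if "a \<le> m / 4 + b / 2" "0 \<le> b" "m \<le> a + s" for a b s
      using that m by linarith
    ultimately have "m / 2 \<le> Q / \<kappa> * (E / \<delta>\<^sup>2) + \<delta> * d * (S / norm v)" using est by blast
    also have "\<delta> * d * (S / norm v) = d / norm v * (\<delta> * S)" by simp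
    also have "Q / \<kappa> * (E / \<delta>\<^sup>2) + d / norm v * (\<delta> * S) \<le> K * (E / \<delta>\<^sup>2) + K * (\<delta> * S)"
      using K1 E S(2) \<delta> by (intro add_mono mult_right_mono) (auto simp: K_def)
    finally show "\<exists>E S. E \<ge> 0 \<and> S \<ge> 0 \<and> elastic_energy \<Omega> u \<chi>' = ennreal E \<and> surface_energy \<Omega> \<chi>' = ennreal S \<and>
         m / 2 \<le> K * (E / \<delta>\<^sup>2 + \<delta> * S)"
      using E S fg(11) by (intro exI[of _ E] exI[of _ S]) (simp add: E_def distrib_left)
  qed
qed

text \<open>The estimate holds for every small \<delta>; the choice \<delta> = \<epsilon>^(1/3)
  makes the ratio of the two weights equal to \<epsilon>, and the threshold for \<epsilon> is the
  cube of the threshold for \<delta>.\<close>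

lemma min_total_energy_compatible_lower:
  fixes Aop :: "('d::finite \<Rightarrow> nat) \<Rightarrow> real^'n::finite^'m::finite"
  assumes \<Omega>: "bounded \<Omega>" "lipschitz_domain \<Omega>" and t: "t \<in> {0<..<1}"
    and v: "B - A \<notin> common_kernel Aop 1" and F: "F = t *\<^sub>R A + (1 - t) *\<^sub>R B"
  shows "\<exists>C>0. \<exists>\<epsilon>\<^sub>0>0. \<forall>\<epsilon>\<in>{0<..<\<epsilon>\<^sub>0}. min_total_energy Aop 1 \<Omega> A B F \<epsilon> \<ge> ennreal (C * \<epsilon> powr (2/3))"
proof -
  obtain c K \<delta>0 where c: "c > 0" and K: "K > 0" and \<delta>0: "\<delta>0 > 0"
    and *: "\<And>\<chi>' u \<delta>. \<chi>' \<in> BV_fields \<Omega> {A, B} \<Longrightarrow> u \<in> admissible Aop 1 \<Omega> F \<Longrightarrow> 0 < \<delta> \<Longrightarrow> \<delta> \<le> \<delta>0 \<Longrightarrow>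
       \<exists>E S. E \<ge> 0 \<and> S \<ge> 0 \<and> elastic_energy \<Omega> u \<chi>' = ennreal E \<and> surface_energy \<Omega> \<chi>' = ennreal S \<and>
         c \<le> K * (E / \<delta>\<^sup>2 + \<delta> * S)"
    using compatible_energy_estimate[OF assms] by metis
  have "min_total_energy Aop 1 \<Omega> A B F \<epsilon> \<ge> ennreal (c / K * \<epsilon> powr (2/3))" if \<epsilon>: "\<epsilon> \<in> {0<..<\<delta>0 ^ 3}" for \<epsilon>
    unfolding min_total_energy_def
  proof (intro INF_greatest)
    fix \<chi>' u assume \<chi>': "\<chi>' \<in> BV_fields \<Omega> {A, B}" and u: "u \<in> admissible Aop 1 \<Omega> F"
    define \<delta> where "\<delta> = \<epsilon> powr (1/3)"
    have \<delta>: "\<delta> > 0" using \<epsilon> by (simp add: \<delta>_def)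
    have \<delta>3: "\<delta> ^ 3 = \<epsilon>" using \<epsilon> by (simp add: \<delta>_def powr_realpow[symmetric] powr_powr)
    have \<delta>2: "\<delta>\<^sup>2 = \<epsilon> powr (2/3)" using \<epsilon> by (simp add: \<delta>_def powr_power)
    have "\<delta> \<le> \<delta>0" using \<epsilon> \<delta>3 \<delta>0 power_less_imp_less_base[of \<delta> 3 \<delta>0] by auto
    then obtain E S where ES: "E \<ge> 0" "S \<ge> 0" "elastic_energy \<Omega> u \<chi>' = ennreal E" "surface_energy \<Omega> \<chi>' = ennreal S"
      "c \<le> K * (E / \<delta>\<^sup>2 + \<delta> * S)" using *[OF \<chi>' u \<delta>] by blast
    have "c / K * \<delta>\<^sup>2 \<le> (E / \<delta>\<^sup>2 + \<delta> * S) * \<delta>\<^sup>2"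
      using ES(5) K by (intro mult_right_mono) (auto simp: field_simps)
    also have "\<dots> = E + \<epsilon> * S" using \<delta> unfolding \<delta>3[symmetric] by (simp add: field_simps power2_eq_square power3_eq_cube)
    finally have "ennreal (c / K * \<epsilon> powr (2/3)) \<le> ennreal (E + \<epsilon> * S)" unfolding \<delta>2 by (rule ennreal_leI)
    also have "\<dots> = elastic_energy \<Omega> u \<chi>' + ennreal \<epsilon> * surface_energy \<Omega> \<chi>'"
      using ES \<epsilon> by (simp add: ennreal_plus ennreal_mult)
    finally show "ennreal (c / K * \<epsilon> powr (2/3)) \<le> elastic_energy \<Omega> u \<chi>' + ennreal \<epsilon> * surface_energy \<Omega> \<chi>'" .
  qed
  then show ?thesis using c K \<delta>0 by (intro exI[of _ "c / K"] conjI exI[of _ "\<delta>0 ^ 3"]) auto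
qed

section \<open>Positive definite trigonometric kernels\<close>

lemma partial_deriv_pow_local:
  assumes "open U" "\<And>y. y \<in> U \<Longrightarrow> f y = g y"
  shows "\<And>x. x \<in> U \<Longrightarrow> (partial_deriv j ^^ n) f x = (partial_deriv j ^^ n) g x"
proof (induction n)
  case (Suc n)
  then show ?case using partial_deriv_local[OF assms(1), of x "(partial_deriv j ^^ n) f"] by simp
qed (use assms in simp)

lemma multi_deriv_local:
  assumes "open U" "\<And>y. y \<in> U \<Longrightarrow> f y = g y" "x \<in> U"
  shows "multi_deriv \<alpha> f x = multi_deriv \<alpha> g x"
proof -
  have "y \<in> U \<Longrightarrow> foldr (\<lambda>j. partial_deriv j ^^ \<alpha> j) js f y = foldr (\<lambda>j. partial_deriv j ^^ \<alpha> j) js g y" for y js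
  proof (induction js arbitrary: y)
    case (Cons l js)
    then show ?case using partial_deriv_pow_local[OF assms(1), of "foldr (\<lambda>j. partial_deriv j ^^ \<alpha> j) js f"] by simp
  qed (use assms in simp)
  then show ?thesis using assms(3) unfolding multi_deriv_def by blast
qed

text \<open>The free phase \<tau> keeps real plane waves closed under differentiation: a derivative
  is a shift of the phase by pi / 2 and a factor from \<xi>. This takes the place of complex
  exponentials.\<close>

lemma C_diff_cos: "C_diff r (\<lambda>x. cos ((\<xi>::real^'d::finite) \<bullet> x + \<tau>))"
proof -
  have "C_diff_real r (\<lambda>s. cos (s + \<tau>))" for \<tau>
  proof (induction r arbitrary: \<tau>)
    case (Suc r)
    show ?case
    proof (rule C_diff_real_SucI[OF _ Suc[of "\<tau> + pi / 2"]])
      show "((\<lambda>s. cos (s + \<tau>)) has_real_derivative cos (s + (\<tau> + pi / 2))) (at s)" for s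
        using minus_sin_cos_eq[of "s + \<tau>"] by (auto intro!: derivative_eq_intros simp: add.assoc)
    qed
  qed (auto intro!: continuous_intros)
  from C_diff_compose[OF this C_diff_inner] show ?thesis .
qed

lemma partial_deriv_cos:
  "partial_deriv j (\<lambda>x. c * cos ((\<xi>::real^'d::finite) \<bullet> x + \<tau>)) = (\<lambda>x. (c * \<xi> $ j) * cos (\<xi> \<bullet> x + (\<tau> + pi / 2)))"
proof
  fix x
  have "((\<lambda>x. c * cos (\<xi> \<bullet> x + \<tau>)) has_derivative (\<lambda>h. c * ((\<xi> \<bullet> h) * - sin (\<xi> \<bullet> x + \<tau>)))) (at x)"
    by (auto intro!: derivative_eq_intros)
  from partial_deriv_eqI[OF this, of j]
  show "partial_deriv j (\<lambda>x. c * cos (\<xi> \<bullet> x + \<tau>)) x = (c * \<xi> $ j) * cos (\<xi> \<bullet> x + (\<tau> + pi / 2))"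
    using minus_sin_cos_eq[of "\<xi> \<bullet> x + \<tau>"] by (simp add: inner_axis add.assoc)
qed

lemma partial_deriv_pow_cos:
  "(partial_deriv j ^^ n) (\<lambda>x. c * cos ((\<xi>::real^'d::finite) \<bullet> x + \<tau>)) =
    (\<lambda>x. (c * (\<xi> $ j) ^ n) * cos (\<xi> \<bullet> x + (\<tau> + real n * (pi / 2))))"
proof (induction n)
  case (Suc n)
  have eq: "\<tau> + real n * (pi / 2) + pi / 2 = \<tau> + real (Suc n) * (pi / 2)" by (simp add: algebra_simps add_divide_distrib)
  show ?case unfolding funpow.simps comp_apply Suc partial_deriv_cos eq by (simp add: mult_ac)
qed simp

text \<open>The phase shift depends on \<alpha> only through its length k, so the cosine is a common
  factor of all terms of the operator and the monomials assemble to the symbol.\<close>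

lemma multi_deriv_cos:
  assumes "\<alpha> \<in> multi_indices k"
  shows "multi_deriv \<alpha> (\<lambda>x. cos ((\<xi>::real^'d::finite) \<bullet> x + \<tau>)) =
    (\<lambda>x. (\<Prod>j\<in>UNIV. (\<xi> $ j) ^ \<alpha> j) * cos (\<xi> \<bullet> x + (\<tau> + real k * (pi / 2))))"
proof -
  have *: "foldr (\<lambda>j. partial_deriv j ^^ \<alpha> j) js (\<lambda>x. 1 * cos (\<xi> \<bullet> x + \<tau>)) =
    (\<lambda>x. prod_list (map (\<lambda>j. (\<xi> $ j) ^ \<alpha> j) js) * cos (\<xi> \<bullet> x + (\<tau> + real (sum_list (map \<alpha> js)) * (pi / 2))))" for js
  proof (induction js)
    case (Cons l js)
    have eq: "\<tau> + real (sum_list (map \<alpha> js)) * (pi / 2) + real (\<alpha> l) * (pi / 2) = \<tau> + real (sum_list (map \<alpha> (l # js))) * (pi / 2)"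
      by (simp add: algebra_simps add_divide_distrib)
    show ?case unfolding foldr.simps comp_apply Cons partial_deriv_pow_cos eq by (simp add: mult_ac)
  qed simp
  define js where "js = (SOME js. distinct js \<and> set js = (UNIV :: 'd set))"
  have js: "distinct js" "set js = UNIV" unfolding js_def by (rule enum_UNIV)+
  have "prod_list (map (\<lambda>j. (\<xi> $ j) ^ \<alpha> j) js) = (\<Prod>j\<in>UNIV. (\<xi> $ j) ^ \<alpha> j)"
    using prod.distinct_set_conv_list[OF js(1), of "\<lambda>j. (\<xi> $ j) ^ \<alpha> j"] js(2) by simp
  moreover have "sum_list (map \<alpha> js) = k"
    using sum.distinct_set_conv_list[OF js(1), of \<alpha>] js(2) assms by (simp add: multi_indices_def)
  ultimately show ?thesis using *[of js] unfolding multi_deriv_def js_def[symmetric] by simp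
qed

text \<open>On the compact sphere the symbol applied to v is bounded below by some m > 0, and the
  symbol itself is bounded by M; homogeneity extends the ratio m / M to all nonzero \<xi>. The
  constant involves only the operator and v, which is why the final one does not depend on the
  domain or on the volume fraction.\<close>

lemma op_symbol_kernel_bound:
  fixes Aop :: "('d::finite \<Rightarrow> nat) \<Rightarrow> real^'n::finite^'m::finite"
  assumes "v \<notin> wave_cone Aop k"
  obtains c where "c > 0" "\<And>\<xi> s z. \<xi> \<noteq> 0 \<Longrightarrow> op_symbol Aop k \<xi> *v (s *\<^sub>R v + z) = 0 \<Longrightarrow> c * \<bar>s\<bar> \<le> norm z"
proof -
  have cont: "continuous_on (sphere 0 1) (\<lambda>\<xi>. norm (op_symbol Aop k \<xi> *v v))"
    unfolding op_symbol_mult by (intro continuous_intros)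
  have "axis (undefined::'d) (1::real) \<in> sphere 0 1" by simp
  then have "sphere (0::real^'d) 1 \<noteq> {}" by blast
  then obtain \<xi>0 where \<xi>0: "\<xi>0 \<in> sphere 0 1" "\<And>\<xi>. \<xi> \<in> sphere 0 1 \<Longrightarrow> norm (op_symbol Aop k \<xi>0 *v v) \<le> norm (op_symbol Aop k \<xi> *v v)"
    using continuous_attains_inf[OF compact_sphere _ cont] by blast
  define m where "m = norm (op_symbol Aop k \<xi>0 *v v)"
  have m: "m > 0" using assms \<xi>0(1) by (auto simp: m_def wave_cone_def mat_kernel_def)
  have "\<exists>K>0. \<forall>z. norm (Aop \<alpha> *v z) \<le> K * norm z" for \<alpha>
    using bounded_linear.pos_bounded[OF matrix_vector_mul_bounded_linear[of "Aop \<alpha>"]] by (auto simp: mult.commute)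
  then obtain L where L: "\<And>\<alpha>. L \<alpha> > 0" "\<And>\<alpha> z. norm (Aop \<alpha> *v z) \<le> L \<alpha> * norm z" by metis
  define M where "M = (\<Sum>\<alpha>\<in>multi_indices k. L \<alpha>) + 1"
  have "(\<Sum>\<alpha>\<in>multi_indices k. L \<alpha>) \<ge> 0" using L(1) by (intro sum_nonneg) (auto intro: less_imp_le)
  then have M: "M > 0" by (simp add: M_def)
  have up: "norm (op_symbol Aop k \<xi> *v z) \<le> M * norm z" if "\<xi> \<in> sphere 0 1" for \<xi> z
  proof -
    have c1: "\<bar>\<Prod>j\<in>UNIV. (\<xi> $ j) ^ \<alpha> j\<bar> \<le> 1" for \<alpha> :: "'d \<Rightarrow> nat"
      unfolding abs_prod power_abs using that component_le_norm_cart[of \<xi>]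
      by (intro prod_le_1) (auto intro!: power_le_one)
    have "norm (op_symbol Aop k \<xi> *v z) \<le> (\<Sum>\<alpha>\<in>multi_indices k. norm ((\<Prod>j\<in>UNIV. (\<xi> $ j) ^ \<alpha> j) *\<^sub>R (Aop \<alpha> *v z)))"
      unfolding op_symbol_mult by (rule norm_sum)
    also have "\<dots> \<le> (\<Sum>\<alpha>\<in>multi_indices k. L \<alpha> * norm z)"
    proof (rule sum_mono)
      fix \<alpha>
      have "\<bar>\<Prod>j\<in>UNIV. (\<xi> $ j) ^ \<alpha> j\<bar> * norm (Aop \<alpha> *v z) \<le> 1 * (L \<alpha> * norm z)"
        using c1 L by (intro mult_mono) auto
      then show "norm ((\<Prod>j\<in>UNIV. (\<xi> $ j) ^ \<alpha> j) *\<^sub>R (Aop \<alpha> *v z)) \<le> L \<alpha> * norm z" by simp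
    qed
    also have "\<dots> \<le> M * norm z" by (simp add: M_def sum_distrib_right distrib_right)
    finally show ?thesis .
  qed
  have "m / M * \<bar>s\<bar> \<le> norm z" if \<xi>: "\<xi> \<noteq> 0" and eq: "op_symbol Aop k \<xi> *v (s *\<^sub>R v + z) = 0" for \<xi> s z
  proof -
    define \<omega> where "\<omega> = (1 / norm \<xi>) *\<^sub>R \<xi>"
    have \<omega>: "\<omega> \<in> sphere 0 1" using \<xi> by (simp add: \<omega>_def)
    have "(\<Prod>j\<in>UNIV. (\<omega> $ j) ^ \<alpha> j) = (1 / norm \<xi>) ^ k * (\<Prod>j\<in>UNIV. (\<xi> $ j) ^ \<alpha> j)" if "\<alpha> \<in> multi_indices k" for \<alpha>
      using that by (simp only: \<omega>_def vector_scaleR_component power_mult_distrib prod.distrib power_sum[symmetric] multi_indices_def mem_Collect_eq real_scaleR_def)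
    then have "op_symbol Aop k \<omega> *v y = (1 / norm \<xi>) ^ k *\<^sub>R (op_symbol Aop k \<xi> *v y)" for y
      unfolding op_symbol_mult by (simp add: scaleR_sum_right)
    then have "op_symbol Aop k \<omega> *v (s *\<^sub>R v + z) = 0" using eq by simp
    then have "s *\<^sub>R (op_symbol Aop k \<omega> *v v) = - (op_symbol Aop k \<omega> *v z)"
      by (simp add: matrix_vector_right_distrib matrix_vector_mult_scaleR eq_neg_iff_add_eq_0)
    then have "\<bar>s\<bar> * norm (op_symbol Aop k \<omega> *v v) = norm (op_symbol Aop k \<omega> *v z)"
      by (metis norm_minus_cancel norm_scaleR)
    moreover have "\<bar>s\<bar> * m \<le> \<bar>s\<bar> * norm (op_symbol Aop k \<omega> *v v)" using \<xi>0(2)[OF \<omega>] by (intro mult_left_mono) (auto simp: m_def)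
    ultimately have "\<bar>s\<bar> * m \<le> M * norm z" using up[OF \<omega>, of z] by linarith
    then show ?thesis using M by (simp add: field_simps)
  qed
  then show ?thesis using that[of "m / M"] m M by auto
qed

text \<open>The equation at the frequency \<xi>, for each phase separately. The wave is cut off by a
  function equal to 1 near the closure of \<Omega>; as f and g vanish outside \<Omega>, the cutoff
  leaves no trace in the integrals.\<close>

lemma admissible_cosine_moments:
  fixes Aop :: "('d::finite \<Rightarrow> nat) \<Rightarrow> real^'n::finite^'m::finite"
  assumes \<Omega>: "bounded \<Omega>" and k: "k \<ge> 1" and u: "u \<in> admissible Aop k \<Omega> F"
    and ufg: "AE x in lebesgue. u x = F + f x *\<^sub>R v + g x" and i: "integrable lebesgue f" "integrable lebesgue g"
    and 0: "\<And>x. x \<notin> \<Omega> \<Longrightarrow> f x = 0" "\<And>x. x \<notin> \<Omega> \<Longrightarrow> g x = 0"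
  shows "op_symbol Aop k \<xi> *v ((LINT x|lebesgue. f x * cos (\<xi> \<bullet> x + \<sigma>)) *\<^sub>R v + (LINT x|lebesgue. cos (\<xi> \<bullet> x + \<sigma>) *\<^sub>R g x)) = 0"
proof -
  have "compact (closure \<Omega>)" using \<Omega> by (simp add: compact_closure)
  from smooth_urysohn[OF this open_UNIV] obtain \<eta> V L where \<eta>: "\<And>r. C_diff r \<eta>" "open V" "closure \<Omega> \<subseteq> V"
    "\<And>x. x \<in> V \<Longrightarrow> \<eta> x = 1" "compact L" "\<And>x. x \<notin> L \<Longrightarrow> \<eta> x = 0" by (metis subset_UNIV)
  \<comment> \<open>Compensates in advance the shift produced by k derivatives.\<close>
  define \<tau> where "\<tau> = \<sigma> - real k * (pi / 2)"
  define \<phi> where "\<phi> x = \<eta> x * cos (\<xi> \<bullet> x + \<tau>)" for x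
  have \<phi>: "\<phi> \<in> test_functions"
  proof (rule test_functionsI[of _ L])
    show "C_diff r \<phi>" for r unfolding \<phi>_def by (rule C_diff_mult[OF \<eta>(1) C_diff_cos])
  qed (use \<eta> compact_imp_bounded in \<open>auto simp: \<phi>_def\<close>)
  define P where "P \<alpha> = (\<Prod>j\<in>UNIV. (\<xi> $ j) ^ \<alpha> j)" for \<alpha> :: "'d \<Rightarrow> nat"
  have md: "multi_deriv \<alpha> \<phi> x = P \<alpha> * cos (\<xi> \<bullet> x + \<sigma>)" if "\<alpha> \<in> multi_indices k" "x \<in> \<Omega>" for \<alpha> x
  proof -
    have "x \<in> V" using that(2) \<eta>(3) closure_subset by blast
    then have "multi_deriv \<alpha> \<phi> x = multi_deriv \<alpha> (\<lambda>x. cos (\<xi> \<bullet> x + \<tau>)) x"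
      using \<eta>(4) by (intro multi_deriv_local[OF \<eta>(2)]) (auto simp: \<phi>_def)
    then show ?thesis unfolding multi_deriv_cos[OF that(1)] by (simp add: \<tau>_def P_def)
  qed
  have um: "u \<in> borel_measurable lebesgue" using u by (simp add: admissible_def L2_loc_def)
  define X where "X = (LINT x|lebesgue. f x * cos (\<xi> \<bullet> x + \<sigma>))"
  define Y where "Y = (LINT x|lebesgue. cos (\<xi> \<bullet> x + \<sigma>) *\<^sub>R g x)"
  have I: "(LINT x|lebesgue. multi_deriv \<alpha> \<phi> x *\<^sub>R u x) = P \<alpha> *\<^sub>R (X *\<^sub>R v + Y)" if \<alpha>: "\<alpha> \<in> multi_indices k" for \<alpha>
  proof -
    have "(LINT x|lebesgue. multi_deriv \<alpha> \<phi> x *\<^sub>R u x) =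
      (LINT x|lebesgue. f x * multi_deriv \<alpha> \<phi> x) *\<^sub>R v + (LINT x|lebesgue. multi_deriv \<alpha> \<phi> x *\<^sub>R g x)"
      by (rule integral_scaleR_two_phase(1)[OF test_functions_multi_deriv[OF \<phi>] integral_multi_deriv_zero[OF \<phi> \<alpha> k] ufg i um])
    also have "(LINT x|lebesgue. f x * multi_deriv \<alpha> \<phi> x) = (LINT x|lebesgue. P \<alpha> * (f x * cos (\<xi> \<bullet> x + \<sigma>)))"
    proof (rule Bochner_Integration.integral_cong)
      show "f x * multi_deriv \<alpha> \<phi> x = P \<alpha> * (f x * cos (\<xi> \<bullet> x + \<sigma>))" for x
        by (cases "x \<in> \<Omega>") (simp_all add: md[OF \<alpha>] 0)
    qed simp
    also have "(LINT x|lebesgue. multi_deriv \<alpha> \<phi> x *\<^sub>R g x) = (LINT x|lebesgue. P \<alpha> *\<^sub>R (cos (\<xi> \<bullet> x + \<sigma>) *\<^sub>R g x))"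
    proof (rule Bochner_Integration.integral_cong)
      show "multi_deriv \<alpha> \<phi> x *\<^sub>R g x = P \<alpha> *\<^sub>R (cos (\<xi> \<bullet> x + \<sigma>) *\<^sub>R g x)" for x
        by (cases "x \<in> \<Omega>") (simp_all add: md[OF \<alpha>] 0)
    qed simp
    also have "(LINT x|lebesgue. P \<alpha> *\<^sub>R (cos (\<xi> \<bullet> x + \<sigma>) *\<^sub>R g x)) = P \<alpha> *\<^sub>R Y"
      unfolding Y_def by (rule integral_scaleR_right)
    finally show ?thesis by (simp add: X_def scaleR_add_right)
  qed
  have "0 = (\<Sum>\<alpha>\<in>multi_indices k. Aop \<alpha> *v ((-1) ^ k *\<^sub>R (LINT x|lebesgue. multi_deriv \<alpha> \<phi> x *\<^sub>R u x)))"
    using u \<phi> by (simp add: admissible_def distributional_solution_def)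
  also have "\<dots> = (\<Sum>\<alpha>\<in>multi_indices k. (-1) ^ k *\<^sub>R (P \<alpha> *\<^sub>R (Aop \<alpha> *v (X *\<^sub>R v + Y))))"
    using I by (intro sum.cong) (simp_all add: matrix_vector_mult_scaleR)
  also have "\<dots> = (-1) ^ k *\<^sub>R (op_symbol Aop k \<xi> *v (X *\<^sub>R v + Y))"
    unfolding op_symbol_mult P_def by (simp add: scaleR_sum_right)
  finally show ?thesis unfolding X_def Y_def by simp
qed

lemma cosine_moment_bound:
  fixes Aop :: "('d::finite \<Rightarrow> nat) \<Rightarrow> real^'n::finite^'m::finite"
  assumes \<Omega>: "bounded \<Omega>" and k: "k \<ge> 1" and u: "u \<in> admissible Aop k \<Omega> F"
    and ufg: "AE x in lebesgue. u x = F + f x *\<^sub>R v + g x" and i: "integrable lebesgue f" "integrable lebesgue g"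
    and 0: "\<And>x. x \<notin> \<Omega> \<Longrightarrow> f x = 0" "\<And>x. x \<notin> \<Omega> \<Longrightarrow> g x = 0"
    and c: "\<And>\<xi> s z. \<xi> \<noteq> 0 \<Longrightarrow> op_symbol Aop k \<xi> *v (s *\<^sub>R v + z) = 0 \<Longrightarrow> c * \<bar>s\<bar> \<le> norm z"
  shows "c * \<bar>LINT x|lebesgue. f x * cos (\<xi> \<bullet> x + \<sigma>)\<bar> \<le> norm (LINT x|lebesgue. cos (\<xi> \<bullet> x + \<sigma>) *\<^sub>R g x)"
proof (cases "\<xi> = 0")
  case False
  show ?thesis by (rule c[OF False admissible_cosine_moments[OF \<Omega> k u ufg i 0]])
next
  case True
  \<comment> \<open>At frequency zero the symbol vanishes and the equation says nothing; the bound
    there is the limit of the bounds at small nonzero frequencies.\<close>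
  define \<xi>' where "\<xi>' n = (1 / real (Suc n)) *\<^sub>R axis (undefined::'d) (1::real)" for n
  have ne: "\<xi>' n \<noteq> 0" for n by (simp add: \<xi>'_def axis_eq_0_iff)
  have "(\<lambda>n. 1 / real (Suc n)) \<longlonglongrightarrow> 0" using LIMSEQ_inverse_real_of_nat by (simp add: inverse_eq_divide)
  then have "\<xi>' \<longlonglongrightarrow> 0 *\<^sub>R axis undefined 1" unfolding \<xi>'_def by (intro tendsto_scaleR tendsto_const)
  then have lim: "\<xi>' \<longlonglongrightarrow> \<xi>" using True by simp
  have cm: "(\<lambda>x. cos (\<zeta> \<bullet> x + \<sigma>)) \<in> borel_measurable lebesgue" for \<zeta> :: "real^'d"
    by (intro continuous_imp_lebesgue_measurable continuous_intros)
  have cl: "(\<lambda>n. cos (\<xi>' n \<bullet> x + \<sigma>)) \<longlonglongrightarrow> cos (\<xi> \<bullet> x + \<sigma>)" for x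
    using lim by (intro tendsto_intros)
  have fm: "f \<in> borel_measurable lebesgue" "g \<in> borel_measurable lebesgue" using i by auto
  have l1: "(\<lambda>n. LINT x|lebesgue. f x * cos (\<xi>' n \<bullet> x + \<sigma>)) \<longlonglongrightarrow> (LINT x|lebesgue. f x * cos (\<xi> \<bullet> x + \<sigma>))"
  proof (rule integral_dominated_convergence[where w="\<lambda>x. norm (f x)"])
    show "AE x in lebesgue. norm (f x * cos (\<xi>' n \<bullet> x + \<sigma>)) \<le> norm (f x)" for n
      by (rule AE_I2) (simp add: abs_mult mult_left_le)
    show "AE x in lebesgue. (\<lambda>n. f x * cos (\<xi>' n \<bullet> x + \<sigma>)) \<longlonglongrightarrow> f x * cos (\<xi> \<bullet> x + \<sigma>)"
      using cl by (intro AE_I2 tendsto_mult tendsto_const)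
  qed (use i(1) fm cm in auto)
  have l2: "(\<lambda>n. LINT x|lebesgue. cos (\<xi>' n \<bullet> x + \<sigma>) *\<^sub>R g x) \<longlonglongrightarrow> (LINT x|lebesgue. cos (\<xi> \<bullet> x + \<sigma>) *\<^sub>R g x)"
  proof (rule integral_dominated_convergence[where w="\<lambda>x. norm (g x)"])
    show "AE x in lebesgue. norm (cos (\<xi>' n \<bullet> x + \<sigma>) *\<^sub>R g x) \<le> norm (g x)" for n
      by (rule AE_I2) (simp add: mult_left_le_one_le)
    show "AE x in lebesgue. (\<lambda>n. cos (\<xi>' n \<bullet> x + \<sigma>) *\<^sub>R g x) \<longlonglongrightarrow> cos (\<xi> \<bullet> x + \<sigma>) *\<^sub>R g x"
      using cl by (intro AE_I2 tendsto_scaleR tendsto_const)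
  qed (use i(2) fm cm in auto)
  show ?thesis
  proof (rule LIMSEQ_le)
    show "(\<lambda>n. c * \<bar>LINT x|lebesgue. f x * cos (\<xi>' n \<bullet> x + \<sigma>)\<bar>) \<longlonglongrightarrow> c * \<bar>LINT x|lebesgue. f x * cos (\<xi> \<bullet> x + \<sigma>)\<bar>"
      by (intro tendsto_mult tendsto_const tendsto_rabs l1)
    show "(\<lambda>n. norm (LINT x|lebesgue. cos (\<xi>' n \<bullet> x + \<sigma>) *\<^sub>R g x)) \<longlonglongrightarrow> norm (LINT x|lebesgue. cos (\<xi> \<bullet> x + \<sigma>) *\<^sub>R g x)"
      by (intro tendsto_norm l2)
    show "\<exists>N. \<forall>n\<ge>N. c * \<bar>LINT x|lebesgue. f x * cos (\<xi>' n \<bullet> x + \<sigma>)\<bar> \<le> norm (LINT x|lebesgue. cos (\<xi>' n \<bullet> x + \<sigma>) *\<^sub>R g x)"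
      using c[OF ne admissible_cosine_moments[OF \<Omega> k u ufg i 0]] by blast
  qed
qed

text \<open>The cone of finite cosine sums with nonnegative coefficients. Its generation from single
  cosines means that additive statements about the associated quadratic forms need a check at one
  frequency only.\<close>

inductive pos_trig :: "('a::euclidean_space \<Rightarrow> real) \<Rightarrow> bool" where
  pos_trig_cos: "pos_trig (\<lambda>z. cos (\<xi> \<bullet> z))"
| pos_trig_add: "pos_trig K \<Longrightarrow> pos_trig L \<Longrightarrow> pos_trig (\<lambda>z. K z + L z)"
| pos_trig_scale: "c \<ge> 0 \<Longrightarrow> pos_trig K \<Longrightarrow> pos_trig (\<lambda>z. c * K z)"

text \<open>The product-to-sum formula has nonnegative coefficients. Closure under products makes
  high powers, and so concentrating kernels, available inside the cone.\<close>

lemma pos_trig_mult: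
  assumes K: "pos_trig K" and L: "pos_trig L" shows "pos_trig (\<lambda>z. K z * L z)"
  using K
proof (induction rule: pos_trig.induct)
  case (pos_trig_cos \<xi>)
  show ?case using L
  proof (induction rule: pos_trig.induct)
    case (pos_trig_cos \<zeta>)
    have "cos (\<xi> \<bullet> z) * cos (\<zeta> \<bullet> z) = (1/2) * cos ((\<xi> - \<zeta>) \<bullet> z) + (1/2) * cos ((\<xi> + \<zeta>) \<bullet> z)" for z
      by (simp add: cos_times_cos inner_diff_left inner_add_left)
    moreover have "pos_trig (\<lambda>z. (1/2) * cos ((\<xi> - \<zeta>) \<bullet> z) + (1/2) * cos ((\<xi> + \<zeta>) \<bullet> z))"
      by (intro pos_trig.intros) auto
    ultimately show ?case by simp
  next
    case (pos_trig_add K L)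
    then show ?case using pos_trig.pos_trig_add by (fastforce simp: distrib_left)
  next
    case (pos_trig_scale c K)
    then show ?case using pos_trig.pos_trig_scale[of c "\<lambda>z. cos (\<xi> \<bullet> z) * K z"] by (simp add: mult.left_commute)
  qed
next
  case (pos_trig_add K L')
  then show ?case using pos_trig.pos_trig_add by (fastforce simp: distrib_right)
next
  case (pos_trig_scale c K)
  then show ?case using pos_trig.pos_trig_scale[of c "\<lambda>z. K z * L z"] by (simp add: mult.assoc)
qed

lemma pos_trig_1: "pos_trig (\<lambda>z. 1)"
  using pos_trig_cos[of 0] by simp

lemma pos_trig_prod: "finite I \<Longrightarrow> (\<And>i. i \<in> I \<Longrightarrow> pos_trig (K i)) \<Longrightarrow> pos_trig (\<lambda>z. \<Prod>i\<in>I. K i z)"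
  by (induction I rule: finite_induct) (auto intro: pos_trig_1 pos_trig_mult)

lemma pos_trig_power: "pos_trig K \<Longrightarrow> pos_trig (\<lambda>z. K z ^ n)"
  by (induction n) (auto intro: pos_trig_1 pos_trig_mult)

lemma pos_trig_props:
  assumes "pos_trig K"
  shows "continuous_on UNIV K" "\<exists>C. \<forall>z. \<bar>K z\<bar> \<le> C" "K (- z) = K z"
  using assms
proof (induction rule: pos_trig.induct)
  case (pos_trig_cos \<xi>)
  { case 1 show ?case by (intro continuous_intros) }
  { case 2 show ?case by (rule exI[of _ 1]) simp }
  { case 3 show ?case by simp }
next
  case (pos_trig_add K L)
  { case 1 show ?case using pos_trig_add by (intro continuous_intros) }
  { case 2
    obtain C D where "\<And>z. \<bar>K z\<bar> \<le> C" "\<And>z. \<bar>L z\<bar> \<le> D" using pos_trig_add by blast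
    then have "\<bar>K z + L z\<bar> \<le> C + D" for z using abs_triangle_ineq[of "K z" "L z"] by (meson add_mono order.trans)
    then show ?case by blast }
  { case 3 show ?case using pos_trig_add by simp }
next
  case (pos_trig_scale c K)
  { case 1 show ?case using pos_trig_scale by (intro continuous_intros) }
  { case 2
    obtain C where "\<And>z. \<bar>K z\<bar> \<le> C" using pos_trig_scale by blast
    then have "\<bar>c * K z\<bar> \<le> c * C" for z using pos_trig_scale(1) by (simp add: abs_mult mult_left_mono)
    then show ?case by blast }
  { case 3 show ?case using pos_trig_scale by simp }
qed

section \<open>Quadratic forms of the kernels\<close>

definition conv :: "('a::euclidean_space \<Rightarrow> real) \<Rightarrow> ('a \<Rightarrow> real) \<Rightarrow> 'a \<Rightarrow> real" where
  "conv K q x = (LINT y|lebesgue. q y * K (x - y))"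

text \<open>The iterated form of the double integral of p x K (x - y) q y. Symmetry and positivity
  are read off from the cosines rather than from an interchange of integrals.\<close>

definition quad_form :: "('a::euclidean_space \<Rightarrow> real) \<Rightarrow> ('a \<Rightarrow> real) \<Rightarrow> ('a \<Rightarrow> real) \<Rightarrow> real" where
  "quad_form K p q = (LINT x|lebesgue. p x * conv K q x)"

lemma pos_trig_shift_measurable:
  assumes "pos_trig K" shows "(\<lambda>y. K (x - y)) \<in> borel_measurable lebesgue"
  by (intro continuous_imp_lebesgue_measurable continuous_on_compose2[OF pos_trig_props(1)[OF assms]] continuous_intros) auto

lemma conv_integrable:
  assumes "pos_trig K" "integrable lebesgue q"
  shows "integrable lebesgue (\<lambda>y. q y * K (x - y))"
proof -
  obtain C where "\<And>z. \<bar>K z\<bar> \<le> C" using pos_trig_props(2)[OF assms(1)] by blast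
  then show ?thesis by (intro integrable_mult_bounded[OF assms(2) pos_trig_shift_measurable[OF assms(1)]]) auto
qed

lemma conv_cos:
  assumes "integrable lebesgue q"
  shows "conv (\<lambda>z. cos (\<xi> \<bullet> z)) q x = cos (\<xi> \<bullet> x) * (LINT y|lebesgue. q y * cos (\<xi> \<bullet> y)) + sin (\<xi> \<bullet> x) * (LINT y|lebesgue. q y * sin (\<xi> \<bullet> y))"
proof -
  have m: "(\<lambda>y. cos (\<xi> \<bullet> y)) \<in> borel_measurable lebesgue" "(\<lambda>y. sin (\<xi> \<bullet> y)) \<in> borel_measurable lebesgue"
    by (intro continuous_imp_lebesgue_measurable continuous_intros)+
  have i: "integrable lebesgue (\<lambda>y. q y * cos (\<xi> \<bullet> y))" "integrable lebesgue (\<lambda>y. q y * sin (\<xi> \<bullet> y))"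
    by (auto intro!: integrable_mult_bounded[OF assms, of _ 1] m)
  have "conv (\<lambda>z. cos (\<xi> \<bullet> z)) q x = (LINT y|lebesgue. cos (\<xi> \<bullet> x) * (q y * cos (\<xi> \<bullet> y)) + sin (\<xi> \<bullet> x) * (q y * sin (\<xi> \<bullet> y)))"
    unfolding conv_def inner_diff_right cos_diff by (simp add: algebra_simps)
  also have "\<dots> = cos (\<xi> \<bullet> x) * (LINT y|lebesgue. q y * cos (\<xi> \<bullet> y)) + sin (\<xi> \<bullet> x) * (LINT y|lebesgue. q y * sin (\<xi> \<bullet> y))"
    using i by simp
  finally show ?thesis .
qed

lemma conv_add:
  "pos_trig K \<Longrightarrow> pos_trig L \<Longrightarrow> integrable lebesgue q \<Longrightarrow> conv (\<lambda>z. K z + L z) q x = conv K q x + conv L q x"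
  unfolding conv_def by (simp add: distrib_left conv_integrable)

lemma conv_scale: "conv (\<lambda>z. c * K z) q x = c * conv K q x"
  unfolding conv_def by (simp add: mult.left_commute)

lemma conv_measurable_bounded:
  assumes "pos_trig K" and q: "integrable lebesgue q"
  shows "conv K q \<in> borel_measurable lebesgue \<and> (\<exists>C. \<forall>x. \<bar>conv K q x\<bar> \<le> C)"
  using assms(1)
proof (induction rule: pos_trig.induct)
  case (pos_trig_cos \<xi>)
  define C where "C = (LINT y|lebesgue. q y * cos (\<xi> \<bullet> y))"
  define S where "S = (LINT y|lebesgue. q y * sin (\<xi> \<bullet> y))"
  have eq: "conv (\<lambda>z. cos (\<xi> \<bullet> z)) q = (\<lambda>x. cos (\<xi> \<bullet> x) * C + sin (\<xi> \<bullet> x) * S)"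
    using conv_cos[OF q] by (simp add: C_def S_def fun_eq_iff)
  have "\<bar>cos (\<xi> \<bullet> x) * C + sin (\<xi> \<bullet> x) * S\<bar> \<le> \<bar>C\<bar> + \<bar>S\<bar>" for x
  proof -
    have "\<bar>cos (\<xi> \<bullet> x) * C\<bar> \<le> \<bar>C\<bar>" "\<bar>sin (\<xi> \<bullet> x) * S\<bar> \<le> \<bar>S\<bar>"
      by (simp_all add: abs_mult mult_left_le_one_le)
    then show ?thesis by linarith
  qed
  then show ?case unfolding eq by (auto intro!: continuous_imp_lebesgue_measurable continuous_intros)
next
  case (pos_trig_add K L)
  then obtain C D where "\<And>z. \<bar>conv K q z\<bar> \<le> C" "\<And>z. \<bar>conv L q z\<bar> \<le> D" by blast
  then have "\<bar>conv K q z + conv L q z\<bar> \<le> C + D" for z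
    using abs_triangle_ineq[of "conv K q z" "conv L q z"] by (meson add_mono order.trans)
  moreover have "conv (\<lambda>z. K z + L z) q = (\<lambda>x. conv K q x + conv L q x)"
    using conv_add[OF pos_trig_add.hyps q] by (rule ext)
  ultimately show ?case using pos_trig_add by auto
next
  case (pos_trig_scale c K)
  then obtain C where "\<And>z. \<bar>conv K q z\<bar> \<le> C" by blast
  then have "\<bar>c * conv K q z\<bar> \<le> c * C" for z using pos_trig_scale(1) by (simp add: abs_mult mult_left_mono)
  moreover have "conv (\<lambda>z. c * K z) q = (\<lambda>x. c * conv K q x)"
    using conv_scale by (rule ext)
  ultimately show ?case using pos_trig_scale by auto
qed

lemma quad_form_integrable:
  assumes "pos_trig K" "integrable lebesgue p" "integrable lebesgue q"
  shows "integrable lebesgue (\<lambda>x. p x * conv K q x)"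
  using conv_measurable_bounded[OF assms(1,3)] integrable_mult_bounded[OF assms(2)] by blast

text \<open>The addition theorem separates the variables: for p = q the form is the sum of the
  squares of the cosine and the sine moment.\<close>

lemma quad_form_cos:
  assumes p: "integrable lebesgue p" and q: "integrable lebesgue q"
  shows "quad_form (\<lambda>z. cos (\<xi> \<bullet> z)) p q =
    (LINT y|lebesgue. p y * cos (\<xi> \<bullet> y)) * (LINT y|lebesgue. q y * cos (\<xi> \<bullet> y)) +
    (LINT y|lebesgue. p y * sin (\<xi> \<bullet> y)) * (LINT y|lebesgue. q y * sin (\<xi> \<bullet> y))"
proof -
  have m: "(\<lambda>y. cos (\<xi> \<bullet> y)) \<in> borel_measurable lebesgue" "(\<lambda>y. sin (\<xi> \<bullet> y)) \<in> borel_measurable lebesgue"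
    by (intro continuous_imp_lebesgue_measurable continuous_intros)+
  have i: "integrable lebesgue (\<lambda>y. p y * cos (\<xi> \<bullet> y))" "integrable lebesgue (\<lambda>y. p y * sin (\<xi> \<bullet> y))"
    by (auto intro!: integrable_mult_bounded[OF p, of _ 1] m)
  have "quad_form (\<lambda>z. cos (\<xi> \<bullet> z)) p q = (LINT x|lebesgue.
      (p x * cos (\<xi> \<bullet> x)) * (LINT y|lebesgue. q y * cos (\<xi> \<bullet> y)) + (p x * sin (\<xi> \<bullet> x)) * (LINT y|lebesgue. q y * sin (\<xi> \<bullet> y)))"
    unfolding quad_form_def conv_cos[OF q] by (simp add: distrib_left mult.assoc)
  then show ?thesis using i by simp
qed

lemma quad_form_add:
  "pos_trig K \<Longrightarrow> pos_trig L \<Longrightarrow> integrable lebesgue p \<Longrightarrow> integrable lebesgue q \<Longrightarrow>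
    quad_form (\<lambda>z. K z + L z) p q = quad_form K p q + quad_form L p q"
  unfolding quad_form_def by (simp add: conv_add distrib_left quad_form_integrable)

lemma quad_form_scale: "quad_form (\<lambda>z. c * K z) p q = c * quad_form K p q"
  unfolding quad_form_def conv_scale by (simp add: mult.left_commute)

lemma quad_form_sym:
  assumes "pos_trig K" "integrable lebesgue p" "integrable lebesgue q"
  shows "quad_form K p q = quad_form K q p"
  using assms(1)
  by (induction rule: pos_trig.induct) (simp_all add: quad_form_cos quad_form_add quad_form_scale assms(2,3) mult.commute)

lemma quad_form_nonneg:
  assumes "pos_trig K" "integrable lebesgue p"
  shows "quad_form K p p \<ge> 0"
  using assms(1)
  by (induction rule: pos_trig.induct) (simp_all add: quad_form_cos quad_form_add quad_form_scale assms(2))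

lemma quad_form_square_sum:
  assumes "pos_trig K" and p: "integrable lebesgue p" and q: "integrable lebesgue q"
  shows "quad_form K (\<lambda>x. p x + q x) (\<lambda>x. p x + q x) = quad_form K p p + 2 * quad_form K p q + quad_form K q q"
  using assms(1)
proof (induction rule: pos_trig.induct)
  case (pos_trig_cos \<xi>)
  have m: "(\<lambda>y. cos (\<xi> \<bullet> y)) \<in> borel_measurable lebesgue" "(\<lambda>y. sin (\<xi> \<bullet> y)) \<in> borel_measurable lebesgue"
    by (intro continuous_imp_lebesgue_measurable continuous_intros)+
  have i: "integrable lebesgue (\<lambda>y. p y * cos (\<xi> \<bullet> y))" "integrable lebesgue (\<lambda>y. p y * sin (\<xi> \<bullet> y))"
    "integrable lebesgue (\<lambda>y. q y * cos (\<xi> \<bullet> y))" "integrable lebesgue (\<lambda>y. q y * sin (\<xi> \<bullet> y))"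
    by (auto intro!: integrable_mult_bounded[OF p, of _ 1] integrable_mult_bounded[OF q, of _ 1] m)
  show ?case using p q i by (simp add: quad_form_cos distrib_right) (simp add: algebra_simps)
next
  case (pos_trig_add K L)
  then show ?case using p q by (simp add: quad_form_add)
next
  case (pos_trig_scale c K)
  then show ?case by (simp add: quad_form_scale algebra_simps)
qed

text \<open>The hypothesis is exactly the claim for a single cosine, and the claim is preserved by
  sums and nonnegative multiples of kernels.\<close>

lemma quad_form_compare:
  assumes "pos_trig K" and f: "integrable lebesgue f" and g: "\<And>i. i \<in> I \<Longrightarrow> integrable lebesgue (g i)"
    and le: "\<And>\<xi>. C * ((LINT y|lebesgue. f y * cos (\<xi> \<bullet> y))\<^sup>2 + (LINT y|lebesgue. f y * sin (\<xi> \<bullet> y))\<^sup>2) \<le>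
      (\<Sum>i\<in>I. (LINT y|lebesgue. g i y * cos (\<xi> \<bullet> y))\<^sup>2 + (LINT y|lebesgue. g i y * sin (\<xi> \<bullet> y))\<^sup>2)"
  shows "C * quad_form K f f \<le> (\<Sum>i\<in>I. quad_form K (g i) (g i))"
  using assms(1)
proof (induction rule: pos_trig.induct)
  case (pos_trig_cos \<xi>)
  show ?case using le[of \<xi>] by (simp add: quad_form_cos f g power2_eq_square cong: sum.cong)
next
  case (pos_trig_add K L)
  then have "(\<Sum>i\<in>I. quad_form (\<lambda>z. K z + L z) (g i) (g i)) = (\<Sum>i\<in>I. quad_form K (g i) (g i)) + (\<Sum>i\<in>I. quad_form L (g i) (g i))"
    using g by (simp add: quad_form_add sum.distrib cong: sum.cong)
  then show ?case using pos_trig_add f by (simp add: quad_form_add distrib_left)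
next
  case (pos_trig_scale c K)
  then have "c * (C * quad_form K f f) \<le> c * (\<Sum>i\<in>I. quad_form K (g i) (g i))" by (intro mult_left_mono)
  then show ?case by (simp add: quad_form_scale sum_distrib_left mult.left_commute)
qed

text \<open>Kernels in the cone need not be integrable on the whole space, so their mass is counted
  on a ball only. For points of \<Omega> just the differences x - y enter, and D is taken so large
  that these stay in the ball.\<close>

definition ball_mass :: "('a::euclidean_space \<Rightarrow> real) \<Rightarrow> real \<Rightarrow> real" where
  "ball_mass K D = (LINT z|lebesgue. indicat_real (cball 0 D) z * K z)"

definition ball_tail :: "('a::euclidean_space \<Rightarrow> real) \<Rightarrow> real \<Rightarrow> real \<Rightarrow> real" where
  "ball_tail K D r = (LINT z|lebesgue. indicat_real (cball 0 D - ball 0 r) z * K z)"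

lemma indicator_kernel_integrable:
  assumes "pos_trig K" "S \<in> sets borel" "bounded S"
  shows "integrable lebesgue (\<lambda>z. indicat_real S z * K z)"
proof -
  obtain C where "\<And>z. \<bar>K z\<bar> \<le> C" using pos_trig_props(2)[OF assms(1)] by blast
  moreover have "integrable lebesgue (indicat_real S)"
    using assms emeasure_bounded_finite[of S] by (auto intro!: integrable_real_indicator simp: less_top)
  ultimately show ?thesis
    using continuous_imp_lebesgue_measurable[OF pos_trig_props(1)[OF assms(1)]] by (intro integrable_mult_bounded) auto
qed

lemma conv_indicator_le:
  assumes K: "pos_trig K" "\<And>z. K z \<ge> 0" and \<Omega>: "\<Omega> \<in> lmeasurable" "\<Omega> \<subseteq> cball x D"
  shows "conv K (indicat_real \<Omega>) x \<le> ball_mass K D"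
proof -
  have "conv K (indicat_real \<Omega>) x \<le> (LINT y|lebesgue. indicat_real (cball x D) y * K (x - y))"
    unfolding conv_def
  proof (rule integral_mono)
    show "integrable lebesgue (\<lambda>y. indicat_real \<Omega> y * K (x - y))"
      using \<Omega> by (intro conv_integrable K) (auto simp: fmeasurable_def intro!: integrable_real_indicator)
    show "integrable lebesgue (\<lambda>y. indicat_real (cball x D) y * K (x - y))"
      by (intro conv_integrable K integrable_indicator_cball)
    show "indicat_real \<Omega> y * K (x - y) \<le> indicat_real (cball x D) y * K (x - y)" for y
      using \<Omega>(2) K(2) by (auto simp: indicator_def)
  qed
  also have "\<dots> = (LINT z|lebesgue. indicat_real (cball x D) (z + x) * K (x - (z + x)))"
  proof -
    have "(\<lambda>y. indicat_real (cball x D) y * K (x - y)) \<in> borel_measurable lebesgue"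
      by (rule borel_measurable_times[OF borel_measurable_integrable[OF integrable_indicator_cball] pos_trig_shift_measurable[OF K(1)]])
    from integral_lebesgue_translate[OF this, of x] show ?thesis by (rule sym)
  qed
  also have "\<dots> = ball_mass K D"
    unfolding ball_mass_def using pos_trig_props(3)[OF K(1)] by (intro Bochner_Integration.integral_cong) (auto simp: indicator_def dist_norm)
  finally show ?thesis .
qed

text \<open>Schur test: \<open>2 * p x * p y \<le> (p x)\<^sup>2 + (p y)\<^sup>2\<close> under the
  nonnegative kernel, the two resulting terms agree by symmetry, and integration over the second
  variable costs at most the mass of K.\<close>

lemma quad_form_upper:
  assumes K: "pos_trig K" "\<And>z. K z \<ge> 0" and \<Omega>: "\<Omega> \<in> lmeasurable" "\<And>x. x \<in> \<Omega> \<Longrightarrow> \<Omega> \<subseteq> cball x D"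
    and p: "integrable lebesgue p" "integrable lebesgue (\<lambda>x. (p x)\<^sup>2)" "\<And>x. x \<notin> \<Omega> \<Longrightarrow> p x = 0"
  shows "quad_form K p p \<le> ball_mass K D * (LINT x|lebesgue. (p x)\<^sup>2)"
proof -
  define q where "q x = (p x)\<^sup>2" for x
  have qi: "integrable lebesgue q" using p(2) by (simp add: q_def[abs_def])
  have oi: "integrable lebesgue (indicat_real \<Omega>)" using \<Omega> by (auto simp: fmeasurable_def intro!: integrable_real_indicator)
  have pt: "p x * conv K p x \<le> (q x * conv K (indicat_real \<Omega>) x + indicat_real \<Omega> x * conv K q x) / 2" for x
  proof (cases "x \<in> \<Omega>")
    case True
    have "p x * conv K p x = (LINT y|lebesgue. p x * (p y * K (x - y)))" by (simp add: conv_def)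
    also have "\<dots> \<le> (LINT y|lebesgue. (q x * (indicat_real \<Omega> y * K (x - y)) + q y * K (x - y)) / 2)"
    proof (rule integral_mono)
      fix y
      show "p x * (p y * K (x - y)) \<le> (q x * (indicat_real \<Omega> y * K (x - y)) + q y * K (x - y)) / 2"
      proof (cases "y \<in> \<Omega>")
        case True
        have "2 * p x * p y \<le> q x + q y" using zero_le_power2[of "p x - p y"] unfolding q_def power2_diff by linarith
        then have "(2 * p x * p y) * K (x - y) \<le> (q x + q y) * K (x - y)" using K(2) by (intro mult_right_mono) auto
        then show ?thesis using True by (simp add: algebra_simps)
      qed (simp add: p(3) q_def)
    qed (use conv_integrable[OF K(1) p(1)] conv_integrable[OF K(1) oi] conv_integrable[OF K(1) qi] in auto)
    also have "\<dots> = (q x * conv K (indicat_real \<Omega>) x + conv K q x) / 2"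
      using conv_integrable[OF K(1) oi] conv_integrable[OF K(1) qi] by (simp add: conv_def)
    finally show ?thesis using True by simp
  qed (simp add: p(3) q_def)
  have "quad_form K p p \<le> (LINT x|lebesgue. (q x * conv K (indicat_real \<Omega>) x + indicat_real \<Omega> x * conv K q x) / 2)"
    unfolding quad_form_def
    using quad_form_integrable[OF K(1) p(1) p(1)] quad_form_integrable[OF K(1) qi oi] quad_form_integrable[OF K(1) oi qi] pt
    by (intro integral_mono) auto
  also have "\<dots> = (quad_form K q (indicat_real \<Omega>) + quad_form K (indicat_real \<Omega>) q) / 2"
    using quad_form_integrable[OF K(1) qi oi] quad_form_integrable[OF K(1) oi qi] by (simp add: quad_form_def)
  also have "\<dots> = quad_form K q (indicat_real \<Omega>)" using quad_form_sym[OF K(1) oi qi] by simp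
  also have "\<dots> \<le> (LINT x|lebesgue. ball_mass K D * q x)"
    unfolding quad_form_def
  proof (rule integral_mono)
    show "q x * conv K (indicat_real \<Omega>) x \<le> ball_mass K D * q x" for x
    proof (cases "x \<in> \<Omega>")
      case True
      then have "q x * conv K (indicat_real \<Omega>) x \<le> q x * ball_mass K D"
        using conv_indicator_le[OF K \<Omega>(1) \<Omega>(2)[OF True]] by (intro mult_left_mono) (auto simp: q_def)
      then show ?thesis by (simp add: mult.commute)
    qed (simp add: p(3) q_def)
  qed (use quad_form_integrable[OF K(1) qi oi] qi in auto)
  finally show ?thesis by (simp add: q_def)
qed

text \<open>Approximate identity: within distance r of x the oscillation of h is at most \<tau>,
  farther away it is at most 2 and only the tail of K counts.\<close>

lemma conv_approx:
  assumes K: "pos_trig K" "\<And>z. K z \<ge> 0" and \<Omega>: "\<Omega> \<subseteq> cball x D"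
    and h: "continuous_on UNIV h" "\<And>y. \<bar>h y\<bar> \<le> 1" "\<And>y. y \<notin> \<Omega> \<Longrightarrow> h y = 0" "integrable lebesgue h"
    and \<tau>: "\<tau> \<ge> 0" "\<And>y. norm (y - x) < r \<Longrightarrow> \<bar>h y - h x\<bar> \<le> \<tau>"
  shows "\<bar>conv K h x - ball_mass K D * h x\<bar> \<le> \<tau> * ball_mass K D + 2 * ball_tail K D r"
proof -
  define T where "T = cball (0::'a) D - ball 0 r"
  have i1: "integrable lebesgue (\<lambda>z. indicat_real (cball 0 D) z * K z)"
    by (intro indicator_kernel_integrable K) auto
  have i2: "integrable lebesgue (\<lambda>z. indicat_real T z * K z)"
    unfolding T_def by (intro indicator_kernel_integrable K) (auto intro: bounded_subset[OF bounded_cball])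
  have hm: "(\<lambda>z. h (z + x)) \<in> borel_measurable lebesgue"
    by (intro continuous_imp_lebesgue_measurable continuous_on_compose2[OF h(1)] continuous_intros) auto
  have i3: "integrable lebesgue (\<lambda>z. (indicat_real (cball 0 D) z * K z) * h (z + x))"
    using h(2) by (intro integrable_mult_bounded[OF i1 hm])
  have "conv K h x = (LINT z|lebesgue. h (z + x) * K (x - (z + x)))"
    unfolding conv_def using h(4) pos_trig_shift_measurable[OF K(1)]
    by (intro integral_lebesgue_translate[symmetric] borel_measurable_times) auto
  also have "\<dots> = (LINT z|lebesgue. (indicat_real (cball 0 D) z * K z) * h (z + x))"
  proof (rule Bochner_Integration.integral_cong)
    fix z
    have "h (z + x) = 0" if "z \<notin> cball 0 D"
    proof -
      have "z + x \<notin> cball x D" using that by (simp add: dist_norm)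
      then show ?thesis using h(3) \<Omega> by blast
    qed
    then show "h (z + x) * K (x - (z + x)) = (indicat_real (cball 0 D) z * K z) * h (z + x)"
      using pos_trig_props(3)[OF K(1), of z] by (cases "z \<in> cball 0 D") (auto simp: mult.commute)
  qed simp
  finally have "conv K h x - ball_mass K D * h x = (LINT z|lebesgue. (indicat_real (cball 0 D) z * K z) * (h (z + x) - h x))"
    using i1 i3 by (simp add: ball_mass_def right_diff_distrib)
  also have "\<bar>\<dots>\<bar> \<le> (LINT z|lebesgue. \<bar>(indicat_real (cball 0 D) z * K z) * (h (z + x) - h x)\<bar>)"
    by (rule integral_abs_bound)
  also have "\<dots> \<le> (LINT z|lebesgue. \<tau> * (indicat_real (cball 0 D) z * K z) + 2 * (indicat_real T z * K z))"
  proof (rule integral_mono)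
    show "\<bar>(indicat_real (cball 0 D) z * K z) * (h (z + x) - h x)\<bar> \<le> \<tau> * (indicat_real (cball 0 D) z * K z) + 2 * (indicat_real T z * K z)" for z
    proof (cases "z \<in> cball 0 D")
      case True
      show ?thesis
      proof (cases "norm z < r")
        case a: True
        then have "K z * \<bar>h (z + x) - h x\<bar> \<le> K z * \<tau>" using \<tau>(2)[of "z + x"] K(2) by (intro mult_left_mono) auto
        then show ?thesis using True a K(2)[of z] by (simp add: T_def abs_mult mult.commute)
      next
        case False
        have "\<bar>h (z + x) - h x\<bar> \<le> 2" using h(2)[of "z + x"] h(2)[of x] by linarith
        then have "K z * \<bar>h (z + x) - h x\<bar> \<le> K z * 2" using K(2) by (intro mult_left_mono) auto
        moreover have "\<tau> * K z \<ge> 0" using \<tau>(1) K(2) by simp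
        ultimately show ?thesis using True False K(2)[of z] by (simp add: T_def abs_mult mult.commute)
      qed
    qed (simp add: T_def)
    have "integrable lebesgue (\<lambda>z. (indicat_real (cball 0 D) z * K z) * (h (z + x) - h x))"
      using i1 i3 by (simp add: right_diff_distrib)
    then show "integrable lebesgue (\<lambda>z. \<bar>(indicat_real (cball 0 D) z * K z) * (h (z + x) - h x)\<bar>)" by (rule integrable_abs)
  qed (use i1 i2 in auto)
  also have "\<dots> = \<tau> * ball_mass K D + 2 * ball_tail K D r"
    using i1 i2 by (simp add: ball_mass_def ball_tail_def T_def)
  finally show ?thesis .
qed

text \<open>Each factor is (1 + cos (z_j / D)) / 2, in the shape of a combination of 1 and a cosine
  as the cone demands. The frequency 1 / D keeps the arguments in [-1, 1] on the ball of radius D,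
  so that the value 1 is attained there at the origin only.\<close>

definition cos_kernel :: "real \<Rightarrow> real^'d::finite \<Rightarrow> real" where
  "cos_kernel D z = (\<Prod>j\<in>UNIV. (1/2) * 1 + (1/2) * cos (axis j (1 / D) \<bullet> z))"

lemma pos_trig_cos_kernel: "pos_trig (\<lambda>z. cos_kernel D z ^ N)"
  unfolding cos_kernel_def
  by (intro pos_trig_power pos_trig_prod pos_trig.intros(2,3) pos_trig_1 pos_trig.intros(1)) auto

lemma cos_kernel_range: "0 \<le> cos_kernel D z" "cos_kernel D z \<le> 1"
proof -
  have "0 \<le> (1/2) * 1 + (1/2) * cos (axis j (1 / D) \<bullet> z)" "(1/2) * 1 + (1/2) * cos (axis j (1 / D) \<bullet> z) \<le> 1" for j
    using cos_ge_minus_one[of "axis j (1 / D) \<bullet> z"] cos_le_one[of "axis j (1 / D) \<bullet> z"] by linarith+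
  then show "0 \<le> cos_kernel D z" "cos_kernel D z \<le> 1"
    unfolding cos_kernel_def by (auto intro!: prod_nonneg prod_le_1)
qed

lemma cos_kernel_less_1:
  assumes "D > 0" "z \<in> cball 0 D" "z \<noteq> 0"
  shows "cos_kernel D z < 1"
proof -
  obtain j where j: "z $ j \<noteq> 0" using assms(3) by (auto simp: vec_eq_iff)
  define a where "a = \<bar>z $ j / D\<bar>"
  have "\<bar>z $ j\<bar> \<le> D" using component_le_norm_cart[of z j] assms(2) by (simp add: dist_norm)
  then have a: "0 < a" "a \<le> 1" using j assms(1) by (auto simp: a_def)
  have "cos a < cos 0" using a pi_gt3 by (intro cos_monotone_0_pi) auto
  then have "cos (z $ j / D) < 1" unfolding a_def cos_abs_real by simp
  then have lt: "(1/2) * 1 + (1/2) * cos (axis j (1 / D) \<bullet> z) < 1" by (simp add: inner_axis')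
  have r: "0 \<le> (1/2) * 1 + (1/2) * cos (axis l (1 / D) \<bullet> z)" "(1/2) * 1 + (1/2) * cos (axis l (1 / D) \<bullet> z) \<le> 1" for l
    using cos_ge_minus_one[of "axis l (1 / D) \<bullet> z"] cos_le_one[of "axis l (1 / D) \<bullet> z"] by linarith+
  have "cos_kernel D z = ((1/2) * 1 + (1/2) * cos (axis j (1 / D) \<bullet> z)) * (\<Prod>l\<in>UNIV - {j}. (1/2) * 1 + (1/2) * cos (axis l (1 / D) \<bullet> z))"
    unfolding cos_kernel_def by (rule prod.remove) auto
  also have "\<dots> \<le> ((1/2) * 1 + (1/2) * cos (axis j (1 / D) \<bullet> z)) * 1"
    using r by (intro mult_left_mono prod_le_1) auto
  finally show ?thesis using lt by simp
qed

text \<open>Off the ball of radius r the kernel is at most some q < 1, while near the origin it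
  exceeds the midpoint q' of q and 1. For the N-th powers the ratio of tail to mass decays like (q /
  q')^N.\<close>

lemma cos_kernel_peak:
  assumes D: "D > 0" and r: "r > 0" and \<theta>: "\<theta> > 0"
  obtains N where "ball_mass (\<lambda>z::real^'d::finite. cos_kernel D z ^ N) D > 0"
    "ball_tail (\<lambda>z::real^'d. cos_kernel D z ^ N) D r \<le> \<theta> * ball_mass (\<lambda>z::real^'d. cos_kernel D z ^ N) D"
proof -
  define T where "T = cball (0::real^'d) D - ball 0 r"
  have c: "continuous_on UNIV (cos_kernel D :: real^'d \<Rightarrow> real)"
    using pos_trig_props(1)[OF pos_trig_cos_kernel[of D 1]] by simp
  have cT: "compact T" unfolding T_def by (intro compact_diff) auto
  have "\<exists>q. 0 \<le> q \<and> q < 1 \<and> (\<forall>z\<in>T. cos_kernel D z \<le> q)"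
  proof (cases "T = {}")
    case False
    obtain z0 where z0: "z0 \<in> T" "\<And>z. z \<in> T \<Longrightarrow> cos_kernel D z \<le> cos_kernel D z0"
      using continuous_attains_sup[OF cT False continuous_on_subset[OF c]] by blast
    have "z0 \<noteq> 0" "z0 \<in> cball 0 D" using z0(1) r by (auto simp: T_def)
    then show ?thesis using cos_kernel_less_1[OF D] cos_kernel_range(1) z0(2) by blast
  qed (auto intro: exI[of _ 0])
  then obtain q where q: "0 \<le> q" "q < 1" "\<And>z. z \<in> T \<Longrightarrow> cos_kernel D z \<le> q" by blast
  define q' where "q' = (1 + q) / 2"
  have q': "q < q'" "q' < 1" "q' > 0" using q by (auto simp: q'_def)
  have "cos_kernel D (0::real^'d) = 1" by (simp add: cos_kernel_def)
  then have "0 \<in> {z::real^'d. q' < cos_kernel D z}" using q' by simp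
  moreover have "open {z::real^'d. q' < cos_kernel D z}" by (intro open_Collect_less c continuous_intros)
  ultimately obtain s where s: "s > 0" "ball 0 s \<subseteq> {z::real^'d. q' < cos_kernel D z}" using open_contains_ball by blast
  define s' where "s' = min s D"
  have s': "s' > 0" using s D by (simp add: s'_def)
  define a where "a = measure lebesgue (ball (0::real^'d) s')"
  define b where "b = measure lebesgue (cball (0::real^'d) D)"
  have a: "a > 0" unfolding a_def using content_ball_pos[OF s', of "0::real^'d"] by simp
  have b: "b \<ge> 0" by (simp add: b_def)
  have iB: "integrable lebesgue (indicat_real (ball (0::real^'d) s'))"
    using lmeasurable_ball[of "0::real^'d" s'] by (auto simp: fmeasurable_def intro!: integrable_real_indicator)
  have low: "q' ^ N * a \<le> ball_mass (\<lambda>z::real^'d. cos_kernel D z ^ N) D" for N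
  proof -
    have "q' ^ N * a = (LINT z|lebesgue. q' ^ N * indicat_real (ball (0::real^'d) s') z)" by (simp add: a_def)
    also have "\<dots> \<le> (LINT z|lebesgue. indicat_real (cball (0::real^'d) D) z * cos_kernel D z ^ N)"
    proof (rule integral_mono)
      show "integrable lebesgue (\<lambda>z. indicat_real (cball (0::real^'d) D) z * cos_kernel D z ^ N)"
        by (intro indicator_kernel_integrable pos_trig_cos_kernel) auto
      fix z :: "real^'d"
      show "q' ^ N * indicat_real (ball 0 s') z \<le> indicat_real (cball 0 D) z * cos_kernel D z ^ N"
      proof (cases "z \<in> ball 0 s'")
        case True
        then have "z \<in> cball 0 D" "z \<in> ball 0 s" by (auto simp: s'_def)
        then have "q' \<le> cos_kernel D z" "z \<in> cball 0 D" using s(2) by (auto intro: less_imp_le)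
        then show ?thesis using True q' by (simp add: power_mono)
      qed (simp add: cos_kernel_range indicator_def)
    qed (use iB in auto)
    finally show ?thesis by (simp add: ball_mass_def)
  qed
  have up: "ball_tail (\<lambda>z::real^'d. cos_kernel D z ^ N) D r \<le> q ^ N * b" for N
  proof -
    have "(LINT z|lebesgue. indicat_real T z * cos_kernel D z ^ N) \<le> (LINT z|lebesgue. q ^ N * indicat_real (cball (0::real^'d) D) z)"
    proof (rule integral_mono)
      show "integrable lebesgue (\<lambda>z. indicat_real T z * cos_kernel D z ^ N)"
        using cT by (intro indicator_kernel_integrable pos_trig_cos_kernel) (auto simp: compact_imp_bounded borel_compact)
      fix z :: "real^'d"
      show "indicat_real T z * cos_kernel D z ^ N \<le> q ^ N * indicat_real (cball 0 D) z"
        using q cos_kernel_range(1)[of D z] by (auto simp: T_def indicator_def intro!: power_mono)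
    qed (auto intro!: integrable_mult_right integrable_indicator_cball)
    then show ?thesis by (simp add: ball_tail_def T_def b_def)
  qed
  have "(\<lambda>N. (q / q') ^ N * b) \<longlonglongrightarrow> 0 * b"
    using q q' by (intro tendsto_mult LIMSEQ_power_zero tendsto_const) auto
  then have "eventually (\<lambda>N. (q / q') ^ N * b < \<theta> * a) sequentially"
    using a \<theta> by (intro order_tendstoD(2)) auto
  then obtain N where "(q / q') ^ N * b < \<theta> * a" by (metis eventually_sequentially order_refl)
  then have "q ^ N * b \<le> \<theta> * (q' ^ N * a)"
    using q' by (simp add: power_divide field_simps)
  also have "\<dots> \<le> \<theta> * ball_mass (\<lambda>z::real^'d. cos_kernel D z ^ N) D" using low[of N] \<theta> by (intro mult_left_mono) auto
  finally have "ball_tail (\<lambda>z::real^'d. cos_kernel D z ^ N) D r \<le> \<theta> * ball_mass (\<lambda>z::real^'d. cos_kernel D z ^ N) D"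
    using up[of N] by linarith
  moreover have "ball_mass (\<lambda>z::real^'d. cos_kernel D z ^ N) D > 0"
    using low[of N] a q' zero_less_power[of q' N] by (smt (verit) mult_pos_pos)
  ultimately show ?thesis using that by blast
qed

section \<open>The incompatible case\<close>

text \<open>The same inner approximation as in \<open>two_valued_test_function\<close>, but with the
  two bumps weighted so that h imitates f itself and not its sign. Closeness in the mean suffices
  because both functions are bounded by 1.\<close>

lemma two_phase_L1_approx:
  fixes f :: "real^'d::finite \<Rightarrow> real"
  assumes t: "t \<in> {0<..<1}" and fm: "f \<in> borel_measurable lebesgue" and \<Omega>: "open \<Omega>" "bounded \<Omega>"
    and f: "\<And>x. x \<in> \<Omega> \<Longrightarrow> f x \<in> {t, t - 1}" "\<And>x. x \<notin> \<Omega> \<Longrightarrow> f x = 0" and \<tau>: "\<tau> > 0"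
  obtains h where "\<And>r. C_diff r h" "\<And>x. \<bar>h x\<bar> \<le> 1" "\<And>x. x \<notin> \<Omega> \<Longrightarrow> h x = 0"
    "(LINT x|lebesgue. \<bar>f x - h x\<bar>) \<le> \<tau>"
proof -
  define \<tau>' where "\<tau>' = \<tau> / 4"
  have \<tau>': "\<tau>' > 0" using \<tau> by (simp add: \<tau>'_def)
  note [measurable] = fm
  have \<Omega>m[measurable]: "\<Omega> \<in> sets lebesgue" using \<Omega> by simp
  define Ep where "Ep = {x \<in> space lebesgue. f x = t} \<inter> \<Omega>"
  define En where "En = {x \<in> space lebesgue. f x \<noteq> t} \<inter> \<Omega>"
  have Em: "Ep \<in> sets lebesgue" "En \<in> sets lebesgue" unfolding Ep_def En_def by measurable
  have Eb: "bounded Ep" "bounded En" using bounded_subset[OF \<Omega>(2)] by (auto simp: Ep_def En_def)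
  obtain Kp where Kp: "compact Kp" "Kp \<subseteq> Ep" "measure lebesgue (Ep - Kp) < \<tau>'" "Ep - Kp \<in> lmeasurable"
    using lebesgue_inner_compact[OF Em(1) Eb(1) \<tau>'] by blast
  obtain Kn where Kn: "compact Kn" "Kn \<subseteq> En" "measure lebesgue (En - Kn) < \<tau>'" "En - Kn \<in> lmeasurable"
    using lebesgue_inner_compact[OF Em(2) Eb(2) \<tau>'] by blast
  have disj: "Kp \<inter> Kn = {}" using Kp Kn by (auto simp: Ep_def En_def)
  have sub: "Kp \<subseteq> \<Omega>" "Kn \<subseteq> \<Omega>" using Kp Kn by (auto simp: Ep_def En_def)
  have o: "open (\<Omega> - Kn)" "open (\<Omega> - Kp)" using Kp Kn \<Omega> by (auto simp: compact_imp_closed intro!: open_Diff)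
  have s1: "Kp \<subseteq> \<Omega> - Kn" "Kn \<subseteq> \<Omega> - Kp" using sub disj by auto
  obtain hp Vp Lp where hp: "\<And>r. C_diff r hp" "\<And>x. 0 \<le> hp x" "\<And>x. hp x \<le> 1" "Kp \<subseteq> Vp" "\<And>x. x \<in> Vp \<Longrightarrow> hp x = 1"
    "Lp \<subseteq> \<Omega> - Kn" "\<And>x. x \<notin> Lp \<Longrightarrow> hp x = 0" using smooth_urysohn[OF Kp(1) o(1) s1(1)] by metis
  obtain hn Vn Ln where hn: "\<And>r. C_diff r hn" "\<And>x. 0 \<le> hn x" "\<And>x. hn x \<le> 1" "Kn \<subseteq> Vn" "\<And>x. x \<in> Vn \<Longrightarrow> hn x = 1"
    "Ln \<subseteq> \<Omega> - Kp" "\<And>x. x \<notin> Ln \<Longrightarrow> hn x = 0" using smooth_urysohn[OF Kn(1) o(2) s1(2)] by metis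
  define h where "h x = t * hp x - (1 - t) * hn x" for x
  have Ch: "C_diff r h" for r unfolding h_def using hp(1) hn(1) by (intro C_diff_diff C_diff_cmult)
  have hb: "\<bar>h x\<bar> \<le> 1" for x
  proof -
    have "0 \<le> t * hp x" "t * hp x \<le> 1" "0 \<le> (1 - t) * hn x" "(1 - t) * hn x \<le> 1"
      using hp(2,3)[of x] hn(2,3)[of x] t by (auto intro: mult_le_one)
    then show ?thesis by (auto simp: h_def)
  qed
  have h0: "h x = 0" if "x \<notin> \<Omega>" for x
  proof -
    have "x \<notin> Lp" "x \<notin> Ln" using that hp(6) hn(6) by auto
    then show ?thesis using hp(7) hn(7) by (simp add: h_def)
  qed
  define N where "N = (Ep - Kp) \<union> (En - Kn)"
  have Nm: "N \<in> lmeasurable" unfolding N_def using Kp Kn by auto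
  have N\<mu>: "measure lebesgue N \<le> 2 * \<tau>'"
  proof -
    have "measure lebesgue N \<le> measure lebesgue (Ep - Kp) + measure lebesgue (En - Kn)"
      unfolding N_def using Kp(4) Kn(4) by (intro measure_Un_le) auto
    then show ?thesis using Kp(3) Kn(3) by linarith
  qed
  have fb: "\<bar>f x\<bar> \<le> 1" for x using f(1)[of x] f(2)[of x] t by (cases "x \<in> \<Omega>") auto
  have pt: "\<bar>f x - h x\<bar> \<le> 2 * indicat_real N x" for x
  proof (cases "x \<in> \<Omega>")
    case True
    consider "x \<in> Kp" | "x \<in> Kn" | "x \<in> N" using True by (auto simp: N_def Ep_def En_def)
    then show ?thesis
    proof cases
      case 1
      then have "f x = t" "x \<in> Vp" "x \<notin> Ln" using Kp(2) hp(4) hn(6) by (auto simp: Ep_def)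
      then show ?thesis using hp(5) hn(7) by (simp add: h_def)
    next
      case 2
      then have "f x = t - 1" "x \<in> Vn" "x \<notin> Lp" using Kn(2) hn(4) hp(6) f(1)[OF True] by (auto simp: En_def)
      then show ?thesis using hn(5) hp(7) by (simp add: h_def)
    next
      case 3
      then show ?thesis using fb[of x] hb[of x] by simp
    qed
  qed (simp add: f(2) h0)
  have Ni: "integrable lebesgue (indicat_real N)" using Nm by (auto simp: fmeasurable_def intro!: integrable_real_indicator)
  have hm[measurable]: "h \<in> borel_measurable lebesgue" using continuous_imp_lebesgue_measurable[OF C_diff_continuous[OF Ch]] .
  have "integrable lebesgue (\<lambda>x. \<bar>f x - h x\<bar>)"
    by (rule Bochner_Integration.integrable_bound[of _ "\<lambda>x. 2 * indicat_real N x"])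
       (use Ni pt in \<open>auto simp: fm intro!: borel_measurable_abs borel_measurable_diff hm\<close>)
  then have "(LINT x|lebesgue. \<bar>f x - h x\<bar>) \<le> (LINT x|lebesgue. 2 * indicat_real N x)"
    using Ni pt by (intro integral_mono) auto
  then have "(LINT x|lebesgue. \<bar>f x - h x\<bar>) \<le> \<tau>" using N\<mu> by (simp add: \<tau>'_def)
  then show ?thesis using that Ch hb h0 by blast
qed

text \<open>Plancherel's inequality without Fourier transforms: the cosine moments are compared through
  the positive definite kernels \<open>cos_kernel D ^ N\<close>, which concentrate at the origin as \<open>N\<close> grows.\<close>

lemma cosine_moments_L2_bound:
  fixes f :: "real^'d::finite \<Rightarrow> real" and g :: "'i \<Rightarrow> real^'d \<Rightarrow> real"
  assumes t: "t \<in> {0<..<1}" and fm: "f \<in> borel_measurable lebesgue" and \<Omega>: "open \<Omega>" "bounded \<Omega>"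
    and f: "\<And>x. x \<in> \<Omega> \<Longrightarrow> f x \<in> {t, t - 1}" "\<And>x. x \<notin> \<Omega> \<Longrightarrow> f x = 0" and fi: "integrable lebesgue f"
    and g: "\<And>i. i \<in> I \<Longrightarrow> integrable lebesgue (g i)" "\<And>i. i \<in> I \<Longrightarrow> integrable lebesgue (\<lambda>x. (g i x)\<^sup>2)"
      "\<And>i x. i \<in> I \<Longrightarrow> x \<notin> \<Omega> \<Longrightarrow> g i x = 0"
    and C: "C \<ge> 0" and le: "\<And>\<xi>. C * ((LINT y|lebesgue. f y * cos (\<xi> \<bullet> y))\<^sup>2 + (LINT y|lebesgue. f y * sin (\<xi> \<bullet> y))\<^sup>2) \<le>
      (\<Sum>i\<in>I. (LINT y|lebesgue. g i y * cos (\<xi> \<bullet> y))\<^sup>2 + (LINT y|lebesgue. g i y * sin (\<xi> \<bullet> y))\<^sup>2)"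
  shows "C * (LINT x|lebesgue. (f x)\<^sup>2) \<le> (\<Sum>i\<in>I. LINT x|lebesgue. (g i x)\<^sup>2)"
proof -
  obtain R where R: "R > 0" "\<And>x. x \<in> \<Omega> \<Longrightarrow> norm x \<le> R" using \<Omega>(2) unfolding bounded_pos by blast
  \<comment> \<open>All differences of two points of \<Omega> lie in the ball of this
    radius.\<close>
  define D where "D = 2 * R"
  have D: "D > 0" using R by (simp add: D_def)
  have sub: "\<Omega> \<subseteq> cball x D" if "x \<in> \<Omega>" for x
  proof
    fix y assume "y \<in> \<Omega>"
    then show "y \<in> cball x D" using R(2)[of y] R(2)[OF that] norm_triangle_ineq4[of x y] by (simp add: dist_norm D_def)
  qed
  have \<Omega>m: "\<Omega> \<in> lmeasurable" using \<Omega> by (simp add: lmeasurable_open)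
  have oi: "integrable lebesgue (indicat_real \<Omega>)" using \<Omega>m by (auto simp: fmeasurable_def intro!: integrable_real_indicator)
  define \<mu> where "\<mu> = measure lebesgue \<Omega>"
  have \<mu>: "\<mu> \<ge> 0" by (simp add: \<mu>_def)
  define G where "G = (\<Sum>i\<in>I. LINT x|lebesgue. (g i x)\<^sup>2)"
  define f2 where "f2 = (LINT x|lebesgue. (f x)\<^sup>2)"
  have fb: "\<bar>f x\<bar> \<le> 1" for x using f(1)[of x] f(2)[of x] t by (cases "x \<in> \<Omega>") auto
  \<comment> \<open>Of the error, 3 \<mu> \<kappa> stems from the approximate identity on \<Omega>
    (oscillation \<kappa>, tail 2 \<kappa>), 2 \<kappa> from the mixed terms between h and f - h,
    and 2 \<kappa> from replacing the square of f by that of h.\<close>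
  have main: "C * (f2 - (3 * \<mu> + 4) * \<kappa>) \<le> G" if \<kappa>: "\<kappa> > 0" for \<kappa>
  proof -
    obtain h where h: "\<And>r. C_diff r h" "\<And>x. \<bar>h x\<bar> \<le> 1" "\<And>x. x \<notin> \<Omega> \<Longrightarrow> h x = 0"
      and h1: "(LINT x|lebesgue. \<bar>f x - h x\<bar>) \<le> \<kappa>"
      using two_phase_L1_approx[OF t fm \<Omega> f \<kappa>] by metis
    have hc: "continuous_on UNIV h" using h(1) C_diff_continuous by blast
    have hm: "h \<in> borel_measurable lebesgue" by (rule continuous_imp_lebesgue_measurable[OF hc])
    have hR: "h x = 0" if "x \<notin> cball 0 R" for x using h(3)[of x] R(2)[of x] that by auto
    have hi: "integrable lebesgue h"
      by (rule integrable_bounded_on_ball[OF hm, of 1 R]) (use h(2) hR in auto)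
    obtain L where L: "L > 0" "\<And>x y. \<bar>h x - h y\<bar> \<le> L * norm (x - y)" using C_diff_lipschitz[OF h(1) hR] by metis
    define r where "r = \<kappa> / L"
    have r: "r > 0" using \<kappa> L by (simp add: r_def)
    have hr: "\<bar>h y - h x\<bar> \<le> \<kappa>" if "norm (y - x) < r" for x y
    proof -
      have "L * norm (y - x) \<le> L * r" using that L(1) by (intro mult_left_mono) auto
      then show ?thesis using L(2)[of y x] L(1) by (simp add: r_def)
    qed
    obtain N where N: "ball_mass (\<lambda>z::real^'d. cos_kernel D z ^ N) D > 0"
      "ball_tail (\<lambda>z::real^'d. cos_kernel D z ^ N) D r \<le> \<kappa> * ball_mass (\<lambda>z::real^'d. cos_kernel D z ^ N) D"
      using cos_kernel_peak[OF D r \<kappa>] by metis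
    define K :: "real^'d \<Rightarrow> real" where "K z = cos_kernel D z ^ N" for z
    have K: "pos_trig K" "\<And>z. K z \<ge> 0" unfolding K_def using pos_trig_cos_kernel by (auto simp: cos_kernel_range)
    define m where "m = ball_mass K D"
    have m: "m > 0" "ball_tail K D r \<le> \<kappa> * m" using N unfolding m_def K_def by auto
    define e where "e x = f x - h x" for x
    have ei: "integrable lebesgue e" unfolding e_def using fi hi by auto
    have e0: "e x = 0" if "x \<notin> \<Omega>" for x using that f(2) h(3) by (simp add: e_def)
    have ca: "\<bar>conv K h x - m * h x\<bar> \<le> 3 * \<kappa> * m" if x: "x \<in> \<Omega>" for x
    proof -
      have "\<bar>conv K h x - ball_mass K D * h x\<bar> \<le> \<kappa> * ball_mass K D + 2 * ball_tail K D r"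
        by (rule conv_approx[OF K sub[OF x] hc h(2,3) hi _ hr]) (use \<kappa> in auto)
      then show ?thesis using m(2) unfolding m_def[symmetric] by linarith
    qed
    have cb: "\<bar>conv K h x\<bar> \<le> m" if x: "x \<in> \<Omega>" for x
    proof -
      have "\<bar>conv K h x\<bar> \<le> (LINT y|lebesgue. \<bar>h y * K (x - y)\<bar>)" unfolding conv_def by (rule integral_abs_bound)
      also have "\<dots> \<le> conv K (indicat_real \<Omega>) x" unfolding conv_def
      proof (rule integral_mono)
        show "integrable lebesgue (\<lambda>y. \<bar>h y * K (x - y)\<bar>)" using conv_integrable[OF K(1) hi] by (rule integrable_abs)
        show "integrable lebesgue (\<lambda>y. indicat_real \<Omega> y * K (x - y))" by (rule conv_integrable[OF K(1) oi])
        show "\<bar>h y * K (x - y)\<bar> \<le> indicat_real \<Omega> y * K (x - y)" for y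
          using h(2)[of y] h(3)[of y] K(2)[of "x - y"] by (cases "y \<in> \<Omega>") (auto simp: abs_mult mult_left_le_one_le)
      qed
      also have "\<dots> \<le> m" unfolding m_def by (rule conv_indicator_le[OF K \<Omega>m sub[OF x]])
      finally show ?thesis .
    qed
    have i1: "integrable lebesgue (\<lambda>x. (h x)\<^sup>2)" unfolding power2_eq_square by (rule integrable_mult_bounded[OF hi hm h(2)])
    have i2: "integrable lebesgue (\<lambda>x. (f x)\<^sup>2)" unfolding power2_eq_square by (rule integrable_mult_bounded[OF fi fm fb])
    have hh: "quad_form K h h \<ge> m * (LINT x|lebesgue. (h x)\<^sup>2) - 3 * \<kappa> * m * \<mu>"
    proof -
      have "m * (LINT x|lebesgue. (h x)\<^sup>2) - 3 * \<kappa> * m * \<mu> = (LINT x|lebesgue. m * (h x)\<^sup>2 - 3 * \<kappa> * m * indicat_real \<Omega> x)"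
        using i1 oi by (simp add: \<mu>_def)
      also have "\<dots> \<le> quad_form K h h" unfolding quad_form_def
      proof (rule integral_mono)
        show "m * (h x)\<^sup>2 - 3 * \<kappa> * m * indicat_real \<Omega> x \<le> h x * conv K h x" for x
        proof (cases "x \<in> \<Omega>")
          case True
          have "\<bar>h x * (conv K h x - m * h x)\<bar> \<le> 1 * (3 * \<kappa> * m)"
            unfolding abs_mult using ca[OF True] h(2)[of x] by (intro mult_mono) auto
          then show ?thesis using True by (simp add: power2_eq_square algebra_simps)
        qed (simp add: h(3))
      qed (use i1 oi quad_form_integrable[OF K(1) hi hi] in auto)
      finally show ?thesis .
    qed
    have he: "\<bar>quad_form K h e\<bar> \<le> m * \<kappa>"
    proof -
      have "\<bar>quad_form K h e\<bar> = \<bar>quad_form K e h\<bar>" using quad_form_sym[OF K(1) hi ei] by simp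
      also have "\<dots> \<le> (LINT x|lebesgue. \<bar>e x * conv K h x\<bar>)" unfolding quad_form_def by (rule integral_abs_bound)
      also have "\<dots> \<le> (LINT x|lebesgue. m * \<bar>e x\<bar>)"
      proof (rule integral_mono)
        show "\<bar>e x * conv K h x\<bar> \<le> m * \<bar>e x\<bar>" for x
        proof (cases "x \<in> \<Omega>")
          case True
          then show ?thesis using mult_left_mono[OF cb[OF True], of "\<bar>e x\<bar>"] by (simp add: abs_mult mult.commute)
        qed (simp add: e0)
      qed (use ei quad_form_integrable[OF K(1) ei hi] in auto)
      also have "\<dots> \<le> m * \<kappa>" using h1 m by (simp add: e_def)
      finally show ?thesis .
    qed
    have h2: "(LINT x|lebesgue. (h x)\<^sup>2) \<ge> f2 - 2 * \<kappa>"
    proof -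
      have "f2 - (LINT x|lebesgue. (h x)\<^sup>2) = (LINT x|lebesgue. (f x)\<^sup>2 - (h x)\<^sup>2)" using i1 i2 by (simp add: f2_def)
      also have "\<dots> \<le> (LINT x|lebesgue. 2 * \<bar>f x - h x\<bar>)"
      proof (rule integral_mono)
        show "(f x)\<^sup>2 - (h x)\<^sup>2 \<le> 2 * \<bar>f x - h x\<bar>" for x
        proof -
          have "\<bar>f x + h x\<bar> * \<bar>f x - h x\<bar> \<le> 2 * \<bar>f x - h x\<bar>" using fb[of x] h(2)[of x] by (intro mult_right_mono) linarith+
          moreover have "(f x)\<^sup>2 - (h x)\<^sup>2 \<le> \<bar>f x + h x\<bar> * \<bar>f x - h x\<bar>"
            unfolding abs_mult[symmetric] by (rule order.trans[OF _ abs_ge_self]) (simp add: power2_eq_square algebra_simps)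
          ultimately show ?thesis by linarith
        qed
      qed (use i1 i2 fi hi in auto)
      also have "\<dots> \<le> 2 * \<kappa>" using h1 by simp
      finally show ?thesis by linarith
    qed
    \<comment> \<open>The approximate identity applies only to the smooth h. The form of the rough
      remainder e is simply dropped, being nonnegative, and the mixed term is small because e is
      small in the mean.\<close>
    have "quad_form K f f = quad_form K (\<lambda>x. h x + e x) (\<lambda>x. h x + e x)" by (simp add: e_def)
    also have "\<dots> = quad_form K h h + 2 * quad_form K h e + quad_form K e e" by (rule quad_form_square_sum[OF K(1) hi ei])
    also have "\<dots> \<ge> quad_form K h h - 2 * (m * \<kappa>)" using he quad_form_nonneg[OF K(1) ei] by linarith
    finally have "quad_form K f f \<ge> m * (LINT x|lebesgue. (h x)\<^sup>2) - 3 * \<kappa> * m * \<mu> - 2 * (m * \<kappa>)" using hh by linarith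
    moreover have "m * (LINT x|lebesgue. (h x)\<^sup>2) \<ge> m * (f2 - 2 * \<kappa>)" using h2 m(1) by (intro mult_left_mono) auto
    moreover have "m * (f2 - 2 * \<kappa>) - 3 * \<kappa> * m * \<mu> - 2 * (m * \<kappa>) = m * (f2 - (3 * \<mu> + 4) * \<kappa>)" by (simp add: algebra_simps)
    ultimately have "C * (m * (f2 - (3 * \<mu> + 4) * \<kappa>)) \<le> C * quad_form K f f" using C by (intro mult_left_mono) linarith+
    also have "\<dots> \<le> (\<Sum>i\<in>I. quad_form K (g i) (g i))" by (rule quad_form_compare[OF K(1) fi g(1) le])
    also have "\<dots> \<le> (\<Sum>i\<in>I. m * (LINT x|lebesgue. (g i x)\<^sup>2))"
      unfolding m_def using g by (intro sum_mono quad_form_upper[OF K \<Omega>m sub]) auto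
    also have "\<dots> = m * G" by (simp add: G_def sum_distrib_left)
    finally have "m * (C * (f2 - (3 * \<mu> + 4) * \<kappa>)) \<le> m * G" by (simp add: mult.left_commute)
    then show ?thesis using m(1) by simp
  qed
  have "C * f2 \<le> G + s" if s: "s > 0" for s
  proof -
    define P where "P = (C + 1) * (3 * \<mu> + 4)"
    define \<kappa> where "\<kappa> = s / P"
    have p: "P > 0" unfolding P_def using C \<mu> by (intro mult_pos_pos) auto
    have \<kappa>: "\<kappa> > 0" using s p by (simp add: \<kappa>_def)
    have "P * \<kappa> = s" using p by (simp add: \<kappa>_def)
    then have "(C + 1) * ((3 * \<mu> + 4) * \<kappa>) = s" by (simp add: P_def mult.assoc)
    moreover have "0 \<le> (3 * \<mu> + 4) * \<kappa>" using \<mu> \<kappa> by simp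
    ultimately have "C * ((3 * \<mu> + 4) * \<kappa>) \<le> s" by (simp add: distrib_right)
    then show ?thesis using main[OF \<kappa>] by (simp add: right_diff_distrib)
  qed
  then show ?thesis unfolding G_def[symmetric] f2_def[symmetric] by (rule field_le_epsilon)
qed

text \<open>The constant is the square of the symbol bound, fixed before \<Omega> and t. The
  comparison of moments bounds the squared norm of f, and
  \<open>\<bar>f x\<bar> \<ge> min t (1 - t)\<close> throughout \<Omega>.\<close>

lemma min_elastic_energy_incompatible:
  fixes Aop :: "('d::finite \<Rightarrow> nat) \<Rightarrow> real^'n::finite^'m::finite"
  assumes k: "k \<ge> 1" and v: "B - A \<notin> wave_cone Aop k"
  shows "\<exists>C>0. \<forall>\<Omega> t. bounded \<Omega> \<and> lipschitz_domain \<Omega> \<and> t \<in> {0<..<1} \<longrightarrow>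
     min_elastic_energy Aop k \<Omega> A B (t *\<^sub>R A + (1 - t) *\<^sub>R B) \<ge> ennreal (C * (min t (1 - t))\<^sup>2) * emeasure lebesgue \<Omega>"
proof -
  have AB: "A \<noteq> B"
  proof
    assume "A = B"
    then have "B - A \<in> wave_cone Aop k"
      by (auto simp: wave_cone_def mat_kernel_def intro!: exI[of _ "axis undefined 1"])
    then show False using v by simp
  qed
  obtain c where c: "c > 0" "\<And>\<xi> s z. \<xi> \<noteq> 0 \<Longrightarrow> op_symbol Aop k \<xi> *v (s *\<^sub>R (B - A) + z) = 0 \<Longrightarrow> c * \<bar>s\<bar> \<le> norm z"
    using op_symbol_kernel_bound[OF v] by metis
  have "ennreal (c\<^sup>2 * (min t (1 - t))\<^sup>2) * emeasure lebesgue \<Omega> \<le> min_elastic_energy Aop k \<Omega> A B (t *\<^sub>R A + (1 - t) *\<^sub>R B)"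
    if \<Omega>: "bounded \<Omega>" "lipschitz_domain \<Omega>" and t: "t \<in> {0<..<1}" for \<Omega> :: "(real^'d) set" and t
    unfolding min_elastic_energy_def
  proof (intro INF_greatest)
    define F where "F = t *\<^sub>R A + (1 - t) *\<^sub>R B"
    fix \<chi>' u assume \<chi>': "\<chi>' \<in> L2_fields \<Omega> {A, B}" and u: "u \<in> admissible Aop k \<Omega> (t *\<^sub>R A + (1 - t) *\<^sub>R B)"
    have \<chi>m: "set_borel_measurable lebesgue \<Omega> \<chi>'" and \<chi>AE: "AE x in lebesgue. x \<in> \<Omega> \<longrightarrow> \<chi>' x \<in> {A, B}"
      using \<chi>' by (auto simp: L2_fields_def)
    obtain f g where fg: "f \<in> borel_measurable lebesgue" "\<And>x. x \<in> \<Omega> \<Longrightarrow> f x \<in> {t, t - 1}" "\<And>x. x \<notin> \<Omega> \<Longrightarrow> f x = 0"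
      "AE x in lebesgue. x \<in> \<Omega> \<longrightarrow> \<chi>' x = F + f x *\<^sub>R (B - A)"
      "g \<in> borel_measurable lebesgue" "\<And>x. x \<notin> \<Omega> \<Longrightarrow> g x = 0"
      "AE x in lebesgue. u x = F + f x *\<^sub>R (B - A) + g x"
      "integrable lebesgue (\<lambda>x. (norm (g x))\<^sup>2)" "integrable lebesgue g" "integrable lebesgue f"
      "elastic_energy \<Omega> u \<chi>' = ennreal (LINT x|lebesgue. (norm (g x))\<^sup>2)"
      by (rule two_phase_setup[OF \<Omega> t AB F_def \<chi>m \<chi>AE u[folded F_def]], rule that) blast+
    have o: "open \<Omega>" using \<Omega> by (simp add: lipschitz_domain_def)
    have \<Omega>m: "\<Omega> \<in> lmeasurable" using o \<Omega>(1) by (simp add: lmeasurable_open)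
    define G where "G i x = g x $ i" for i x
    have comp: "(LINT x|lebesgue. q x *\<^sub>R g x) $ i = (LINT x|lebesgue. G i x * q x)"
      if "integrable lebesgue (\<lambda>x. q x *\<^sub>R g x)" for q :: "real^'d \<Rightarrow> real" and i
      using integral_bounded_linear[OF bounded_linear_vec_nth that, of i] by (simp add: G_def mult.commute)
    have cosm: "(\<lambda>x. cos (\<xi> \<bullet> x + \<sigma>)) \<in> borel_measurable lebesgue" for \<xi> :: "real^'d" and \<sigma>
      by (intro continuous_imp_lebesgue_measurable continuous_intros)
    have ci: "integrable lebesgue (\<lambda>x. cos (\<xi> \<bullet> x + \<sigma>) *\<^sub>R g x)" for \<xi> :: "real^'d" and \<sigma>
    proof (rule Bochner_Integration.integrable_bound[OF fg(9)])
      show "AE x in lebesgue. norm (cos (\<xi> \<bullet> x + \<sigma>) *\<^sub>R g x) \<le> norm (g x)"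
        by (rule AE_I2) (simp add: mult_left_le_one_le)
    qed (intro borel_measurable_scaleR cosm fg(5))
    have mom: "c\<^sup>2 * (LINT x|lebesgue. f x * cos (\<xi> \<bullet> x + \<sigma>))\<^sup>2 \<le> (\<Sum>i\<in>UNIV. (LINT x|lebesgue. G i x * cos (\<xi> \<bullet> x + \<sigma>))\<^sup>2)" for \<xi> \<sigma>
    proof -
      have "c * \<bar>LINT x|lebesgue. f x * cos (\<xi> \<bullet> x + \<sigma>)\<bar> \<le> norm (LINT x|lebesgue. cos (\<xi> \<bullet> x + \<sigma>) *\<^sub>R g x)"
        by (rule cosine_moment_bound[OF \<Omega>(1) k u[folded F_def] fg(7,10,9,3,6) c(2)])
      then have "(c * \<bar>LINT x|lebesgue. f x * cos (\<xi> \<bullet> x + \<sigma>)\<bar>)\<^sup>2 \<le> (norm (LINT x|lebesgue. cos (\<xi> \<bullet> x + \<sigma>) *\<^sub>R g x))\<^sup>2"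
        using c(1) by (intro power_mono) auto
      also have "\<dots> = (\<Sum>i\<in>UNIV. ((LINT x|lebesgue. cos (\<xi> \<bullet> x + \<sigma>) *\<^sub>R g x) $ i)\<^sup>2)"
        by (simp only: power2_norm_eq_inner inner_vec_def) (simp add: power2_eq_square)
      finally show ?thesis by (simp add: comp[OF ci] power_mult_distrib)
    qed
    \<comment> \<open>The sine moments are cosine moments with phase -pi / 2, so both come from the
      same bound.\<close>
    have sc: "cos (s + - (pi / 2)) = sin s" for s :: real by (simp add: cos_diff)
    have le: "c\<^sup>2 * ((LINT y|lebesgue. f y * cos (\<xi> \<bullet> y))\<^sup>2 + (LINT y|lebesgue. f y * sin (\<xi> \<bullet> y))\<^sup>2) \<le>
      (\<Sum>i\<in>UNIV. (LINT y|lebesgue. G i y * cos (\<xi> \<bullet> y))\<^sup>2 + (LINT y|lebesgue. G i y * sin (\<xi> \<bullet> y))\<^sup>2)" for \<xi>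
      using add_mono[OF mom[of \<xi> 0] mom[of \<xi> "- (pi / 2)"]] unfolding sc by (simp add: distrib_left sum.distrib)
    have Gi: "integrable lebesgue (G i)" for i
      using integrable_bounded_linear[OF bounded_linear_vec_nth fg(9), of i] by (simp add: G_def[abs_def])
    have G2: "integrable lebesgue (\<lambda>x. (G i x)\<^sup>2)" for i
    proof (rule Bochner_Integration.integrable_bound[OF fg(8)])
      show "AE x in lebesgue. norm ((G i x)\<^sup>2) \<le> norm ((norm (g x))\<^sup>2)"
      proof (rule AE_I2)
        fix x
        have "\<bar>G i x\<bar>\<^sup>2 \<le> (norm (g x))\<^sup>2" unfolding G_def by (intro power_mono component_le_norm_cart) auto
        then show "norm ((G i x)\<^sup>2) \<le> norm ((norm (g x))\<^sup>2)" by simp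
      qed
    qed (use Gi in auto)
    have "c\<^sup>2 * (LINT x|lebesgue. (f x)\<^sup>2) \<le> (\<Sum>i\<in>UNIV. LINT x|lebesgue. (G i x)\<^sup>2)"
      by (rule cosine_moments_L2_bound[OF t fg(1) o \<Omega>(1) fg(2,3,10) Gi G2 _ _ le]) (auto simp: G_def fg(6))
    also have "\<dots> = (LINT x|lebesgue. (\<Sum>i\<in>UNIV. (G i x)\<^sup>2))" using G2 by (simp add: Bochner_Integration.integral_sum)
    also have "\<dots> = (LINT x|lebesgue. (norm (g x))\<^sup>2)"
      by (simp only: power2_norm_eq_inner inner_vec_def G_def) (simp add: power2_eq_square)
    finally have E: "c\<^sup>2 * (LINT x|lebesgue. (f x)\<^sup>2) \<le> (LINT x|lebesgue. (norm (g x))\<^sup>2)" .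
    have fb: "\<bar>f x\<bar> \<le> 1" for x using fg(2)[of x] fg(3)[of x] t by (cases "x \<in> \<Omega>") auto
    have "(min t (1 - t))\<^sup>2 * measure lebesgue \<Omega> = (LINT x|lebesgue. (min t (1 - t))\<^sup>2 * indicat_real \<Omega> x)" by simp
    also have "\<dots> \<le> (LINT x|lebesgue. (f x)\<^sup>2)"
    proof (rule integral_mono)
      show "integrable lebesgue (\<lambda>x. (min t (1 - t))\<^sup>2 * indicat_real \<Omega> x)"
        using \<Omega>m by (auto simp: fmeasurable_def intro!: integrable_mult_right integrable_real_indicator)
      show "integrable lebesgue (\<lambda>x. (f x)\<^sup>2)" unfolding power2_eq_square by (rule integrable_mult_bounded[OF fg(10,1) fb])
      show "(min t (1 - t))\<^sup>2 * indicat_real \<Omega> x \<le> (f x)\<^sup>2" for x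
      proof (cases "x \<in> \<Omega>")
        case True
        then have "min t (1 - t) \<le> \<bar>f x\<bar>" using fg(2)[OF True] t by auto
        then have "(min t (1 - t))\<^sup>2 \<le> \<bar>f x\<bar>\<^sup>2" using t by (intro power_mono) auto
        then show ?thesis using True by simp
      qed simp
    qed
    finally have "c\<^sup>2 * ((min t (1 - t))\<^sup>2 * measure lebesgue \<Omega>) \<le> (LINT x|lebesgue. (norm (g x))\<^sup>2)"
      using E mult_left_mono[of "(min t (1 - t))\<^sup>2 * measure lebesgue \<Omega>" "LINT x|lebesgue. (f x)\<^sup>2" "c\<^sup>2"] by simp
    then have "ennreal (c\<^sup>2 * (min t (1 - t))\<^sup>2 * measure lebesgue \<Omega>) \<le> elastic_energy \<Omega> u \<chi>'"
      unfolding fg(11) by (intro ennreal_leI) (simp add: mult.assoc)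
    then show "ennreal (c\<^sup>2 * (min t (1 - t))\<^sup>2) * emeasure lebesgue \<Omega> \<le> elastic_energy \<Omega> u \<chi>'"
      using \<Omega>m by (simp add: emeasure_eq_measure2 ennreal_mult)
  qed
  then show ?thesis using c(1) by (intro exI[of _ "c\<^sup>2"]) auto
qed

section \<open>Divergence-free fields from Lipschitz potentials\<close>

text \<open>Off the hyperplanes on which two different pieces agree, exactly one piece is selected, and
  by continuity the same one nearby.\<close>

lemma continuous_affine_selection_differentiable:
  fixes \<Phi> :: "'a::euclidean_space \<Rightarrow> real"
  assumes c: "continuous_on UNIV \<Phi>" and fin: "finite \<Lambda>"
    and sel: "\<And>x. \<exists>(p, c)\<in>\<Lambda>. \<Phi> x = p \<bullet> x + c"
  shows "\<exists>N. negligible N \<and> (\<forall>x. x \<notin> N \<longrightarrow> (\<exists>p. (\<Phi> has_derivative (\<lambda>h. p \<bullet> h)) (at x)))"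
proof -
  define N where "N = (\<Union>l\<in>\<Lambda>. \<Union>l'\<in>\<Lambda> - {l}. {x. (fst l - fst l') \<bullet> x = snd l' - snd l})"
  have "negligible {x. (fst l - fst l') \<bullet> x = snd l' - snd l}" if "l' \<noteq> l" for l l' :: "'a \<times> real"
    using that by (intro negligible_hyperplane) (auto simp: prod_eq_iff)
  then have "negligible N" unfolding N_def using fin
    by (intro negligible_Union finite_imageI finite_Diff) (auto intro!: negligible_Union)
  moreover have "\<exists>p. (\<Phi> has_derivative (\<lambda>h. p \<bullet> h)) (at x)" if x: "x \<notin> N" for x
  proof -
    obtain p c where pc: "(p, c) \<in> \<Lambda>" "\<Phi> x = p \<bullet> x + c" using sel by fast
    define U where "U = (\<Inter>l\<in>\<Lambda> - {(p, c)}. {y. \<Phi> y \<noteq> fst l \<bullet> y + snd l})"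
    have "open U" unfolding U_def
      by (intro open_INT ballI open_Collect_neq continuous_intros assms(1) finite_Diff fin)
    moreover have "x \<in> U" unfolding U_def
    proof (intro INT_I CollectI notI)
      fix l assume l: "l \<in> \<Lambda> - {(p, c)}" "\<Phi> x = fst l \<bullet> x + snd l"
      then have "x \<in> {x. (fst (p, c) - fst l) \<bullet> x = snd l - snd (p, c)}"
        using pc(2) by (simp add: inner_diff_left)
      then have "x \<in> N" unfolding N_def using pc(1) l(1) by blast
      then show False using x by simp
    qed
    moreover have "p \<bullet> y + c = \<Phi> y" if "y \<in> U" for y
    proof -
      obtain l where l: "l \<in> \<Lambda>" "\<Phi> y = fst l \<bullet> y + snd l" using sel[of y] by force
      then have "l = (p, c)" using that unfolding U_def by blast
      then show ?thesis using l by simp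
    qed
    moreover have "((\<lambda>y. p \<bullet> y + c) has_derivative (\<lambda>h. p \<bullet> h)) (at x)" by (auto intro!: derivative_eq_intros)
    ultimately show ?thesis using has_derivative_transform_within_open[of "\<lambda>y. p \<bullet> y + c" _ x UNIV U \<Phi>] by blast
  qed
  ultimately show ?thesis by blast
qed

lemma borel_measurable_vec_lambda:
  fixes f :: "'a \<Rightarrow> 'i::finite \<Rightarrow> real"
  assumes "\<And>i. (\<lambda>x. f x i) \<in> borel_measurable M"
  shows "(\<lambda>x. \<chi> i. f x i) \<in> borel_measurable M"
  by (subst borel_measurable_euclidean_space) (use assms in \<open>auto simp: Basis_vec_def inner_axis\<close>)

lemma has_derivative_translate:
  fixes f :: "real^'d::finite \<Rightarrow> real"
  assumes "f differentiable (at (x + c))"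
  shows "((\<lambda>x. f (x + c)) has_derivative (\<lambda>h. dir_deriv h f (x + c))) (at x)"
  by (rule has_derivative_compose[of "\<lambda>x. x + c" "\<lambda>h. h" x UNIV f "\<lambda>h. dir_deriv h f (x + c)", simplified])
     (use has_derivative_dir_deriv[OF assms] in \<open>auto intro!: derivative_eq_intros\<close>)

text \<open>Measurability comes from writing the gradient as a limit of continuous difference
  quotients, masked to zero on N. The sharp bound L follows from differentiating in the direction of
  the gradient itself.\<close>

lemma lipschitz_gradient:
  fixes \<Phi> :: "real^'d::finite \<Rightarrow> real"
  assumes lip: "\<And>x y. \<bar>\<Phi> x - \<Phi> y\<bar> \<le> L * norm (x - y)" and L: "L \<ge> 0" and N: "negligible N"
    and diff: "\<And>x. x \<notin> N \<Longrightarrow> \<exists>p. (\<Phi> has_derivative (\<lambda>h. p \<bullet> h)) (at x)"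
  obtains gr where "gr \<in> borel_measurable lebesgue" "\<And>x. x \<notin> N \<Longrightarrow> (\<Phi> has_derivative (\<lambda>h. gr x \<bullet> h)) (at x)"
    "\<And>x. norm (gr x) \<le> L"
proof -
  have c: "continuous_on UNIV \<Phi>"
  proof (rule lipschitz_on_continuous_on)
    show "L-lipschitz_on UNIV \<Phi>" using lip L by (intro lipschitz_onI) (auto simp: dist_norm)
  qed
  have Nm: "N \<in> sets lebesgue" using N by (simp add: negligible_iff_null_sets null_setsD2)
  define dq where "dq j n x = indicat_real (- N) x * (real (Suc n) * (\<Phi> (x + (1 / real (Suc n)) *\<^sub>R axis j 1) - \<Phi> x))" for j n x
  define gr :: "real^'d \<Rightarrow> real^'d" where "gr x = (\<chi> j. lim (\<lambda>n. dq j n x))" for x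
  have "dq j n \<in> borel_measurable lebesgue" for j n
  proof -
    have "(\<lambda>x. \<Phi> (x + (1 / real (Suc n)) *\<^sub>R axis j 1)) \<in> borel_measurable lebesgue" "\<Phi> \<in> borel_measurable lebesgue"
      by (intro continuous_imp_lebesgue_measurable continuous_on_compose2[OF c] continuous_intros; simp)+
    then show ?thesis unfolding dq_def using Nm by (intro borel_measurable_times borel_measurable_diff) auto
  qed
  then have grm: "gr \<in> borel_measurable lebesgue"
    unfolding gr_def by (intro borel_measurable_vec_lambda borel_measurable_lim_metric)
  have der: "(\<Phi> has_derivative (\<lambda>h. gr x \<bullet> h)) (at x)" if x: "x \<notin> N" for x
  proof -
    obtain p where p: "(\<Phi> has_derivative (\<lambda>h. p \<bullet> h)) (at x)" using diff[OF x] by blast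
    have "dq j n x = real (Suc n) * (\<Phi> (x + (1 / real (Suc n)) *\<^sub>R axis j 1) - \<Phi> x)" for j n
      using x by (simp add: dq_def)
    moreover have "(\<lambda>n. real (Suc n) * (\<Phi> (x + (1 / real (Suc n)) *\<^sub>R axis j 1) - \<Phi> x)) \<longlonglongrightarrow> dir_deriv (axis j 1) \<Phi> x" for j
      by (rule LIMSEQ_diff_quot[OF differentiableI[OF p]])
    moreover have "dir_deriv (axis j 1) \<Phi> x = p $ j" for j using dir_deriv_eqI[OF p] by (simp add: inner_axis)
    ultimately have "(\<lambda>n. dq j n x) \<longlonglongrightarrow> p $ j" for j by simp
    then have "gr x = p" by (simp add: gr_def vec_eq_iff limI)
    then show ?thesis using p by simp
  qed
  have "norm (gr x) \<le> L" for x
  proof (cases "x \<in> N")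
    case True
    then have "dq j n x = 0" for j n by (simp add: dq_def)
    then have "gr x = 0" by (simp add: gr_def vec_eq_iff limI)
    then show ?thesis using L by simp
  next
    case False
    have "(\<lambda>n. real (Suc n) * (\<Phi> (x + (1 / real (Suc n)) *\<^sub>R gr x) - \<Phi> x)) \<longlonglongrightarrow> dir_deriv (gr x) \<Phi> x"
      by (rule LIMSEQ_diff_quot[OF differentiableI[OF der[OF False]]])
    moreover have "real (Suc n) * (\<Phi> (x + (1 / real (Suc n)) *\<^sub>R gr x) - \<Phi> x) \<le> L * norm (gr x)" for n
    proof -
      have "\<Phi> (x + (1 / real (Suc n)) *\<^sub>R gr x) - \<Phi> x \<le> L * norm ((1 / real (Suc n)) *\<^sub>R gr x)"
        using lip[of "x + (1 / real (Suc n)) *\<^sub>R gr x" x] by simp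
      then have "real (Suc n) * (\<Phi> (x + (1 / real (Suc n)) *\<^sub>R gr x) - \<Phi> x) \<le> real (Suc n) * (L * norm ((1 / real (Suc n)) *\<^sub>R gr x))"
        by (intro mult_left_mono) auto
      then show ?thesis by simp
    qed
    ultimately have "dir_deriv (gr x) \<Phi> x \<le> L * norm (gr x)"
      by (intro LIMSEQ_le_const2) auto
    then have "norm (gr x) * norm (gr x) \<le> L * norm (gr x)"
      using dir_deriv_eqI[OF der[OF False], of "gr x"] by (simp add: power2_norm_eq_inner[symmetric] power2_eq_square)
    then show ?thesis using L by (cases "gr x = 0") auto
  qed
  then show ?thesis using that grm der by blast
qed

lemma bounded_set_integrable_cball:
  fixes q :: "real^'d::finite \<Rightarrow> real"
  assumes "q \<in> borel_measurable lebesgue" "\<And>x. \<bar>q x\<bar> \<le> M"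
  shows "set_integrable lebesgue (cball 0 R) q"
proof -
  have "M \<ge> 0" using assms(2)[of 0] by linarith
  have "(\<lambda>x. indicat_real (cball 0 R) x *\<^sub>R q x) \<in> borel_measurable lebesgue"
    using assms(1) borel_measurable_integrable[OF integrable_indicator_cball] by (rule borel_measurable_scaleR[rotated])
  then show ?thesis unfolding set_integrable_def
    by (rule integrable_bounded_on_ball[of _ M R]) (use assms(2) \<open>M \<ge> 0\<close> in \<open>auto simp: indicator_def\<close>)
qed

text \<open>A translation turns the forward quotient of \<Phi> against \<psi> into \<Phi> against
  the quotient of \<psi> in direction -e. Both sides converge, the first by the Lipschitz bound of
  \<Phi> and differentiability off N.\<close>

lemma gradient_integration_by_parts:
  fixes \<Phi> :: "real^'d::finite \<Rightarrow> real"
  assumes lip: "\<And>x y. \<bar>\<Phi> x - \<Phi> y\<bar> \<le> L * norm (x - y)" and L: "L \<ge> 0" and b: "\<And>x. \<bar>\<Phi> x\<bar> \<le> B"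
    and N: "negligible N" and gr: "gr \<in> borel_measurable lebesgue" "\<And>x. x \<notin> N \<Longrightarrow> (\<Phi> has_derivative (\<lambda>h. gr x \<bullet> h)) (at x)"
    and \<psi>: "\<psi> \<in> test_functions"
  shows "(LINT x|lebesgue. (gr x \<bullet> e) * \<psi> x) = - (LINT x|lebesgue. \<Phi> x * dir_deriv e \<psi> x)"
proof -
  have c: "continuous_on UNIV \<Phi>"
  proof (rule lipschitz_on_continuous_on)
    show "L-lipschitz_on UNIV \<Phi>" using lip L by (intro lipschitz_onI) (auto simp: dist_norm)
  qed
  have \<Phi>m: "\<Phi> \<in> borel_measurable lebesgue" by (rule continuous_imp_lebesgue_measurable[OF c])
  obtain M R where \<psi>b: "\<And>x. \<bar>\<psi> x\<bar> \<le> M" "\<And>x. x \<notin> cball 0 R \<Longrightarrow> \<psi> x = 0" "\<psi> \<in> borel_measurable lebesgue"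
    using test_functions_bounds[OF \<psi>] by metis
  have \<psi>i: "integrable lebesgue \<psi>" by (rule test_functions_integrable[OF \<psi>])
  define \<epsilon> where "\<epsilon> n = 1 / real (Suc n)" for n
  have N0: "AE x in lebesgue. x \<notin> N" using N by (intro AE_not_in) (simp add: negligible_iff_null_sets)
  have sm: "(\<lambda>x. \<Phi> (x + \<epsilon> n *\<^sub>R e)) \<in> borel_measurable lebesgue" for n
    by (rule borel_measurable_lebesgue_translate[OF \<Phi>m])
  have l1: "(\<lambda>n. LINT x|lebesgue. (real (Suc n) * (\<Phi> (x + \<epsilon> n *\<^sub>R e) - \<Phi> x)) * \<psi> x) \<longlonglongrightarrow> (LINT x|lebesgue. (gr x \<bullet> e) * \<psi> x)"
  proof (rule integral_dominated_convergence[where w="\<lambda>x. L * norm e * \<bar>\<psi> x\<bar>"])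
    show "AE x in lebesgue. (\<lambda>n. (real (Suc n) * (\<Phi> (x + \<epsilon> n *\<^sub>R e) - \<Phi> x)) * \<psi> x) \<longlonglongrightarrow> (gr x \<bullet> e) * \<psi> x"
      using N0
    proof eventually_elim
      case (elim x)
      have "(\<lambda>n. real (Suc n) * (\<Phi> (x + \<epsilon> n *\<^sub>R e) - \<Phi> x)) \<longlonglongrightarrow> dir_deriv e \<Phi> x"
        unfolding \<epsilon>_def by (rule LIMSEQ_diff_quot[OF differentiableI[OF gr(2)[OF elim]]])
      then show ?case unfolding dir_deriv_eqI[OF gr(2)[OF elim]] by (intro tendsto_mult tendsto_const)
    qed
    show "AE x in lebesgue. norm ((real (Suc n) * (\<Phi> (x + \<epsilon> n *\<^sub>R e) - \<Phi> x)) * \<psi> x) \<le> L * norm e * \<bar>\<psi> x\<bar>" for n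
    proof (rule AE_I2)
      fix x
      have "\<bar>real (Suc n) * (\<Phi> (x + \<epsilon> n *\<^sub>R e) - \<Phi> x)\<bar> \<le> real (Suc n) * (L * norm (\<epsilon> n *\<^sub>R e))"
        using lip[of "x + \<epsilon> n *\<^sub>R e" x] by (simp only: abs_mult abs_of_nat) (intro mult_left_mono, simp_all)
      also have "\<dots> = L * norm e" by (simp add: \<epsilon>_def)
      finally show "norm ((real (Suc n) * (\<Phi> (x + \<epsilon> n *\<^sub>R e) - \<Phi> x)) * \<psi> x) \<le> L * norm e * \<bar>\<psi> x\<bar>"
        unfolding real_norm_def abs_mult[of _ "\<psi> x"] by (rule mult_right_mono) simp
    qed
    show "integrable lebesgue (\<lambda>x. L * norm e * \<bar>\<psi> x\<bar>)" using \<psi>i by (intro integrable_mult_right integrable_abs)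
    show "(\<lambda>x. (gr x \<bullet> e) * \<psi> x) \<in> borel_measurable lebesgue" using gr(1) \<psi>b(3) by measurable
    show "(\<lambda>x. (real (Suc n) * (\<Phi> (x + \<epsilon> n *\<^sub>R e) - \<Phi> x)) * \<psi> x) \<in> borel_measurable lebesgue" for n
      by (intro borel_measurable_times borel_measurable_diff sm \<Phi>m \<psi>b(3)) simp
  qed
  have "(\<lambda>n. LINT x|lebesgue. \<Phi> x * (real (Suc n) * (\<psi> (x + (1 / real (Suc n)) *\<^sub>R (- e)) - \<psi> x)))
      \<longlonglongrightarrow> (LINT x|lebesgue. \<Phi> x * dir_deriv (- e) \<psi> x)"
    by (rule LIMSEQ_integral_diff_quot[OF test_functions_C_diff[OF \<psi>] \<psi>b(2) \<Phi>m bounded_set_integrable_cball[OF \<Phi>m b]])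
  moreover have "(LINT x|lebesgue. \<Phi> x * (real (Suc n) * (\<psi> (x + (1 / real (Suc n)) *\<^sub>R (- e)) - \<psi> x)))
      = (LINT x|lebesgue. (real (Suc n) * (\<Phi> (x + \<epsilon> n *\<^sub>R e) - \<Phi> x)) * \<psi> x)" for n
  proof -
    have i0: "integrable lebesgue (\<lambda>x. \<Phi> x * \<psi> x)"
      using integrable_mult_bounded[OF \<psi>i \<Phi>m b] by (simp add: mult.commute)
    have i1: "integrable lebesgue (\<lambda>x. \<Phi> x * \<psi> (x + - (\<epsilon> n *\<^sub>R e)))"
      using integrable_mult_bounded[OF integrable_lebesgue_translate[OF \<psi>i] \<Phi>m b, of "- (\<epsilon> n *\<^sub>R e)"] by (simp add: mult.commute)
    have i2: "integrable lebesgue (\<lambda>x. \<Phi> (x + \<epsilon> n *\<^sub>R e) * \<psi> x)"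
      using integrable_mult_bounded[OF \<psi>i sm b, of n] by (simp add: mult.commute)
    have tr: "(LINT x|lebesgue. \<Phi> x * \<psi> (x + - (\<epsilon> n *\<^sub>R e))) = (LINT x|lebesgue. \<Phi> (x + \<epsilon> n *\<^sub>R e) * \<psi> x)"
      using integral_lebesgue_translate[OF borel_measurable_integrable[OF i1], of "\<epsilon> n *\<^sub>R e"] by simp
    have "(LINT x|lebesgue. \<Phi> x * (real (Suc n) * (\<psi> (x + (1 / real (Suc n)) *\<^sub>R (- e)) - \<psi> x)))
      = (LINT x|lebesgue. real (Suc n) * (\<Phi> x * \<psi> (x + - (\<epsilon> n *\<^sub>R e)) - \<Phi> x * \<psi> x))"
      by (rule Bochner_Integration.integral_cong) (simp_all add: \<epsilon>_def algebra_simps)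
    also have "\<dots> = real (Suc n) * ((LINT x|lebesgue. \<Phi> (x + \<epsilon> n *\<^sub>R e) * \<psi> x) - (LINT x|lebesgue. \<Phi> x * \<psi> x))"
      using i0 i1 tr by simp
    also have "\<dots> = (LINT x|lebesgue. real (Suc n) * (\<Phi> (x + \<epsilon> n *\<^sub>R e) * \<psi> x - \<Phi> x * \<psi> x))"
      using i0 i2 by simp
    also have "\<dots> = (LINT x|lebesgue. (real (Suc n) * (\<Phi> (x + \<epsilon> n *\<^sub>R e) - \<Phi> x)) * \<psi> x)"
      by (rule Bochner_Integration.integral_cong) (simp_all add: algebra_simps)
    finally show ?thesis .
  qed
  ultimately have "(LINT x|lebesgue. (gr x \<bullet> e) * \<psi> x) = (LINT x|lebesgue. \<Phi> x * dir_deriv (- e) \<psi> x)"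
    using l1 LIMSEQ_unique by simp
  also have "\<dots> = - (LINT x|lebesgue. \<Phi> x * dir_deriv e \<psi> x)" by (simp add: dir_deriv_def sum_negf)
  finally show ?thesis .
qed

lemma test_functions_dir_deriv:
  assumes "\<phi> \<in> test_functions" shows "dir_deriv e \<phi> \<in> test_functions"
proof -
  obtain R where R: "\<And>x. x \<notin> cball 0 R \<Longrightarrow> \<phi> x = 0" using test_functions_vanish[OF assms] by blast
  show ?thesis
  proof (rule test_functionsI[of _ "cball 0 R"])
    show "C_diff r (dir_deriv e \<phi>)" for r
      unfolding dir_deriv_def[abs_def]
      by (intro C_diff_sum C_diff_cmult test_functions_C_diff[OF test_functions_partial_deriv[OF assms]]) auto
    show "dir_deriv e \<phi> x = 0" if "x \<notin> cball 0 R" for x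
      unfolding dir_deriv_def using partial_deriv_vanish[OF closed_cball R that] by simp
  qed simp
qed

lemma partial_deriv_translate:
  fixes f :: "real^'d::finite \<Rightarrow> real"
  assumes "\<And>x. f differentiable (at x)"
  shows "partial_deriv j (\<lambda>x. f (x + c)) = (\<lambda>x. partial_deriv j f (x + c))"
proof
  fix x
  from partial_deriv_eqI[OF has_derivative_translate[OF assms], of j]
  show "partial_deriv j (\<lambda>x. f (x + c)) x = partial_deriv j f (x + c)"
    by (simp add: dir_deriv_axis)
qed

lemma C_diff_translate:
  fixes f :: "real^'d::finite \<Rightarrow> real"
  shows "C_diff r f \<Longrightarrow> C_diff r (\<lambda>x. f (x + c))"
proof (induction r arbitrary: f)
  case 0
  then show ?case by (auto intro!: continuous_on_compose2[of UNIV f] continuous_intros)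
next
  case (Suc r)
  have d: "f differentiable (at x)" for x using Suc.prems by simp
  have "(\<lambda>x. f (x + c)) differentiable (at x)" for x
    by (rule differentiableI[OF has_derivative_translate[OF d]])
  then show ?case using Suc partial_deriv_translate[OF d] by simp
qed

text \<open>Weak gradients are curl-free; discretising one of the two derivatives of \<open>\<phi>\<close> avoids the
  symmetry of second derivatives.\<close>

lemma gradient_curl_free:
  fixes \<Phi> :: "real^'d::finite \<Rightarrow> real"
  assumes lip: "\<And>x y. \<bar>\<Phi> x - \<Phi> y\<bar> \<le> L * norm (x - y)" and L: "L \<ge> 0" and b: "\<And>x. \<bar>\<Phi> x\<bar> \<le> B"
    and N: "negligible N" and gr: "gr \<in> borel_measurable lebesgue" "\<And>x. x \<notin> N \<Longrightarrow> (\<Phi> has_derivative (\<lambda>h. gr x \<bullet> h)) (at x)"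
    and grb: "\<And>x. norm (gr x) \<le> L" and \<phi>: "\<phi> \<in> test_functions"
  shows "(LINT x|lebesgue. (gr x \<bullet> e) * dir_deriv v \<phi> x) = (LINT x|lebesgue. (gr x \<bullet> v) * dir_deriv e \<phi> x)"
proof -
  have c: "continuous_on UNIV \<Phi>"
  proof (rule lipschitz_on_continuous_on)
    show "L-lipschitz_on UNIV \<Phi>" using lip L by (intro lipschitz_onI) (auto simp: dist_norm)
  qed
  have \<Phi>m: "\<Phi> \<in> borel_measurable lebesgue" by (rule continuous_imp_lebesgue_measurable[OF c])
  obtain R where R: "\<And>x. x \<notin> cball 0 R \<Longrightarrow> \<phi> x = 0" using test_functions_vanish[OF \<phi>] by blast
  have D\<phi>: "dir_deriv v \<phi> \<in> test_functions" by (rule test_functions_dir_deriv[OF \<phi>])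
  obtain R' where R': "\<And>x. x \<notin> cball 0 R' \<Longrightarrow> dir_deriv v \<phi> x = 0" using test_functions_vanish[OF D\<phi>] by blast
  have df: "\<phi> differentiable (at x)" for x using C_diff_differentiable[OF test_functions_C_diff[OF \<phi>], of 1] by simp
  have qm: "(\<lambda>x. gr x \<bullet> v) \<in> borel_measurable lebesgue" using gr(1) by measurable
  have qb: "\<bar>gr x \<bullet> v\<bar> \<le> L * norm v" for x
    using Cauchy_Schwarz_ineq2[of "gr x" v] mult_right_mono[OF grb[of x] norm_ge_zero[of v]] by linarith
  have l1: "(\<lambda>n. LINT x|lebesgue. \<Phi> x * (real (Suc n) * (dir_deriv v \<phi> (x + (1 / real (Suc n)) *\<^sub>R e) - dir_deriv v \<phi> x)))
      \<longlonglongrightarrow> (LINT x|lebesgue. \<Phi> x * dir_deriv e (dir_deriv v \<phi>) x)"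
    by (rule LIMSEQ_integral_diff_quot[OF test_functions_C_diff[OF D\<phi>] R' \<Phi>m bounded_set_integrable_cball[OF \<Phi>m b]])
  have l2: "(\<lambda>n. LINT x|lebesgue. (gr x \<bullet> v) * (real (Suc n) * (\<phi> (x + (1 / real (Suc n)) *\<^sub>R e) - \<phi> x)))
      \<longlonglongrightarrow> (LINT x|lebesgue. (gr x \<bullet> v) * dir_deriv e \<phi> x)"
    by (rule LIMSEQ_integral_diff_quot[OF test_functions_C_diff[OF \<phi>] R qm bounded_set_integrable_cball[OF qm qb]])
  have eq: "(LINT x|lebesgue. \<Phi> x * (real (Suc n) * (dir_deriv v \<phi> (x + (1 / real (Suc n)) *\<^sub>R e) - dir_deriv v \<phi> x)))
      = - (LINT x|lebesgue. (gr x \<bullet> v) * (real (Suc n) * (\<phi> (x + (1 / real (Suc n)) *\<^sub>R e) - \<phi> x)))" for n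
  proof -
    define c where "c = (1 / real (Suc n)) *\<^sub>R e"
    define \<psi> where "\<psi> x = real (Suc n) * (\<phi> (x + c) - \<phi> x)" for x
    have C\<psi>: "C_diff r \<psi>" for r unfolding \<psi>_def
      by (intro C_diff_cmult C_diff_diff C_diff_translate test_functions_C_diff[OF \<phi>])
    have \<psi>: "\<psi> \<in> test_functions"
    proof (rule test_functionsI[OF C\<psi>, of "cball 0 (R + norm c)"])
      fix x :: "real^'d" assume "x \<notin> cball 0 (R + norm c)"
      then have x: "norm x > R + norm c" by simp
      then have "norm (x + c) > R" using norm_diff_ineq[of x c] by linarith
      moreover have "norm x > R" using x norm_ge_zero[of c] by linarith
      ultimately show "\<psi> x = 0" using R by (simp add: \<psi>_def)
    qed simp
    have dt: "dir_deriv v \<psi> x = real (Suc n) * (dir_deriv v \<phi> (x + c) - dir_deriv v \<phi> x)" for x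
    proof -
      have "(\<psi> has_derivative (\<lambda>h. real (Suc n) * (dir_deriv h \<phi> (x + c) - dir_deriv h \<phi> x))) (at x)"
        unfolding \<psi>_def by (intro has_derivative_mult_right has_derivative_diff has_derivative_dir_deriv[OF df] has_derivative_translate[OF df])
      from dir_deriv_eqI[OF this, of v] show ?thesis .
    qed
    show ?thesis
      using gradient_integration_by_parts[OF lip L b N gr \<psi>, of v] unfolding dt unfolding \<psi>_def c_def by simp
  qed
  have "(LINT x|lebesgue. \<Phi> x * dir_deriv e (dir_deriv v \<phi>) x) = - (LINT x|lebesgue. (gr x \<bullet> v) * dir_deriv e \<phi> x)"
    using LIMSEQ_unique[OF l1[unfolded eq] tendsto_minus[OF l2]] .
  moreover have "(LINT x|lebesgue. (gr x \<bullet> e) * dir_deriv v \<phi> x) = - (LINT x|lebesgue. \<Phi> x * dir_deriv e (dir_deriv v \<phi>) x)"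
    by (rule gradient_integration_by_parts[OF lip L b N gr D\<phi>])
  ultimately show ?thesis by simp
qed

text \<open>Row i is the antisymmetric matrix V \<otimes> \<xi> - \<xi> \<otimes> V applied to g,
  with V the i-th row of v. An antisymmetric matrix applied to a gradient is divergence free, as
  rotated gradients are in the plane.\<close>

definition stream_field ::
    "('m::finite \<times> 'd::finite \<Rightarrow> 'n::finite) \<Rightarrow> real^'n \<Rightarrow> real^'d \<Rightarrow> real^'d \<Rightarrow> real^'n" where
  "stream_field e v \<xi> g = (\<chi> n. case inv e n of (i, j) \<Rightarrow>
     v $ n * (g \<bullet> \<xi>) - \<xi> $ j * (g \<bullet> (\<chi> l. v $ e (i, l))))"

lemma stream_field_nth:
  assumes "bij e"
  shows "stream_field e v \<xi> g $ e (i, j) = v $ e (i, j) * (g \<bullet> \<xi>) - \<xi> $ j * (g \<bullet> (\<chi> l. v $ e (i, l)))"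
  using assms by (simp add: stream_field_def bij_is_inj)

lemma stream_field_bound:
  fixes e :: "'m::finite \<times> 'd::finite \<Rightarrow> 'n::finite"
  assumes "norm \<xi> = 1"
  shows "norm (stream_field e v \<xi> g) \<le> real CARD('n) * (1 + real CARD('d)) * norm v * norm g"
proof -
  have "\<bar>stream_field e v \<xi> g $ n\<bar> \<le> (1 + real CARD('d)) * norm v * norm g" for n
  proof -
    obtain i j where ij: "inv e n = (i, j)" by force
    have 1: "\<bar>v $ n * (g \<bullet> \<xi>)\<bar> \<le> norm v * norm g"
      unfolding abs_mult using Cauchy_Schwarz_ineq2[of g \<xi>] assms component_le_norm_cart[of v n] by (intro mult_mono) auto
    have "norm (\<chi> l. v $ e (i, l)) \<le> (\<Sum>l\<in>UNIV. \<bar>(\<chi> l. v $ e (i, l)) $ l\<bar>)" by (rule norm_le_l1_cart)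
    also have "\<dots> \<le> (\<Sum>l\<in>(UNIV::'d set). norm v)" using component_le_norm_cart[of v] by (intro sum_mono) simp
    finally have V: "norm (\<chi> l::'d. v $ e (i, l)) \<le> real CARD('d) * norm v" by simp
    have "\<bar>g \<bullet> (\<chi> l. v $ e (i, l))\<bar> \<le> norm g * (real CARD('d) * norm v)"
      by (rule order.trans[OF Cauchy_Schwarz_ineq2 mult_left_mono[OF V norm_ge_zero]])
    then have 2: "\<bar>\<xi> $ j * (g \<bullet> (\<chi> l. v $ e (i, l)))\<bar> \<le> 1 * (norm g * (real CARD('d) * norm v))"
      unfolding abs_mult using component_le_norm_cart[of \<xi> j] assms by (intro mult_mono) auto
    have "\<bar>stream_field e v \<xi> g $ n\<bar> \<le> \<bar>v $ n * (g \<bullet> \<xi>)\<bar> + \<bar>\<xi> $ j * (g \<bullet> (\<chi> l. v $ e (i, l)))\<bar>"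
      by (simp add: stream_field_def ij)
    then show ?thesis using 1 2 by (simp add: algebra_simps)
  qed
  then have "norm (stream_field e v \<xi> g) \<le> (\<Sum>n\<in>(UNIV::'n set). (1 + real CARD('d)) * norm v * norm g)"
    by (intro order.trans[OF norm_le_l1_cart] sum_mono)
  then show ?thesis by (simp add: mult.assoc)
qed

lemma stream_field_measurable:
  fixes e :: "'m::finite \<times> 'd::finite \<Rightarrow> 'n::finite"
  assumes "gr \<in> borel_measurable lebesgue"
  shows "(\<lambda>x::real^'d. stream_field e v \<xi> (gr x)) \<in> borel_measurable lebesgue"
  unfolding stream_field_def
proof (intro borel_measurable_vec_lambda)
  fix n
  obtain i j where "inv e n = (i, j)" by force
  then show "(\<lambda>x. case inv e n of (i, j) \<Rightarrow> v $ n * (gr x \<bullet> \<xi>) - \<xi> $ j * (gr x \<bullet> (\<chi> l. v $ e (i, l)))) \<in> borel_measurable lebesgue"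
    using assms by simp
qed

text \<open>Tested with \<phi>, row i becomes the difference of the integrals of (\<nabla>\<Phi>
  \<bullet> \<xi>) times the V-derivative of \<phi> and of the same expression with V and \<xi>
  exchanged; this vanishes because weak gradients are curl free.\<close>

lemma stream_field_divergence_free:
  fixes Aop :: "('d::finite \<Rightarrow> nat) \<Rightarrow> real^'n::finite^'m::finite" and \<Phi> :: "real^'d \<Rightarrow> real" and F v :: "real^'n"
  assumes div: "is_row_divergence e Aop" and \<xi>: "norm \<xi> = 1"
    and lip: "\<And>x y. \<bar>\<Phi> x - \<Phi> y\<bar> \<le> L * norm (x - y)" and L: "L \<ge> 0" and b: "\<And>x. \<bar>\<Phi> x\<bar> \<le> B"
    and N: "negligible N" and gr: "gr \<in> borel_measurable lebesgue" "\<And>x. x \<notin> N \<Longrightarrow> (\<Phi> has_derivative (\<lambda>h. gr x \<bullet> h)) (at x)"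
    and grb: "\<And>x. norm (gr x) \<le> L"
  defines "u \<equiv> \<lambda>x. F + stream_field e v \<xi> (gr x)"
  shows "u \<in> L2_loc" "distributional_solution Aop 1 u"
proof -
  have wm: "(\<lambda>x. stream_field e v \<xi> (gr x)) \<in> borel_measurable lebesgue" by (rule stream_field_measurable[OF gr(1)])
  define K where "K = real CARD('n) * (1 + real CARD('d)) * norm v * L"
  have wb: "norm (stream_field e v \<xi> (gr x)) \<le> K" for x
    unfolding K_def by (rule order.trans[OF stream_field_bound[OF \<xi>] mult_left_mono[OF grb]]) simp
  have um: "u \<in> borel_measurable lebesgue" unfolding u_def using wm by (intro borel_measurable_add) auto
  show u: "u \<in> L2_loc"
  proof (rule L2_locI_bounded[OF um, of "norm F + K"])
    show "norm (u x) \<le> norm F + K" for x unfolding u_def by (rule order.trans[OF norm_triangle_ineq add_left_mono[OF wb]])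
  qed
  have bij: "bij e" and col: "\<And>j z. Aop (unit_index j) *v z = (\<chi> i. z $ e (i, j))"
    using div by (auto simp: is_row_divergence_def)
  show "distributional_solution Aop 1 u"
    unfolding distributional_solution_1
  proof (intro ballI)
    fix \<phi> :: "real^'d \<Rightarrow> real" assume \<phi>: "\<phi> \<in> test_functions"
    have pt: "partial_deriv j \<phi> \<in> test_functions" for j by (rule test_functions_partial_deriv[OF \<phi>])
    obtain R where R: "\<And>x. x \<notin> cball 0 R \<Longrightarrow> \<phi> x = 0" using test_functions_vanish[OF \<phi>] by blast
    have pz: "(LINT x|lebesgue. partial_deriv j \<phi> x) = 0" for j
      by (rule integral_partial_deriv_zero[OF test_functions_C_diff[OF \<phi>] R])
    have pi: "integrable lebesgue (partial_deriv j \<phi>)" for j by (rule test_functions_integrable[OF pt])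
    have gm: "(\<lambda>x. gr x \<bullet> y) \<in> borel_measurable lebesgue" for y using gr(1) by measurable
    have gb: "\<bar>gr x \<bullet> y\<bar> \<le> L * norm y" for x y
      using Cauchy_Schwarz_ineq2[of "gr x" y] mult_right_mono[OF grb[of x] norm_ge_zero[of y]] by linarith
    have ig: "integrable lebesgue (\<lambda>x. partial_deriv j \<phi> x * (gr x \<bullet> y))" for j y
      by (rule integrable_mult_bounded[OF pi gm gb])
    define G where "G j y = (LINT x|lebesgue. partial_deriv j \<phi> x * (gr x \<bullet> y))" for j y
    have Gsum: "(\<Sum>j\<in>UNIV. y $ j * G j z) = (LINT x|lebesgue. (gr x \<bullet> z) * dir_deriv y \<phi> x)" for y z
    proof -
      have "(\<Sum>j\<in>UNIV. y $ j * G j z) = (LINT x|lebesgue. (\<Sum>j\<in>UNIV. y $ j * (partial_deriv j \<phi> x * (gr x \<bullet> z))))"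
        unfolding G_def using ig by (simp add: Bochner_Integration.integral_sum)
      then show ?thesis by (simp add: dir_deriv_def sum_distrib_left mult_ac)
    qed
    have comp: "(LINT x|lebesgue. partial_deriv j \<phi> x *\<^sub>R u x) $ e (i, j) = v $ e (i, j) * G j \<xi> - \<xi> $ j * G j (\<chi> l. v $ e (i, l))" for i j
    proof -
      have iu: "integrable lebesgue (\<lambda>x. partial_deriv j \<phi> x *\<^sub>R u x)" by (rule test_functions_L2_loc_integrable[OF pt u])
      have "(LINT x|lebesgue. partial_deriv j \<phi> x *\<^sub>R u x) $ e (i, j) = (LINT x|lebesgue. (partial_deriv j \<phi> x *\<^sub>R u x) $ e (i, j))"
        using integral_bounded_linear[OF bounded_linear_vec_nth iu] by simp
      also have "\<dots> = (LINT x|lebesgue. partial_deriv j \<phi> x * F $ e (i, j) +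
          (v $ e (i, j) * (partial_deriv j \<phi> x * (gr x \<bullet> \<xi>)) - \<xi> $ j * (partial_deriv j \<phi> x * (gr x \<bullet> (\<chi> l. v $ e (i, l))))))"
        by (rule Bochner_Integration.integral_cong) (simp_all add: u_def stream_field_nth[OF bij] algebra_simps)
      also have "\<dots> = v $ e (i, j) * G j \<xi> - \<xi> $ j * G j (\<chi> l. v $ e (i, l))"
        unfolding G_def using ig pi pz by simp
      finally show ?thesis .
    qed
    have "(\<Sum>j\<in>UNIV. Aop (unit_index j) *v (LINT x|lebesgue. partial_deriv j \<phi> x *\<^sub>R u x)) $ i = 0" for i
    proof -
      define V where "V = (\<chi> l. v $ e (i, l))"
      have "(\<Sum>j\<in>UNIV. Aop (unit_index j) *v (LINT x|lebesgue. partial_deriv j \<phi> x *\<^sub>R u x)) $ i =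
         (\<Sum>j\<in>UNIV. V $ j * G j \<xi>) - (\<Sum>j\<in>UNIV. \<xi> $ j * G j V)"
        by (simp add: col comp sum_subtractf V_def)
      also have "\<dots> = 0" unfolding Gsum
        using gradient_curl_free[OF lip L b N gr grb \<phi>, of \<xi> V] by simp
      finally show ?thesis .
    qed
    then show "(\<Sum>j\<in>UNIV. Aop (unit_index j) *v (LINT x|lebesgue. partial_deriv j \<phi> x *\<^sub>R u x)) = 0"
      by (simp add: vec_eq_iff)
  qed
qed

section \<open>The branching construction\<close>

lemma Min_image_lipschitz:
  fixes f :: "'i \<Rightarrow> 'a \<Rightarrow> real"
  assumes "finite I" "I \<noteq> {}" "\<And>i. i \<in> I \<Longrightarrow> \<bar>f i x - f i y\<bar> \<le> L"
  shows "\<bar>Min ((\<lambda>i. f i x) ` I) - Min ((\<lambda>i. f i y) ` I)\<bar> \<le> L"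
proof -
  have "Min ((\<lambda>i. f i x) ` I) \<le> Min ((\<lambda>i. f i y) ` I) + L" if *: "\<And>i. i \<in> I \<Longrightarrow> \<bar>f i x - f i y\<bar> \<le> L" for x y
  proof -
    have "Min ((\<lambda>i. f i y) ` I) \<in> (\<lambda>i. f i y) ` I" using assms by (intro Min_in) auto
    then obtain i where i: "i \<in> I" "Min ((\<lambda>i. f i y) ` I) = f i y" by blast
    have "Min ((\<lambda>i. f i x) ` I) \<le> f i x" using assms i by (intro Min_le) auto
    then show ?thesis using *[OF i(1)] i(2) by linarith
  qed
  from this[of x y] this[of y x] show ?thesis using assms(3) by (simp add: abs_le_iff abs_minus_commute)
qed

text \<open>Inside the unit cube this is the distance to the boundary, outside it is 0. As a maximum
  and minimum of finitely many affine functions it keeps the potential piecewise affine.\<close>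

definition cube_dist :: "real^'d::finite \<Rightarrow> real" where
  "cube_dist x = max 0 (Min ((\<lambda>i. min (x $ i) (1 - x $ i)) ` UNIV))"

lemma cube_dist_nonneg: "cube_dist x \<ge> 0"
  by (simp add: cube_dist_def)

lemma cube_dist_lipschitz: "\<bar>cube_dist x - cube_dist y\<bar> \<le> norm (x - y)"
proof -
  have "\<bar>min (x $ i) (1 - x $ i) - min (y $ i) (1 - y $ i)\<bar> \<le> norm (x - y)" for i
    using component_le_norm_cart[of "x - y" i] by (auto simp: min_def abs_le_iff)
  then have "\<bar>Min ((\<lambda>i. min (x $ i) (1 - x $ i)) ` UNIV) - Min ((\<lambda>i. min (y $ i) (1 - y $ i)) ` UNIV)\<bar> \<le> norm (x - y)"
    using Min_image_lipschitz[of UNIV "\<lambda>i x. min (x $ i) (1 - x $ i)" x y "norm (x - y)"] by simp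
  moreover have "\<bar>max 0 p - max 0 q\<bar> \<le> n" if "\<bar>p - q\<bar> \<le> n" for p q n :: real using that by linarith
  ultimately show ?thesis unfolding cube_dist_def by blast
qed

lemma cube_dist_continuous: "continuous_on S cube_dist"
proof -
  have "1-lipschitz_on S cube_dist" using cube_dist_lipschitz by (intro lipschitz_onI) (auto simp: dist_norm)
  then show ?thesis by (rule lipschitz_on_continuous_on)
qed

lemma cube_dist_outside:
  fixes x :: "real^'d::finite"
  assumes "x \<notin> box 0 1" shows "cube_dist x = 0"
proof -
  obtain i where "x $ i \<le> 0 \<or> x $ i \<ge> 1" using assms by (auto simp: mem_box_cart not_less)
  then have "min (x $ i) (1 - x $ i) \<le> 0" by auto
  then have "Min ((\<lambda>i. min (x $ i) (1 - x $ i)) ` UNIV) \<le> 0" by (intro order.trans[OF Min_le]) auto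
  then show ?thesis by (simp add: cube_dist_def)
qed

lemma cube_dist_selection:
  fixes x :: "real^'d::finite"
  shows "cube_dist x = 0 \<or> (\<exists>i. cube_dist x = x $ i) \<or> (\<exists>i. cube_dist x = 1 - x $ i)"
proof -
  have "Min ((\<lambda>i. min (x $ i) (1 - x $ i)) ` UNIV) \<in> (\<lambda>i. min (x $ i) (1 - x $ i)) ` UNIV" by (intro Min_in) auto
  then obtain i where "Min ((\<lambda>i. min (x $ i) (1 - x $ i)) ` UNIV) = min (x $ i) (1 - x $ i)" by blast
  then show ?thesis by (auto simp: cube_dist_def max_def min_def)
qed

lemma cube_dist_small:
  fixes x :: "real^'d::finite"
  assumes "cube_dist x \<le> l" shows "\<exists>i. x $ i \<le> l \<or> 1 - l \<le> x $ i"
proof -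
  have "Min ((\<lambda>i. min (x $ i) (1 - x $ i)) ` UNIV) \<in> (\<lambda>i. min (x $ i) (1 - x $ i)) ` UNIV" by (intro Min_in) auto
  then obtain i where "Min ((\<lambda>i. min (x $ i) (1 - x $ i)) ` UNIV) = min (x $ i) (1 - x $ i)" by blast
  then have "min (x $ i) (1 - x $ i) \<le> l" using assms by (simp add: cube_dist_def)
  then show ?thesis by (intro exI[of _ i]) (auto simp: min_def split: if_splits)
qed

lemma cube_dist_le_1: "cube_dist (x::real^'d::finite) \<le> 1"
proof -
  have "Min ((\<lambda>i. min (x $ i) (1 - x $ i)) ` UNIV) \<le> min (x $ undefined) (1 - x $ undefined)" by (intro Min_le) auto
  also have "\<dots> \<le> 1" by linarith
  finally show ?thesis by (simp add: cube_dist_def)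
qed

text \<open>A layer of depth l along the faces, inside the cube enlarged by r; the enlargement
  leaves room for translates of subsets of the cube.\<close>

definition slab :: "real \<Rightarrow> real \<Rightarrow> (real^'d::finite) set" where
  "slab l r = {x. (\<forall>k. - r \<le> x $ k \<and> x $ k \<le> 1 + r) \<and> (\<exists>i. x $ i \<le> l \<or> 1 - l \<le> x $ i)}"

text \<open>One box for each of the 2 d faces covers the layer: one side has length l + r, the
  others 1 + 2 r \<le> 3.\<close>

lemma slab_measure:
  assumes r: "0 \<le> r" "r \<le> 1" and l: "0 \<le> l"
  shows "(slab l r :: (real^'d::finite) set) \<in> lmeasurable"
    "measure lebesgue (slab l r :: (real^'d) set) \<le> 2 * real CARD('d) * 3 ^ CARD('d) * (l + r)"
proof -
  let ?S = "slab l r :: (real^'d) set"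
  have eq: "?S = {x. \<forall>k. - r \<le> x $ k \<and> x $ k \<le> 1 + r} \<inter> (\<Union>i. {x. x $ i \<le> l} \<union> {x. 1 - l \<le> x $ i})"
    by (auto simp: slab_def)
  have "closed {x::real^'d. \<forall>k. - r \<le> x $ k \<and> x $ k \<le> 1 + r}"
    by (intro closed_Collect_all closed_Collect_conj closed_Collect_le continuous_intros)
  moreover have "closed (\<Union>i. {x::real^'d. x $ i \<le> l} \<union> {x. 1 - l \<le> x $ i})"
    by (intro closed_UN closed_Un ballI closed_Collect_le continuous_intros) simp
  ultimately have cl: "closed ?S" unfolding eq by (rule closed_Int)
  have "bounded ?S"
  proof (rule bounded_subset[OF bounded_cbox])
    show "?S \<subseteq> cbox (\<chi> k. - r) (\<chi> k. 1 + r)" by (auto simp: slab_def mem_box_cart)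
  qed
  then show lm: "?S \<in> lmeasurable" using cl by (simp add: compact_eq_bounded_closed lmeasurable_compact)
  define B1 :: "'d \<Rightarrow> (real^'d) set" where "B1 i = cbox (\<chi> k. - r) (\<chi> k. if k = i then l else 1 + r)" for i
  define B2 :: "'d \<Rightarrow> (real^'d) set" where "B2 i = cbox (\<chi> k. if k = i then 1 - l else - r) (\<chi> k. 1 + r)" for i
  have pr: "(\<Prod>k\<in>UNIV. if k = i then l + r else 1 + 2 * r) \<le> 3 ^ CARD('d) * (l + r)" for i :: 'd
  proof -
    have "(\<Prod>k\<in>UNIV. if k = i then l + r else 1 + 2 * r) = (l + r) * (\<Prod>k\<in>UNIV - {i}. if k = i then l + r else 1 + 2 * r)"
      using prod.remove[of UNIV i "\<lambda>k. if k = i then l + r else 1 + 2 * r"] by simp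
    also have "(\<Prod>k\<in>UNIV - {i}. if k = i then l + r else 1 + 2 * r) = (1 + 2 * r) ^ (CARD('d) - 1)"
      by (simp add: card_Diff_singleton)
    also have "\<dots> \<le> 3 ^ (CARD('d) - 1)" using r by (intro power_mono) auto
    also have "\<dots> \<le> (3::real) ^ CARD('d)" by (intro power_increasing) auto
    finally show ?thesis using r l by (simp add: mult.commute mult_right_mono)
  qed
  have m1: "measure lebesgue (B1 i) \<le> 3 ^ CARD('d) * (l + r)" for i
  proof -
    have "B1 i \<noteq> {}" unfolding B1_def using r l by (auto simp: interval_ne_empty_cart)
    then have "measure lebesgue (B1 i) = (\<Prod>k\<in>UNIV. (if k = i then l else 1 + r) - (- r))"
      unfolding B1_def by (simp add: content_cbox_cart)
    also have "\<dots> = (\<Prod>k\<in>UNIV. if k = i then l + r else 1 + 2 * r)" by (rule prod.cong) auto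
    finally show ?thesis using pr[of i] by simp
  qed
  have m2: "measure lebesgue (B2 i) \<le> 3 ^ CARD('d) * (l + r)" for i
  proof -
    have "B2 i \<noteq> {}" unfolding B2_def using r l by (auto simp: interval_ne_empty_cart)
    then have "measure lebesgue (B2 i) = (\<Prod>k\<in>UNIV. (1 + r) - (if k = i then 1 - l else - r))"
      unfolding B2_def by (simp add: content_cbox_cart)
    also have "\<dots> = (\<Prod>k\<in>UNIV. if k = i then l + r else 1 + 2 * r)" by (rule prod.cong) auto
    finally show ?thesis using pr[of i] by simp
  qed
  have sub: "?S \<subseteq> (\<Union>i. B1 i \<union> B2 i)"
  proof
    fix x assume x: "x \<in> ?S"
    then obtain i where "x $ i \<le> l \<or> 1 - l \<le> x $ i" by (auto simp: slab_def)
    then have "x \<in> B1 i \<or> x \<in> B2 i" using x by (auto simp: slab_def B1_def B2_def mem_box_cart)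
    then show "x \<in> (\<Union>i. B1 i \<union> B2 i)" by blast
  qed
  have B: "B1 i \<in> lmeasurable" "B2 i \<in> lmeasurable" for i by (auto simp: B1_def B2_def)
  have "measure lebesgue ?S \<le> measure lebesgue (\<Union>i. B1 i \<union> B2 i)"
    using B lm by (intro measure_mono_fmeasurable[OF sub]) (auto intro!: fmeasurable.finite_UN)
  also have "\<dots> \<le> (\<Sum>i\<in>UNIV. measure lebesgue (B1 i \<union> B2 i))"
    using B by (intro measure_UNION_le) auto
  also have "\<dots> \<le> (\<Sum>i\<in>(UNIV::'d set). 3 ^ CARD('d) * (l + r) + 3 ^ CARD('d) * (l + r))"
    using B m1 m2 by (intro sum_mono order.trans[OF measure_Un_le] add_mono) auto
  also have "\<dots> = 2 * real CARD('d) * 3 ^ CARD('d) * (l + r)" by simp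
  finally show "measure lebesgue ?S \<le> 2 * real CARD('d) * 3 ^ CARD('d) * (l + r)" .
qed

text \<open>The translates of \<open>P\<close> by multiples of \<open>3 \<eta> \<xi>\<close> up to length \<open>h\<close> are pairwise disjoint.\<close>

lemma periodic_slab_measure:
  fixes P :: "(real^'d::finite) set"
  assumes P: "P \<in> lmeasurable" and W: "W \<in> lmeasurable" and \<xi>: "norm \<xi> = 1" and \<eta>: "0 < \<eta>" "3 * \<eta> \<le> h"
    and near: "\<And>x. x \<in> P \<Longrightarrow> \<exists>k::int. \<bar>x \<bullet> \<xi> - of_int k * h\<bar> \<le> \<eta>"
    and sub: "\<And>x r. x \<in> P \<Longrightarrow> 0 \<le> r \<Longrightarrow> r \<le> h \<Longrightarrow> x + r *\<^sub>R \<xi> \<in> W"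
  shows "measure lebesgue P \<le> 6 * \<eta> / h * measure lebesgue W"
proof -
  define M where "M = nat \<lfloor>h / (3 * \<eta>)\<rfloor>"
  have q: "h / (3 * \<eta>) \<ge> 1" using \<eta> by simp
  have M1: "real M \<le> h / (3 * \<eta>)" using q by (simp add: M_def)
  \<comment> \<open>Rounding down a number that is at least 1 loses at most a factor 2, hence 6
    instead of 3 in the conclusion.\<close>
  have M2: "real M \<ge> h / (6 * \<eta>)"
  proof -
    have "real M \<ge> 1" using q by (simp add: M_def le_nat_floor)
    moreover have "real M > h / (3 * \<eta>) - 1" using q unfolding M_def by linarith
    ultimately have "2 * real M \<ge> h / (3 * \<eta>)" by linarith
    then show ?thesis using \<eta> by (simp add: field_simps)
  qed
  have M3: "real M * (3 * \<eta>) \<le> h" using M1 \<eta> by (simp add: field_simps)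
  define T where "T m = (+) ((real m * (3 * \<eta>)) *\<^sub>R \<xi>) ` P" for m :: nat
  have TP: "T m \<in> lmeasurable" "measure lebesgue (T m) = measure lebesgue P" for m
    unfolding T_def using P by (auto simp: measurable_translation measure_translation)
  have \<xi>\<xi>: "\<xi> \<bullet> \<xi> = 1" using \<xi> by (simp add: dot_square_norm)
  have "disjoint_family_on T {..<M}"
    unfolding disjoint_family_on_def
  proof (intro ballI impI)
    fix m n assume mn: "m \<in> {..<M}" "n \<in> {..<M}" "m \<noteq> n"
    have aux: False if lt: "n < m" "m < M" and y: "y \<in> T m" "y \<in> T n" for m n y
    proof -
      obtain x x' where x: "x \<in> P" "y = (real m * (3 * \<eta>)) *\<^sub>R \<xi> + x" and x': "x' \<in> P" "y = (real n * (3 * \<eta>)) *\<^sub>R \<xi> + x'"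
        using y by (auto simp: T_def)
      obtain k k' :: int where k: "\<bar>x \<bullet> \<xi> - of_int k * h\<bar> \<le> \<eta>" "\<bar>x' \<bullet> \<xi> - of_int k' * h\<bar> \<le> \<eta>"
        using near[OF x(1)] near[OF x'(1)] by blast
      have "y \<bullet> \<xi> = real m * (3 * \<eta>) + x \<bullet> \<xi>" unfolding x(2) using \<xi>\<xi> by (simp add: inner_add_left)
      moreover have "y \<bullet> \<xi> = real n * (3 * \<eta>) + x' \<bullet> \<xi>" unfolding x'(2) using \<xi>\<xi> by (simp add: inner_add_left)
      ultimately have e: "\<bar>(real m - real n) * (3 * \<eta>) + of_int (k - k') * h\<bar> \<le> 2 * \<eta>"
        using k by (simp add: algebra_simps abs_le_iff)
      \<comment> \<open>Two translates differ by at least 3 \<eta> and at most h - 3 \<eta>, modulo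
        multiples of h, whereas a common point would make this difference at most 2 \<eta> in
        modulus modulo h.\<close>
      have mn1: "real m - real n \<ge> 1" "real m - real n \<le> real M - 1" using lt by auto
      have a1: "(real m - real n) * (3 * \<eta>) \<ge> 3 * \<eta>" using mult_right_mono[OF mn1(1), of "3 * \<eta>"] \<eta>(1) by simp
      have "(real m - real n) * (3 * \<eta>) \<le> (real M - 1) * (3 * \<eta>)" using mult_right_mono[OF mn1(2), of "3 * \<eta>"] \<eta>(1) by simp
      then have a2: "(real m - real n) * (3 * \<eta>) \<le> h - 3 * \<eta>" using M3 by (simp add: algebra_simps)
      have h: "h > 0" using \<eta> by linarith
      consider "k - k' \<ge> 0" | "k - k' \<le> -1" by linarith
      then show False
      proof cases
        case 1
        then have "of_int (k - k') * h \<ge> 0" using h by (simp del: of_int_diff)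
        then show False using e a1 \<eta>(1) by linarith
      next
        case 2
        then have "real_of_int (k - k') \<le> -1" by linarith
        then have "of_int (k - k') * h \<le> (-1) * h" using h by (intro mult_right_mono) auto
        then show False using e a2 \<eta>(1) by linarith
      qed
    qed
    show "T m \<inter> T n = {}"
    proof (rule equals0I)
      fix y assume "y \<in> T m \<inter> T n"
      then show False using aux[of n m y] aux[of m n y] mn by (cases "n < m") auto
    qed
  qed
  then have "measure lebesgue (\<Union>m\<in>{..<M}. T m) = (\<Sum>m<M. measure lebesgue (T m))"
  proof (intro measure_finite_Union)
    show "T ` {..<M} \<subseteq> sets lebesgue" using fmeasurableD[OF TP(1)] by blast
    show "emeasure lebesgue (T m) \<noteq> \<infinity>" for m using fmeasurableD2[OF TP(1)] by simp
  qed simp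
  then have "real M * measure lebesgue P = measure lebesgue (\<Union>m\<in>{..<M}. T m)" using TP by simp
  also have "\<dots> \<le> measure lebesgue W"
  proof (rule measure_mono_fmeasurable[OF _ _ W])
    show "(\<Union>m\<in>{..<M}. T m) \<subseteq> W"
    proof
      fix y assume "y \<in> (\<Union>m\<in>{..<M}. T m)"
      then obtain m x where m: "m < M" and x: "x \<in> P" "y = x + (real m * (3 * \<eta>)) *\<^sub>R \<xi>"
        by (auto simp: T_def add.commute)
      have "real m * (3 * \<eta>) \<le> real M * (3 * \<eta>)" using m \<eta>(1) by (intro mult_right_mono) auto
      then have "real m * (3 * \<eta>) \<le> h" by (rule order.trans[OF _ M3])
      moreover have "0 \<le> real m * (3 * \<eta>)" using \<eta>(1) by simp
      ultimately have "real m * (3 * \<eta>) \<le> h" "0 \<le> real m * (3 * \<eta>)" .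
      then show "y \<in> W" using sub[OF x(1)] x(2) by blast
    qed
    show "(\<Union>m\<in>{..<M}. T m) \<in> sets lebesgue" using TP by (intro sets.finite_UN) auto
  qed
  finally have "h / (6 * \<eta>) * measure lebesgue P \<le> measure lebesgue W"
    using mult_right_mono[OF M2, of "measure lebesgue P"] by simp
  then show ?thesis using \<eta> by (simp add: field_simps)
qed

text \<open>On the \<open>j\<close>-th scale the laminate has period \<open>hh j\<close> and pays the slope \<open>kap j\<close>; the two factors 4
  and 2 are chosen such that scale \<open>j\<close> is active only where \<open>cube_dist\<close> is at most of order \<open>8\<^sup>-\<^sup>j\<close>, and scale
  \<open>J\<close> is replaced by a cutoff.\<close>

locale branching =
  fixes \<xi> :: "real^'d::finite" and t :: real and J :: nat
  assumes \<xi>: "norm \<xi> = 1" and t: "0 < t" "t < 1" and J: "J \<ge> 1"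
begin

text \<open>The quarter makes the slopes of the tents, t and 1 - t, at least 4 times every penalty
  slope; \<open>piece_strict_decrease\<close> depends on this margin.\<close>

definition c0 :: real where "c0 = min t (1 - t) / 4"
definition hh :: "nat \<Rightarrow> real" where "hh j = 1 / (2 ^ J * 4 ^ j)"
definition kap :: "nat \<Rightarrow> real" where "kap j = c0 * 2 ^ j / 2 ^ J"
text \<open>The two slopes are the two values of f, so that the gradient t \<xi> or (t - 1) \<xi>
  corresponds exactly to one of the phases.\<close>

definition tent :: "real \<Rightarrow> real" where "tent y = max (t * y) ((t - 1) * y)"
text \<open>On the cube x \<bullet> \<xi> is at most d in modulus, and every period used is at least
  8^(-J), so these translates reach all kinks near the cube.\<close>

definition M :: int where "M = \<lceil>real CARD('d) * 8 ^ J\<rceil> + 1"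
definition I :: "(nat \<times> int) set" where "I = {..<J} \<times> {- M..M}"
definition piece :: "nat \<times> int \<Rightarrow> real^'d \<Rightarrow> real" where
  "piece i x = tent (x \<bullet> \<xi> - of_int (snd i) * hh (fst i)) + kap (fst i) * cube_dist x"
definition Phit :: "real^'d \<Rightarrow> real" where "Phit x = Min ((\<lambda>i. piece i x) ` I)"
text \<open>The cutoff forces the potential to vanish on and outside the boundary of the cube, which
  gives u = F there; it acts like a scale J without oscillation.\<close>

definition Phi :: "real^'d \<Rightarrow> real" where "Phi x = min (Phit x) (c0 * cube_dist x)"
text \<open>The region of phase B. The existential quantifier makes it a finite union of Borel sets;
  off E every active piece is at or to the left of its kink.\<close>

definition E :: "(real^'d) set" where
  "E = {x. \<exists>i\<in>I. piece i x = Phit x \<and> of_int (snd i) * hh (fst i) < x \<bullet> \<xi>}"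

lemma c0: "c0 > 0" "c0 \<le> 1 / 8" "4 * c0 \<le> t" "4 * c0 \<le> 1 - t"
  using t by (auto simp: c0_def min_def)

lemma hh: "hh j > 0" "hh j \<le> 1"
proof -
  show "hh j > 0" by (simp add: hh_def)
  have "(1::real) \<le> 2 ^ J * 4 ^ j" using mult_mono[of 1 "2 ^ J" 1 "4 ^ j :: real"] by simp
  then show "hh j \<le> 1" by (simp add: hh_def)
qed

lemma kap: "kap j > 0" "j < J \<Longrightarrow> kap j \<le> c0 / 2"
proof -
  show "kap j > 0" using c0 by (simp add: kap_def)
  assume "j < J"
  then have "(2::real) ^ Suc j \<le> 2 ^ J" by (intro power_increasing) auto
  then have "2 ^ j / 2 ^ J \<le> (1::real) / 2" by (simp add: field_simps)
  then have "c0 * (2 ^ j / 2 ^ J) \<le> c0 * (1 / 2)" using c0 by (intro mult_left_mono) auto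
  then show "kap j \<le> c0 / 2" by (simp add: kap_def)
qed

lemma tent: "tent y \<ge> 0" "\<bar>tent y - tent z\<bar> \<le> \<bar>y - z\<bar>" "0 \<le> y \<Longrightarrow> tent y = t * y" "y \<le> 0 \<Longrightarrow> tent y = (t - 1) * y"
proof -
  have p: "tent y = t * y" if "0 \<le> y" for y using that by (simp add: tent_def max_def algebra_simps)
  have n: "tent y = (t - 1) * y" if "y \<le> 0" for y using that by (simp add: tent_def max_def algebra_simps)
  show "0 \<le> y \<Longrightarrow> tent y = t * y" "y \<le> 0 \<Longrightarrow> tent y = (t - 1) * y" by (rule p, simp) (rule n, simp)
  show "tent y \<ge> 0"
  proof (cases "y \<ge> 0")
    case True then show ?thesis using p t by simp
  next
    case False then show ?thesis using n t by (simp add: mult_nonpos_nonpos)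
  qed
  have 1: "\<bar>t * y - t * z\<bar> \<le> \<bar>y - z\<bar>"
    using t mult_right_mono[of t 1 "\<bar>y - z\<bar>"] by (simp add: right_diff_distrib[symmetric] abs_mult)
  have 2: "\<bar>(t - 1) * y - (t - 1) * z\<bar> \<le> \<bar>y - z\<bar>"
    using t mult_right_mono[of "\<bar>t - 1\<bar>" 1 "\<bar>y - z\<bar>"] by (simp add: right_diff_distrib[symmetric] abs_mult)
  show "\<bar>tent y - tent z\<bar> \<le> \<bar>y - z\<bar>" using 1 2 unfolding tent_def by (auto simp: max_def abs_le_iff)
qed

lemma I: "finite I" "I \<noteq> {}"
proof -
  have "-1 < real CARD('d) * 8 ^ J" by (rule less_le_trans[of _ 0]) auto
  then have "M \<ge> 0" using zero_le_ceiling[of "real CARD('d) * 8 ^ J"] unfolding M_def by linarith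
  then have "(0, 0) \<in> I" using J by (simp add: I_def)
  then show "I \<noteq> {}" by blast
qed (simp add: I_def)

lemma s_lipschitz: "\<bar>x \<bullet> \<xi> - y \<bullet> \<xi>\<bar> \<le> norm (x - y)"
  using Cauchy_Schwarz_ineq2[of "x - y" \<xi>] \<xi> by (simp add: inner_diff_left)

lemma piece_lipschitz:
  assumes "i \<in> I" shows "\<bar>piece i x - piece i y\<bar> \<le> 2 * norm (x - y)"
proof -
  have j: "fst i < J" using assms by (auto simp: I_def)
  have "\<bar>tent (x \<bullet> \<xi> - of_int (snd i) * hh (fst i)) - tent (y \<bullet> \<xi> - of_int (snd i) * hh (fst i))\<bar> \<le> norm (x - y)"
    using tent(2)[of "x \<bullet> \<xi> - of_int (snd i) * hh (fst i)" "y \<bullet> \<xi> - of_int (snd i) * hh (fst i)"] s_lipschitz[of x y] by simp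
  moreover have "\<bar>kap (fst i) * cube_dist x - kap (fst i) * cube_dist y\<bar> \<le> norm (x - y)"
  proof -
    have "kap (fst i) * \<bar>cube_dist x - cube_dist y\<bar> \<le> 1 * norm (x - y)"
      using kap[of "fst i"] j c0 cube_dist_lipschitz[of x y] by (intro mult_mono) auto
    then show ?thesis using kap(1)[of "fst i"] by (simp add: right_diff_distrib[symmetric] abs_mult)
  qed
  ultimately show ?thesis unfolding piece_def by linarith
qed

lemma Phit_lipschitz: "\<bar>Phit x - Phit y\<bar> \<le> 2 * norm (x - y)"
  unfolding Phit_def using piece_lipschitz by (intro Min_image_lipschitz[OF I]) auto

lemma Phit_continuous: "continuous_on S Phit"
proof -
  have "2-lipschitz_on S Phit" using Phit_lipschitz by (intro lipschitz_onI) (auto simp: dist_norm)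
  then show ?thesis by (rule lipschitz_on_continuous_on)
qed

lemma piece_continuous: "i \<in> I \<Longrightarrow> continuous_on S (piece i)"
proof -
  assume "i \<in> I"
  then have "2-lipschitz_on S (piece i)" using piece_lipschitz by (intro lipschitz_onI) (auto simp: dist_norm)
  then show ?thesis by (rule lipschitz_on_continuous_on)
qed

lemma Phit_le: "i \<in> I \<Longrightarrow> Phit x \<le> piece i x"
  unfolding Phit_def using I by (intro Min_le) auto

lemma Phit_active: "\<exists>i\<in>I. piece i x = Phit x"
proof -
  have "Phit x \<in> (\<lambda>i. piece i x) ` I" unfolding Phit_def using I by (intro Min_in) auto
  then show ?thesis by auto
qed

lemma piece_ge: "piece i x \<ge> kap (fst i) * cube_dist x"
  using tent(1) by (simp add: piece_def)

lemma Phit_nonneg: "Phit x \<ge> 0"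
proof -
  obtain i where "i \<in> I" "piece i x = Phit x" using Phit_active by blast
  then show ?thesis using piece_ge[of i x] kap(1)[of "fst i"] cube_dist_nonneg[of x]
    by (metis less_eq_real_def mult_nonneg_nonneg order.trans)
qed

lemma Phi_lipschitz: "\<bar>Phi x - Phi y\<bar> \<le> 2 * norm (x - y)"
proof -
  have "c0 * \<bar>cube_dist x - cube_dist y\<bar> \<le> 2 * norm (x - y)"
    using c0 cube_dist_lipschitz[of x y] by (intro mult_mono) auto
  then have "\<bar>c0 * cube_dist x - c0 * cube_dist y\<bar> \<le> 2 * norm (x - y)"
    using c0 by (simp add: right_diff_distrib[symmetric] abs_mult)
  then show ?thesis using Phit_lipschitz[of x y] unfolding Phi_def by (auto simp: min_def abs_le_iff)
qed

lemma Phi_bounded: "\<bar>Phi x\<bar> \<le> 1"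
proof -
  have "0 \<le> c0 * cube_dist x" using c0(1) cube_dist_nonneg[of x] by simp
  moreover have "c0 * cube_dist x \<le> 1 * 1" using c0 cube_dist_le_1 cube_dist_nonneg by (intro mult_mono) auto
  ultimately show ?thesis using Phit_nonneg[of x] by (auto simp: Phi_def min_def)
qed

lemma Phi_outside: "x \<notin> box 0 1 \<Longrightarrow> Phi x = 0"
  using Phit_nonneg[of x] by (simp add: Phi_def cube_dist_outside)

text \<open>The competitor is the tent of scale j at the nearest kink to the left of x, found by
  rounding down; its value there is at most the period.\<close>

lemma Phit_upper:
  assumes x: "x \<in> box 0 1" and j: "j < J"
  shows "Phit x \<le> hh j + kap j * cube_dist x"
proof -
  define k where "k = \<lfloor>(x \<bullet> \<xi>) / hh j\<rfloor>"
  have h: "hh j > 0" by (rule hh)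
  have k1: "of_int k * hh j \<le> x \<bullet> \<xi>" unfolding k_def using h by (simp add: pos_le_divide_eq[symmetric])
  have "(x \<bullet> \<xi>) / hh j < of_int k + 1" unfolding k_def by linarith
  then have k2: "x \<bullet> \<xi> < of_int k * hh j + hh j" using h by (simp add: pos_divide_less_eq algebra_simps)
  have "norm x \<le> (\<Sum>i\<in>UNIV. \<bar>x $ i\<bar>)" by (rule norm_le_l1_cart)
  also have "\<dots> \<le> (\<Sum>i\<in>(UNIV::'d set). 1)" using x by (intro sum_mono) (auto simp: mem_box_cart less_imp_le)
  finally have nx: "norm x \<le> real CARD('d)" by simp
  have sx: "\<bar>x \<bullet> \<xi>\<bar> \<le> real CARD('d)" using Cauchy_Schwarz_ineq2[of x \<xi>] \<xi> nx by simp
  have "(4::real) ^ j \<le> 4 ^ J" using j by (intro power_increasing) auto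
  then have "2 ^ J * 4 ^ j \<le> (2::real) ^ J * 4 ^ J" by simp
  also have "\<dots> = 8 ^ J" by (simp add: power_mult_distrib[symmetric])
  finally have p8: "2 ^ J * 4 ^ j \<le> (8::real) ^ J" .
  have "\<bar>(x \<bullet> \<xi>) / hh j\<bar> = \<bar>x \<bullet> \<xi>\<bar> * (2 ^ J * 4 ^ j)" by (simp add: hh_def abs_mult)
  also have "\<dots> \<le> real CARD('d) * 8 ^ J" using sx p8 by (intro mult_mono) auto
  finally have a: "\<bar>(x \<bullet> \<xi>) / hh j\<bar> \<le> real CARD('d) * 8 ^ J" .
  define C where "C = \<lceil>real CARD('d) * 8 ^ J\<rceil>"
  have "real CARD('d) * 8 ^ J \<le> of_int C" unfolding C_def by (rule le_of_int_ceiling)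
  with abs_le_D1[OF a] abs_le_D2[OF a] have "(x \<bullet> \<xi>) / hh j \<le> of_int C" "- ((x \<bullet> \<xi>) / hh j) \<le> of_int C" by linarith+
  then have "(x \<bullet> \<xi>) / hh j \<le> of_int C" "- of_int C \<le> (x \<bullet> \<xi>) / hh j" by linarith+
  then have "k \<le> C" "- C \<le> k" unfolding k_def by (simp_all add: le_floor_iff floor_le_iff)
  then have "k \<in> {- M..M}" unfolding M_def C_def[symmetric] by simp
  then have i: "(j, k) \<in> I" using j by (simp add: I_def)
  have "tent (x \<bullet> \<xi> - of_int k * hh j) = t * (x \<bullet> \<xi> - of_int k * hh j)" using k1 by (intro tent(3)) simp
  also have "\<dots> \<le> 1 * hh j" using k1 k2 t h by (intro mult_mono) auto
  finally have "piece (j, k) x \<le> hh j + kap j * cube_dist x" by (simp add: piece_def)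
  then show ?thesis using Phit_le[OF i, of x] by linarith
qed

text \<open>The penalty doubles from one scale to the next, so if scale j + 1 does not exceed the
  upper bound for scale j, then \<open>kap j * \<rho> \<le> hh j\<close>, and this quotient is
  8^(-j) / c0. The slope is written out so that Suc j = J, the cutoff with slope c0, is
  included.\<close>

lemma scale_gap:
  assumes "j < J" "(c0 * 2 ^ Suc j / 2 ^ J) * \<rho> \<le> hh j + kap j * \<rho>"
  shows "\<rho> \<le> 8 / c0 / 8 ^ Suc j"
proof -
  have "c0 * 2 ^ Suc j / 2 ^ J = 2 * kap j" by (simp add: kap_def)
  then have "2 * (kap j * \<rho>) \<le> hh j + kap j * \<rho>" using assms(2) by (simp add: mult.assoc)
  then have "kap j * \<rho> \<le> hh j" by linarith
  then have "(c0 * 2 ^ j / 2 ^ J) * \<rho> \<le> 1 / (2 ^ J * 4 ^ j)" by (simp add: hh_def kap_def)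
  then have "(2 ^ J / (c0 * 2 ^ j)) * ((c0 * 2 ^ j / 2 ^ J) * \<rho>) \<le> (2 ^ J / (c0 * 2 ^ j)) * (1 / (2 ^ J * 4 ^ j))"
    using c0 by (intro mult_left_mono) auto
  then have "\<rho> \<le> 1 / (c0 * (2 ^ j * 4 ^ j))" using c0 by (simp add: mult.assoc)
  also have "(2::real) ^ j * 4 ^ j = 8 ^ j" by (simp add: power_mult_distrib[symmetric])
  finally show ?thesis by simp
qed

text \<open>An active scale j + 1 is compared with the competitor of scale j; for j = 0 the bound
  exceeds 1 and says nothing.\<close>

lemma active_cube_dist:
  assumes x: "x \<in> box 0 1" and i: "i \<in> I" "piece i x = Phit x"
  shows "cube_dist x \<le> 8 / c0 / 8 ^ fst i"
proof (cases "fst i")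
  case 0
  have "1 \<le> 8 / c0" using c0 by simp
  then show ?thesis using cube_dist_le_1[of x] 0 by simp
next
  case (Suc j)
  have j: "j < J" using i(1) Suc by (auto simp: I_def)
  have "(c0 * 2 ^ Suc j / 2 ^ J) * cube_dist x = kap (fst i) * cube_dist x" by (simp add: kap_def Suc)
  also have "\<dots> \<le> hh j + kap j * cube_dist x" using piece_ge[of i x] i(2) Phit_upper[OF x j] by linarith
  finally show ?thesis using scale_gap[OF j] Suc by simp
qed

text \<open>Where the cutoff wins, it is compared with scale J - 1, so the cutoff region is a layer
  of width of order 8^(-J).\<close>

lemma cutoff_cube_dist:
  assumes x: "x \<in> box 0 1" and le: "c0 * cube_dist x \<le> Phit x"
  shows "cube_dist x \<le> 8 / c0 / 8 ^ J"
proof -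
  obtain j where j: "J = Suc j" using J by (cases J) auto
  have "(c0 * 2 ^ Suc j / 2 ^ J) * cube_dist x = c0 * cube_dist x" by (simp add: j)
  also have "\<dots> \<le> hh j + kap j * cube_dist x" using le Phit_upper[OF x, of j] j by linarith
  finally show ?thesis using scale_gap[of j "cube_dist x"] j by simp
qed

text \<open>Each value comes from the cutoff or from an index, a branch of its tent and an affine
  piece of \<open>cube_dist\<close>: finitely many choices in all.\<close>

lemma Phi_selection:
  "\<exists>\<Lambda>. finite \<Lambda> \<and> (\<forall>x. \<exists>(p, c)\<in>\<Lambda>. Phi x = p \<bullet> x + c)"
proof -
  define R :: "((real^'d) \<times> real) set" where "R = insert (0, 0) ((\<lambda>i. (axis i 1, 0)) ` UNIV \<union> (\<lambda>i. (- axis i 1, 1)) ` (UNIV :: 'd set))"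
  have R: "finite R" by (simp add: R_def)
  have Rs: "\<exists>(p, c)\<in>R. cube_dist x = p \<bullet> x + c" for x
  proof -
    have "(0, 0) \<in> R" "(axis i 1, 0) \<in> R" "(- axis i 1, 1) \<in> R" for i by (auto simp: R_def)
    then show ?thesis using cube_dist_selection[of x] by (elim disjE exE) (force simp: inner_axis')+
  qed
  define A1 where "A1 = (\<lambda>(i, p, c). (t *\<^sub>R \<xi> + kap (fst i) *\<^sub>R p, - t * (of_int (snd i) * hh (fst i)) + kap (fst i) * c)) ` (I \<times> R)"
  define A2 where "A2 = (\<lambda>(i, p, c). ((t - 1) *\<^sub>R \<xi> + kap (fst i) *\<^sub>R p, - (t - 1) * (of_int (snd i) * hh (fst i)) + kap (fst i) * c)) ` (I \<times> R)"
  define A3 where "A3 = (\<lambda>(p, c). (c0 *\<^sub>R p, c0 * c)) ` R"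
  have "finite (A1 \<union> A2 \<union> A3)" using I R by (simp add: A1_def A2_def A3_def)
  moreover have "\<exists>(p, c)\<in>A1 \<union> A2 \<union> A3. Phi x = p \<bullet> x + c" for x
  proof -
    obtain p c where pc: "(p, c) \<in> R" "cube_dist x = p \<bullet> x + c" using Rs[of x] by blast
    obtain i where i: "i \<in> I" "piece i x = Phit x" using Phit_active by blast
    have a1: "(t *\<^sub>R \<xi> + kap (fst i) *\<^sub>R p, - t * (of_int (snd i) * hh (fst i)) + kap (fst i) * c) \<in> A1"
      unfolding A1_def by (rule image_eqI[of _ _ "(i, p, c)"]) (use i pc in auto)
    have a2: "((t - 1) *\<^sub>R \<xi> + kap (fst i) *\<^sub>R p, - (t - 1) * (of_int (snd i) * hh (fst i)) + kap (fst i) * c) \<in> A2"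
      unfolding A2_def by (rule image_eqI[of _ _ "(i, p, c)"]) (use i pc in auto)
    have a3: "(c0 *\<^sub>R p, c0 * c) \<in> A3" unfolding A3_def by (rule image_eqI[of _ _ "(p, c)"]) (use pc in auto)
    consider "Phi x = t * (x \<bullet> \<xi> - of_int (snd i) * hh (fst i)) + kap (fst i) * cube_dist x"
      | "Phi x = (t - 1) * (x \<bullet> \<xi> - of_int (snd i) * hh (fst i)) + kap (fst i) * cube_dist x" | "Phi x = c0 * cube_dist x"
    proof -
      have "Phi x = Phit x \<or> Phi x = c0 * cube_dist x" by (simp add: Phi_def min_def)
      moreover have "tent y = t * y \<or> tent y = (t - 1) * y" for y using tent(3,4)[of y] by linarith
      ultimately show ?thesis using i(2)[symmetric] that unfolding piece_def by metis
    qed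
    then show ?thesis
    proof cases
      case 1 then show ?thesis using a1 pc(2) by (intro bexI[OF _ UnI1[OF UnI1[OF a1]]]) (auto simp: inner_add_left inner_commute algebra_simps)
    next
      case 2 then show ?thesis using a2 pc(2) by (intro bexI[OF _ UnI1[OF UnI2[OF a2]]]) (auto simp: inner_add_left inner_commute algebra_simps)
    next
      case 3 then show ?thesis using a3 pc(2) by (intro bexI[OF _ UnI2[OF a3]]) (auto simp: algebra_simps)
    qed
  qed
  ultimately show ?thesis by (intro exI[of _ "A1 \<union> A2 \<union> A3"] conjI allI)
qed


section \<open>The phase function and the elastic error\<close>

definition phase :: "real^'d \<Rightarrow> real" where "phase x = (if x \<in> E then t else t - 1)"

lemma E_borel: "E \<in> sets borel"
proof -
  have eq: "E = (\<Union>i\<in>I. {x. piece i x = Phit x} \<inter> {x. of_int (snd i) * hh (fst i) < x \<bullet> \<xi>})" by (auto simp: E_def)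
  have "{x. piece i x = Phit x} \<inter> {x. of_int (snd i) * hh (fst i) < x \<bullet> \<xi>} \<in> sets borel" if "i \<in> I" for i
  proof (rule sets.Int)
    show "{x. piece i x = Phit x} \<in> sets borel"
      by (intro borel_closed closed_Collect_eq piece_continuous Phit_continuous that)
    show "{x. of_int (snd i) * hh (fst i) < x \<bullet> \<xi>} \<in> sets borel"
      by (intro borel_open open_Collect_less continuous_intros)
  qed
  then show ?thesis unfolding eq using I by (intro sets.finite_UN) auto
qed

lemma hyperplanes_negligible: "negligible (\<Union>i\<in>I. {x. \<xi> \<bullet> x = of_int (snd i) * hh (fst i)})"
proof (intro negligible_Union finite_imageI I)
  fix S assume "S \<in> (\<lambda>i. {x. \<xi> \<bullet> x = of_int (snd i) * hh (fst i)}) ` I"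
  then show "negligible S" using \<xi> negligible_hyperplane[of \<xi>] by force
qed

text \<open>The difference has a minimum at the point of contact. This reads off the gradient of a
  minimum from any one active piece, without knowing which pieces are active nearby.\<close>

lemma touching_gradients:
  fixes u w :: "real^'d \<Rightarrow> real"
  assumes "(u has_derivative (\<lambda>h. p \<bullet> h)) (at x)" "(w has_derivative (\<lambda>h. q \<bullet> h)) (at x)"
    and "\<And>y. u y \<le> w y" "u x = w x"
  shows "p = q"
proof -
  have "((\<lambda>y. w y - u y) has_derivative (\<lambda>h. q \<bullet> h - p \<bullet> h)) (at x)"
    by (intro has_derivative_diff assms)
  then have "(\<lambda>h. q \<bullet> h - p \<bullet> h) = (\<lambda>h. 0)"
    by (rule has_derivative_local_min) (use assms in simp)
  then have "q \<bullet> (q - p) - p \<bullet> (q - p) = 0" by meson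
  then have "(q - p) \<bullet> (q - p) = 0" by (simp add: inner_diff_left)
  then show ?thesis by simp
qed

lemma tent_derivative:
  assumes "y \<noteq> 0" shows "(tent has_real_derivative (if y > 0 then t else t - 1)) (at y)"
proof (cases "y > 0")
  case True
  have "((\<lambda>y. t * y) has_real_derivative t) (at y)" by (auto intro!: derivative_eq_intros)
  then have "(tent has_real_derivative t) (at y)"
    by (rule has_field_derivative_transform_within_open[of _ _ _ "{0<..}"]) (use True tent(3) in auto)
  then show ?thesis using True by simp
next
  case False
  have "((\<lambda>y. (t - 1) * y) has_real_derivative (t - 1)) (at y)" by (auto intro!: derivative_eq_intros)
  then have "(tent has_real_derivative (t - 1)) (at y)"
    by (rule has_field_derivative_transform_within_open[of _ _ _ "{..<0}"]) (use False assms tent(4) in auto)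
  then show ?thesis using False by simp
qed

lemma piece_derivative:
  assumes "(cube_dist has_derivative (\<lambda>h. q \<bullet> h)) (at x)" "x \<bullet> \<xi> \<noteq> of_int (snd i) * hh (fst i)"
  shows "(piece i has_derivative (\<lambda>h. ((if x \<bullet> \<xi> > of_int (snd i) * hh (fst i) then t else t - 1) *\<^sub>R \<xi> + kap (fst i) *\<^sub>R q) \<bullet> h)) (at x)"
proof -
  define y where "y = x \<bullet> \<xi> - of_int (snd i) * hh (fst i)"
  define a where "a = (if y > 0 then t else t - 1)"
  have "y \<noteq> 0" using assms(2) by (simp add: y_def)
  then have "(tent has_derivative (*) a) (at y)" using tent_derivative unfolding a_def by (simp add: has_field_derivative_def)
  then have "((\<lambda>x. tent (x \<bullet> \<xi> - of_int (snd i) * hh (fst i))) has_derivative (\<lambda>h. a * (h \<bullet> \<xi>))) (at x)"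
    unfolding y_def
    by (rule has_derivative_compose[of "\<lambda>x. x \<bullet> \<xi> - of_int (snd i) * hh (fst i)" "\<lambda>h. h \<bullet> \<xi>" x UNIV, rotated])
       (auto intro!: derivative_eq_intros)
  then have "(piece i has_derivative (\<lambda>h. a * (h \<bullet> \<xi>) + kap (fst i) * (q \<bullet> h))) (at x)"
    unfolding piece_def by (intro has_derivative_add has_derivative_mult_right assms(1))
  moreover have "(\<lambda>h. a * (h \<bullet> \<xi>) + kap (fst i) * (q \<bullet> h)) = (\<lambda>h. (a *\<^sub>R \<xi> + kap (fst i) *\<^sub>R q) \<bullet> h)"
    by (auto simp: inner_add_left inner_add_right inner_commute)
  ultimately show ?thesis unfolding a_def y_def by simp
qed

text \<open>A sum over all scales that may be active at x, so that the actual one need not be known.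
  Scale j errs by its penalty slope, confined to the layer where it can be active; on the cutoff
  layer the error is at most 2 = 1 + 1.\<close>

definition error_density :: "real^'d \<Rightarrow> real" where
  "error_density x = (\<Sum>j<J. (kap j)\<^sup>2 * indicat_real {x. cube_dist x \<le> 8 / c0 / 8 ^ j} x) +
     4 * indicat_real {x. cube_dist x \<le> 8 / c0 / 8 ^ J} x"

lemma error_density_nonneg: "error_density x \<ge> 0"
  unfolding error_density_def by (intro add_nonneg_nonneg sum_nonneg) auto

lemma gradient_error:
  assumes x: "x \<in> box 0 1" and g: "(Phi has_derivative (\<lambda>h. g \<bullet> h)) (at x)"
    and q: "(cube_dist has_derivative (\<lambda>h. q \<bullet> h)) (at x)" "norm q \<le> 1"
    and ne: "\<And>i. i \<in> I \<Longrightarrow> x \<bullet> \<xi> \<noteq> of_int (snd i) * hh (fst i)"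
  shows "(norm (g - phase x *\<^sub>R \<xi>))\<^sup>2 \<le> error_density x"
proof (cases "Phit x \<le> c0 * cube_dist x")
  case True
  then have eq: "Phi x = Phit x" by (simp add: Phi_def)
  \<comment> \<open>Among the active pieces one with the slope of the phase is chosen: in E the
    witness of membership, off E any active piece.\<close>
  have "\<exists>i\<in>I. piece i x = Phit x \<and> (if x \<bullet> \<xi> > of_int (snd i) * hh (fst i) then t else t - 1) = phase x"
  proof (cases "x \<in> E")
    case True
    then show ?thesis unfolding E_def phase_def by auto
  next
    case False
    obtain i where i: "i \<in> I" "piece i x = Phit x" using Phit_active by blast
    then have "\<not> x \<bullet> \<xi> > of_int (snd i) * hh (fst i)" using False unfolding E_def by blast
    then show ?thesis using i False by (intro bexI[of _ i]) (simp_all add: phase_def)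
  qed
  then obtain i where i: "i \<in> I" "piece i x = Phit x"
    and ph: "(if x \<bullet> \<xi> > of_int (snd i) * hh (fst i) then t else t - 1) = phase x" by blast
  have "g = phase x *\<^sub>R \<xi> + kap (fst i) *\<^sub>R q"
  proof (rule touching_gradients[OF g piece_derivative[OF q(1) ne[OF i(1)], unfolded ph]])
    show "Phi y \<le> piece i y" for y using Phit_le[OF i(1), of y] by (simp add: Phi_def)
    show "Phi x = piece i x" using eq i(2) by simp
  qed
  then have "norm (g - phase x *\<^sub>R \<xi>) = kap (fst i) * norm q" using kap(1)[of "fst i"] by simp
  also have "\<dots> \<le> kap (fst i) * 1" using q(2) kap(1)[of "fst i"] by (intro mult_left_mono) auto
  finally have "(norm (g - phase x *\<^sub>R \<xi>))\<^sup>2 \<le> (kap (fst i))\<^sup>2" by (intro power_mono) auto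
  also have "\<dots> = (kap (fst i))\<^sup>2 * indicat_real {x. cube_dist x \<le> 8 / c0 / 8 ^ fst i} x"
    using active_cube_dist[OF x i] by simp
  also have "\<dots> \<le> (\<Sum>j<J. (kap j)\<^sup>2 * indicat_real {x. cube_dist x \<le> 8 / c0 / 8 ^ j} x)"
    using i(1) by (intro member_le_sum) (auto simp: I_def)
  also have "\<dots> \<le> error_density x" unfolding error_density_def by simp
  finally show ?thesis .
next
  case False
  then have eq: "Phi x = c0 * cube_dist x" by (simp add: Phi_def)
  have "g = c0 *\<^sub>R q"
  proof (rule touching_gradients[OF g])
    have "((\<lambda>y. c0 * cube_dist y) has_derivative (\<lambda>h. c0 * (q \<bullet> h))) (at x)" by (rule has_derivative_mult_right[OF q(1)])
    then show "((\<lambda>y. c0 * cube_dist y) has_derivative (\<lambda>h. (c0 *\<^sub>R q) \<bullet> h)) (at x)" by simp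
    show "Phi y \<le> c0 * cube_dist y" for y by (simp add: Phi_def)
  qed (rule eq)
  then have "norm g \<le> 1" using c0 q(2) mult_mono[of c0 1 "norm q" 1] by simp
  moreover have "norm (phase x *\<^sub>R \<xi>) \<le> 1" using \<xi> t by (simp add: phase_def)
  ultimately have "norm (g - phase x *\<^sub>R \<xi>) \<le> 2" using norm_triangle_ineq4[of g "phase x *\<^sub>R \<xi>"] by linarith
  then have "(norm (g - phase x *\<^sub>R \<xi>))\<^sup>2 \<le> 2\<^sup>2" by (intro power_mono) auto
  also have "\<dots> = 4 * indicat_real {x. cube_dist x \<le> 8 / c0 / 8 ^ J} x"
    using cutoff_cube_dist[OF x] False by simp
  also have "\<dots> \<le> error_density x" unfolding error_density_def by (simp add: sum_nonneg)
  finally show ?thesis .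
qed

definition slab_const :: real where "slab_const = 2 * real CARD('d) * 3 ^ CARD('d)"

lemma slab_const: "slab_const > 0" by (simp add: slab_const_def)

lemma boundary_layer:
  assumes l: "l \<ge> 0"
  shows "box 0 1 \<inter> {x::real^'d. cube_dist x \<le> l} \<in> lmeasurable"
    "measure lebesgue (box 0 1 \<inter> {x::real^'d. cube_dist x \<le> l}) \<le> slab_const * l"
proof -
  have "closed {x::real^'d. cube_dist x \<le> l}" by (intro closed_Collect_le cube_dist_continuous continuous_intros)
  then have m: "{x::real^'d. cube_dist x \<le> l} \<in> sets lebesgue" by simp
  show lm: "box 0 1 \<inter> {x::real^'d. cube_dist x \<le> l} \<in> lmeasurable" by (rule fmeasurable_Int_fmeasurable[OF lmeasurable_box m])
  have "box 0 1 \<inter> {x::real^'d. cube_dist x \<le> l} \<subseteq> slab l 0"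
    using cube_dist_small by (auto simp: slab_def mem_box_cart less_imp_le)
  then have "measure lebesgue (box 0 1 \<inter> {x::real^'d. cube_dist x \<le> l}) \<le> measure lebesgue (slab l 0 :: (real^'d) set)"
    using lm slab_measure(1)[of 0 l] l by (intro measure_mono_fmeasurable) auto
  also have "\<dots> \<le> slab_const * l" using slab_measure(2)[of 0 l] l by (simp add: slab_const_def)
  finally show "measure lebesgue (box 0 1 \<inter> {x::real^'d. cube_dist x \<le> l}) \<le> slab_const * l" .
qed

text \<open>The squared slope is of order 4^j / 4^J and the layer has width of order 8^(-j), so the
  terms decay geometrically with ratio 1 / 2. The factor 6 is 2 from this series and 4 from the
  cutoff layer.\<close>

lemma error_density_integral:
  "(\<integral>\<^sup>+x\<in>box 0 1. ennreal (error_density x) \<partial>lebesgue) \<le> ennreal (slab_const * (8 / c0) * 6 / 4 ^ J)"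
proof -
  define S where "S j = box 0 1 \<inter> {x::real^'d. cube_dist x \<le> 8 / c0 / 8 ^ j}" for j :: nat
  have l0: "8 / c0 / 8 ^ j \<ge> 0" for j :: nat using c0 by simp
  have S: "S j \<in> lmeasurable" "measure lebesgue (S j) \<le> slab_const * (8 / c0) / 8 ^ j" for j
    using boundary_layer[OF l0[of j]] by (simp_all add: S_def)
  have Si: "integrable lebesgue (indicat_real (S j))" for j
    using S(1)[of j] by (auto simp: fmeasurable_def intro!: integrable_real_indicator)
  define D where "D x = (\<Sum>j<J. (kap j)\<^sup>2 * indicat_real (S j) x) + 4 * indicat_real (S J) x" for x
  have Di: "integrable lebesgue D" unfolding D_def
    by (intro Bochner_Integration.integrable_add Bochner_Integration.integrable_sum integrable_mult_right Si)
  have "ennreal (error_density x) * indicator (box 0 1) x = ennreal (D x)" for x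
    by (cases "x \<in> box 0 1") (auto simp: D_def error_density_def S_def indicator_def)
  then have "(\<integral>\<^sup>+x\<in>box 0 1. ennreal (error_density x) \<partial>lebesgue) = (\<integral>\<^sup>+x. ennreal (D x) \<partial>lebesgue)" by simp
  also have "\<dots> = ennreal (LINT x|lebesgue. D x)"
    by (rule nn_integral_eq_integral[OF Di]) (auto simp: D_def intro!: add_nonneg_nonneg sum_nonneg)
  also have "(LINT x|lebesgue. D x) = (\<Sum>j<J. (kap j)\<^sup>2 * measure lebesgue (S j)) + 4 * measure lebesgue (S J)"
  proof -
    have "(LINT x|lebesgue. D x) = (LINT x|lebesgue. (\<Sum>j<J. (kap j)\<^sup>2 * indicat_real (S j) x)) + (LINT x|lebesgue. 4 * indicat_real (S J) x)"
      unfolding D_def by (intro Bochner_Integration.integral_add Bochner_Integration.integrable_sum integrable_mult_right Si)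
    also have "(LINT x|lebesgue. (\<Sum>j<J. (kap j)\<^sup>2 * indicat_real (S j) x)) = (\<Sum>j<J. (LINT x|lebesgue. (kap j)\<^sup>2 * indicat_real (S j) x))"
      by (intro Bochner_Integration.integral_sum integrable_mult_right Si)
    finally show ?thesis by simp
  qed
  also have "ennreal \<dots> \<le> ennreal (slab_const * (8 / c0) * 6 / 4 ^ J)"
  proof (rule ennreal_leI)
    define A where "A = slab_const * (8 / c0)"
    have A: "A > 0" using slab_const c0 by (simp add: A_def)
    have "(kap j)\<^sup>2 * measure lebesgue (S j) \<le> A / 4 ^ J * (1 / 2) ^ j" for j
    proof -
      have kj: "(kap j)\<^sup>2 = c0\<^sup>2 * 4 ^ j / 4 ^ J" by (simp add: kap_def power2_eq_square power_mult_distrib[symmetric])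
      have "(kap j)\<^sup>2 * measure lebesgue (S j) \<le> (kap j)\<^sup>2 * (A / 8 ^ j)" using S(2)[of j] by (intro mult_left_mono) (auto simp: A_def)
      also have "\<dots> = c0\<^sup>2 * (A / 4 ^ J * (4 / 8) ^ j)" unfolding kj by (simp only: power_divide) simp
      also have "\<dots> \<le> 1 * (A / 4 ^ J * (4 / 8) ^ j)" using c0 A by (intro mult_right_mono power_le_one) auto
      finally show ?thesis by simp
    qed
    then have "(\<Sum>j<J. (kap j)\<^sup>2 * measure lebesgue (S j)) \<le> (\<Sum>j<J. A / 4 ^ J * (1 / 2) ^ j)" by (intro sum_mono)
    also have "\<dots> = A / 4 ^ J * (\<Sum>j<J. (1 / 2) ^ j)" by (simp add: sum_distrib_left)
    also have "\<dots> \<le> A / 4 ^ J * 2"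
    proof (rule mult_left_mono)
      show "(\<Sum>j<J. (1 / 2) ^ j) \<le> (2::real)" by (simp add: geometric_sum)
    qed (use A in simp)
    finally have 1: "(\<Sum>j<J. (kap j)\<^sup>2 * measure lebesgue (S j)) \<le> A / 4 ^ J * 2" .
    have "measure lebesgue (S J) \<le> A / 8 ^ J" using S(2)[of J] by (simp add: A_def)
    also have "\<dots> \<le> A / 4 ^ J" using A by (intro divide_left_mono power_mono) auto
    finally have 2: "4 * measure lebesgue (S J) \<le> 4 * (A / 4 ^ J)" by simp
    show "(\<Sum>j<J. (kap j)\<^sup>2 * measure lebesgue (S j)) + 4 * measure lebesgue (S J) \<le> slab_const * (8 / c0) * 6 / 4 ^ J"
    proof -
      have eq: "slab_const * (8 / c0) * 6 / 4 ^ J = A / 4 ^ J * 2 + 4 * (A / 4 ^ J)" unfolding A_def[symmetric] by simp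
      show ?thesis unfolding eq by (rule add_mono[OF 1 2])
    qed
  qed
  finally show ?thesis .
qed

text \<open>Towards the kink the tent falls at rate at least 4 c0 / 2, while the penalty grows at
  rate at most (c0 / 2) 2. Arbitrary directions b near \<xi> are allowed because the variation in
  all coordinate directions is needed later.\<close>

lemma piece_strict_decrease:
  assumes i: "i \<in> I" and b: "b \<bullet> \<xi> \<ge> 1 / 2" "norm b \<le> 2"
  shows "of_int (snd i) * hh (fst i) < x \<bullet> \<xi> \<Longrightarrow> \<exists>r0>0. \<forall>r. 0 < r \<and> r < r0 \<longrightarrow> piece i (x - r *\<^sub>R b) < piece i x"
    "x \<bullet> \<xi> < of_int (snd i) * hh (fst i) \<Longrightarrow> \<exists>r0>0. \<forall>r. 0 < r \<and> r < r0 \<longrightarrow> piece i (x + r *\<^sub>R b) < piece i x"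
proof -
  define z where "z = of_int (snd i) * hh (fst i)"
  have k: "kap (fst i) > 0" "kap (fst i) \<le> c0 / 2" using kap[of "fst i"] i by (auto simp: I_def)
  have cd: "kap (fst i) * cube_dist y \<le> kap (fst i) * cube_dist x + r * c0" if "norm (y - x) \<le> r * 2" "r \<ge> 0" for y r
  proof -
    have "cube_dist y \<le> cube_dist x + r * 2" using cube_dist_lipschitz[of y x] that by linarith
    then have "kap (fst i) * cube_dist y \<le> kap (fst i) * (cube_dist x + r * 2)" using k by (intro mult_left_mono) auto
    moreover have "kap (fst i) * (r * 2) \<le> (c0 / 2) * (r * 2)" using k that by (intro mult_right_mono) auto
    ultimately show ?thesis by (simp add: algebra_simps)
  qed
  have nb: "norm (r *\<^sub>R b) \<le> r * 2" if "r \<ge> 0" for r using b(2) that by (simp add: mult_left_mono)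
  { assume s: "of_int (snd i) * hh (fst i) < x \<bullet> \<xi>"
    have p: "piece i (x - r *\<^sub>R b) < piece i x" if r: "0 < r" "r < (x \<bullet> \<xi> - z) / (b \<bullet> \<xi>)" for r
    proof -
      have rb: "r * (b \<bullet> \<xi>) < x \<bullet> \<xi> - z" using r b(1) by (simp add: pos_less_divide_eq)
      have "tent (x \<bullet> \<xi> - r * (b \<bullet> \<xi>) - z) = t * (x \<bullet> \<xi> - r * (b \<bullet> \<xi>) - z)" using rb by (intro tent(3)) simp
      moreover have "tent (x \<bullet> \<xi> - z) = t * (x \<bullet> \<xi> - z)" using s by (intro tent(3)) (simp add: z_def)
      moreover have "t * (r * (b \<bullet> \<xi>)) \<ge> (4 * c0) * (r * (1 / 2))" using c0 b(1) r by (intro mult_mono) auto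
      moreover have "kap (fst i) * cube_dist (x - r *\<^sub>R b) \<le> kap (fst i) * cube_dist x + r * c0" using r nb by (intro cd) auto
      moreover have "r * c0 > 0" using r c0 by simp
      ultimately show ?thesis unfolding piece_def inner_diff_left inner_scaleR_left z_def[symmetric] by (simp add: algebra_simps)
    qed
    have "(x \<bullet> \<xi> - z) / (b \<bullet> \<xi>) > 0" using s b(1) by (simp add: z_def)
    then show "\<exists>r0>0. \<forall>r. 0 < r \<and> r < r0 \<longrightarrow> piece i (x - r *\<^sub>R b) < piece i x" using p by blast }
  { assume s: "x \<bullet> \<xi> < of_int (snd i) * hh (fst i)"
    have p: "piece i (x + r *\<^sub>R b) < piece i x" if r: "0 < r" "r < (z - x \<bullet> \<xi>) / (b \<bullet> \<xi>)" for r
    proof -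
      have rb: "r * (b \<bullet> \<xi>) < z - x \<bullet> \<xi>" using r b(1) by (simp add: pos_less_divide_eq)
      have "tent (x \<bullet> \<xi> + r * (b \<bullet> \<xi>) - z) = (t - 1) * (x \<bullet> \<xi> + r * (b \<bullet> \<xi>) - z)" using rb by (intro tent(4)) simp
      moreover have "tent (x \<bullet> \<xi> - z) = (t - 1) * (x \<bullet> \<xi> - z)" using s by (intro tent(4)) (simp add: z_def)
      moreover have "(1 - t) * (r * (b \<bullet> \<xi>)) \<ge> (4 * c0) * (r * (1 / 2))" using c0 b(1) r by (intro mult_mono) auto
      moreover have "kap (fst i) * cube_dist (x + r *\<^sub>R b) \<le> kap (fst i) * cube_dist x + r * c0" using r nb by (intro cd) auto
      moreover have "r * c0 > 0" using r c0 by simp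
      ultimately show ?thesis unfolding piece_def inner_add_left inner_scaleR_left z_def[symmetric] by (simp add: algebra_simps)
    qed
    have "(z - x \<bullet> \<xi>) / (b \<bullet> \<xi>) > 0" using s b(1) by (simp add: z_def)
    then show "\<exists>r0>0. \<forall>r. 0 < r \<and> r < r0 \<longrightarrow> piece i (x + r *\<^sub>R b) < piece i x" using p by blast }
qed

text \<open>Between a point outside \<open>E\<close> and a point of \<open>E\<close> ahead of it, \<open>Phit\<close> has a local minimum along
  the segment, and a minimum of finitely many pieces can only have one at a kink of an active piece.\<close>

lemma crossing:
  assumes b: "b \<bullet> \<xi> \<ge> 1 / 2" "norm b \<le> 2" and y: "y \<notin> E" "y + \<tau> *\<^sub>R b \<in> E" and \<tau>: "\<tau> > 0"
  shows "\<exists>r i. 0 \<le> r \<and> r \<le> \<tau> \<and> i \<in> I \<and> piece i (y + r *\<^sub>R b) = Phit (y + r *\<^sub>R b) \<and>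
    (y + r *\<^sub>R b) \<bullet> \<xi> = of_int (snd i) * hh (fst i)"
proof -
  have "continuous_on {0..\<tau>} (\<lambda>r. Phit (y + r *\<^sub>R b))"
    by (intro continuous_on_compose2[OF Phit_continuous[of UNIV]] continuous_intros) auto
  then obtain r where r: "r \<in> {0..\<tau>}" and mn: "\<And>s. s \<in> {0..\<tau>} \<Longrightarrow> Phit (y + r *\<^sub>R b) \<le> Phit (y + s *\<^sub>R b)"
    using continuous_attains_inf[of "{0..\<tau>}"] \<tau> by (metis atLeastatMost_empty_iff2 compact_Icc less_imp_le not_le)
  define z where "z = y + r *\<^sub>R b"
  have up: False if i: "i \<in> I" "piece i z = Phit z" "z \<bullet> \<xi> < of_int (snd i) * hh (fst i)" and rt: "r < \<tau>" for i
  proof -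
    obtain r0 where r0: "r0 > 0" "\<And>s. 0 < s \<and> s < r0 \<Longrightarrow> piece i (z + s *\<^sub>R b) < piece i z"
      using piece_strict_decrease(2)[OF i(1) b i(3)] by blast
    define s where "s = min (r0 / 2) (\<tau> - r)"
    have s: "0 < s" "s < r0" "r + s \<in> {0..\<tau>}" using r0(1) rt r by (auto simp: s_def)
    have lt: "Phit (z + s *\<^sub>R b) < Phit z" using Phit_le[OF i(1), of "z + s *\<^sub>R b"] r0(2)[of s] s i(2) by simp
    have e: "z + s *\<^sub>R b = y + (r + s) *\<^sub>R b" by (simp add: z_def algebra_simps)
    show False using mn[OF s(3)] lt unfolding e[symmetric] z_def[symmetric] by simp
  qed
  have down: False if i: "i \<in> I" "piece i z = Phit z" "of_int (snd i) * hh (fst i) < z \<bullet> \<xi>" and rt: "0 < r" for i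
  proof -
    obtain r0 where r0: "r0 > 0" "\<And>s. 0 < s \<and> s < r0 \<Longrightarrow> piece i (z - s *\<^sub>R b) < piece i z"
      using piece_strict_decrease(1)[OF i(1) b i(3)] by blast
    define s where "s = min (r0 / 2) r"
    have s: "0 < s" "s < r0" "r - s \<in> {0..\<tau>}" using r0(1) rt r by (auto simp: s_def)
    have lt: "Phit (z - s *\<^sub>R b) < Phit z" using Phit_le[OF i(1), of "z - s *\<^sub>R b"] r0(2)[of s] s i(2) by simp
    have e: "z - s *\<^sub>R b = y + (r - s) *\<^sub>R b" by (simp add: z_def algebra_simps)
    show False using mn[OF s(3)] lt unfolding e[symmetric] z_def[symmetric] by simp
  qed
  have "r < \<tau>"
  proof (rule ccontr)
    assume "\<not> r < \<tau>"
    then have "z \<in> E" "0 < r" using r y(2) \<tau> by (auto simp: z_def)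
    then show False using down unfolding E_def by blast
  qed
  obtain i where i: "i \<in> I" "piece i z = Phit z" using Phit_active by blast
  have "\<not> z \<bullet> \<xi> < of_int (snd i) * hh (fst i)" using up[OF i] \<open>r < \<tau>\<close> by blast
  moreover have "\<not> of_int (snd i) * hh (fst i) < z \<bullet> \<xi>"
  proof
    assume a: "of_int (snd i) * hh (fst i) < z \<bullet> \<xi>"
    show False
    proof (cases "r = 0")
      case True
      then have "y \<in> E" using a i unfolding E_def z_def by auto
      then show False using y(1) by simp
    next
      case False
      then show False using down[OF i a] r by simp
    qed
  qed
  ultimately have "z \<bullet> \<xi> = of_int (snd i) * hh (fst i)" by simp
  then show ?thesis using i r unfolding z_def by (intro exI[of _ r] exI[of _ i]) simp
qed


text \<open>In the sum over scales 16 / c0 is 8 / c0 times the bound 2 for the geometric series; 3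
  accounts for the periods and step lengths added to the layer width.\<close>

definition cross_const :: real where "cross_const = 12 * slab_const * (16 / c0 + 3)"

text \<open>A segment entering E meets a kink of an active piece, so its start is within 2 \<tau> of
  a kink hyperplane of some scale j and in the layer of that scale. Dividing layer width by period
  counts hyperplane area, of order 2^J 2^(-j) plus a constant, which sums to order 2^J.\<close>

lemma crossing_set_measure:
  assumes b: "b \<bullet> \<xi> \<ge> 1 / 2" "norm b \<le> 2" and \<tau>: "0 < \<tau>" "6 * \<tau> * 8 ^ J \<le> 1"
    and P: "P \<in> lmeasurable" "\<And>y. y \<in> P \<Longrightarrow> y \<in> box 0 1 \<and> y + \<tau> *\<^sub>R b \<in> box 0 1 \<and> y \<notin> E \<and> y + \<tau> *\<^sub>R b \<in> E"
  shows "measure lebesgue P \<le> cross_const * \<tau> * 2 ^ J"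
proof -
  define l where "l j = 8 / c0 / 8 ^ j" for j :: nat
  have l: "l j \<ge> 0" for j using c0 by (simp add: l_def)
  define Q where "Q j = (box 0 1 \<inter> {y::real^'d. cube_dist y \<le> l j + 2 * \<tau>}) \<inter> (\<Union>k\<in>{- M..M}. {y. \<bar>y \<bullet> \<xi> - of_int k * hh j\<bar> \<le> 2 * \<tau>})" for j
  have Qm: "Q j \<in> lmeasurable" for j
  proof -
    have "closed (\<Union>k\<in>{- M..M}. {y. \<bar>y \<bullet> \<xi> - of_int k * hh j\<bar> \<le> 2 * \<tau>})"
      by (intro closed_UN ballI closed_Collect_le continuous_intros) simp
    then show ?thesis unfolding Q_def
      by (intro fmeasurable_Int_fmeasurable[OF boundary_layer(1)]) (use l[of j] \<tau>(1) in auto)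
  qed
  have h6: "6 * \<tau> \<le> hh j" if "j < J" for j
  proof -
    have "(4::real) ^ j \<le> 4 ^ J" using that by (intro power_increasing) auto
    then have "2 ^ J * 4 ^ j \<le> (2::real) ^ J * 4 ^ J" by simp
    also have "\<dots> = 8 ^ J" by (simp add: power_mult_distrib[symmetric])
    finally have "6 * \<tau> * (2 ^ J * 4 ^ j) \<le> 6 * \<tau> * 8 ^ J" using \<tau>(1) by (intro mult_left_mono) auto
    also have "\<dots> \<le> 1" by (rule \<tau>(2))
    finally show ?thesis by (simp add: hh_def field_simps)
  qed
  have sub: "P \<subseteq> (\<Union>j\<in>{..<J}. Q j)"
  proof
    fix y assume "y \<in> P"
    then have y: "y \<in> box 0 1" "y + \<tau> *\<^sub>R b \<in> box 0 1" "y \<notin> E" "y + \<tau> *\<^sub>R b \<in> E" using P(2) by auto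
    obtain r i where r: "0 \<le> r" "r \<le> \<tau>" and i: "i \<in> I" "piece i (y + r *\<^sub>R b) = Phit (y + r *\<^sub>R b)"
      "(y + r *\<^sub>R b) \<bullet> \<xi> = of_int (snd i) * hh (fst i)" using crossing[OF b y(3,4) \<tau>(1)] by blast
    have rb: "norm (r *\<^sub>R b) \<le> 2 * \<tau>" using mult_mono[of r \<tau> "norm b" 2] r b(2) by simp
    have "y + r *\<^sub>R b = (1 - r / \<tau>) *\<^sub>R y + (r / \<tau>) *\<^sub>R (y + \<tau> *\<^sub>R b)" using \<tau>(1) by (simp add: algebra_simps)
    also have "\<dots> \<in> box 0 1" using r \<tau>(1) y(1,2) by (intro convexD[OF convex_box(2)]) auto
    finally have z: "y + r *\<^sub>R b \<in> box 0 1" .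
    have "cube_dist (y + r *\<^sub>R b) \<le> l (fst i)" unfolding l_def by (rule active_cube_dist[OF z i(1,2)])
    then have 1: "cube_dist y \<le> l (fst i) + 2 * \<tau>" using cube_dist_lipschitz[of y "y + r *\<^sub>R b"] rb by simp
    have 2: "\<bar>y \<bullet> \<xi> - of_int (snd i) * hh (fst i)\<bar> \<le> 2 * \<tau>"
      using s_lipschitz[of y "y + r *\<^sub>R b"] rb unfolding i(3) by simp
    have "y \<in> Q (fst i)" using y(1) 1 2 i(1) unfolding Q_def by (auto simp: I_def)
    then show "y \<in> (\<Union>j\<in>{..<J}. Q j)" using i(1) by (auto simp: I_def)
  qed
  have Qb: "measure lebesgue (Q j) \<le> 12 * \<tau> * slab_const * (8 / c0 * 2 ^ J * (1 / 2) ^ j + 3)" if j: "j < J" for j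
  proof -
    have h: "hh j > 0" "hh j \<le> 1" by (rule hh)+
    have lp: "0 \<le> l j + 2 * \<tau> + hh j" using l[of j] \<tau>(1) h by simp
    have "measure lebesgue (Q j) \<le> 6 * (2 * \<tau>) / hh j * measure lebesgue (slab (l j + 2 * \<tau> + hh j) (hh j) :: (real^'d) set)"
    proof (rule periodic_slab_measure[OF Qm _ \<xi>])
      show "slab (l j + 2 * \<tau> + hh j) (hh j) \<in> lmeasurable" using h lp by (intro slab_measure(1)) auto
      show "0 < 2 * \<tau>" "3 * (2 * \<tau>) \<le> hh j" using \<tau>(1) h6[OF j] by auto
      show "\<exists>k::int. \<bar>x \<bullet> \<xi> - of_int k * hh j\<bar> \<le> 2 * \<tau>" if "x \<in> Q j" for x using that by (auto simp: Q_def)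
      fix x r assume x: "x \<in> Q j" and r: "0 \<le> r" "r \<le> hh j"
      have c: "\<bar>r * \<xi> $ k\<bar> \<le> hh j" for k
        using mult_mono[of r "hh j" "\<bar>\<xi> $ k\<bar>" 1] r component_le_norm_cart[of \<xi> k] \<xi> by (simp add: abs_mult)
      have bx: "0 < x $ k \<and> x $ k < 1" for k using x by (simp add: Q_def mem_box_cart)
      obtain i where i: "x $ i \<le> l j + 2 * \<tau> \<or> 1 - (l j + 2 * \<tau>) \<le> x $ i" using cube_dist_small[of x] x by (auto simp: Q_def)
      have "- hh j \<le> (x + r *\<^sub>R \<xi>) $ k \<and> (x + r *\<^sub>R \<xi>) $ k \<le> 1 + hh j" for k
        using c[of k] bx[of k] by (simp add: abs_le_iff)
      moreover have "(x + r *\<^sub>R \<xi>) $ i \<le> l j + 2 * \<tau> + hh j \<or> 1 - (l j + 2 * \<tau> + hh j) \<le> (x + r *\<^sub>R \<xi>) $ i"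
        using i c[of i] by (auto simp: abs_le_iff)
      ultimately show "x + r *\<^sub>R \<xi> \<in> slab (l j + 2 * \<tau> + hh j) (hh j)" unfolding slab_def by blast
    qed
    also have "\<dots> \<le> 6 * (2 * \<tau>) / hh j * (slab_const * (l j + 2 * \<tau> + hh j + hh j))"
      using slab_measure(2)[of "hh j" "l j + 2 * \<tau> + hh j", where 'd='d] h lp \<tau>(1)
      by (intro mult_left_mono) (auto simp: slab_const_def)
    also have "\<dots> \<le> 6 * (2 * \<tau>) / hh j * (slab_const * (l j + 3 * hh j))"
      using h6[OF j] slab_const h \<tau>(1) by (intro mult_left_mono) auto
    also have "\<dots> = 12 * \<tau> * slab_const * (l j / hh j + 3)" using h by (simp add: field_simps)
    also have "l j / hh j = 8 / c0 * 2 ^ J * (1 / 2) ^ j"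
    proof -
      have "l j / hh j = 8 / c0 * 2 ^ J * (4 / 8) ^ j" unfolding l_def hh_def by (simp only: power_divide) simp
      then show ?thesis by simp
    qed
    finally show ?thesis .
  qed
  have "measure lebesgue P \<le> measure lebesgue (\<Union>j\<in>{..<J}. Q j)"
    using Qm P(1) by (intro measure_mono_fmeasurable[OF sub]) (auto intro!: fmeasurable.finite_UN)
  also have "\<dots> \<le> (\<Sum>j<J. measure lebesgue (Q j))" using Qm by (intro measure_UNION_le) auto
  also have "\<dots> \<le> (\<Sum>j<J. 12 * \<tau> * slab_const * (8 / c0 * 2 ^ J * (1 / 2) ^ j + 3))" using Qb by (intro sum_mono) auto
  also have "\<dots> = 12 * \<tau> * slab_const * (8 / c0 * 2 ^ J * (\<Sum>j<J. (1 / 2) ^ j) + 3 * real J)"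
    by (simp only: sum_distrib_left[symmetric] sum.distrib) simp
  also have "\<dots> \<le> 12 * \<tau> * slab_const * (8 / c0 * 2 ^ J * 2 + 3 * 2 ^ J)"
  proof (intro mult_left_mono add_mono)
    show "(\<Sum>j<J. (1 / 2) ^ j) \<le> (2::real)" by (simp add: geometric_sum)
    show "real J \<le> 2 ^ J" using of_nat_less_two_power[of J, where 'a=real] by simp
  qed (use c0 slab_const \<tau> in auto)
  also have "\<dots> = cross_const * \<tau> * 2 ^ J" by (simp add: cross_const_def algebra_simps)
  finally show ?thesis .
qed

lemma phase_measurable: "phase \<in> borel_measurable lebesgue"
proof -
  have "E \<in> sets lebesgue" using E_borel by simp
  then show ?thesis unfolding phase_def by (intro measurable_If_set) auto
qed

lemma phase_bound: "\<bar>phase x\<bar> \<le> 1"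
  using t by (simp add: phase_def)

definition tv_const :: real where "tv_const = 2 * cross_const + 2 * slab_const"

text \<open>Entries into E along b are controlled by the crossing estimate. Exits are not crossings
  of that kind; they are bounded by a balance of measure: a translation preserves the measure of E
  up to what is lost in a layer of width 2 \<tau> at the boundary.\<close>

lemma phase_difference_bound:
  assumes b: "b \<bullet> \<xi> \<ge> 1 / 2" "norm b \<le> 2" and \<tau>: "0 < \<tau>" "6 * \<tau> * 8 ^ J \<le> 1"
  shows "(LINT x|lebesgue. indicat_real (box 0 1 \<inter> {x. x - \<tau> *\<^sub>R b \<in> box 0 1}) x * \<bar>phase (x - \<tau> *\<^sub>R b) - phase x\<bar>) \<le> tv_const * \<tau> * 2 ^ J"
proof -
  define c where "c = \<tau> *\<^sub>R b"
  have sb: "{x. x - c \<in> S} \<in> sets borel" if "S \<in> sets borel" for S :: "(real^'d) set"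
  proof -
    have "(\<lambda>x. x - c) \<in> borel \<rightarrow>\<^sub>M borel" by simp
    from measurable_sets[OF this that] show ?thesis by (simp add: vimage_def)
  qed
  define Q where "Q = box 0 1 \<inter> {x::real^'d. x - c \<in> box 0 1}"
  have Qb: "Q \<in> sets borel" unfolding Q_def by (intro sets.Int sb) auto
  define E' where "E' = {x. x - c \<in> E}"
  have E'b: "E' \<in> sets borel" unfolding E'_def by (rule sb[OF E_borel])
  have lm: "Q \<inter> S \<in> lmeasurable" if "S \<in> sets borel" for S :: "(real^'d) set"
    using fmeasurable_Int_fmeasurable[OF lmeasurable_box, of "{x. x - c \<in> box 0 1} \<inter> S" 0 1] sb[of "box 0 1"] that
    by (simp add: Q_def Int_assoc)
  have ii: "integrable lebesgue (indicat_real S)" if "S \<in> lmeasurable" for S :: "(real^'d) set"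
    using that by (auto simp: fmeasurable_def intro!: integrable_real_indicator)
  define P1 where "P1 = Q \<inter> (E - E')"
  define P2 where "P2 = Q \<inter> (E' - E)"
  have P: "P1 \<in> lmeasurable" "P2 \<in> lmeasurable" unfolding P1_def P2_def using E_borel E'b by (intro lm; auto)+
  have QE: "Q \<inter> E \<in> lmeasurable" "Q \<inter> E' \<in> lmeasurable" using E_borel E'b lm by auto
  have BE: "box 0 1 \<inter> E \<in> lmeasurable" using E_borel by (intro fmeasurable_Int_fmeasurable) auto
  have m1: "measure lebesgue P1 \<le> cross_const * \<tau> * 2 ^ J"
  proof -
    have "measure lebesgue P1 = measure lebesgue ((+) (- c) ` P1)" by (rule measure_translation[symmetric])
    also have "\<dots> \<le> cross_const * \<tau> * 2 ^ J"
    proof (rule crossing_set_measure[OF b \<tau>])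
      show "(+) (- c) ` P1 \<in> lmeasurable" using P(1) by (rule measurable_translation)
      show "y \<in> box 0 1 \<and> y + \<tau> *\<^sub>R b \<in> box 0 1 \<and> y \<notin> E \<and> y + \<tau> *\<^sub>R b \<in> E" if "y \<in> (+) (- c) ` P1" for y
        using that by (auto simp: P1_def Q_def E'_def c_def[symmetric])
    qed
    finally show ?thesis .
  qed
  have bl: "box 0 1 \<inter> {x::real^'d. cube_dist x \<le> 2 * \<tau>} \<in> lmeasurable"
    "measure lebesgue (box 0 1 \<inter> {x::real^'d. cube_dist x \<le> 2 * \<tau>}) \<le> slab_const * (2 * \<tau>)"
    using boundary_layer[of "2 * \<tau>"] \<tau>(1) by auto
  have e1: "measure lebesgue (Q \<inter> E') \<le> measure lebesgue (box 0 1 \<inter> E)"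
  proof -
    have "measure lebesgue (Q \<inter> E') = measure lebesgue ((+) (- c) ` (Q \<inter> E'))" by (rule measure_translation[symmetric])
    also have "\<dots> \<le> measure lebesgue (box 0 1 \<inter> E)"
    proof (rule measure_mono_fmeasurable[OF _ _ BE])
      show "(+) (- c) ` (Q \<inter> E') \<subseteq> box 0 1 \<inter> E" by (auto simp: Q_def E'_def)
      show "(+) (- c) ` (Q \<inter> E') \<in> sets lebesgue" by (rule fmeasurableD[OF measurable_translation[OF QE(2)]])
    qed
    finally show ?thesis .
  qed
  have e2: "measure lebesgue (box 0 1 \<inter> E) \<le> measure lebesgue (Q \<inter> E) + slab_const * (2 * \<tau>)"
  proof -
    have "box 0 1 \<inter> E \<subseteq> (Q \<inter> E) \<union> (box 0 1 \<inter> {x. cube_dist x \<le> 2 * \<tau>})"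
    proof
      fix x assume x: "x \<in> box 0 1 \<inter> E"
      show "x \<in> (Q \<inter> E) \<union> (box 0 1 \<inter> {x. cube_dist x \<le> 2 * \<tau>})"
      proof (cases "x - c \<in> box 0 1")
        case False
        have "norm c \<le> 2 * \<tau>" using b(2) \<tau>(1) by (simp add: c_def)
        then have "cube_dist x \<le> 2 * \<tau>" using cube_dist_lipschitz[of x "x - c"] cube_dist_outside[OF False] by simp
        then show ?thesis using x by simp
      qed (use x in \<open>simp add: Q_def\<close>)
    qed
    then have "measure lebesgue (box 0 1 \<inter> E) \<le> measure lebesgue ((Q \<inter> E) \<union> (box 0 1 \<inter> {x. cube_dist x \<le> 2 * \<tau>}))"
      using BE QE bl(1) by (intro measure_mono_fmeasurable) auto
    also have "\<dots> \<le> measure lebesgue (Q \<inter> E) + measure lebesgue (box 0 1 \<inter> {x::real^'d. cube_dist x \<le> 2 * \<tau>})"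
      using QE bl(1) by (intro measure_Un_le) auto
    finally show ?thesis using bl(2) by linarith
  qed
  \<comment> \<open>The balance: exits exceed entries only by the amount by which translated E
    exceeds E within Q.\<close>
  have pt2: "indicat_real P2 x = indicat_real P1 x + indicat_real (Q \<inter> E') x - indicat_real (Q \<inter> E) x" for x
    by (auto simp: P1_def P2_def indicator_def)
  have "measure lebesgue P2 = (LINT x|lebesgue. indicat_real P1 x + indicat_real (Q \<inter> E') x - indicat_real (Q \<inter> E) x)"
    unfolding pt2[symmetric] by simp
  also have "\<dots> = measure lebesgue P1 + measure lebesgue (Q \<inter> E') - measure lebesgue (Q \<inter> E)"
    using ii[OF P(1)] ii[OF QE(1)] ii[OF QE(2)] by simp
  finally have m2: "measure lebesgue P2 \<le> measure lebesgue P1 + slab_const * (2 * \<tau>)" using e1 e2 by linarith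
  have "indicat_real Q x * \<bar>phase (x - c) - phase x\<bar> = indicat_real P1 x + indicat_real P2 x" for x
    by (auto simp: P1_def P2_def E'_def phase_def indicator_def)
  then have "(LINT x|lebesgue. indicat_real Q x * \<bar>phase (x - c) - phase x\<bar>) = (LINT x|lebesgue. indicat_real P1 x + indicat_real P2 x)" by simp
  also have "\<dots> = measure lebesgue P1 + measure lebesgue P2" using ii[OF P(1)] ii[OF P(2)] by simp
  also have "\<dots> \<le> 2 * (cross_const * \<tau> * 2 ^ J) + slab_const * (2 * \<tau>)" using m1 m2 by linarith
  also have "slab_const * (2 * \<tau>) \<le> slab_const * (2 * \<tau>) * 2 ^ J"
    using slab_const \<tau>(1) mult_left_mono[of 1 "2 ^ J" "slab_const * (2 * \<tau>)"] by simp
  also have "2 * (cross_const * \<tau> * 2 ^ J) + slab_const * (2 * \<tau>) * 2 ^ J = tv_const * \<tau> * 2 ^ J" by (simp add: tv_const_def algebra_simps)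
  finally show ?thesis unfolding Q_def c_def by simp
qed

text \<open>The derivative of \<zeta> is discretised and the difference shifted to the phase. For
  large n the step is so short that the support of \<zeta> stays inside the cube under the shift and
  the bound on differences applies.\<close>

lemma phase_variation:
  assumes b: "b \<bullet> \<xi> \<ge> 1 / 2" "norm b \<le> 2"
    and \<zeta>: "C_diff 1 \<zeta>" "\<And>x. \<bar>\<zeta> x\<bar> \<le> 1" "compact L" "L \<subseteq> box 0 1" "\<And>x. x \<notin> L \<Longrightarrow> \<zeta> x = 0"
  shows "\<bar>LINT x|lebesgue. phase x * dir_deriv b \<zeta> x\<bar> \<le> tv_const * 2 ^ J"
proof -
  obtain R where R: "\<And>x. x \<in> L \<Longrightarrow> norm x \<le> R" using compact_imp_bounded[OF \<zeta>(3)] unfolding bounded_iff by blast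
  have \<zeta>R: "\<zeta> x = 0" if "x \<notin> cball 0 R" for x using that R \<zeta>(5)[of x] by force
  have \<zeta>m: "\<zeta> \<in> borel_measurable lebesgue" by (rule continuous_imp_lebesgue_measurable[OF C_diff_continuous[OF \<zeta>(1)]])
  have \<zeta>i: "integrable lebesgue \<zeta>" by (rule integrable_bounded_on_ball[OF \<zeta>m, of 1 R]) (use \<zeta>(2) \<zeta>R in auto)
  obtain \<delta> where \<delta>: "\<delta> > 0" "(\<Union>x\<in>L. cball x \<delta>) \<subseteq> box 0 1"
    using compact_subset_open_imp_cball_epsilon_subset[OF \<zeta>(3) open_box \<zeta>(4)] by blast
  have lim: "(\<lambda>n. LINT x|lebesgue. phase x * (real (Suc n) * (\<zeta> (x + (1 / real (Suc n)) *\<^sub>R b) - \<zeta> x))) \<longlonglongrightarrow> (LINT x|lebesgue. phase x * dir_deriv b \<zeta> x)"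
    by (rule LIMSEQ_integral_diff_quot[OF \<zeta>(1) \<zeta>R phase_measurable bounded_set_integrable_cball[OF phase_measurable phase_bound]])
  have bd: "\<bar>LINT x|lebesgue. phase x * (real (Suc n) * (\<zeta> (x + (1 / real (Suc n)) *\<^sub>R b) - \<zeta> x))\<bar> \<le> tv_const * 2 ^ J"
    if n: "real (Suc n) \<ge> 6 * 8 ^ J" "real (Suc n) \<ge> 2 / \<delta>" for n
  proof -
    define \<tau> where "\<tau> = 1 / real (Suc n)"
    have \<tau>: "0 < \<tau>" "6 * \<tau> * 8 ^ J \<le> 1" using n(1) by (auto simp: \<tau>_def field_simps)
    have \<tau>\<delta>: "2 * \<tau> \<le> \<delta>" using n(2) \<delta>(1) by (simp add: \<tau>_def field_simps)
    define c where "c = \<tau> *\<^sub>R b"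
    have "norm c = \<tau> * norm b" using \<tau>(1) by (simp add: c_def)
    also have "\<dots> \<le> \<tau> * 2" using b(2) \<tau>(1) by (intro mult_left_mono) auto
    finally have nc: "norm c \<le> \<delta>" using \<tau>\<delta> by linarith
    define Q where "Q = box 0 1 \<inter> {x::real^'d. x - c \<in> box 0 1}"
    have LQ: "x \<in> Q" if "x \<in> L" for x
    proof -
      have "x - c \<in> cball x \<delta>" using nc by (simp add: dist_norm)
      then have "x - c \<in> box 0 1" using \<delta>(2) that by blast
      then show ?thesis using that \<zeta>(4) by (auto simp: Q_def)
    qed
    have pm: "(\<lambda>x. phase (x + - c)) \<in> borel_measurable lebesgue" by (rule borel_measurable_lebesgue_translate[OF phase_measurable])
    have i1: "integrable lebesgue (\<lambda>x. phase x * \<zeta> (x + c))"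
      using integrable_mult_bounded[OF integrable_lebesgue_translate[OF \<zeta>i] phase_measurable phase_bound, of c] by (simp add: mult.commute)
    have i2: "integrable lebesgue (\<lambda>x. phase x * \<zeta> x)"
      using integrable_mult_bounded[OF \<zeta>i phase_measurable phase_bound] by (simp add: mult.commute)
    have i3: "integrable lebesgue (\<lambda>x. phase (x - c) * \<zeta> x)"
      using integrable_mult_bounded[OF \<zeta>i pm phase_bound] by (simp add: mult.commute)
    have tr: "(LINT x|lebesgue. phase x * \<zeta> (x + c)) = (LINT x|lebesgue. phase (x - c) * \<zeta> x)"
      using integral_lebesgue_translate[OF borel_measurable_integrable[OF i1], of "- c"] by simp
    have "(LINT x|lebesgue. phase x * (real (Suc n) * (\<zeta> (x + (1 / real (Suc n)) *\<^sub>R b) - \<zeta> x)))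
      = (LINT x|lebesgue. real (Suc n) * (phase x * \<zeta> (x + c) - phase x * \<zeta> x))"
      by (rule Bochner_Integration.integral_cong) (simp_all add: c_def \<tau>_def algebra_simps)
    also have "\<dots> = real (Suc n) * ((LINT x|lebesgue. phase (x - c) * \<zeta> x) - (LINT x|lebesgue. phase x * \<zeta> x))"
      using i1 i2 tr by simp
    also have "\<dots> = real (Suc n) * (LINT x|lebesgue. phase (x - c) * \<zeta> x - phase x * \<zeta> x)" using i2 i3 by simp
    finally have eq: "(LINT x|lebesgue. phase x * (real (Suc n) * (\<zeta> (x + (1 / real (Suc n)) *\<^sub>R b) - \<zeta> x)))
      = real (Suc n) * (LINT x|lebesgue. phase (x - c) * \<zeta> x - phase x * \<zeta> x)" .
    have "\<bar>LINT x|lebesgue. phase (x - c) * \<zeta> x - phase x * \<zeta> x\<bar> \<le> (LINT x|lebesgue. \<bar>phase (x - c) * \<zeta> x - phase x * \<zeta> x\<bar>)"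
      by (rule integral_abs_bound)
    also have "\<dots> \<le> (LINT x|lebesgue. indicat_real Q x * \<bar>phase (x - c) - phase x\<bar>)"
    proof (rule integral_mono)
      show "integrable lebesgue (\<lambda>x. \<bar>phase (x - c) * \<zeta> x - phase x * \<zeta> x\<bar>)" using i2 i3 by (intro integrable_abs) auto
      have Qm: "Q \<in> lmeasurable"
      proof -
        have "open {x::real^'d. x - c \<in> box 0 1}"
          using open_vimage[OF open_box, of "\<lambda>x. x - c" 0 1] by (simp add: vimage_def continuous_intros)
        then show ?thesis unfolding Q_def by (intro fmeasurable_Int_fmeasurable) auto
      qed
      then have "integrable lebesgue (indicat_real Q)" by (auto simp: fmeasurable_def intro!: integrable_real_indicator)
      then show "integrable lebesgue (\<lambda>x. indicat_real Q x * \<bar>phase (x - c) - phase x\<bar>)"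
      proof (rule integrable_mult_bounded)
        show "(\<lambda>x. \<bar>phase (x - c) - phase x\<bar>) \<in> borel_measurable lebesgue" using pm phase_measurable by simp
        show "\<bar>\<bar>phase (x - c) - phase x\<bar>\<bar> \<le> 2" for x using phase_bound[of x] phase_bound[of "x - c"] by linarith
      qed
      show "\<bar>phase (x - c) * \<zeta> x - phase x * \<zeta> x\<bar> \<le> indicat_real Q x * \<bar>phase (x - c) - phase x\<bar>" for x
      proof (cases "x \<in> L")
        case True
        have "\<bar>phase (x - c) - phase x\<bar> * \<bar>\<zeta> x\<bar> \<le> \<bar>phase (x - c) - phase x\<bar> * 1" using \<zeta>(2)[of x] by (intro mult_left_mono) auto
        then show ?thesis using LQ[OF True] by (simp add: left_diff_distrib[symmetric] abs_mult)
      qed (simp add: \<zeta>(5))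
    qed
    also have "\<dots> \<le> tv_const * \<tau> * 2 ^ J" using phase_difference_bound[OF b \<tau>] by (simp add: Q_def c_def)
    finally have "real (Suc n) * \<bar>LINT x|lebesgue. phase (x - c) * \<zeta> x - phase x * \<zeta> x\<bar> \<le> real (Suc n) * (tv_const * \<tau> * 2 ^ J)"
      by (intro mult_left_mono) auto
    also have "\<dots> = tv_const * 2 ^ J" by (simp add: \<tau>_def)
    finally show ?thesis unfolding eq by (simp add: abs_mult)
  qed
  obtain N where N: "real N \<ge> max (6 * 8 ^ J) (2 / \<delta>)" using real_arch_simple by blast
  show ?thesis
  proof (rule LIMSEQ_le_const2[OF tendsto_rabs[OF lim]])
    show "\<exists>N. \<forall>n\<ge>N. \<bar>LINT x|lebesgue. phase x * (real (Suc n) * (\<zeta> (x + (1 / real (Suc n)) *\<^sub>R b) - \<zeta> x))\<bar> \<le> tv_const * 2 ^ J"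
    proof (intro exI[of _ N] allI impI bd)
      fix n assume "N \<le> n"
      then have "real (Suc n) \<ge> real N" by simp
      then show "6 * 8 ^ J \<le> real (Suc n)" "2 / \<delta> \<le> real (Suc n)" using N by linarith+
    qed
  qed
qed

text \<open>Crossings are controlled only in directions with b \<bullet> \<xi> \<ge> 1 / 2. Both
  \<xi> and \<xi> + e_j / 2 qualify, and the partial derivative is twice the difference of the two
  directional ones, whence the factor 4.\<close>

lemma phase_partial_variation:
  assumes \<zeta>: "C_diff 1 \<zeta>" "\<And>x. \<bar>\<zeta> x\<bar> \<le> 1" "compact L" "L \<subseteq> box 0 1" "\<And>x. x \<notin> L \<Longrightarrow> \<zeta> x = 0"
  shows "\<bar>LINT x|lebesgue. phase x * partial_deriv j \<zeta> x\<bar> \<le> 4 * tv_const * 2 ^ J"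
proof -
  define b where "b = \<xi> + axis j (1 / 2)"
  have \<xi>\<xi>: "\<xi> \<bullet> \<xi> = 1" using \<xi> by (simp add: dot_square_norm)
  have \<xi>j: "\<bar>\<xi> $ j\<bar> \<le> 1" using component_le_norm_cart[of \<xi> j] \<xi> by simp
  have b: "b \<bullet> \<xi> \<ge> 1 / 2" "norm b \<le> 2"
  proof -
    have "b \<bullet> \<xi> = 1 + \<xi> $ j / 2" using \<xi>\<xi> by (simp add: b_def inner_add_left inner_axis')
    then show "b \<bullet> \<xi> \<ge> 1 / 2" using \<xi>j by linarith
    have "norm (axis j (1 / 2 :: real) :: real^'d) = 1 / 2"
    proof -
      have "(axis j (1 / 2) :: real^'d) = (1 / 2) *\<^sub>R axis j 1" by (simp add: vec_eq_iff axis_def)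
      then show ?thesis by (simp add: norm_axis_1)
    qed
    then show "norm b \<le> 2" using norm_triangle_ineq[of \<xi> "axis j (1 / 2)"] \<xi> by (simp add: b_def)
  qed
  have \<xi>': "\<xi> \<bullet> \<xi> \<ge> 1 / 2" "norm \<xi> \<le> 2" using \<xi> \<xi>\<xi> by auto
  obtain R where R: "\<And>x. x \<in> L \<Longrightarrow> norm x \<le> R" using compact_imp_bounded[OF \<zeta>(3)] unfolding bounded_iff by blast
  have \<zeta>R: "\<zeta> x = 0" if "x \<notin> cball 0 R" for x using that R \<zeta>(5)[of x] by force
  have pi: "integrable lebesgue (partial_deriv l \<zeta>)" for l by (rule C1_compact_support_partial_integrable[OF \<zeta>(1) \<zeta>R])
  have di: "integrable lebesgue (\<lambda>x. phase x * dir_deriv e \<zeta> x)" for e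
  proof -
    have "integrable lebesgue (\<lambda>x. dir_deriv e \<zeta> x * phase x)"
      unfolding dir_deriv_def using pi
      by (intro integrable_mult_bounded[OF _ phase_measurable phase_bound] Bochner_Integration.integrable_sum integrable_mult_right)
    then show ?thesis by (simp add: mult.commute)
  qed
  have eq: "partial_deriv j \<zeta> x = 2 * (dir_deriv b \<zeta> x - dir_deriv \<xi> \<zeta> x)" for x
  proof -
    have d: "\<zeta> differentiable (at x)" by (rule C_diff_differentiable[OF \<zeta>(1)]) simp
    have "linear (\<lambda>h. dir_deriv h \<zeta> x)" using has_derivative_linear[OF has_derivative_dir_deriv[OF d]] .
    then have "dir_deriv b \<zeta> x = dir_deriv \<xi> \<zeta> x + dir_deriv ((1 / 2) *\<^sub>R axis j 1) \<zeta> x"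
      unfolding b_def by (subst linear_add[symmetric]) (auto simp: axis_def vec_eq_iff intro!: arg_cong[where f="\<lambda>h. dir_deriv h \<zeta> x"])
    also have "dir_deriv ((1 / 2) *\<^sub>R axis j 1) \<zeta> x = (1 / 2) * partial_deriv j \<zeta> x"
      using linear_cmul[OF \<open>linear (\<lambda>h. dir_deriv h \<zeta> x)\<close>, of "1 / 2" "axis j 1"] by (simp add: dir_deriv_axis)
    finally show ?thesis by simp
  qed
  have "(LINT x|lebesgue. phase x * partial_deriv j \<zeta> x) = (LINT x|lebesgue. 2 * (phase x * dir_deriv b \<zeta> x - phase x * dir_deriv \<xi> \<zeta> x))"
    unfolding eq by (simp add: algebra_simps)
  also have "\<dots> = 2 * ((LINT x|lebesgue. phase x * dir_deriv b \<zeta> x) - (LINT x|lebesgue. phase x * dir_deriv \<xi> \<zeta> x))"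
    using di by simp
  finally have "(LINT x|lebesgue. phase x * partial_deriv j \<zeta> x) =
    2 * ((LINT x|lebesgue. phase x * dir_deriv b \<zeta> x) - (LINT x|lebesgue. phase x * dir_deriv \<xi> \<zeta> x))" .
  moreover have "\<bar>LINT x|lebesgue. phase x * dir_deriv b \<zeta> x\<bar> \<le> tv_const * 2 ^ J"
    by (rule phase_variation[OF b \<zeta>(1-4)]) (rule \<zeta>(5))
  moreover have "\<bar>LINT x|lebesgue. phase x * dir_deriv \<xi> \<zeta> x\<bar> \<le> tv_const * 2 ^ J"
    by (rule phase_variation[OF \<xi>' \<zeta>(1-4)]) (rule \<zeta>(5))
  moreover have "\<bar>2 * (p - q)\<bar> \<le> 4 * r" if "\<bar>p\<bar> \<le> r" "\<bar>q\<bar> \<le> r" for p q r :: real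
    using that by (simp add: abs_le_iff)
  ultimately show ?thesis by (simp add: mult.assoc)
qed

end

section \<open>Upper bound for the divergence\<close>

lemma row_divergence_wave_vector:
  fixes Aop :: "('d::finite \<Rightarrow> nat) \<Rightarrow> real^'n::finite^'m::finite"
  assumes div: "is_row_divergence e Aop" and z: "op_symbol Aop 1 \<xi> *v v = 0"
  shows "\<xi> \<bullet> (\<chi> l. v $ e (i, l)) = 0"
proof -
  have "op_symbol Aop 1 \<xi> *v v = (\<Sum>j\<in>UNIV. (\<xi> $ j) *\<^sub>R (Aop (unit_index j) *v v))"
  proof -
    have "sum f S *v v = (\<Sum>j\<in>S. f j *v v)" if "finite S" for f :: "'d \<Rightarrow> real^'n^'m" and S
      using that by (induction S rule: finite_induct) (auto simp: matrix_vector_mult_add_rdistrib)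
    then show ?thesis unfolding op_symbol_1 by (simp add: scaleR_matrix_vector_assoc)
  qed
  also have "\<dots> $ i = (\<Sum>j\<in>UNIV. \<xi> $ j * v $ e (i, j))"
    using div by (simp add: is_row_divergence_def)
  finally show ?thesis using z by (simp add: inner_vec_def)
qed

text \<open>As the rows of v are orthogonal to \<xi>, the gradient c \<xi> produces exactly the
  field c v. By linearity the mismatch between field and phase is the stream field of the gradient
  error.\<close>

lemma stream_field_rank_one:
  fixes e :: "'m::finite \<times> 'd::finite \<Rightarrow> 'n::finite"
  assumes e: "bij e" and \<xi>: "norm \<xi> = 1" and orth: "\<And>i. \<xi> \<bullet> (\<chi> l. v $ e (i, l)) = 0"
  shows "stream_field e v \<xi> g - c *\<^sub>R v = stream_field e v \<xi> (g - c *\<^sub>R \<xi>)"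
proof -
  have \<xi>\<xi>: "\<xi> \<bullet> \<xi> = 1" using \<xi> by (simp add: dot_square_norm)
  have "(stream_field e v \<xi> g - c *\<^sub>R v) $ n = stream_field e v \<xi> (g - c *\<^sub>R \<xi>) $ n" for n
  proof -
    obtain i j where n: "n = e (i, j)" using e by (metis bij_pointE surj_pair)
    show ?thesis unfolding n vector_minus_component stream_field_nth[OF e]
      by (simp add: inner_diff_left \<xi>\<xi> orth algebra_simps)
  qed
  then show ?thesis by (simp add: vec_eq_iff)
qed

lemma const_admissible:
  fixes Aop :: "('d::finite \<Rightarrow> nat) \<Rightarrow> real^'n::finite^'m::finite"
  assumes "k \<ge> 1"
  shows "(\<lambda>x. F) \<in> admissible Aop k \<Omega> F"
proof -
  have u: "(\<lambda>x::real^'d. F) \<in> L2_loc" by (rule L2_locI_bounded[of _ "norm F"]) auto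
  have "distributional_solution Aop k (\<lambda>x. F)"
    by (rule distributional_solution_zero_coeff[OF u assms, where c=F]) simp
  then show ?thesis using u by (simp add: admissible_def)
qed

lemma cube_dist_gradient:
  "\<exists>N q. negligible N \<and> (\<forall>x::real^'d::finite. x \<notin> N \<longrightarrow> (cube_dist has_derivative (\<lambda>h. q x \<bullet> h)) (at x)) \<and>
    (\<forall>x. norm (q x) \<le> 1)"
proof -
  define R :: "((real^'d) \<times> real) set" where
    "R = insert (0, 0) ((\<lambda>i. (axis i 1, 0)) ` UNIV \<union> (\<lambda>i. (- axis i 1, 1)) ` UNIV)"
  have "\<exists>(p, c)\<in>R. cube_dist x = p \<bullet> x + c" for x
  proof -
    consider "cube_dist x = 0" | i where "cube_dist x = x $ i" | i where "cube_dist x = 1 - x $ i"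
      using cube_dist_selection[of x] by blast
    then show ?thesis
    proof cases
      case 1 then show ?thesis by (intro bexI[of _ "(0, 0)"]) (auto simp: R_def)
    next
      case (2 i) then show ?thesis by (intro bexI[of _ "(axis i 1, 0)"]) (auto simp: R_def inner_axis')
    next
      case (3 i) then show ?thesis by (intro bexI[of _ "(- axis i 1, 1)"]) (auto simp: R_def inner_axis')
    qed
  qed
  then have "\<exists>N. negligible N \<and> (\<forall>x::real^'d. x \<notin> N \<longrightarrow> (\<exists>p. (cube_dist has_derivative (\<lambda>h. p \<bullet> h)) (at x)))"
    by (intro continuous_affine_selection_differentiable[OF cube_dist_continuous, of R]) (auto simp: R_def)
  then obtain N where N: "negligible N" "\<And>x::real^'d. x \<notin> N \<Longrightarrow> \<exists>p. (cube_dist has_derivative (\<lambda>h. p \<bullet> h)) (at x)"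
    by blast
  have lip: "\<bar>cube_dist x - cube_dist y\<bar> \<le> 1 * norm (x - y)" for x y :: "real^'d" using cube_dist_lipschitz[of x y] by simp
  have "\<exists>q. (\<forall>x. x \<notin> N \<longrightarrow> (cube_dist has_derivative (\<lambda>h. q x \<bullet> h)) (at x)) \<and> (\<forall>x::real^'d. norm (q x) \<le> 1)"
    by (rule lipschitz_gradient[OF lip zero_le_one N]) blast+
  with N(1) show ?thesis by blast
qed

context branching
begin

lemma phase_surface_energy:
  fixes F v :: "real^'n::finite"
  shows "surface_energy (box 0 1) (\<lambda>x. F + phase x *\<^sub>R v)
    \<le> ennreal (real CARD('n) * (norm v * (real CARD('d) * (4 * tv_const * 2 ^ J))))"
  unfolding surface_energy_def
proof (intro SUP_least ennreal_leI)
  fix \<phi> :: "real^'d \<Rightarrow> real^'d^'n" assume \<phi>: "\<phi> \<in> TV_test_fields (box 0 1)"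
  let ?D = "\<lambda>i j. partial_deriv j (\<lambda>y. \<phi> y $ i $ j)"
  have pi: "integrable lebesgue (?D i j)" for i j by (rule TV_test_fields_partial_integrable[OF \<phi>])
  have ppi: "integrable lebesgue (\<lambda>x. phase x * ?D i j x)" for i j
    using integrable_mult_bounded[OF pi[of j i] phase_measurable phase_bound] by (simp add: mult.commute)
  have b: "\<bar>LINT x|lebesgue. phase x * ?D i j x\<bar> \<le> 4 * tv_const * 2 ^ J" for i j
  proof (rule phase_partial_variation)
    show "C_diff 1 (\<lambda>y. \<phi> y $ i $ j)" "\<bar>\<phi> x $ i $ j\<bar> \<le> 1" for x using TV_test_fieldsD[OF \<phi>] by auto
    show "compact (closure {x. \<phi> x \<noteq> 0})" "closure {x. \<phi> x \<noteq> 0} \<subseteq> box 0 1"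
      using \<phi> by (auto simp: TV_test_fields_def)
    show "\<phi> x $ i $ j = 0" if "x \<notin> closure {x. \<phi> x \<noteq> 0}" for x
      using that closure_subset[of "{x. \<phi> x \<noteq> 0}"] by force
  qed
  have "(LINT x:box 0 1|lebesgue. (\<Sum>i\<in>UNIV. (F + phase x *\<^sub>R v) $ i * (\<Sum>j\<in>UNIV. ?D i j x)))
    = (LINT x|lebesgue. (\<Sum>i\<in>UNIV. \<Sum>j\<in>UNIV. F $ i * ?D i j x + v $ i * (phase x * ?D i j x)))"
    unfolding set_lebesgue_integral_def using TV_test_fieldsD(4)[OF \<phi>]
    by (intro Bochner_Integration.integral_cong)
       (auto simp: indicator_def sum_distrib_left algebra_simps)
  also have "\<dots> = (\<Sum>i\<in>UNIV. \<Sum>j\<in>UNIV. F $ i * (LINT x|lebesgue. ?D i j x) + v $ i * (LINT x|lebesgue. phase x * ?D i j x))"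
    using pi ppi by (subst Bochner_Integration.integral_sum, simp)+ simp
  also have "\<dots> = (\<Sum>i\<in>UNIV. \<Sum>j\<in>UNIV. v $ i * (LINT x|lebesgue. phase x * ?D i j x))"
    by (simp add: TV_test_fields_integral_zero[OF \<phi>])
  also have "\<dots> \<le> (\<Sum>i\<in>(UNIV::'n set). \<Sum>j\<in>(UNIV::'d set). norm v * (4 * tv_const * 2 ^ J))"
  proof (intro sum_mono)
    fix i j
    have "v $ i * (LINT x|lebesgue. phase x * ?D i j x) \<le> \<bar>v $ i\<bar> * \<bar>LINT x|lebesgue. phase x * ?D i j x\<bar>"
      by (simp add: abs_mult[symmetric])
    also have "\<dots> \<le> norm v * (4 * tv_const * 2 ^ J)"
      by (intro mult_mono b component_le_norm_cart) auto
    finally show "v $ i * (LINT x|lebesgue. phase x * ?D i j x) \<le> norm v * (4 * tv_const * 2 ^ J)" .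
  qed
  finally show "(LINT x:box 0 1|lebesgue. (\<Sum>i\<in>UNIV. (F + phase x *\<^sub>R v) $ i * (\<Sum>j\<in>UNIV. ?D i j x)))
    \<le> real CARD('n) * (norm v * (real CARD('d) * (4 * tv_const * 2 ^ J)))" by (simp add: algebra_simps)
qed

lemma error_density_measurable: "error_density \<in> borel_measurable lebesgue"
proof -
  have [measurable]: "cube_dist \<in> borel_measurable borel" by (rule borel_measurable_continuous_onI[OF cube_dist_continuous])
  have "error_density \<in> borel_measurable borel" unfolding error_density_def by measurable
  then show ?thesis by (intro measurable_completion) simp
qed

text \<open>The field is the stream field of \<open>Phi\<close>, the phase is read off from E. The
  gradients of the potential and of \<open>cube_dist\<close>, and the sides of all kinks, are
  determined off a null set, which is enough for the elastic energy.\<close>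

lemma branching_energy:
  fixes Aop :: "('d \<Rightarrow> nat) \<Rightarrow> real^'n::finite^'m::finite" and A B :: "real^'n"
  assumes div: "is_row_divergence e Aop" and z: "op_symbol Aop 1 \<xi> *v (B - A) = 0"
  shows "min_total_energy Aop 1 (box 0 1) A B (t *\<^sub>R A + (1 - t) *\<^sub>R B) \<epsilon> \<le>
    ennreal ((real CARD('n) * (1 + real CARD('d)) * norm (B - A))\<^sup>2) * ennreal (slab_const * (8 / c0) * 6 / 4 ^ J) +
    ennreal \<epsilon> * ennreal (real CARD('n) * (norm (B - A) * (real CARD('d) * (4 * tv_const * 2 ^ J))))"
proof -
  define v where "v = B - A"
  define F where "F = t *\<^sub>R A + (1 - t) *\<^sub>R B"
  define K where "K = real CARD('n) * (1 + real CARD('d)) * norm v"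
  have e: "bij e" using div by (simp add: is_row_divergence_def)
  have orth: "\<xi> \<bullet> (\<chi> l. v $ e (i, l)) = 0" for i unfolding v_def by (rule row_divergence_wave_vector[OF div z])
  obtain \<Lambda> where \<Lambda>: "finite \<Lambda>" "\<And>x. \<exists>(p, c)\<in>\<Lambda>. Phi x = p \<bullet> x + c" using Phi_selection by blast
  have "2-lipschitz_on UNIV Phi" using Phi_lipschitz by (intro lipschitz_onI) (auto simp: dist_norm)
  then have "continuous_on UNIV Phi" by (rule lipschitz_on_continuous_on)
  from continuous_affine_selection_differentiable[OF this \<Lambda>] obtain N1 where
    N1: "negligible N1" "\<And>x. x \<notin> N1 \<Longrightarrow> \<exists>p. (Phi has_derivative (\<lambda>h. p \<bullet> h)) (at x)" by blast
  obtain gr where gr: "gr \<in> borel_measurable lebesgue" "\<And>x. x \<notin> N1 \<Longrightarrow> (Phi has_derivative (\<lambda>h. gr x \<bullet> h)) (at x)"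
    "\<And>x. norm (gr x) \<le> 2" using lipschitz_gradient[OF Phi_lipschitz _ N1] by (metis zero_le_numeral)
  obtain N2 q where q: "negligible N2" "\<And>x::real^'d. x \<notin> N2 \<Longrightarrow> (cube_dist has_derivative (\<lambda>h. q x \<bullet> h)) (at x)"
    "\<And>x. norm (q x) \<le> 1" using cube_dist_gradient by blast
  define u where "u x = F + stream_field e v \<xi> (gr x)" for x
  define f where "f x = F + phase x *\<^sub>R v" for x
  have u1: "u \<in> L2_loc" "distributional_solution Aop 1 u"
    using stream_field_divergence_free[OF div \<xi> Phi_lipschitz _ Phi_bounded N1(1) gr, of F v] by (simp_all add: u_def[abs_def])
  have "u x = F" if x: "x \<notin> N1" "x \<notin> closure (box 0 1)" for x
  proof -
    have "(Phi has_derivative (\<lambda>h. 0)) (at x)"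
      by (rule has_derivative_transform_within_open[of "\<lambda>x. 0" _ _ _ "- closure (box 0 1)"])
         (use x Phi_outside closure_subset[of "box 0 (1::real^'d)"] in auto)
    from has_derivative_unique[OF this gr(2)[OF x(1)]] have "gr x \<bullet> gr x = 0" by metis
    then have "gr x = 0" by simp
    moreover have "stream_field e v \<xi> 0 = 0" by (simp add: stream_field_def vec_eq_iff split: prod.split)
    ultimately show ?thesis by (simp add: u_def)
  qed
  then have "AE x in lebesgue. x \<notin> closure (box 0 1) \<longrightarrow> u x = F"
    using AE_not_in[of N1 lebesgue] N1(1) by (auto simp: negligible_iff_null_sets elim!: eventually_mono)
  with u1 have u: "u \<in> admissible Aop 1 (box 0 1) F" by (simp add: admissible_def)
  have fAB: "f x \<in> {A, B}" for x by (simp add: f_def phase_def F_def v_def algebra_simps)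
  have se: "surface_energy (box 0 1) f \<le> ennreal (real CARD('n) * (norm v * (real CARD('d) * (4 * tv_const * 2 ^ J))))"
    using phase_surface_energy[of F v] by (simp add: f_def[abs_def])
  have f: "f \<in> BV_fields (box 0 1) {A, B}"
  proof -
    have "set_integrable lebesgue (box 0 1) f" unfolding set_integrable_def
    proof (rule Bochner_Integration.integrable_bound)
      show "integrable lebesgue (\<lambda>x. (norm A + norm B) * indicat_real (box 0 (1::real^'d)) x)"
        using emeasure_bounded_finite[OF bounded_box, of "0::real^'d" 1]
        by (intro integrable_mult_right integrable_real_indicator) auto
      have "f \<in> borel_measurable lebesgue" unfolding f_def[abs_def]
        by (intro borel_measurable_add borel_measurable_const borel_measurable_scaleR phase_measurable)
      then show "(\<lambda>x. indicat_real (box 0 1) x *\<^sub>R f x) \<in> borel_measurable lebesgue"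
        by (intro borel_measurable_scaleR borel_measurable_indicator) auto
      show "AE x in lebesgue. norm (indicat_real (box 0 1) x *\<^sub>R f x) \<le> norm ((norm A + norm B) * indicat_real (box 0 1) x)"
      proof (intro AE_I2)
        fix x show "norm (indicat_real (box 0 1) x *\<^sub>R f x) \<le> norm ((norm A + norm B) * indicat_real (box 0 1) x)"
          using fAB[of x] by (auto simp: indicator_def)
      qed
    qed
    moreover have "surface_energy (box 0 1) f < \<infinity>" using se by (rule order.strict_trans1) simp
    ultimately show ?thesis using fAB by (auto simp: BV_fields_def)
  qed
  have pw: "(norm (u x - f x))\<^sup>2 \<le> K\<^sup>2 * error_density x"
    if x: "x \<in> box 0 1" "x \<notin> N1" "x \<notin> N2" "x \<notin> (\<Union>i\<in>I. {x. \<xi> \<bullet> x = of_int (snd i) * hh (fst i)})" for x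
  proof -
    have "u x - f x = stream_field e v \<xi> (gr x - phase x *\<^sub>R \<xi>)"
      using stream_field_rank_one[OF e \<xi> orth, of "gr x" "phase x"] by (simp add: u_def f_def)
    then have "norm (u x - f x) \<le> K * norm (gr x - phase x *\<^sub>R \<xi>)"
      using stream_field_bound[OF \<xi>, of e v "gr x - phase x *\<^sub>R \<xi>"] by (simp add: K_def)
    from power_mono[OF this norm_ge_zero, of 2] have "(norm (u x - f x))\<^sup>2 \<le> K\<^sup>2 * (norm (gr x - phase x *\<^sub>R \<xi>))\<^sup>2"
      by (simp add: power_mult_distrib)
    also have "\<dots> \<le> K\<^sup>2 * error_density x"
    proof (intro mult_left_mono gradient_error[OF x(1) gr(2)[OF x(2)] q(2)[OF x(3)] q(3)])
      show "x \<bullet> \<xi> \<noteq> of_int (snd i) * hh (fst i)" if "i \<in> I" for i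
        using x(4) that by (auto simp: inner_commute)
    qed simp
    finally show ?thesis .
  qed
  have "elastic_energy (box 0 1) u f \<le> (\<integral>\<^sup>+x. ennreal (K\<^sup>2) * (ennreal (error_density x) * indicator (box 0 1) x) \<partial>lebesgue)"
    unfolding elastic_energy_def
  proof (rule nn_integral_mono_AE)
    have "AE x in lebesgue. x \<notin> N1 \<and> x \<notin> N2 \<and> x \<notin> (\<Union>i\<in>I. {x. \<xi> \<bullet> x = of_int (snd i) * hh (fst i)})"
      using AE_not_in[of N1 lebesgue] AE_not_in[of N2 lebesgue] N1(1) q(1)
        AE_not_in[of "\<Union>i\<in>I. {x. \<xi> \<bullet> x = of_int (snd i) * hh (fst i)}" lebesgue] hyperplanes_negligible
      unfolding negligible_iff_null_sets by (intro AE_conjI) blast+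
    then show "AE x in lebesgue. ennreal ((norm (u x - f x))\<^sup>2) * indicator (box 0 1) x
      \<le> ennreal (K\<^sup>2) * (ennreal (error_density x) * indicator (box 0 1) x)"
    proof (rule eventually_mono)
      fix x assume "x \<notin> N1 \<and> x \<notin> N2 \<and> x \<notin> (\<Union>i\<in>I. {x. \<xi> \<bullet> x = of_int (snd i) * hh (fst i)})"
      then show "ennreal ((norm (u x - f x))\<^sup>2) * indicator (box 0 1) x
        \<le> ennreal (K\<^sup>2) * (ennreal (error_density x) * indicator (box 0 1) x)"
        using pw[of x] error_density_nonneg[of x]
        by (cases "x \<in> box 0 1") (auto simp: ennreal_mult[symmetric] intro!: ennreal_leI)
    qed
  qed
  also have "\<dots> = ennreal (K\<^sup>2) * (\<integral>\<^sup>+x\<in>box 0 1. ennreal (error_density x) \<partial>lebesgue)"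
  proof (rule nn_integral_cmult)
    show "(\<lambda>x. ennreal (error_density x) * indicator (box 0 1) x) \<in> borel_measurable lebesgue"
      by (intro borel_measurable_times_ennreal borel_measurable_indicator measurable_compose[OF error_density_measurable]) auto
  qed
  also have "\<dots> \<le> ennreal (K\<^sup>2) * ennreal (slab_const * (8 / c0) * 6 / 4 ^ J)"
    by (intro mult_left_mono error_density_integral) simp
  finally have el: "elastic_energy (box 0 1) u f \<le> ennreal (K\<^sup>2) * ennreal (slab_const * (8 / c0) * 6 / 4 ^ J)" .
  show ?thesis
    using min_total_energy_leI[OF f u add_mono[OF el mult_left_mono[OF se]]] by (simp add: F_def v_def K_def)
qed

end

text \<open>J is the least exponent with 8^(-J) \<le> \<epsilon>; minimality makes \<epsilon>
  comparable to 8^(-J), so that \<epsilon> 2^J and \<epsilon>^(2/3) are both comparable to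
  4^(-J).\<close>

lemma scale_selection:
  fixes \<epsilon> :: real
  assumes \<epsilon>: "0 < \<epsilon>" "\<epsilon> < 1"
  obtains J :: nat where "J \<ge> 1" "1 / 4 ^ J \<le> \<epsilon> powr (2 / 3)" "\<epsilon> * 2 ^ J \<le> 8 * (1 / 4 ^ J)"
proof -
  obtain n where "(1 / 8) ^ n < \<epsilon>" using real_arch_pow_inv[OF \<epsilon>(1), of "1 / 8"] by auto
  then have ex: "1 / 8 ^ n \<le> \<epsilon>" by (simp add: power_one_over)
  define J where "J = (LEAST n. 1 / 8 ^ n \<le> \<epsilon>)"
  have J: "1 / 8 ^ J \<le> \<epsilon>" unfolding J_def using ex by (rule LeastI)
  have J1: "J \<ge> 1" using J \<epsilon>(2) by (cases J) auto
  then have "\<not> 1 / 8 ^ (J - 1) \<le> \<epsilon>" by (intro not_less_Least) (simp add: J_def[symmetric])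
  moreover have "(8::real) ^ J = 8 * 8 ^ (J - 1)" using J1 by (cases J) auto
  ultimately have "\<epsilon> * 8 ^ J \<le> 8" by (simp add: field_simps)
  moreover have "(8::real) ^ J = 2 ^ J * 4 ^ J" by (simp add: power_mult_distrib[symmetric])
  ultimately have 2: "\<epsilon> * 2 ^ J \<le> 8 * (1 / 4 ^ J)" by (simp add: field_simps)
  have "(1 / 8 ^ J) powr (2 / 3) \<le> \<epsilon> powr (2 / 3)" using J by (intro powr_mono2) auto
  moreover have "(1 / 8 ^ J) powr (2 / 3) = (1 / 4 ^ J :: real)"
  proof -
    define z :: real where "z = 1 / 2 ^ J"
    have z: "z > 0" by (simp add: z_def)
    have "(8::real) ^ J = (2 ^ J) ^ 3" "(4::real) ^ J = (2 ^ J) ^ 2"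
      by (simp_all only: power_mult[symmetric] mult.commute[of J]) (simp_all add: power_mult)
    then have z3: "1 / 8 ^ J = z ^ 3" and z2: "1 / 4 ^ J = z ^ 2" by (simp_all add: z_def power_one_over)
    have "(z ^ 3) powr (2 / 3) = z powr 2" using z by (simp add: powr_powr flip: powr_numeral)
    also have "\<dots> = z ^ 2" using z by simp
    finally have ?thesis unfolding z2 z3 .
    then show ?thesis .
  qed
  ultimately show ?thesis using that[OF J1 _ 2] by simp
qed

lemma min_total_energy_divergence_upper:
  fixes Aop :: "('d::finite \<Rightarrow> nat) \<Rightarrow> real^'n::finite^'m::finite" and A B :: "real^'n"
  assumes div: "is_row_divergence e Aop" and wc: "B - A \<in> wave_cone Aop 1" and t: "t \<in> {0<..<1}"
  shows "\<exists>c>0. \<forall>\<epsilon>>0. min_total_energy Aop 1 (box 0 1) A B (t *\<^sub>R A + (1 - t) *\<^sub>R B) \<epsilon> \<le> ennreal (c * \<epsilon> powr (2 / 3))"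
proof -
  define F where "F = t *\<^sub>R A + (1 - t) *\<^sub>R B"
  obtain w where w: "norm w = 1" "op_symbol Aop 1 w *v (B - A) = 0"
    using wc by (auto simp: wave_cone_def mat_kernel_def)
  have br: "branching w t J" if "J \<ge> 1" for J using t w(1) that by (simp add: branching_def)
  \<comment> \<open>\<open>s\<close>, \<open>\<kappa>\<close> and \<open>T\<close> repeat
    \<open>slab_const\<close>, \<open>c0\<close> and \<open>tv_const\<close> outside the locale,
    where they are visibly independent of the number of scales and hence of \<epsilon>.\<close>
  define s where "s = 2 * real CARD('d) * 3 ^ CARD('d)"
  define \<kappa> where "\<kappa> = min t (1 - t) / 4"
  define T where "T = 2 * (12 * s * (16 / \<kappa> + 3)) + 2 * s"
  define C1 where "C1 = (real CARD('n) * (1 + real CARD('d)) * norm (B - A))\<^sup>2 * (s * (8 / \<kappa>) * 6)"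
  define C2 where "C2 = real CARD('n) * (norm (B - A) * (real CARD('d) * (4 * T)))"
  have "\<kappa> > 0" "s > 0" using t by (auto simp: \<kappa>_def s_def)
  then have C: "C1 \<ge> 0" "C2 \<ge> 0" by (auto simp: C1_def C2_def T_def)
  define c where "c = C1 + 8 * C2 + (norm (F - A))\<^sup>2 + 1"
  have small: "min_total_energy Aop 1 (box 0 1) A B F \<epsilon> \<le> ennreal (c * \<epsilon> powr (2 / 3))" if \<epsilon>: "0 < \<epsilon>" "\<epsilon> < 1" for \<epsilon>
  proof -
    obtain n where n: "n \<ge> 1" "1 / 4 ^ n \<le> \<epsilon> powr (2 / 3)" "\<epsilon> * 2 ^ n \<le> 8 * (1 / 4 ^ n)" using scale_selection[OF \<epsilon>] .
    interpret branching w t n by (rule br[OF n(1)])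
    have "min_total_energy Aop 1 (box 0 1) A B F \<epsilon> \<le>
      ennreal ((real CARD('n) * (1 + real CARD('d)) * norm (B - A))\<^sup>2) * ennreal (s * (8 / \<kappa>) * 6 / 4 ^ n) +
      ennreal \<epsilon> * ennreal (real CARD('n) * (norm (B - A) * (real CARD('d) * (4 * T * 2 ^ n))))"
      using branching_energy[OF div w(2), of \<epsilon>]
      unfolding F_def s_def \<kappa>_def T_def slab_const_def tv_const_def cross_const_def branching.c0_def[OF br[OF n(1)]] by simp
    also have "\<dots> = ennreal (C1 * (1 / 4 ^ n) + C2 * (\<epsilon> * 2 ^ n))"
      using \<epsilon> \<open>\<kappa> > 0\<close> \<open>s > 0\<close> C unfolding C1_def C2_def T_def
      by (simp add: ennreal_mult[symmetric] ennreal_plus[symmetric] del: ennreal_plus)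
    also have "\<dots> \<le> ennreal (c * \<epsilon> powr (2 / 3))"
    proof (rule ennreal_leI)
      have "C1 * (1 / 4 ^ n) + C2 * (\<epsilon> * 2 ^ n) \<le> C1 * (1 / 4 ^ n) + C2 * (8 * (1 / 4 ^ n))"
        using C n(3) by (intro add_left_mono mult_left_mono) auto
      also have "\<dots> = (C1 + 8 * C2) * (1 / 4 ^ n)" by (simp add: algebra_simps)
      also have "\<dots> \<le> c * \<epsilon> powr (2 / 3)" using C n(2) by (intro mult_mono) (auto simp: c_def)
      finally show "C1 * (1 / 4 ^ n) + C2 * (\<epsilon> * 2 ^ n) \<le> c * \<epsilon> powr (2 / 3)" .
    qed
    finally show ?thesis .
  qed
  \<comment> \<open>For large \<epsilon> no interface is affordable: the constant phase A with the
    constant field F has bounded energy, and \<epsilon>^(2/3) is at least 1.\<close>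
  have large: "min_total_energy Aop 1 (box 0 1) A B F \<epsilon> \<le> ennreal (c * \<epsilon> powr (2 / 3))" if \<epsilon>: "\<epsilon> \<ge> 1" for \<epsilon>
  proof (rule min_total_energy_leI)
    show "(\<lambda>x. A) \<in> BV_fields (box 0 1) {A, B}" by (rule const_in_BV_fields) auto
    show "(\<lambda>x. F) \<in> admissible Aop 1 (box 0 1) F" by (rule const_admissible) simp
    have "emeasure lebesgue (box 0 (1::real^'d)) = 1"
      by (simp add: emeasure_lborel_box_eq one_index inner_axis Basis_vec_def prod.neutral)
    then have "elastic_energy (box 0 (1::real^'d)) (\<lambda>x. F) (\<lambda>x. A) = ennreal ((norm (F - A))\<^sup>2)"
      unfolding elastic_energy_def by (subst nn_integral_cmult_indicator) auto
    moreover have "(norm (F - A))\<^sup>2 * 1 \<le> c * \<epsilon> powr (2 / 3)"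
      using C \<epsilon> by (intro mult_mono) (auto simp: c_def ge_one_powr_ge_zero)
    ultimately show "elastic_energy (box 0 (1::real^'d)) (\<lambda>x. F) (\<lambda>x. A) + ennreal \<epsilon> * surface_energy (box 0 1) (\<lambda>x::real^'d. A)
      \<le> ennreal (c * \<epsilon> powr (2 / 3))" by (simp add: surface_energy_const ennreal_leI)
  qed
  have "c > 0" using C by (simp add: c_def add_nonneg_pos)
  with small large show ?thesis unfolding F_def by (intro exI[of _ c]) (metis not_le)
qed

theorem theorem1:
  fixes Aop :: "('d::finite \<Rightarrow> nat) \<Rightarrow> real^'n::finite^'m::finite"
    and k :: nat and A B :: "real^'n" and F :: "real \<Rightarrow> real^'n"
  assumes "CARD('n) > 1" and "k \<ge> 1"
    and F: "\<And>t. F t = t *\<^sub>R A + (1 - t) *\<^sub>R B"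
  shows
    "(B - A \<notin> wave_cone Aop k \<longrightarrow>
        (\<exists>C>0. \<forall>\<Omega> t. bounded \<Omega> \<and> lipschitz_domain \<Omega> \<and> t \<in> {0<..<1} \<longrightarrow>
           min_elastic_energy Aop k \<Omega> A B (F t)
             \<ge> ennreal (C * (min t (1 - t))\<^sup>2) * emeasure lebesgue \<Omega>))
     \<and> (k = 1 \<and> B - A \<in> wave_cone Aop k - common_kernel Aop k \<longrightarrow>
        (\<forall>\<Omega> t. bounded \<Omega> \<and> lipschitz_domain \<Omega> \<and> t \<in> {0<..<1} \<longrightarrow>
           (\<exists>C>0. \<exists>\<epsilon>\<^sub>0>0. \<forall>\<epsilon>\<in>{0<..<\<epsilon>\<^sub>0}.
              min_total_energy Aop k \<Omega> A B (F t) \<epsilon> \<ge> ennreal (C * \<epsilon> powr (2/3))))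
        \<and> (\<forall>e t. is_row_divergence e Aop \<and> t \<in> {0<..<1} \<longrightarrow>
           (\<exists>c>0. \<forall>\<epsilon>>0.
              min_total_energy Aop k (box 0 1) A B (F t) \<epsilon> \<le> ennreal (c * \<epsilon> powr (2/3)))))
     \<and> (A - B \<in> common_kernel Aop k \<longrightarrow>
        (\<forall>\<Omega> t. bounded \<Omega> \<and> lipschitz_domain \<Omega> \<and> t \<in> {0<..<1} \<longrightarrow>
           (\<forall>\<epsilon>>0. min_total_energy Aop k \<Omega> A B (F t) \<epsilon> = 0)))"
proof (intro conjI impI allI)
  assume "B - A \<notin> wave_cone Aop k"
  then show "\<exists>C>0. \<forall>\<Omega> t. bounded \<Omega> \<and> lipschitz_domain \<Omega> \<and> t \<in> {0<..<1} \<longrightarrow>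
      min_elastic_energy Aop k \<Omega> A B (F t) \<ge> ennreal (C * (min t (1 - t))\<^sup>2) * emeasure lebesgue \<Omega>"
    unfolding F by (rule min_elastic_energy_incompatible[OF \<open>k \<ge> 1\<close>])
next
  fix \<Omega> :: "(real^'d) set" and t :: real
  assume "k = 1 \<and> B - A \<in> wave_cone Aop k - common_kernel Aop k" "bounded \<Omega> \<and> lipschitz_domain \<Omega> \<and> t \<in> {0<..<1}"
  then show "\<exists>C>0. \<exists>\<epsilon>\<^sub>0>0. \<forall>\<epsilon>\<in>{0<..<\<epsilon>\<^sub>0}.
      min_total_energy Aop k \<Omega> A B (F t) \<epsilon> \<ge> ennreal (C * \<epsilon> powr (2/3))"
    using min_total_energy_compatible_lower[OF _ _ _ _ F, of \<Omega> t Aop] by blast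
next
  fix e :: "'m \<times> 'd \<Rightarrow> 'n" and t :: real
  assume "k = 1 \<and> B - A \<in> wave_cone Aop k - common_kernel Aop k" "is_row_divergence e Aop \<and> t \<in> {0<..<1}"
  then show "\<exists>c>0. \<forall>\<epsilon>>0. min_total_energy Aop k (box 0 1) A B (F t) \<epsilon> \<le> ennreal (c * \<epsilon> powr (2/3))"
    unfolding F using min_total_energy_divergence_upper[of e Aop B A t] by blast
next
  fix \<Omega> :: "(real^'d) set" and t \<epsilon> :: real
  assume "A - B \<in> common_kernel Aop k" "bounded \<Omega> \<and> lipschitz_domain \<Omega> \<and> t \<in> {0<..<1}"
  then show "min_total_energy Aop k \<Omega> A B (F t) \<epsilon> = 0"
    unfolding F by (intro min_total_energy_supercompatible \<open>k \<ge> 1\<close>) (auto simp: lipschitz_domain_def)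
qed

end
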